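(* Fix $\alpha\ge 1$, $0<\beta\le 1$ and $\rho\ge 1$. There exist a constant $\delta=\delta(\rho,\alpha,\beta)>0$, depending only on $\rho,\alpha,\beta$, and an absolute constant $\kappa>0$ such that the following holds. Let $m,n$ be positive integers with $m\le\rho n$ and $n\le\rho m$, and let $(R,C)$ be lower $\beta$-smooth and strongly upper $\alpha$-smooth margins, with $R=(r_1,\dots,r_m)$, $C=(c_1,\dots,c_n)$ and total $N$. Let $X=(x_{ij})$ be a random $m\times n$ matrix with density $\psi_{R,C}$. Then $$\mathbf{P}\left\{X:\ p(X)>N^{\delta\ln N}\right\}\le \kappa\left(2^{-m}+2^{-n}\right).$$ Therefore the approximation algorithm described in the context (with threshold $\tau=N^{\delta\ln N}$) has quasi-polynomial $N^{O(\ln N)}$ complexity on this class of margins: there is a constant $K=K(\rho,\alpha,\beta)>0$ such that for all such $m,n,(R,C)$ and all $0<\epsilon<1$ with $\epsilon\ge K(2^{-m}+2^{-n})$, the algorithm computes, with probability at least $2/3$, a number approximating $\#(R,C)$ within relative error $\epsilon$, in time at most $K\epsilon^{-K}N^{K\ln N}$ in the unit cost model.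
   Context: Margins: $R=(r_1,\dots,r_m)$ and $C=(c_1,\dots,c_n)$ are positive integer vectors with $\sum_i r_i=\sum_j c_j=N$. A contingency table with margins $(R,C)$ is an $m\times n$ non-negative integer matrix with row sums $R$ and column sums $C$; $\#(R,C)$ is the number of such tables. Put $s=N/(mn)$. Typical table: $\mathcal{P}(R,C)$ is the polytope of $m\times n$ non-negative real matrices with row sums $R$ and column sums $C$. The typical table $X^*=(x^*_{ij})$ is the unique maximizer on $\mathcal{P}(R,C)$ of the strictly concave function $g(X)=\sum_{ij}\left((x_{ij}+1)\ln(x_{ij}+1)-x_{ij}\ln x_{ij}\right)$ (with $0\ln 0=0$). Smoothness: the margins are lower $\beta$-smooth if $\min_i r_i\ge\beta N/m$ and $\min_j c_j\ge\beta N/n$; they are strongly upper $\alpha$-smooth if $x^*_{ij}\le\alpha s$ for all $i,j$. Density: on positive $m\times n$ matrices, $$\psi_{R,C}(X)=\frac{1}{\#(R,C)}\sum_{D=(d_{ij})}\prod_{ij}\frac{x_{ij}^{d_{ij}}}{d_{ij}!}e^{-x_{ij}},$$ the sum being over all contingency tables $D$ with margins $(R,C)$; $\psi_{R,C}(X)=0$ if $X$ is not positive. This is a probability density on $\mathbb{R}^{mn}$. Function $p$: for a positive $m\times n$ matrix $X$ there is a unique $m\times n$ matrix $Y=(y_{ij})$ with row sums $R$ and column sums $C$ such that $x_{ij}=y_{ij}\lambda_i\mu_j$ for some positive $\lambda_1,\dots,\lambda_m,\mu_1,\dots,\mu_n$. Let $B(X)$ be the $N\times N$ doubly stochastic block matrix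 whose $(i,j)$-th block is the $r_i\times c_j$ matrix with all entries equal to $y_{ij}/(r_ic_j)$. Set $p(X)=\frac{N^N}{N!}\operatorname{per}B(X)$. Algorithm: let $\Delta$ be the open simplex of positive $m\times n$ matrices with entries summing to $1$, with Lebesgue measure $dX$ normalized to be a probability measure. On $\Delta$ define $$\phi(X)=\frac{(N+mn-1)!\,N!}{(mn-1)!\,N^N}\prod_{i=1}^m\frac{r_i^{r_i}}{r_i!}\prod_{j=1}^n\frac{c_j^{c_j}}{c_j!}\prod_{i=1}^m\lambda_i^{r_i}\prod_{j=1}^n\mu_j^{c_j},$$ which is log-concave; one has $\#(R,C)=\int_\Delta p\,\phi\,dX$. Let $\overline p=\min\{p,\tau\}$ for a threshold $\tau$. The algorithm outputs an estimate of $\int_\Delta\overline p\,\phi\,dX$ as the product of (i) an estimate of $\int_\Delta\phi\,dX$ obtained by a randomized polynomial-time integration algorithm for log-concave functions and (ii) a sample mean $\frac1k\sum_{i=1}^k\overline p(X_i)$, with $k=O(\epsilon^{-2}\tau^2)$, where $X_1,\dots,X_k\in\Delta$ are sampled independently, by a randomized polynomial-time sampling algorithm for log-concave densities, from a distribution sufficiently close in total variation to the one with density proportional to $\phi$. The values $\phi(X)$ are computed by a polynomial-time matrix scaling algorithm and the values $p(X)$ by the randomized polynomial-time permanent approximation algorithm. *)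

theory Defs
  imports "HOL-Probability.Probability"
begin

(* m x n matrices are extensional functions on the index set idx m n (0-based); margin vectors
   are functions on nat of which only the first m (resp. n) values are ever used. The dimensions
   cannot be types, because the constants of the theorem are uniform in m and n. *)

type_synonym mat = "nat \<times> nat \<Rightarrow> real"

definition idx :: "nat \<Rightarrow> nat \<Rightarrow> (nat \<times> nat) set" where
  "idx m n = {..<m} \<times> {..<n}"

definition total :: "nat \<Rightarrow> (nat \<Rightarrow> nat) \<Rightarrow> nat" where
  "total m R = (\<Sum>i<m. R i)"

definition margins :: "nat \<Rightarrow> nat \<Rightarrow> (nat \<Rightarrow> nat) \<Rightarrow> (nat \<Rightarrow> nat) \<Rightarrow> bool" where
  "margins m n R C \<longleftrightarrow>
     0 < m \<and> 0 < n \<and> (\<forall>i<m. 0 < R i) \<and> (\<forall>j<n. 0 < C j) \<and> total m R = total n C"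

definition tables :: "nat \<Rightarrow> nat \<Rightarrow> (nat \<Rightarrow> nat) \<Rightarrow> (nat \<Rightarrow> nat) \<Rightarrow> (nat \<times> nat \<Rightarrow> nat) set" where
  "tables m n R C =
     {D \<in> idx m n \<rightarrow>\<^sub>E UNIV.
        (\<forall>i<m. (\<Sum>j<n. D (i, j)) = R i) \<and> (\<forall>j<n. (\<Sum>i<m. D (i, j)) = C j)}"

definition num_tables :: "nat \<Rightarrow> nat \<Rightarrow> (nat \<Rightarrow> nat) \<Rightarrow> (nat \<Rightarrow> nat) \<Rightarrow> nat" where
  "num_tables m n R C = card (tables m n R C)"


section \<open>Typical table and smoothness\<close>

definition has_margins :: "nat \<Rightarrow> nat \<Rightarrow> (nat \<Rightarrow> nat) \<Rightarrow> (nat \<Rightarrow> nat) \<Rightarrow> mat \<Rightarrow> bool" where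
  "has_margins m n R C X \<longleftrightarrow>
     (\<forall>i<m. (\<Sum>j<n. X (i, j)) = real (R i)) \<and> (\<forall>j<n. (\<Sum>i<m. X (i, j)) = real (C j))"

definition transport_polytope :: "nat \<Rightarrow> nat \<Rightarrow> (nat \<Rightarrow> nat) \<Rightarrow> (nat \<Rightarrow> nat) \<Rightarrow> mat set" where
  "transport_polytope m n R C = {X \<in> idx m n \<rightarrow>\<^sub>E {0..}. has_margins m n R C X}"

(* In HOL ln 0 = 0, so the convention 0 ln 0 = 0 is automatic. *)
definition entropy_g :: "nat \<Rightarrow> nat \<Rightarrow> mat \<Rightarrow> real" where
  "entropy_g m n X = (\<Sum>e\<in>idx m n. (X e + 1) * ln (X e + 1) - X e * ln (X e))"

definition typical_table :: "nat \<Rightarrow> nat \<Rightarrow> (nat \<Rightarrow> nat) \<Rightarrow> (nat \<Rightarrow> nat) \<Rightarrow> mat" where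
  "typical_table m n R C =
     (THE X. X \<in> transport_polytope m n R C \<and>
             (\<forall>Z\<in>transport_polytope m n R C. entropy_g m n Z \<le> entropy_g m n X))"

definition lower_smooth :: "real \<Rightarrow> nat \<Rightarrow> nat \<Rightarrow> (nat \<Rightarrow> nat) \<Rightarrow> (nat \<Rightarrow> nat) \<Rightarrow> bool" where
  "lower_smooth \<beta> m n R C \<longleftrightarrow>
     (\<forall>i<m. real (R i) \<ge> \<beta> * real (total m R) / real m) \<and>
     (\<forall>j<n. real (C j) \<ge> \<beta> * real (total m R) / real n)"

definition strongly_upper_smooth ::
    "real \<Rightarrow> nat \<Rightarrow> nat \<Rightarrow> (nat \<Rightarrow> nat) \<Rightarrow> (nat \<Rightarrow> nat) \<Rightarrow> bool" where
  "strongly_upper_smooth \<alpha> m n R C \<longleftrightarrow>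
     (\<forall>e\<in>idx m n. typical_table m n R C e \<le> \<alpha> * (real (total m R) / (real m * real n)))"

definition smooth_instance ::
    "real \<Rightarrow> real \<Rightarrow> real \<Rightarrow> nat \<Rightarrow> nat \<Rightarrow> (nat \<Rightarrow> nat) \<Rightarrow> (nat \<Rightarrow> nat) \<Rightarrow> bool" where
  "smooth_instance \<rho> \<alpha> \<beta> m n R C \<longleftrightarrow>
     margins m n R C \<and> real m \<le> \<rho> * real n \<and> real n \<le> \<rho> * real m \<and>
     lower_smooth \<beta> m n R C \<and> strongly_upper_smooth \<alpha> m n R C"


section \<open>The density on m x n matrices\<close>

definition mat_space :: "nat \<Rightarrow> nat \<Rightarrow> mat measure" where
  "mat_space m n = (\<Pi>\<^sub>M e\<in>idx m n. borel)"

definition mat_lebesgue :: "nat \<Rightarrow> nat \<Rightarrow> mat measure" where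
  "mat_lebesgue m n = (\<Pi>\<^sub>M e\<in>idx m n. lborel)"

definition positive_mats :: "nat \<Rightarrow> nat \<Rightarrow> mat set" where
  "positive_mats m n = idx m n \<rightarrow>\<^sub>E {0<..}"

definition psi :: "nat \<Rightarrow> nat \<Rightarrow> (nat \<Rightarrow> nat) \<Rightarrow> (nat \<Rightarrow> nat) \<Rightarrow> mat \<Rightarrow> real" where
  "psi m n R C X =
     (if X \<in> positive_mats m n
      then 1 / real (num_tables m n R C) *
           (\<Sum>D\<in>tables m n R C. \<Prod>e\<in>idx m n. X e ^ D e / fact (D e) * exp (- X e))
      else 0)"

definition psi_measure :: "nat \<Rightarrow> nat \<Rightarrow> (nat \<Rightarrow> nat) \<Rightarrow> (nat \<Rightarrow> nat) \<Rightarrow> mat measure" where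
  "psi_measure m n R C = density (mat_lebesgue m n) (\<lambda>X. ennreal (psi m n R C X))"


section \<open>Scaling and the functions p and phi\<close>

(* X e is recovered from the scaled matrix by X (i,j) = unscale (i,j) * l i * u j. *)
definition unscale :: "nat \<Rightarrow> nat \<Rightarrow> mat \<Rightarrow> (nat \<Rightarrow> real) \<Rightarrow> (nat \<Rightarrow> real) \<Rightarrow> mat" where
  "unscale m n X l u = (\<lambda>(i, j)\<in>idx m n. X (i, j) / (l i * u j))"

definition scales ::
    "nat \<Rightarrow> nat \<Rightarrow> (nat \<Rightarrow> nat) \<Rightarrow> (nat \<Rightarrow> nat) \<Rightarrow> mat \<Rightarrow> mat \<Rightarrow> (nat \<Rightarrow> real) \<Rightarrow> (nat \<Rightarrow> real) \<Rightarrow> bool" where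
  "scales m n R C X Y l u \<longleftrightarrow>
     Y \<in> extensional (idx m n) \<and> has_margins m n R C Y \<and>
     (\<forall>i<m. 0 < l i) \<and> (\<forall>j<n. 0 < u j) \<and>
     (\<forall>i<m. \<forall>j<n. X (i, j) = Y (i, j) * l i * u j)"

definition scaled_mat :: "nat \<Rightarrow> nat \<Rightarrow> (nat \<Rightarrow> nat) \<Rightarrow> (nat \<Rightarrow> nat) \<Rightarrow> mat \<Rightarrow> mat" where
  "scaled_mat m n R C X = (THE Y. \<exists>l u. scales m n R C X Y l u)"

definition scaling_product ::
    "nat \<Rightarrow> nat \<Rightarrow> (nat \<Rightarrow> nat) \<Rightarrow> (nat \<Rightarrow> nat) \<Rightarrow> (nat \<Rightarrow> real) \<Rightarrow> (nat \<Rightarrow> real) \<Rightarrow> real" where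
  "scaling_product m n R C l u = (\<Prod>i<m. l i ^ R i) * (\<Prod>j<n. u j ^ C j)"

(* The factors are determined up to l -> t l, u -> u / t, which leaves the product unchanged
   since the two margins have the same total; so any choice of factors gives the same value. *)
definition scaling_value :: "nat \<Rightarrow> nat \<Rightarrow> (nat \<Rightarrow> nat) \<Rightarrow> (nat \<Rightarrow> nat) \<Rightarrow> mat \<Rightarrow> real" where
  "scaling_value m n R C X =
     (THE v. \<exists>Y l u. scales m n R C X Y l u \<and> v = scaling_product m n R C l u)"

definition permanent :: "nat \<Rightarrow> mat \<Rightarrow> real" where
  "permanent N A = (\<Sum>\<sigma> | \<sigma> permutes {..<N}. \<Prod>a<N. A (a, \<sigma> a))"

(* The block that contains the position a, when consecutive blocks have sizes R 0, R 1, ... *)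
definition block_of :: "(nat \<Rightarrow> nat) \<Rightarrow> nat \<Rightarrow> nat" where
  "block_of R a = (LEAST i. a < (\<Sum>i'\<le>i. R i'))"

definition block_mat :: "nat \<Rightarrow> (nat \<Rightarrow> nat) \<Rightarrow> (nat \<Rightarrow> nat) \<Rightarrow> mat \<Rightarrow> mat" where
  "block_mat N R C Y =
     (\<lambda>(a, b)\<in>idx N N.
        let i = block_of R a; j = block_of C b in Y (i, j) / (real (R i) * real (C j)))"

definition normalized_per :: "nat \<Rightarrow> real \<Rightarrow> real" where
  "normalized_per N v = real N ^ N / fact N * v"

definition p_fun :: "nat \<Rightarrow> nat \<Rightarrow> (nat \<Rightarrow> nat) \<Rightarrow> (nat \<Rightarrow> nat) \<Rightarrow> mat \<Rightarrow> real" where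
  "p_fun m n R C X =
     (let N = total m R
      in normalized_per N (permanent N (block_mat N R C (scaled_mat m n R C X))))"

definition phi_const :: "nat \<Rightarrow> nat \<Rightarrow> (nat \<Rightarrow> nat) \<Rightarrow> (nat \<Rightarrow> nat) \<Rightarrow> real" where
  "phi_const m n R C =
     (let N = total m R
      in fact (N + m * n - 1) * fact N / (fact (m * n - 1) * real N ^ N) *
         (\<Prod>i<m. real (R i) ^ R i / fact (R i)) * (\<Prod>j<n. real (C j) ^ C j / fact (C j)))"

definition phi_fun :: "nat \<Rightarrow> nat \<Rightarrow> (nat \<Rightarrow> nat) \<Rightarrow> (nat \<Rightarrow> nat) \<Rightarrow> mat \<Rightarrow> real" where
  "phi_fun m n R C X = phi_const m n R C * scaling_value m n R C X"


section \<open>The open simplex\<close>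

definition open_simplex :: "nat \<Rightarrow> nat \<Rightarrow> mat set" where
  "open_simplex m n = {X \<in> positive_mats m n. (\<Sum>e\<in>idx m n. X e) = 1}"

(* Normalized Lebesgue measure on the simplex, through the affine chart that omits the entry
   (0,0); affine maps preserve normalized Lebesgue measure, so the chart is immaterial. *)
definition simplex_measure :: "nat \<Rightarrow> nat \<Rightarrow> mat measure" where
  "simplex_measure m n =
     (let J = idx m n - {(0, 0)};
          M = (\<Pi>\<^sub>M e\<in>J. lborel)
      in restrict_space
           (distr (uniform_measure M {x \<in> J \<rightarrow>\<^sub>E {0<..}. (\<Sum>e\<in>J. x e) < 1})
                  (mat_space m n)
                  (\<lambda>x. x((0, 0) := 1 - (\<Sum>e\<in>J. x e))))
           (open_simplex m n))"

definition log_concave_on_simplex :: "nat \<Rightarrow> nat \<Rightarrow> (mat \<Rightarrow> real) \<Rightarrow> bool" where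
  "log_concave_on_simplex m n F \<longleftrightarrow>
     (\<forall>X\<in>open_simplex m n. 0 < F X) \<and>
     (\<forall>X\<in>open_simplex m n. \<forall>Z\<in>open_simplex m n. \<forall>t\<in>{0..1}.
        F X powr t * F Z powr (1 - t) \<le> F (\<lambda>e\<in>idx m n. t * X e + (1 - t) * Z e))"

(* The functions handled by the integration and sampling procedures: positive log-concave
   functions on the simplex whose supremum exceeds their mean by a factor of at most exp L. *)
definition conditioned :: "nat \<Rightarrow> nat \<Rightarrow> real \<Rightarrow> (mat \<Rightarrow> real) \<Rightarrow> bool" where
  "conditioned m n L F \<longleftrightarrow>
     log_concave_on_simplex m n F \<and> F \<in> borel_measurable (simplex_measure m n) \<and>
     (\<forall>X\<in>open_simplex m n. F X \<le> exp L * (\<integral>Z. F Z \<partial>simplex_measure m n))"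

definition approximates :: "nat \<Rightarrow> nat \<Rightarrow> real \<Rightarrow> (mat \<Rightarrow> real) \<Rightarrow> (mat \<Rightarrow> real) \<Rightarrow> bool" where
  "approximates m n \<eta> F' F \<longleftrightarrow>
     F' \<in> borel_measurable (simplex_measure m n) \<and>
     (\<forall>X\<in>open_simplex m n. \<bar>F' X - F X\<bar> \<le> \<eta> * F X)"


section \<open>The four subroutines\<close>

(* Unit cost model: real arithmetic operations, comparisons, evaluations of ln and powr, and
   draws of a uniform number in [0,1] cost one step each. A randomized procedure is a function of
   its input and of a seed, an infinite sequence of independent uniform numbers. *)

type_synonym seed = "nat \<Rightarrow> real"

definition seed_space :: "seed measure" where
  "seed_space = (\<Pi>\<^sub>M i\<in>UNIV. uniform_measure lborel {0..1})"

(* A run of a procedure with oracle access to a function of matrices. Each call of the oracle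
   counts as one of the steps; the cost of answering it is charged separately. *)
datatype 'a oracle_run = Oracle_Run (outcome: 'a) (steps: nat) (calls: "mat list")

(* scaling m n R C \<eta> X returns approximate scaling factors and the number of steps;
   permanent_alg N A \<epsilon> \<zeta> seed returns a value and the number of steps;
   integrate m n L \<epsilon> \<zeta> F seed and sample m n L \<xi> F seed use F as an oracle. *)
record toolkit =
  scaling :: "nat \<Rightarrow> nat \<Rightarrow> (nat \<Rightarrow> nat) \<Rightarrow> (nat \<Rightarrow> nat) \<Rightarrow> real \<Rightarrow> mat \<Rightarrow>
                (nat \<Rightarrow> real) \<times> (nat \<Rightarrow> real) \<times> nat"
  permanent_alg :: "nat \<Rightarrow> mat \<Rightarrow> real \<Rightarrow> real \<Rightarrow> seed \<Rightarrow> real \<times> nat"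
  integrate :: "nat \<Rightarrow> nat \<Rightarrow> real \<Rightarrow> real \<Rightarrow> real \<Rightarrow> (mat \<Rightarrow> real) \<Rightarrow> seed \<Rightarrow> real oracle_run"
  sample :: "nat \<Rightarrow> nat \<Rightarrow> real \<Rightarrow> real \<Rightarrow> (mat \<Rightarrow> real) \<Rightarrow> seed \<Rightarrow> mat oracle_run"

(* Deterministic strongly polynomial matrix scaling: the scaled matrix has almost the right
   margins, and the product of the factors, hence the value of phi, is almost right. *)
definition scaling_ok :: "toolkit \<Rightarrow> bool" where
  "scaling_ok T \<longleftrightarrow> (\<exists>a::nat. \<forall>m n R C. margins m n R C \<longrightarrow> (\<forall>\<eta>\<in>{0<..<1}.
     (\<forall>i<m. (\<lambda>X. fst (scaling T m n R C \<eta> X) i)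
              \<in> borel_measurable (restrict_space (mat_space m n) (positive_mats m n))) \<and>
     (\<forall>j<n. (\<lambda>X. fst (snd (scaling T m n R C \<eta> X)) j)
              \<in> borel_measurable (restrict_space (mat_space m n) (positive_mats m n))) \<and>
     (\<forall>X\<in>positive_mats m n.
        case scaling T m n R C \<eta> X of (l, u, t) \<Rightarrow>
          (\<forall>i<m. 0 < l i) \<and> (\<forall>j<n. 0 < u j) \<and>
          (let Y = unscale m n X l u in
             (\<Sum>i<m. \<bar>(\<Sum>j<n. Y (i, j)) - real (R i)\<bar>) +
             (\<Sum>j<n. \<bar>(\<Sum>i<m. Y (i, j)) - real (C j)\<bar>) \<le> \<eta>) \<and>
          \<bar>scaling_product m n R C l u - scaling_value m n R C X\<bar>
            \<le> \<eta> * scaling_value m n R C X \<and>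
          real t \<le> real a * (real (total m R) / \<eta>) ^ a)))"

(* Fully polynomial randomized approximation of the permanent of a non-negative matrix. *)
definition permanent_ok :: "toolkit \<Rightarrow> bool" where
  "permanent_ok T \<longleftrightarrow> (\<exists>a::nat. \<forall>N>0. \<forall>\<epsilon>\<in>{0<..<1}. \<forall>\<zeta>\<in>{0<..<1}.
     (\<lambda>(A, s). fst (permanent_alg T N A \<epsilon> \<zeta> s))
        \<in> borel_measurable (restrict_space (mat_space N N) (idx N N \<rightarrow>\<^sub>E {0..}) \<Otimes>\<^sub>M seed_space) \<and>
     (\<forall>A\<in>idx N N \<rightarrow>\<^sub>E {0..}.
        measure seed_space
          {s \<in> space seed_space.
             \<bar>fst (permanent_alg T N A \<epsilon> \<zeta> s) - permanent N A\<bar> \<le> \<epsilon> * permanent N A} \<ge> 1 - \<zeta> \<and>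
        (\<forall>s\<in>space seed_space.
           real (snd (permanent_alg T N A \<epsilon> \<zeta> s)) \<le> real a * (real N / (\<epsilon> * \<zeta>)) ^ a)))"

(* In the next two definitions b is the time bound; the reciprocal of b also bounds the relative
   error that the procedure tolerates in the oracle. *)

definition integrate_ok :: "toolkit \<Rightarrow> bool" where
  "integrate_ok T \<longleftrightarrow> (\<exists>a::nat. a > 0 \<and>
     (\<forall>m>0. \<forall>n>0. \<forall>L\<ge>1. \<forall>\<epsilon>\<in>{0<..<1}. \<forall>\<zeta>\<in>{0<..<1}. \<forall>F F'.
        let b = real a * (real (m * n) * L / (\<epsilon> * \<zeta>)) ^ a;
            run = integrate T m n L \<epsilon> \<zeta> F';
            I = (\<integral>X. F X \<partial>simplex_measure m n)
        in conditioned m n L F \<and> approximates m n (1 / b) F' F \<longrightarrow>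
             (\<lambda>s. outcome (run s)) \<in> borel_measurable seed_space \<and>
             measure seed_space {s \<in> space seed_space. \<bar>outcome (run s) - I\<bar> \<le> \<epsilon> * I} \<ge> 1 - \<zeta> \<and>
             (\<forall>s\<in>space seed_space.
                real (steps (run s)) \<le> b \<and> length (calls (run s)) \<le> steps (run s) \<and>
                set (calls (run s)) \<subseteq> open_simplex m n)))"

(* The output distribution is within \<xi> in total variation of the one with density
   proportional to F. *)
definition sample_ok :: "toolkit \<Rightarrow> bool" where
  "sample_ok T \<longleftrightarrow> (\<exists>a::nat. a > 0 \<and>
     (\<forall>m>0. \<forall>n>0. \<forall>L\<ge>1. \<forall>\<xi>\<in>{0<..<1}. \<forall>F F'.
        let b = real a * (real (m * n) * L / \<xi>) ^ a;
            run = sample T m n L \<xi> F';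
            S = simplex_measure m n;
            I = (\<integral>X. F X \<partial>S)
        in conditioned m n L F \<and> approximates m n (1 / b) F' F \<longrightarrow>
             (\<lambda>s. outcome (run s)) \<in> measurable seed_space S \<and>
             (\<forall>A\<in>sets S.
                \<bar>measure (distr seed_space S (\<lambda>s. outcome (run s))) A
                  - measure (density S (\<lambda>X. ennreal (F X / I))) A\<bar> \<le> \<xi>) \<and>
             (\<forall>s\<in>space seed_space.
                real (steps (run s)) \<le> b \<and> length (calls (run s)) \<le> steps (run s) \<and>
                set (calls (run s)) \<subseteq> open_simplex m n)))"

definition toolkit_ok :: "toolkit \<Rightarrow> bool" where
  "toolkit_ok T \<longleftrightarrow> scaling_ok T \<and> permanent_ok T \<and> integrate_ok T \<and> sample_ok T"


section \<open>The approximation algorithm\<close>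

definition threshold :: "real \<Rightarrow> nat \<Rightarrow> real" where
  "threshold \<delta> N = real N powr (\<delta> * ln (real N))"

(* The integer c governs all internal accuracies. *)
definition num_samples :: "nat \<Rightarrow> real \<Rightarrow> real \<Rightarrow> nat" where
  "num_samples c \<tau> \<epsilon> = nat \<lceil>real c * \<tau>\<^sup>2 / \<epsilon>\<^sup>2\<rceil>"

definition scaling_tol :: "nat \<Rightarrow> nat \<Rightarrow> real \<Rightarrow> real \<Rightarrow> real" where
  "scaling_tol c N \<tau> \<epsilon> = (\<epsilon> / (real c * real N * \<tau>)) ^ c"

definition phi_alg ::
    "toolkit \<Rightarrow> nat \<Rightarrow> nat \<Rightarrow> (nat \<Rightarrow> nat) \<Rightarrow> (nat \<Rightarrow> nat) \<Rightarrow> real \<Rightarrow> mat \<Rightarrow> real" where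
  "phi_alg T m n R C \<eta> X =
     (case scaling T m n R C \<eta> X of (l, u, t) \<Rightarrow>
        phi_const m n R C * scaling_product m n R C l u)"

(* 20 N bounds the arithmetic operations that the explicit formula for phi needs. *)
definition phi_cost ::
    "toolkit \<Rightarrow> nat \<Rightarrow> nat \<Rightarrow> (nat \<Rightarrow> nat) \<Rightarrow> (nat \<Rightarrow> nat) \<Rightarrow> real \<Rightarrow> mat \<Rightarrow> nat" where
  "phi_cost T m n R C \<eta> X =
     (case scaling T m n R C \<eta> X of (l, u, t) \<Rightarrow> t + 20 * total m R)"

definition p_alg ::
    "toolkit \<Rightarrow> nat \<Rightarrow> nat \<Rightarrow> (nat \<Rightarrow> nat) \<Rightarrow> (nat \<Rightarrow> nat) \<Rightarrow> real \<Rightarrow> real \<Rightarrow> real \<Rightarrow> mat \<Rightarrow> seed \<Rightarrow> real \<times> nat" where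
  "p_alg T m n R C \<eta> \<epsilon> \<zeta> X s =
     (case scaling T m n R C \<eta> X of (l, u, t) \<Rightarrow>
        let N = total m R;
            B = block_mat N R C (unscale m n X l u)
        in case permanent_alg T N B \<epsilon> \<zeta> s of (v, t') \<Rightarrow>
             (normalized_per N v, t + 20 * N\<^sup>2 + t'))"

definition oracle_cost :: "(mat \<Rightarrow> nat) \<Rightarrow> 'a oracle_run \<Rightarrow> nat" where
  "oracle_cost cost r = steps r + (\<Sum>X\<leftarrow>calls r. cost X)"

(* The seed \<omega> 0 is used for the integration of phi, the seeds \<omega> (2 i + 1) and \<omega> (2 i + 2) for
   the i-th sample point and for the permanent at that point. The result is the estimate
   together with the total number of steps. *)
definition count_alg ::
    "toolkit \<Rightarrow> real \<Rightarrow> nat \<Rightarrow> nat \<Rightarrow> nat \<Rightarrow> (nat \<Rightarrow> nat) \<Rightarrow> (nat \<Rightarrow> nat) \<Rightarrow> real \<Rightarrow>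
       (nat \<Rightarrow> seed) \<Rightarrow> real \<times> nat" where
  "count_alg T \<delta> c m n R C \<epsilon> \<omega> =
     (let N = total m R;
          \<tau> = threshold \<delta> N;
          k = num_samples c \<tau> \<epsilon>;
          \<eta> = scaling_tol c N \<tau> \<epsilon>;
          L = real (N + m * n);
          \<Phi> = phi_alg T m n R C \<eta>;
          cost = oracle_cost (phi_cost T m n R C \<eta>);
          int_run = integrate T m n L (\<epsilon> / real c) (1 / real c) \<Phi> (\<omega> 0);
          smp = (\<lambda>i. sample T m n L (\<epsilon> / (real c * \<tau>)) \<Phi> (\<omega> (2 * i + 1)));
          p_run = (\<lambda>i. p_alg T m n R C \<eta> (\<epsilon> / real c) (1 / (real c * real k))
                          (outcome (smp i)) (\<omega> (2 * i + 2)))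
      in (outcome int_run * (1 / real k * (\<Sum>i<k. min (fst (p_run i)) \<tau>)),
          cost int_run + (\<Sum>i<k. oracle_cost (phi_cost T m n R C \<eta>) (smp i) + snd (p_run i) + 5)
            + c + 20))"

definition coin_space :: "(nat \<Rightarrow> seed) measure" where
  "coin_space = (\<Pi>\<^sub>M i\<in>UNIV. seed_space)"

end

(* Expanding the permanent along the blocks shows that p X * phi X is a constant multiple of the
   generating polynomial h X = (\<Sum>D. \<Prod>e. X e ^ D e / D e!) of the contingency tables, while
   the scaling value is an infimum of powers of linear forms, hence homogeneous and log-concave.

   Tail of p. The van der Waerden bound gives p >= 1. Conversely an entropy argument bounds a
   permanent with unit row sums by N!/N^N * exp ((1 + ln N) * S), where S is the largest diagonal
   sum; for the block matrix S is O(ln N) unless more than O(ln N) rows or columns of X are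
   atypically small, or the maxima of the rows of X are atypically large. These events are rare
   for independent exponential entries of means 1 + Z, with Z the typical table, and psi is at most
   e^{g(Z)} / #(R,C) times the density of such a matrix. It remains to see that
   #(R,C) >= e^{g(Z)} N^{-O(m+n)}: by the Prekopa-Leindler inequality the integral I of the capacity
   of h is log-concave in the margins; I is within N^{O(m+n)} of #(R,C), by van der Waerden again;
   and I at (R,C) is compared with its value at the margins of a rounding of a large multiple of Z.

   Algorithm. Since h is homogeneous, polar coordinates carry psi to the density p phi / #(R,C) on
   the simplex, so that truncating p at the threshold loses only a fraction P(p > tau) of #(R,C).
   Translating the orthant bounds phi by e^(N+mn) times its mean, so phi is a legitimate input of
   the integration and sampling procedures, and the errors of the subroutines are combined with
   Hoeffding's inequality for the sample mean. *)

theory Submission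
  imports Defs "HOL-Computational_Algebra.Fundamental_Theorem_Algebra" "HOL-Real_Asymp.Real_Asymp"
begin

section \<open>Permanents and the van der Waerden bound\<close>

text \<open>The density is compared with independent exponentials only up to a factor exp(O((m+n) ln
  N)), so an event can be discarded only if its probability there is below exp(-c n ln N) with a
  large c. One atypically small row has probability about exp(-c n), which is too much; only about
  ln N such rows together are rare enough. So O(ln N) exceptional rows and columns must be
  tolerated, each adding at most 1 to the diagonal sum S, and the bound exp((1 + ln N) S) then
  produces the threshold N^(delta ln N) in place of a power of N. When m or n is itself O(ln N) the
  events are not rare enough, but then S <= min(m, n) suffices. The entropy bound is reached by
  counting K-tuples of tables with margins K R and K C. Halving tuples uses log-concavity at
  midpoints only, so K is a power of two. K of order N^2 is large enough that the m n rounding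
  errors, each O(ln N), add up to O(ln N) after division by K, while ln K itself stays O(ln
  N).\<close>

definition bijs :: "'a set => 'b set => ('a => 'b) set" where
 "bijs A C = {\<sigma> \<in> A \<rightarrow>\<^sub>E C. bij_betw \<sigma> A C}"

text \<open>Rows and columns are indexed by two unrelated finite sets, so that deleting a row and a
  column yields a quantity of the same kind; the inductions below rely on this.\<close>

definition per_on :: "'a set => 'b set => ('a => 'b => real) => real" where
 "per_on A C w = (\<Sum>\<sigma>\<in>bijs A C. \<Prod>a\<in>A. w a (\<sigma> a))"

section \<open>Expansion of permanents along a row or a column\<close>

lemma finite_bijs: "finite A ==> finite C ==> finite (bijs A C)"
 unfolding bijs_def by (rule finite_subset[OF _ finite_PiE[of A "%_. C"]]) auto

lemma bijs_fibre:
 assumes "a \<in> A" "c \<in> C"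
 shows "bij_betw (%\<sigma>. \<sigma>(a := c)) (bijs (A - {a}) (C - {c})) {\<sigma> \<in> bijs A C. \<sigma> a = c}"
proof (rule bij_betw_byWitness[where f' = "%\<sigma>. restrict \<sigma> (A - {a})"])
 show "\<forall>\<sigma>\<in>bijs (A - {a}) (C - {c}). restrict (\<sigma>(a := c)) (A - {a}) = \<sigma>"
  by (auto simp: bijs_def PiE_def extensional_def restrict_def fun_eq_iff)
 show "\<forall>\<sigma>\<in>{\<sigma> \<in> bijs A C. \<sigma> a = c}. (restrict \<sigma> (A - {a}))(a := c) = \<sigma>"
  using assms by (auto simp: bijs_def PiE_def extensional_def restrict_def fun_eq_iff)
 show "(%\<sigma>. \<sigma>(a := c)) ` bijs (A - {a}) (C - {c}) \<subseteq> {\<sigma> \<in> bijs A C. \<sigma> a = c}"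
 proof clarify
  fix \<sigma> assume s: "\<sigma> \<in> bijs (A - {a}) (C - {c})"
  have 1: "bij_betw (\<sigma>(a := c)) (A - {a}) (C - {c})"
   using s by (subst bij_betw_cong[of _ _ \<sigma>]) (auto simp: bijs_def)
  have "bij_betw (\<sigma>(a := c)) ((A - {a}) \<union> {a}) ((C - {c}) \<union> {(\<sigma>(a := c)) a})"
   using 1 by (subst notIn_Un_bij_betw3[symmetric]) auto
  then have "bij_betw (\<sigma>(a := c)) A C"
   using assms by (simp add: insert_absorb)
  then show "\<sigma>(a := c) \<in> bijs A C \<and> (\<sigma>(a := c)) a = c"
   using s assms by (auto simp: bijs_def PiE_def extensional_def dest: bij_betwE)
 qed
 show "(%\<sigma>. restrict \<sigma> (A - {a})) ` {\<sigma> \<in> bijs A C. \<sigma> a = c} \<subseteq> bijs (A - {a}) (C - {c})"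
 proof clarify
  fix \<sigma> assume s: "\<sigma> \<in> bijs A C" "c = \<sigma> a"
  have "bij_betw \<sigma> (A - {a}) (C - {\<sigma> a})"
   using s assms by (simp add: bijs_def bij_betw_DiffI)
  then have "bij_betw (restrict \<sigma> (A - {a})) (A - {a}) (C - {\<sigma> a})"
   by (simp add: bij_betw_restrict_eq)
  then show "restrict \<sigma> (A - {a}) \<in> bijs (A - {a}) (C - {\<sigma> a})"
   by (auto simp: bijs_def dest: bij_betwE)
 qed
qed

lemma sum_bijs_row:
 assumes "finite A" "finite C" "a \<in> A"
 shows "(\<Sum>\<sigma>\<in>bijs A C. f \<sigma>) = (\<Sum>c\<in>C. \<Sum>\<sigma>\<in>bijs (A - {a}) (C - {c}). f (\<sigma>(a := c)))"
proof -
 have "(\<Sum>\<sigma>\<in>bijs A C. f \<sigma>) = (\<Sum>c\<in>C. \<Sum>\<sigma>\<in>{\<sigma> \<in> bijs A C. \<sigma> a = c}. f \<sigma>)"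
  using assms by (intro sum.group[symmetric] finite_bijs) (auto simp: bijs_def)
 also have "... = (\<Sum>c\<in>C. \<Sum>\<sigma>\<in>bijs (A - {a}) (C - {c}). f (\<sigma>(a := c)))"
  by (rule sum.cong[OF refl], rule sum.reindex_bij_betw[symmetric], rule bijs_fibre)
   (use assms in auto)
 finally show ?thesis .
qed

lemma sum_bijs_col:
 assumes "finite A" "finite C" "c \<in> C"
 shows "(\<Sum>\<sigma>\<in>bijs A C. f \<sigma>) = (\<Sum>a\<in>A. \<Sum>\<sigma>\<in>bijs (A - {a}) (C - {c}). f (\<sigma>(a := c)))"
proof -
 have "(\<Sum>\<sigma>\<in>bijs A C. f \<sigma>) = (\<Sum>a\<in>A. \<Sum>\<sigma>\<in>{\<sigma> \<in> bijs A C. inv_into A \<sigma> c = a}. f \<sigma>)"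
  using assms
  by (intro sum.group[symmetric] finite_bijs)
   (auto simp: bijs_def bij_betw_def intro!: inv_into_into)
 also have "... = (\<Sum>a\<in>A. \<Sum>\<sigma>\<in>{\<sigma> \<in> bijs A C. \<sigma> a = c}. f \<sigma>)"
 proof (rule sum.cong[OF refl], rule sum.cong[OF _ refl])
  fix a assume "a \<in> A"
  then have "inv_into A \<sigma> c = a \<longleftrightarrow> \<sigma> a = c" if "\<sigma> \<in> bijs A C" for \<sigma>
   using that assms(3) by (metis (no_types, lifting) bijs_def bij_betw_def f_inv_into_f inv_into_f_f mem_Collect_eq)
  then show "{\<sigma> \<in> bijs A C. inv_into A \<sigma> c = a} = {\<sigma> \<in> bijs A C. \<sigma> a = c}" by blast
 qed
 also have "... = (\<Sum>a\<in>A. \<Sum>\<sigma>\<in>bijs (A - {a}) (C - {c}). f (\<sigma>(a := c)))"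
  by (rule sum.cong[OF refl], rule sum.reindex_bij_betw[symmetric], rule bijs_fibre)
   (use assms in auto)
 finally show ?thesis .
qed

lemma prod_fun_upd_remove:
 assumes "finite A" "a \<in> A"
 shows "(\<Prod>a'\<in>A. w a' ((\<sigma>(a := c)) a')) = w a c * (\<Prod>a'\<in>A - {a}. w a' (\<sigma> a'))"
 using assms by (subst prod.remove[of _ a]) auto

lemma per_on_row:
 assumes "finite A" "finite C" "a \<in> A"
 shows "per_on A C w = (\<Sum>c\<in>C. w a c * per_on (A - {a}) (C - {c}) w)"
 unfolding per_on_def sum_bijs_row[OF assms] prod_fun_upd_remove[OF assms(1,3)]
 by (simp add: sum_distrib_left)

lemma per_on_col:
 assumes "finite A" "finite C" "c \<in> C"
 shows "per_on A C w = (\<Sum>a\<in>A. w a c * per_on (A - {a}) (C - {c}) w)"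
proof -
 have "per_on A C w = (\<Sum>a\<in>A. \<Sum>\<sigma>\<in>bijs (A - {a}) (C - {c}). \<Prod>a'\<in>A. w a' ((\<sigma>(a := c)) a'))"
  unfolding per_on_def by (rule sum_bijs_col[OF assms])
 also have "... = (\<Sum>a\<in>A. w a c * per_on (A - {a}) (C - {c}) w)"
  unfolding per_on_def sum_distrib_left
  by (intro sum.cong refl prod_fun_upd_remove) (use assms in auto)
 finally show ?thesis .
qed

lemma per_on_empty: "per_on ({} :: 'a set) ({} :: 'b set) w = 1"
proof -
 have "bijs ({} :: 'a set) ({} :: 'b set) = {%_. undefined}" by (auto simp: bijs_def bij_betw_def)
 then show ?thesis by (simp add: per_on_def del: sum_constant)
qed

lemma permanent_per_on: "permanent N A = per_on {..<N} {..<N} (%a b. A (a, b))"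
 unfolding permanent_def per_on_def
proof (rule sum.reindex_bij_witness[where i = "%\<sigma> a. if a < N then \<sigma> a else a"
   and j = "%\<sigma>. restrict \<sigma> {..<N}"])
 fix \<sigma> assume "\<sigma> \<in> {\<sigma>. \<sigma> permutes {..<N}}"
 then have s: "\<sigma> permutes {..<N}" by simp
 show "(%a. if a < N then restrict \<sigma> {..<N} a else a) = \<sigma>"
  using permutes_not_in[OF s] by (auto simp: fun_eq_iff)
 show "restrict \<sigma> {..<N} \<in> bijs {..<N} {..<N}"
  using s permutes_imp_bij[OF s] by (auto simp: bijs_def bij_betw_restrict_eq dest: bij_betwE)
 show "(\<Prod>a<N. A (a, restrict \<sigma> {..<N} a)) = (\<Prod>a<N. A (a, \<sigma> a))" by simp
next
 fix \<sigma> :: "nat => nat" assume s: "\<sigma> \<in> bijs {..<N} {..<N}"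
 show "restrict (%a. if a < N then \<sigma> a else a) {..<N} = \<sigma>"
  using s by (auto simp: bijs_def PiE_def extensional_def restrict_def fun_eq_iff)
 have "bij_betw (%a. if a < N then \<sigma> a else a) {..<N} {..<N}"
  using s by (subst bij_betw_cong[of _ _ \<sigma>]) (auto simp: bijs_def)
 then show "(%a. if a < N then \<sigma> a else a) \<in> {\<sigma>. \<sigma> permutes {..<N}}"
  by (auto intro!: bij_imp_permutes split: if_splits)
qed

section \<open>Jensen's inequality and polynomials with roots in a half-plane\<close>

lemma weighted_ln_le:
 fixes w x :: "'i => real"
 assumes "finite A" "!!i. i \<in> A ==> 0 <= w i" "(\<Sum>i\<in>A. w i) = 1" "!!i. i \<in> A ==> 0 < x i"
 shows "(\<Sum>i\<in>A. w i * ln (x i)) <= ln (\<Sum>i\<in>A. w i * x i)" and "0 < (\<Sum>i\<in>A. w i * x i)"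
proof -
 define M where "M = (\<Sum>i\<in>A. w i * x i)"
 obtain i where i: "i \<in> A" "w i \<noteq> 0"
  using assms(3) by (metis sum.neutral zero_neq_one)
 then have "0 < w i * x i" using assms(2)[of i] assms(4)[of i] by auto
 then show M: "0 < (\<Sum>i\<in>A. w i * x i)"
  using i assms(1) by (intro sum_pos2[of A i]) (auto intro: mult_nonneg_nonneg assms(2) less_imp_le[OF assms(4)])
 have "(\<Sum>i\<in>A. w i * (ln (x i) - ln M)) <= (\<Sum>i\<in>A. w i * (x i / M - 1))"
 proof (rule sum_mono)
  fix i assume i: "i \<in> A"
  have "ln (x i) - ln M = ln (x i / M)" using assms(4)[OF i] M by (simp add: ln_div M_def)
  also have "... <= x i / M - 1" using assms(4)[OF i] M by (intro ln_le_minus_one) (simp add: M_def)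
  finally show "w i * (ln (x i) - ln M) <= w i * (x i / M - 1)"
   using assms(2)[OF i] by (rule mult_left_mono)
 qed
 also have "... = (\<Sum>i\<in>A. w i * x i) / M - (\<Sum>i\<in>A. w i)"
  by (simp add: right_diff_distrib sum_subtractf sum_divide_distrib)
 also have "... = 0" using assms(3) M by (simp add: M_def)
 finally show "(\<Sum>i\<in>A. w i * ln (x i)) <= ln (\<Sum>i\<in>A. w i * x i)"
  using assms(3) by (simp add: right_diff_distrib sum_subtractf M_def flip: sum_distrib_right)
qed

text \<open>The quotient is the logarithmic derivative at 0, the sum of \<open>- 1 / r\<close> over
  the roots \<open>r\<close>; each summand lies in the lower half-plane when \<open>r\<close>
  does.\<close>

lemma pderiv_nonzero_lower_half_plane:
 fixes p :: "complex poly"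
 assumes "!!z. poly p z = 0 ==> Im z < 0" "p \<noteq> 0"
 shows "Im (coeff p 1 / coeff p 0) <= 0 \<and> (degree p > 0 \<longrightarrow> Im (coeff p 1 / coeff p 0) < 0)"
 using assms
proof (induction "degree p" arbitrary: p)
 case 0
 then show ?case by (auto simp: coeff_eq_0)
next
 case (Suc k)
 have "\<not> constant (poly p)" using Suc.hyps(2) by (simp add: constant_degree)
 then obtain r where r: "poly p r = 0" using fundamental_theorem_of_algebra by blast
 then obtain q where q: "p = [:- r, 1:] * q" by (auto simp: poly_eq_0_iff_dvd dvd_def)
 have qn: "q \<noteq> 0" using q Suc.prems by auto
 have r0: "Im r < 0" using r Suc.prems by blast
 have dq: "k = degree q" using Suc.hyps(2) qn unfolding q by (subst (asm) degree_mult_eq) auto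
 have rq: "Im z < 0" if "poly q z = 0" for z using Suc.prems(1)[of z] that by (simp add: q)
 have IH: "Im (coeff q 1 / coeff q 0) <= 0" using Suc.hyps(1)[OF dq rq qn] by blast
 have q0: "coeff q 0 \<noteq> 0" using rq[of 0] by (auto simp: poly_0_coeff_0)
 have "coeff p 1 / coeff p 0 = coeff q 1 / coeff q 0 + (- 1 / r)"
 proof -
  have "r \<noteq> 0" using r0 by auto
  then show ?thesis using q0 by (simp add: q field_simps)
 qed
 moreover have "Im (- 1 / r) < 0"
 proof -
  have "Im (- 1 / r) = Im r / ((Re r)\<^sup>2 + (Im r)\<^sup>2)" by (simp add: Im_divide)
  also have "... < 0" using r0 by (auto intro!: divide_neg_pos add_nonneg_pos)
  finally show ?thesis .
 qed
 ultimately show ?case using IH by simp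
qed

lemma map_poly_of_real_add: "map_poly of_real (p + q) = map_poly of_real p + map_poly of_real q"
 by (rule poly_eqI) (simp add: coeff_map_poly)

lemma map_poly_of_real_mult: "map_poly of_real (p * q) = map_poly of_real p * map_poly of_real q"
 by (rule poly_eqI) (simp add: coeff_map_poly coeff_mult)

lemma poly_map_poly_of_real: "poly (map_poly of_real p) (of_real x) = of_real (poly p x)"
 by (induction p) (simp_all add: map_poly_pCons)

text \<open>Normalising each linear factor to the value 1 at 0 turns the roots \<open>r\<close> into
  the nonnegative numbers \<open>- 1 / r\<close>. The linear coefficient is recorded because it is
  the quantity that the capacity argument passes on.\<close>

lemma real_rooted_factors:
 fixes p :: "real poly"
 assumes "!!z. poly (map_poly complex_of_real p) z = 0 ==> Im z = 0 \<and> Re z < 0" "p \<noteq> 0"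
 shows "\<exists>xs. length xs = degree p \<and> (\<forall>x\<in>set xs. 0 <= x) \<and>
     (\<forall>t. poly p t = poly p 0 * (\<Prod>x\<leftarrow>xs. 1 + t * x)) \<and> coeff p 1 = poly p 0 * sum_list xs"
 using assms
proof (induction "degree p" arbitrary: p)
 case 0
 then obtain c where "p = [:c:]" by (metis degree_eq_zeroE)
 then show ?case by simp
next
 case (Suc k)
 have "\<not> constant (poly (map_poly complex_of_real p))"
  using Suc.hyps(2) by (simp add: constant_degree degree_map_poly)
 then obtain z where z: "poly (map_poly complex_of_real p) z = 0"
  using fundamental_theorem_of_algebra by blast
 define r where "r = Re z"
 have zr: "z = of_real r" and r: "r < 0" using Suc.prems(1)[OF z] by (auto simp: r_def complex_eq_iff)
 have "poly p r = 0" using z unfolding zr by (simp add: poly_map_poly_of_real)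
 then obtain q where q: "p = [:- r, 1:] * q" by (auto simp: poly_eq_0_iff_dvd dvd_def)
 have qn: "q \<noteq> 0" using q Suc.prems by auto
 have dq: "k = degree q" using Suc.hyps(2) qn unfolding q by (subst (asm) degree_mult_eq) auto
 have rq: "Im z = 0 \<and> Re z < 0" if "poly (map_poly complex_of_real q) z = 0" for z
 proof -
  have "poly (map_poly complex_of_real p) z = poly (map_poly of_real [:- r, 1:]) z * poly (map_poly of_real q) z"
   by (simp only: q map_poly_of_real_mult poly_mult)
  then show ?thesis using Suc.prems(1)[of z] that by simp
 qed
 obtain xs where xs: "length xs = degree q" "\<forall>x\<in>set xs. 0 <= x"
   "!!t. poly q t = poly q 0 * (\<Prod>x\<leftarrow>xs. 1 + t * x)" "coeff q 1 = poly q 0 * sum_list xs"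
  using Suc.hyps(1)[OF dq rq qn] by blast
 have "poly p t = poly p 0 * (\<Prod>x\<leftarrow>(- 1 / r) # xs. 1 + t * x)" for t
 proof -
  have "poly p t = (t - r) * (poly q 0 * (\<Prod>x\<leftarrow>xs. 1 + t * x))"
   unfolding q poly_mult xs(3)[of t] by simp
  also have "t - r = - r * (1 + t * (- 1 / r))" using r by (simp add: right_diff_distrib)
  finally show ?thesis by (simp add: q)
 qed
 moreover have "coeff p 1 = poly p 0 * sum_list ((- 1 / r) # xs)"
 proof -
  have "coeff p 1 = coeff q 0 - r * coeff q 1" by (simp add: q)
  also have "... = - r * poly q 0 * (- 1 / r + sum_list xs)" using r
   unfolding xs(4) by (simp add: poly_0_coeff_0 right_diff_distrib)
  finally show ?thesis by (simp add: q)
 qed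
 ultimately have "(\<forall>t. poly p t = poly p 0 * (\<Prod>x\<leftarrow>(- 1 / r) # xs. 1 + t * x)) \<and>
   coeff p 1 = poly p 0 * sum_list ((- 1 / r) # xs)"
  by blast
 moreover have "length ((- 1 / r) # xs) = degree p" using xs(1) dq Suc.hyps(2) by simp
 moreover have "\<forall>x\<in>set ((- 1 / r) # xs). 0 <= x" using xs(2) r by (simp add: divide_nonpos_neg)
 ultimately show ?case by blast
qed

text \<open>Inequality of arithmetic and geometric means: each factor is at most the mean factor
  \<open>1 + u\<close> times the exponential of its relative deviation, and the deviations add up to
  0.\<close>

lemma prod_list_le_power:
 fixes xs :: "real list"
 assumes "!!x. x \<in> set xs ==> 0 <= x" "0 <= t" "length xs = k" "k > 0"
 shows "(\<Prod>x\<leftarrow>xs. 1 + t * x) <= (1 + t * sum_list xs / k) ^ k"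
proof -
 define u where "u = t * sum_list xs / k"
 have u: "0 <= u" using assms by (auto simp: u_def intro!: divide_nonneg_nonneg mult_nonneg_nonneg sum_list_nonneg)
 have "(\<Prod>x\<leftarrow>xs. 1 + t * x) <= (1 + u) ^ length xs * exp ((t * sum_list xs - length xs * u) / (1 + u))"
  using assms(1)
 proof (induction xs)
  case (Cons x xs)
  have "1 + t * x <= (1 + u) * exp ((t * x - u) / (1 + u))"
  proof -
   have "1 + t * x = (1 + u) * (1 + (t * x - u) / (1 + u))" using u by (simp add: field_simps)
   also have "... <= (1 + u) * exp ((t * x - u) / (1 + u))"
    using u by (intro mult_left_mono exp_ge_add_one_self) auto
   finally show ?thesis .
  qed
  moreover have "(\<Prod>x\<leftarrow>xs. 1 + t * x) \<ge> 0"
   using Cons.prems assms(2) by (intro prod_list_nonneg) auto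
  ultimately have "(\<Prod>x\<leftarrow>x # xs. 1 + t * x) <= ((1 + u) * exp ((t * x - u) / (1 + u))) *
    ((1 + u) ^ length xs * exp ((t * sum_list xs - length xs * u) / (1 + u)))"
   unfolding list.map prod_list.Cons using Cons u
   by (intro mult_mono) auto
  also have "... = (1 + u) ^ length (x # xs) * exp ((t * x - u) / (1 + u) + (t * sum_list xs - length xs * u) / (1 + u))"
   by (simp add: exp_add)
  also have "(t * x - u) / (1 + u) + (t * sum_list xs - length xs * u) / (1 + u)
    = (t * sum_list (x # xs) - length (x # xs) * u) / (1 + u)"
   by (simp add: algebra_simps flip: add_divide_distrib)
  finally show ?case .
 qed simp
 also have "t * sum_list xs - length xs * u = 0" using assms by (simp add: u_def)
 finally show ?thesis using assms by (simp add: u_def)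
qed

text \<open>The coefficient of the product of the variables \<open>j \<in> js\<close> in the product over \<open>i \<in> A\<close> of the linear forms
 \<open>v i + \<Sum>\<^sub>j w i j t\<^sub>j\<close>. Gurvits' argument controls its capacity while one variable after the other moves
 into \<open>js\<close>; when all have moved it is the permanent.\<close>

fun mixed :: "('i => 'j => 'r::comm_ring_1) => 'i set => 'j list => ('i => 'r) => 'r" where
 "mixed w A [] v = (\<Prod>i\<in>A. v i)"
| "mixed w A (j # js) v = (\<Sum>i\<in>A. w i j * mixed w (A - {i}) js v)"

text \<open>\<open>mixed\<close> is defined over an arbitrary commutative ring so that this transfer
  covers evaluation of polynomials, the embedding of the reals into the complex numbers, and complex
  conjugation.\<close>

lemma mixed_hom:
 assumes "!!x y. h (x + y) = h x + h y" "!!x y. h (x * y) = h x * h y" "h 0 = 0" "h 1 = 1"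
 shows "h (mixed w A js v) = mixed (%i j. h (w i j)) A js (%i. h (v i))"
proof (induction js arbitrary: A)
 case Nil
 have "h (prod v A) = (\<Prod>i\<in>A. h (v i))"
  by (induction A rule: infinite_finite_induct) (simp_all add: assms)
 then show ?case by simp
next
 case (Cons j js)
 have "h (sum f A) = (\<Sum>i\<in>A. h (f i))" for f :: "_ => _"
  by (induction A rule: infinite_finite_induct) (simp_all add: assms)
 then show ?case using Cons by (simp add: assms)
qed

lemma mixed_cong:
 "(!!i. i \<in> A ==> v i = v' i) ==> mixed w A js v = mixed w A js v'"
proof (induction js arbitrary: A)
 case (Cons j js)
 have "mixed w (A - {i}) js v = mixed w (A - {i}) js v'" for i
  using Cons.prems by (intro Cons.IH) auto
 then show ?case by simp
qed (auto intro!: prod.cong)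

lemma mixed_pos:
 fixes w :: "'i => 'j => real"
 assumes "finite A" "length js <= card A" "!!i j. i \<in> A ==> 0 < w i j" "!!i. i \<in> A ==> 0 < v i"
 shows "0 < mixed w A js v"
 using assms
proof (induction js arbitrary: A)
 case Nil
 then show ?case by (auto intro: prod_pos)
next
 case (Cons j js)
 have "A \<noteq> {}" using Cons.prems by auto
 then show ?case using Cons.prems
  by (auto intro!: sum_pos mult_pos_pos Cons.IH)
qed

lemma mixed_col: "set js = C ==> distinct js ==> finite A ==> card A = card C ==> mixed w A js v = per_on A C w"
proof (induction js arbitrary: A C)
 case Nil
 then show ?case by (simp add: per_on_empty)
next
 case (Cons j js)
 have "mixed w A (j # js) v = (\<Sum>i\<in>A. w i j * per_on (A - {i}) (C - {j}) w)"
 proof (simp, rule sum.cong[OF refl])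
  fix i assume "i \<in> A"
  then show "w i j * mixed w (A - {i}) js v = w i j * per_on (A - {i}) (C - {j}) w"
   using Cons.prems by (subst Cons.IH[of "C - {j}"]) auto
 qed
 also have "... = per_on A C w" using Cons.prems by (subst per_on_col[of A C j w]) auto
 finally show ?case .
qed

text \<open>The restriction of \<open>mixed\<close> to the line \<open>v + t u\<close>, obtained by
  running \<open>mixed\<close> itself over the polynomial ring; degree, roots and coefficients are
  then available.\<close>

definition line :: "('i => 'j => 'r::comm_ring_1) => 'i set => 'j list => ('i => 'r) => ('i => 'r) => 'r poly" where
 "line w A js v u = mixed (%i j. [:w i j:]) A js (%i. [:v i, u i:])"

lemma poly_line: "poly (line w A js v u) t = mixed w A js (%i. v i + t * u i)"
 unfolding line_def by (subst mixed_hom[where h = "%p. poly p t"]) auto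

lemma degree_line:
 assumes "finite A" "length js <= card A"
 shows "degree (line w A js v u) <= card A - length js"
 using assms
proof (induction js arbitrary: A)
 case Nil
 have "degree (\<Prod>i\<in>A. [:v i, u i:]) <= sum (degree \<circ> (%i. [:v i, u i:])) A"
  by (rule degree_prod_sum_le) fact
 also have "... <= sum (%i. 1) A" by (rule sum_mono) simp
 finally show ?case by (simp add: line_def)
next
 case (Cons j js)
 have "degree ([:w i j:] * line w (A - {i}) js v u) <= card A - length (j # js)" if "i \<in> A" for i
 proof -
  have "degree ([:w i j:] * line w (A - {i}) js v u) <= degree (line w (A - {i}) js v u)"
   by (simp add: degree_smult_le)
  also have "... <= card (A - {i}) - length js" using Cons.prems that by (intro Cons.IH) auto
  finally show ?thesis using Cons.prems that by simp
 qed
 then show ?case unfolding line_def mixed.simps using Cons.prems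
  by (intro degree_sum_le) (auto simp: line_def)
qed

lemma coeff_line_top:
 assumes "finite A" "length js <= card A"
 shows "coeff (line w A js v u) (card A - length js) = mixed w A js u"
 using assms
proof (induction js arbitrary: A)
 case Nil
 have "coeff (\<Prod>i\<in>A. [:v i, u i:]) (card A) = prod u A" using Nil(1)
 proof (induction A)
  case (insert a A)
  have "degree (\<Prod>i\<in>A. [:v i, u i:]) <= card A" using degree_line[of A "[]" w v u] insert by (simp add: line_def)
  then show ?case using insert by (simp add: coeff_pCons coeff_eq_0)
 qed simp
 then show ?case by (simp add: line_def)
next
 case (Cons j js)
 have "coeff (line w (A - {i}) js v u) (card A - length (j # js)) = mixed w (A - {i}) js u" if "i \<in> A" for i
  using Cons.IH[of "A - {i}"] Cons.prems that by simp
 then show ?case by (simp add: line_def coeff_sum)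
qed

text \<open>Adding a variable to the list is differentiation along its column. In the induction step
  the rows for \<open>k\<close> and \<open>j\<close> are removed in the opposite order, hence the
  exchange of the double sum over ordered pairs.\<close>

lemma coeff_line_1:
 fixes w :: "'i => 'j => 'r::idom"
 assumes "finite A"
 shows "coeff (line w A js v (%i. w i j)) 1 = mixed w A (j # js) v"
 using assms
proof (induction js arbitrary: A)
 case Nil
 have "coeff (line w A [] v (%i. w i j)) 1 = poly (pderiv (\<Prod>i\<in>A. [:v i, w i j:])) 0"
  by (simp add: line_def poly_0_coeff_0 coeff_pderiv)
 also have "... = mixed w A [j] v"
  by (simp add: pderiv_prod poly_sum poly_prod pderiv_pCons mult.commute)
 finally show ?case .
next
 case (Cons k js)
 have "coeff (line w A (k # js) v (%i. w i j)) 1 = (\<Sum>i\<in>A. w i k * coeff (line w (A - {i}) js v (%i. w i j)) 1)"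
  by (simp add: line_def coeff_sum)
 also have "... = (\<Sum>i\<in>A. w i k * mixed w (A - {i}) (j # js) v)" using Cons by (intro sum.cong) auto
 also have "... = (\<Sum>i\<in>A. \<Sum>i'\<in>A - {i}. w i k * w i' j * mixed w (A - {i} - {i'}) js v)"
  by (simp add: sum_distrib_left mult_ac)
 also have "... = (\<Sum>i\<in>A. \<Sum>i'\<in>{i'\<in>A. i' \<noteq> i}. w i k * w i' j * mixed w (A - {i} - {i'}) js v)"
  by (intro sum.cong refl) auto
 also have "... = (\<Sum>i'\<in>A. \<Sum>i\<in>{i\<in>A. i' \<noteq> i}. w i k * w i' j * mixed w (A - {i} - {i'}) js v)"
  by (rule sum.swap_restrict) (use Cons in auto)
 also have "... = (\<Sum>i'\<in>A. \<Sum>i\<in>A - {i'}. w i' j * (w i k * mixed w (A - {i'} - {i}) js v))"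
  by (intro sum.cong refl) (auto simp: mult_ac insert_commute Diff_insert2[symmetric] simp flip: Diff_insert)
 also have "... = mixed w A (j # k # js) v" by (simp add: sum_distrib_left)
 finally show ?case .
qed

lemma line_of_real: "map_poly complex_of_real (line w A js v u) = line (%i j. of_real (w i j)) A js (%i. of_real (v i)) (%i. of_real (u i))"
 unfolding line_def
 by (subst mixed_hom[where h = "map_poly complex_of_real"])
  (auto simp: map_poly_of_real_add map_poly_of_real_mult map_poly_pCons)

text \<open>Stability survives differentiation: along the positive direction of column
  \<open>j\<close> all roots lie in the open lower half-plane, since any other \<open>z\<close>
  would leave \<open>v i + z * w i j\<close> in the upper one, and then the logarithmic derivative
  cannot vanish.\<close>

lemma mixed_upper_half_plane:
 fixes w :: "'i => 'j => real" and v :: "'i => complex"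
 assumes "finite A" "length js <= card A" "!!i j. i \<in> A ==> 0 < w i j" "!!i. i \<in> A ==> Im (v i) > 0"
 shows "mixed (%i j. of_real (w i j)) A js v \<noteq> 0"
 using assms
proof (induction js arbitrary: v)
 case Nil
 have "v i \<noteq> 0" if "i \<in> A" for i using Nil(4)[OF that] by auto
 then show ?case using Nil by (auto simp: prod_zero_iff)
next
 case (Cons j js)
 let ?w = "%i j. complex_of_real (w i j)"
 let ?p = "line ?w A js v (%i. ?w i j)"
 have r: "Im z < 0" if "poly ?p z = 0" for z
 proof (rule ccontr)
  assume "\<not> Im z < 0"
  then have "mixed ?w A js (%i. v i + z * ?w i j) \<noteq> 0"
   using Cons.prems by (intro Cons.IH) (auto intro!: add_pos_nonneg mult_nonneg_nonneg less_imp_le[OF Cons.prems(3)])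
  then show False using that by (simp add: poly_line)
 qed
 have "coeff ?p (card A - length js) = mixed ?w A js (%i. ?w i j)"
  using Cons.prems by (intro coeff_line_top) auto
 also have "... = of_real (mixed w A js (%i. w i j))"
  by (subst mixed_hom[where h = complex_of_real]) auto
 also have "... \<noteq> 0" using Cons.prems mixed_pos[of A js w "%i. w i j"] by simp
 finally have "coeff ?p (card A - length js) \<noteq> 0" .
 then have d: "degree ?p \<ge> card A - length js" by (rule le_degree)
 then have "degree ?p > 0" using Cons.prems by simp
 then have "Im (coeff ?p 1 / coeff ?p 0) < 0"
  using pderiv_nonzero_lower_half_plane[of ?p] r by force
 then have "coeff ?p 1 \<noteq> 0" by auto
 then show ?case using coeff_line_1[of A ?w js v j] Cons.prems by simp
qed

text \<open>Stability applied to a root and to its conjugate makes the restriction to the line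
  real-rooted, and positivity makes the roots negative; the inequality of means then bounds it by
  its value and slope at 0.\<close>

lemma mixed_line_le:
 fixes w :: "'i => 'j => real"
 assumes A: "finite A" "length js < card A" and w: "!!i j. i \<in> A ==> 0 < w i j"
  and v: "!!i. i \<in> A ==> 0 < v i" and t: "0 <= t" and k: "k = card A - length js"
 shows "mixed w A js (%i. v i + t * w i j)
     <= mixed w A js v * (1 + t * (mixed w A (j # js) v / mixed w A js v) / real k) ^ k"
proof -
 let ?p = "line w A js v (%i. w i j)"
 have top: "coeff ?p k > 0" unfolding k using A w by (subst coeff_line_top) (auto intro!: mixed_pos)
 have deg: "degree ?p = k" using degree_line[of A js w v "%i. w i j"] A top k le_degree[of ?p k]
  by (auto intro: antisym)
 have roots: "Im z = 0 \<and> Re z < 0" if "poly (map_poly complex_of_real ?p) z = 0" for z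
 proof -
  let ?w = "%i j. complex_of_real (w i j)"
  have z: "mixed ?w A js (%i. of_real (v i) + z * ?w i j) = 0"
   using that by (simp add: line_of_real poly_line)
  have a: "\<not> Im z > 0"
  proof
   assume "Im z > 0"
   then have "mixed ?w A js (%i. of_real (v i) + z * ?w i j) \<noteq> 0"
    using A w by (intro mixed_upper_half_plane) auto
   then show False using z by simp
  qed
  have "cnj (mixed ?w A js (%i. of_real (v i) + z * ?w i j)) = mixed ?w A js (%i. of_real (v i) + cnj z * ?w i j)"
   by (subst mixed_hom[where h = cnj]) auto
  then have z': "mixed ?w A js (%i. of_real (v i) + cnj z * ?w i j) = 0" using z by simp
  have b: "\<not> Im z < 0"
  proof
   assume "Im z < 0"
   then have "mixed ?w A js (%i. of_real (v i) + cnj z * ?w i j) \<noteq> 0"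
    using A w by (intro mixed_upper_half_plane) (auto simp: mult_neg_pos)
   then show False using z' by simp
  qed
  have "\<not> Re z \<ge> 0"
  proof
   assume r: "Re z \<ge> 0"
   have "0 < mixed w A js (%i. v i + Re z * w i j)"
    using A w v r by (intro mixed_pos) (auto intro!: add_pos_nonneg mult_nonneg_nonneg less_imp_le[OF w])
   moreover have "of_real (mixed w A js (%i. v i + Re z * w i j)) = mixed ?w A js (%i. of_real (v i) + of_real (Re z) * ?w i j)"
    by (subst mixed_hom[where h = complex_of_real]) auto
   moreover have "of_real (Re z) = z" using a b by (auto simp: complex_eq_iff)
   ultimately show False using z by simp
  qed
  then show ?thesis using a b by auto
 qed
 have "?p \<noteq> 0" using top by auto
 from real_rooted_factors[OF roots this] obtain xs where len: "length xs = degree ?p"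
   and xs: "\<forall>x\<in>set xs. 0 <= x"
   "!!t. poly ?p t = poly ?p 0 * (\<Prod>x\<leftarrow>xs. 1 + t * x)" "coeff ?p 1 = poly ?p 0 * sum_list xs"
  by blast
 have len: "length xs = k" using len deg by simp
 have p0: "poly ?p 0 = mixed w A js v" by (simp add: poly_line)
 have pos: "mixed w A js v > 0" using A w v by (intro mixed_pos) auto
 have "mixed w A js (%i. v i + t * w i j) = mixed w A js v * (\<Prod>x\<leftarrow>xs. 1 + t * x)"
  using xs(2)[of t] unfolding poly_line by simp
 also have "... <= mixed w A js v * (1 + t * sum_list xs / k) ^ k"
  using xs(1) len t pos k A by (intro mult_left_mono prod_list_le_power) auto
 also have "sum_list xs = mixed w A (j # js) v / mixed w A js v"
  using xs(3) pos unfolding coeff_line_1[OF A(1)] p0 by (simp add: field_simps del: mixed.simps)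
 finally show ?thesis by simp
qed

text \<open>Gurvits' inequality for one variable: \<open>g\<close> bounds the capacity from below
  before the variable \<open>j\<close> is extracted, and the conclusion does so afterwards. For
  \<open>k = 1\<close> no other variable remains, so \<open>v\<close> is an empty sum; hence the two
  separate hypotheses on \<open>v\<close>.\<close>

lemma gurvits_step:
 fixes w :: "'i => 'j => real"
 assumes A: "finite A" "length js < card A" and w: "!!i j. i \<in> A ==> 0 < w i j"
  and v: "k \<ge> 2 ==> (!!i. i \<in> A ==> 0 < v i)" and k: "k = card A - length js"
  and g: "!!t. 0 < t ==> g * t <= mixed w A js (%i. v i + t * w i j)" "0 <= g"
  and v1: "k = 1 ==> (!!i. i \<in> A ==> v i = 0)"
 shows "g * ((real k - 1) / real k) ^ (k - 1) <= mixed w A (j # js) v"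
proof (cases "k = 1")
 case True
 have "mixed w A (j # js) v = coeff (line w A js v (%i. w i j)) 1" using A by (intro coeff_line_1[symmetric])
 also have "... = mixed w A js (%i. w i j)" using coeff_line_top[of A js w v "%i. w i j"] A True k by simp
 also have "... = mixed w A js (%i. v i + 1 * w i j)" using v1[OF True] by (intro mixed_cong) auto
 finally show ?thesis using g(1)[of 1] True by simp
next
 case False
 then have k2: "k \<ge> 2" using k A by auto
 have A': "length js <= card A" "length (j # js) <= card A" using A by auto
 have q: "mixed w A js v > 0" by (rule mixed_pos[OF A(1) A'(1)]) (use w v[OF k2] in auto)
 have q': "mixed w A (j # js) v > 0" by (rule mixed_pos[OF A(1) A'(2)]) (use w v[OF k2] in auto)
 define q0 q1 where "q0 = mixed w A js v" and "q1 = mixed w A (j # js) v"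
 \<comment> \<open>The minimiser of the upper bound of \<open>mixed_line_le\<close> divided by
   \<open>t\<close>.\<close>
 define t where "t = real k * q0 / ((real k - 1) * q1)"
 have t: "t > 0" using q q' k2 by (auto simp: t_def q0_def q1_def intro!: divide_pos_pos mult_pos_pos)
 have "g * t <= mixed w A js (%i. v i + t * w i j)" using g t by blast
 also have "... <= q0 * (1 + t * (q1 / q0) / real k) ^ k"
  unfolding q0_def q1_def using t by (intro mixed_line_le A w v k2 k) auto
 also have "1 + t * (q1 / q0) / real k = real k / (real k - 1)"
  using k2 q q' by (simp add: t_def q0_def q1_def field_simps)
 finally have *: "g * t <= q0 * (real k / (real k - 1)) ^ k" .
 define x where "x = real k / (real k - 1)"
 have x: "x > 0" using k2 by (simp add: x_def)
 have tx: "t = x * q0 / q1" by (simp add: t_def x_def)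
 have "g * (x * q0 / q1) <= q0 * (x * x ^ (k - 1))"
  using * k2 by (simp add: tx flip: x_def power_Suc)
 then have "(x * q0) * (g / q1) <= (x * q0) * x ^ (k - 1)" by (simp add: mult_ac)
 moreover have "x * q0 > 0" using q x by (simp add: q0_def)
 ultimately have "g / q1 <= x ^ (k - 1)" by (rule mult_left_le_imp_le)
 then have "g <= q1 * x ^ (k - 1)"
  using q' unfolding q1_def[symmetric] by (simp add: divide_le_eq mult.commute)
 then have "g * (1 / x) ^ (k - 1) <= q1" using x by (simp add: power_divide field_simps)
 then show ?thesis by (simp add: q1_def x_def)
qed

text \<open>The losses of the single extraction steps telescope to the van der Waerden
  constant.\<close>

lemma prod_vdw: "(\<Prod>k=1..N. ((real k - 1) / real k) ^ (k - 1)) = fact N / real N ^ N"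
proof (induction N)
 case (Suc N)
 have "(\<Prod>k=1..Suc N. ((real k - 1) / real k) ^ (k - 1)) = fact N / real N ^ N * (real N / real (Suc N)) ^ N"
  by (simp add: Suc.IH[simplified])
 also have "... = fact N / real (Suc N) ^ N" by (cases "N = 0") (simp_all add: power_divide)
 also have "... = (real (Suc N) * fact N) / (real (Suc N) * real (Suc N) ^ N)"
  by (rule mult_divide_mult_cancel_left[symmetric]) simp
 also have "... = fact (Suc N) / real (Suc N) ^ Suc N" by simp
 finally show ?case .
qed simp

theorem van_der_waerden:
 fixes w :: "'i => 'j => real"
 assumes fin: "finite A" "finite C" "card A = N" "card C = N"
  and w: "!!i j. i \<in> A ==> 0 < w i j"
  and rows: "!!i. i \<in> A ==> (\<Sum>c\<in>C. w i c) = 1" and cols: "!!c. c \<in> C ==> (\<Sum>i\<in>A. w i c) = 1"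
 shows "fact N / real N ^ N <= per_on A C w"
proof -
 have wn: "0 <= w i j" if "i \<in> A" for i j using w[OF that, of j] by simp
 \<comment> \<open>The invariant: once the variables in \<open>js\<close> are extracted, what
   remains is at least the product of the other variables times the accumulated losses. A doubly
   stochastic matrix starts with capacity 1.\<close>
 have main: "(\<Prod>k\<in>{Suc (N - length js)..N}. ((real k - 1) / real k) ^ (k - 1)) * (\<Prod>c\<in>C - set js. x c)
   <= mixed w A js (%i. \<Sum>c\<in>C - set js. x c * w i c)"
  if "distinct js" "set js \<subseteq> C" "!!c. c \<in> C ==> 0 < x c" for js x
  using that
 proof (induction js arbitrary: x)
  case Nil
  have x: "x c > 0" "x c \<noteq> 0" if "c \<in> C" for c using Nil(3)[OF that] by auto
  have pos: "0 < (\<Sum>c\<in>C. w i c * x c)" if "i \<in> A" for i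
   using fin rows x wn that by (intro weighted_ln_le(2)) auto
  \<comment> \<open>Column sums 1 distribute each logarithm over the rows, and row sums 1 make every
    row an instance of Jensen's inequality.\<close>
  have "ln (\<Prod>c\<in>C. x c) = (\<Sum>c\<in>C. ln (x c))" using x fin by (intro ln_prod) auto
  also have "... = (\<Sum>c\<in>C. (\<Sum>i\<in>A. w i c) * ln (x c))" using cols by simp
  also have "... = (\<Sum>i\<in>A. \<Sum>c\<in>C. w i c * ln (x c))"
   unfolding sum_distrib_right by (rule sum.swap)
  also have "... <= (\<Sum>i\<in>A. ln (\<Sum>c\<in>C. w i c * x c))"
   using fin rows x wn by (intro sum_mono weighted_ln_le(1)) auto
  also have "... = ln (\<Prod>i\<in>A. \<Sum>c\<in>C. w i c * x c)"
   using pos fin by (intro ln_prod[symmetric]) (auto dest: order.strict_implies_not_eq[OF pos])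
  finally have "(\<Prod>c\<in>C. x c) <= (\<Prod>i\<in>A. \<Sum>c\<in>C. w i c * x c)"
   using pos x by (subst (asm) ln_le_cancel_iff) (auto intro!: prod_pos)
  then show ?case by (simp add: mult.commute)
 next
  case (Cons j js)
  define k where "k = card A - length js"
  have len: "length js < N"
   using Cons.prems fin card_mono[of C "set (j # js)"] distinct_card[of "j # js"] by simp
  then have k: "k \<ge> 1" "N - length js = k" "N - length (j # js) = k - 1" using fin by (auto simp: k_def)
  have jC: "j \<in> C" "C - set js = insert j (C - set (j # js))" "j \<notin> C - set (j # js)"
   using Cons.prems by auto
  let ?v = "%i. \<Sum>c\<in>C - set (j # js). x c * w i c"
  let ?G = "\<Prod>k\<in>{Suc k..N}. ((real k - 1) / real k) ^ (k - 1)"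
  have cardC: "card (C - set (j # js)) = k - 1"
   using Cons.prems fin k by (subst card_Diff_subset) (auto simp: distinct_card)
  have "(?G * (\<Prod>c\<in>C - set (j # js). x c)) * ((real k - 1) / real k) ^ (k - 1) <= mixed w A (j # js) ?v"
  proof (rule gurvits_step)
   show "finite A" "length js < card A" "k = card A - length js" using fin len by (auto simp: k_def)
   show "0 < w i j" if "i \<in> A" for i j using w that .
   show "0 < ?v i" if "k \<ge> 2" "i \<in> A" for i
   proof (rule sum_pos)
    show "finite (C - set (j # js))" using fin by simp
    show "C - set (j # js) \<noteq> {}" using cardC that by (metis One_nat_def card.empty diff_is_0_eq not_less_eq_eq numeral_2_eq_2)
    show "0 < x c * w i c" if "c \<in> C - set (j # js)" for c using that w \<open>i \<in> A\<close> Cons.prems by auto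
   qed
   show "?v i = 0" if "k = 1" "i \<in> A" for i
    using cardC that fin by (metis (no_types, lifting) card_0_eq diff_self_eq_0 finite_Diff sum.empty)
   show "0 <= ?G * (\<Prod>c\<in>C - set (j # js). x c)"
   proof (intro mult_nonneg_nonneg prod_nonneg ballI zero_le_power divide_nonneg_nonneg)
    show "0 <= x c" if "c \<in> C - set (j # js)" for c using Cons.prems(3)[of c] that by simp
   qed auto
   fix t :: real assume t: "0 < t"
   have "?G * (\<Prod>c\<in>C - set js. (x(j := t)) c) <= mixed w A js (%i. \<Sum>c\<in>C - set js. (x(j := t)) c * w i c)"
    using Cons.IH[of "x(j := t)"] Cons.prems t k by auto
   moreover have "(\<Prod>c\<in>C - set js. (x(j := t)) c) = t * (\<Prod>c\<in>C - set (j # js). x c)"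
    using fin jC(3) unfolding jC(2) by (subst prod.insert) (auto intro!: prod.cong)
   moreover have "(\<Sum>c\<in>C - set js. (x(j := t)) c * w i c) = ?v i + t * w i j" for i
    using fin jC(3) unfolding jC(2) by (subst sum.insert) (auto intro!: sum.cong)
   ultimately show "?G * (\<Prod>c\<in>C - set (j # js). x c) * t <= mixed w A js (%i. ?v i + t * w i j)"
    by (simp add: mult_ac)
  qed
  moreover have "(\<Prod>k\<in>{Suc (k - 1)..N}. ((real k - 1) / real k) ^ (k - 1)) = ((real k - 1) / real k) ^ (k - 1) * ?G"
   using k by (subst atLeastAtMost_insertL[symmetric]) auto
  ultimately show ?case unfolding k(3) by (simp add: mult_ac)
 qed
 obtain js where js: "set js = C" "distinct js" using fin finite_distinct_list by blast
 have "length js = N" using js fin distinct_card by metis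
 then show ?thesis using main[of js "%_. 1"] js mixed_col[OF js fin(1)] fin prod_vdw[of N] by simp
qed

section \<open>The generating polynomial of contingency tables\<close>

definition table_poly :: "nat => nat => (nat => nat) => (nat => nat) => mat => real" where
 "table_poly m n R C X = (\<Sum>D\<in>tables m n R C. \<Prod>e\<in>idx m n. X e ^ D e / fact (D e))"

lemma finite_idx [simp]: "finite (idx m n)"
 by (simp add: idx_def)

lemma idx_iff: "(i, j) \<in> idx m n \<longleftrightarrow> i < m \<and> j < n"
 by (auto simp: idx_def)

lemma card_idx [simp]: "card (idx m n) = m * n"
 by (simp add: idx_def)

lemma sum_idx: "(\<Sum>e\<in>idx m n. f e) = (\<Sum>i<m. \<Sum>j<n. f (i, j))"
 by (simp add: idx_def sum.cartesian_product)

lemma sum_idx': "(\<Sum>e\<in>idx m n. f e) = (\<Sum>j<n. \<Sum>i<m. f (i, j))"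
 by (subst sum.swap) (rule sum_idx)

lemma prod_idx: "(\<Prod>e\<in>idx m n. f e) = (\<Prod>i<m. \<Prod>j<n. f (i, j))"
 by (simp add: idx_def prod.cartesian_product)

lemma prod_idx': "(\<Prod>e\<in>idx m n. f e) = (\<Prod>j<n. \<Prod>i<m. f (i, j))"
 by (subst prod.swap) (rule prod_idx)

lemma tables_le:
 assumes "D \<in> tables m n R C" "(i, j) \<in> idx m n"
 shows "D (i, j) <= R i" "D (i, j) <= C j"
proof -
 have "D (i, j) <= (\<Sum>j<n. D (i, j))" "D (i, j) <= (\<Sum>i<m. D (i, j))"
  using assms by (auto simp: idx_iff intro!: member_le_sum[of j _ "%j. D (i, j)"] member_le_sum[of i _ "%i. D (i, j)"])
 then show "D (i, j) <= R i" "D (i, j) <= C j" using assms by (auto simp: tables_def idx_iff)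
qed

lemma finite_tables [simp]: "finite (tables m n R C)"
proof (rule finite_subset)
 show "tables m n R C \<subseteq> idx m n \<rightarrow>\<^sub>E {..total m R}"
 proof
  fix D assume D: "D \<in> tables m n R C"
  have "D e <= total m R" if "e \<in> idx m n" for e
  proof -
   obtain i j where e: "e = (i, j)" by fastforce
   have "R i <= total m R" using that unfolding total_def e by (intro member_le_sum) (auto simp: idx_iff)
   then show ?thesis using tables_le(1)[OF D that[unfolded e]] e by simp
  qed
  then show "D \<in> idx m n \<rightarrow>\<^sub>E {..total m R}" using D by (auto simp: tables_def PiE_def)
 qed
qed (auto intro!: finite_PiE)

lemma tables_total: "D \<in> tables m n R C ==> (\<Sum>e\<in>idx m n. D e) = total m R"
 by (simp add: sum_idx tables_def total_def)

text \<open>Differentiation of the polynomial by one entry: subtracting 1 at \<open>(i, j)\<close>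
  is a bijection from the tables that are positive there to the tables with both margins
  lowered.\<close>

lemma table_step:
 assumes ij: "i < m" "j < n" and pos: "R i > 0" "C j > 0"
 shows "(\<Sum>D\<in>tables m n R C. real (D (i, j)) * (\<Prod>e\<in>idx m n. X e ^ D e / fact (D e)))
   = X (i, j) * table_poly m n (R(i := R i - 1)) (C(j := C j - 1)) X"
proof -
 let ?T = "%D. \<Prod>e\<in>idx m n. X e ^ D e / fact (D e) :: real"
 let ?e = "(i, j)"
 let ?S = "tables m n (R(i := R i - 1)) (C(j := C j - 1))"
 have e: "?e \<in> idx m n" using ij by (simp add: idx_iff)
 have row: "(\<Sum>j'<n. (D(?e := k)) (i', j')) = (if i' = i then (\<Sum>j'<n. D (i', j')) - D ?e + k else (\<Sum>j'<n. D (i', j')))"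
  for D :: "nat \<times> nat => nat" and k i'
 proof (cases "i' = i")
  case True
  have "(\<Sum>j'<n. (D(?e := k)) (i, j')) = k + (\<Sum>j'\<in>{..<n} - {j}. D (i, j'))"
   using ij by (subst sum.remove[of _ j]) auto
  moreover have "(\<Sum>j'<n. D (i, j')) = D ?e + (\<Sum>j'\<in>{..<n} - {j}. D (i, j'))"
   using ij by (subst sum.remove[of _ j]) auto
  ultimately show ?thesis using True by simp
 qed auto
 have col: "(\<Sum>i'<m. (D(?e := k)) (i', j')) = (if j' = j then (\<Sum>i'<m. D (i', j')) - D ?e + k else (\<Sum>i'<m. D (i', j')))"
  for D :: "nat \<times> nat => nat" and k j'
 proof (cases "j' = j")
  case True
  have "(\<Sum>i'<m. (D(?e := k)) (i', j)) = k + (\<Sum>i'\<in>{..<m} - {i}. D (i', j))"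
   using ij by (subst sum.remove[of _ i]) auto
  moreover have "(\<Sum>i'<m. D (i', j)) = D ?e + (\<Sum>i'\<in>{..<m} - {i}. D (i', j))"
   using ij by (subst sum.remove[of _ i]) auto
  ultimately show ?thesis using True by simp
 qed auto
 have le: "D ?e <= (\<Sum>j'<n. D (i, j'))" "D ?e <= (\<Sum>i'<m. D (i', j))" for D :: "nat \<times> nat => nat"
  using ij by (auto intro!: member_le_sum[of j _ "%j. D (i, j)"] member_le_sum[of i _ "%i. D (i, j)"])
 have "(\<Sum>D\<in>tables m n R C. real (D ?e) * ?T D) = (\<Sum>D\<in>{D \<in> tables m n R C. D ?e > 0}. real (D ?e) * ?T D)"
  by (rule sum.mono_neutral_right) auto
 also have "... = (\<Sum>D\<in>?S. X ?e * ?T D)"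
 proof (rule sum.reindex_bij_witness[where i = "%D. D(?e := D ?e + 1)" and j = "%D. D(?e := D ?e - 1)"])
  fix D assume D: "D \<in> {D \<in> tables m n R C. D ?e > 0}"
  then show "(D(?e := D ?e - 1))(?e := (D(?e := D ?e - 1)) ?e + 1) = D" by auto
  have "\<forall>i'<m. (\<Sum>j'<n. D (i', j')) = R i'" "\<forall>j'<n. (\<Sum>i'<m. D (i', j')) = C j'" using D by (auto simp: tables_def)
  then have "\<forall>i'<m. (\<Sum>j'<n. (D(?e := D ?e - 1)) (i', j')) = (R(i := R i - 1)) i'"
    "\<forall>j'<n. (\<Sum>i'<m. (D(?e := D ?e - 1)) (i', j')) = (C(j := C j - 1)) j'"
   using D le[of D] ij unfolding row col by auto
  moreover have "D(?e := D ?e - 1) \<in> idx m n \<rightarrow>\<^sub>E UNIV" using D e by (auto simp: tables_def PiE_def extensional_def)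
  ultimately show "D(?e := D ?e - 1) \<in> ?S" unfolding tables_def by blast
  define d where "d = D ?e"
  obtain k where k: "D ?e = Suc k" using D by (cases "D ?e") auto
  have "?T D = X ?e ^ Suc k / fact (Suc k) * (\<Prod>e\<in>idx m n - {?e}. X e ^ D e / fact (D e))"
   using e k by (subst prod.remove[of _ ?e]) auto
  moreover have "?T (D(?e := D ?e - 1)) = X ?e ^ k / fact k * (\<Prod>e\<in>idx m n - {?e}. X e ^ D e / fact (D e))"
   using e k by (subst prod.remove[of _ ?e]) auto
  ultimately show "X ?e * ?T (D(?e := D ?e - 1)) = real (D ?e) * ?T D"
  proof -
   have "X ?e ^ Suc k / fact (Suc k) * real (Suc k) = X ?e * (X ?e ^ k / fact k)"
    by (simp add: fact_Suc del: of_nat_Suc)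
   then have "X ?e * (X ?e ^ k / fact k * P) = real (Suc k) * (X ?e ^ Suc k / fact (Suc k) * P)" for P
    by (metis mult.assoc mult.commute)
   note this[of "\<Prod>e\<in>idx m n - {?e}. X e ^ D e / fact (D e)", folded k]
   then show ?thesis unfolding \<open>?T D = _\<close> \<open>?T (D(?e := D ?e - 1)) = _\<close> unfolding k .
  qed
 next
  fix D assume D: "D \<in> ?S"
  then show "(D(?e := D ?e + 1))(?e := (D(?e := D ?e + 1)) ?e - 1) = D" by auto
  have "\<forall>i'<m. (\<Sum>j'<n. D (i', j')) = (R(i := R i - 1)) i'" "\<forall>j'<n. (\<Sum>i'<m. D (i', j')) = (C(j := C j - 1)) j'" using D unfolding tables_def by blast+
  then have "\<forall>i'<m. (\<Sum>j'<n. (D(?e := D ?e + 1)) (i', j')) = R i'"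
    "\<forall>j'<n. (\<Sum>i'<m. (D(?e := D ?e + 1)) (i', j')) = C j'"
   using le[of D] ij pos unfolding row col by auto
  moreover have "D(?e := D ?e + 1) \<in> idx m n \<rightarrow>\<^sub>E UNIV" using D e by (auto simp: tables_def PiE_def extensional_def)
  ultimately have "D(?e := D ?e + 1) \<in> tables m n R C" unfolding tables_def by blast
  then show "D(?e := D ?e + 1) \<in> {D \<in> tables m n R C. D ?e > 0}" by simp
 qed
 finally show ?thesis by (simp add: table_poly_def sum_distrib_left)
qed

text \<open>Euler's identity: the polynomial is homogeneous of degree \<open>R i\<close> in row
  \<open>i\<close>. Columns with \<open>C j = 0\<close> are left out because natural subtraction
  would keep their margin at 0.\<close>

lemma table_poly_row:
 assumes "i < m" "R i > 0"
 shows "(\<Sum>j | j < n \<and> C j > 0. X (i, j) * table_poly m n (R(i := R i - 1)) (C(j := C j - 1)) X)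
   = R i * table_poly m n R C X"
proof -
 let ?T = "%D. \<Prod>e\<in>idx m n. X e ^ D e / fact (D e) :: real"
 have "R i * table_poly m n R C X = (\<Sum>D\<in>tables m n R C. real (\<Sum>j<n. D (i, j)) * ?T D)"
  unfolding table_poly_def sum_distrib_left using assms by (intro sum.cong) (auto simp: tables_def)
 also have "... = (\<Sum>j<n. \<Sum>D\<in>tables m n R C. real (D (i, j)) * ?T D)"
  by (subst sum.swap) (simp add: sum_distrib_right)
 also have "... = (\<Sum>j | j < n \<and> C j > 0. \<Sum>D\<in>tables m n R C. real (D (i, j)) * ?T D)"
 proof (rule sum.mono_neutral_right)
  show "\<forall>j\<in>{..<n} - {j. j < n \<and> 0 < C j}. (\<Sum>D\<in>tables m n R C. real (D (i, j)) * ?T D) = 0"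
  proof (intro ballI sum.neutral)
   fix j D assume "j \<in> {..<n} - {j. j < n \<and> 0 < C j}" and D: "D \<in> tables m n R C"
   then have "D (i, j) = 0" using tables_le(2)[OF D, of i j] assms by (auto simp: idx_iff)
   then show "real (D (i, j)) * ?T D = 0" by simp
  qed
 qed auto
 also have "... = (\<Sum>j | j < n \<and> C j > 0. X (i, j) * table_poly m n (R(i := R i - 1)) (C(j := C j - 1)) X)"
  by (rule sum.cong[OF refl], rule table_step) (use assms in auto)
 finally show ?thesis by simp
qed

lemma tables_zero:
 assumes "!!i. i < m ==> R i = 0" "!!j. j < n ==> C j = 0"
 shows "tables m n R C = {\<lambda>e\<in>idx m n. 0}"
proof (intro equalityI subsetI)
 fix D assume D: "D \<in> tables m n R C"
 have "D e = 0" if "e \<in> idx m n" for e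
  using tables_le(1)[OF D, of "fst e" "snd e"] assms that by (auto simp: idx_def)
 moreover have "D e = undefined" if "e \<notin> idx m n" for e
  using D that by (auto simp only: tables_def PiE_def extensional_def)
 ultimately have "D e = (\<lambda>e\<in>idx m n. 0) e" for e by (cases "e \<in> idx m n") auto
 then show "D \<in> {\<lambda>e\<in>idx m n. 0}" by auto
qed (use assms in \<open>auto simp: tables_def idx_iff\<close>)

lemma table_poly_zero:
 assumes "!!i. i < m ==> R i = 0" "!!j. j < n ==> C j = 0"
 shows "table_poly m n R C X = 1"
 by (simp add: table_poly_def tables_zero[OF assms])

lemma num_tables_zero: "num_tables m n (%_. 0) (%_. 0) = 1"
 by (simp add: num_tables_def tables_zero)

text \<open>In the expansion along a row of block \<open>i\<close> all columns of one block
  \<open>j\<close> contribute alike; their number \<open>C j\<close> restores a factorial, and the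
  sum over \<open>j\<close> is \<open>table_poly_row\<close>. Blocks are given by labels
  \<open>f\<close>, \<open>g\<close>, so that deleting a row or column causes no
  renumbering.\<close>

lemma per_on_blocks:
 assumes "finite A" "finite B"
  and "!!a. a \<in> A ==> f a < m" "!!b. b \<in> B ==> g b < n"
  and "!!i. i < m ==> R i = card {a \<in> A. f a = i}" "!!j. j < n ==> C j = card {b \<in> B. g b = j}"
  and "card A = card B"
 shows "per_on A B (%a b. X (f a, g b)) = (\<Prod>i<m. fact (R i)) * (\<Prod>j<n. fact (C j)) * table_poly m n R C X"
 using assms
proof (induction "card A" arbitrary: A B R C)
 case 0
 then have "A = {}" "B = {}" by auto
 then show ?case using 0 by (subst table_poly_zero) (auto simp: per_on_empty)
next
 case (Suc k)
 then obtain a where a: "a \<in> A" by fastforce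
 define i where "i = f a"
 have i: "i < m" using a Suc by (simp add: i_def)
 have Ri: "R i > 0" using a Suc i by (auto simp: i_def card_gt_0_iff)
 let ?P = "%R C. (\<Prod>i<m. fact (R i)) * (\<Prod>j<n. fact (C j)) * table_poly m n R C X"
 have decr: "card {b' \<in> B - {b}. g b' = j'} = (C(g b := C (g b) - 1)) j'" if "b \<in> B" "j' < n" for b j'
 proof (cases "j' = g b")
  case True
  have "{b' \<in> B - {b}. g b' = j'} = {b' \<in> B. g b' = j'} - {b}" by auto
  then show ?thesis using True that Suc by (simp add: card_Diff_singleton)
 next
  case False
  then have "{b' \<in> B - {b}. g b' = j'} = {b' \<in> B. g b' = j'}" by auto
  then show ?thesis using False that Suc by simp
 qed
 have decrA: "card {a' \<in> A - {a}. f a' = i'} = (R(i := R i - 1)) i'" if "i' < m" for i'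
 proof (cases "i' = i")
  case True
  have "{a' \<in> A - {a}. f a' = i'} = {a' \<in> A. f a' = i'} - {a}" by auto
  then show ?thesis using True that Suc a by (simp add: card_Diff_singleton i_def)
 next
  case False
  then have "{a' \<in> A - {a}. f a' = i'} = {a' \<in> A. f a' = i'}" by (auto simp: i_def)
  then show ?thesis using False that Suc by simp
 qed
 have "per_on A B (%a b. X (f a, g b)) = (\<Sum>b\<in>B. X (i, g b) * per_on (A - {a}) (B - {b}) (%a b. X (f a, g b)))"
  unfolding i_def by (rule per_on_row) (use Suc a in auto)
 also have "... = (\<Sum>b\<in>B. X (i, g b) * ?P (R(i := R i - 1)) (C(g b := C (g b) - 1)))"
 proof (rule sum.cong[OF refl], rule arg_cong[where f = "%x. X (i, g _) * x"], rule Suc.hyps(1))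
  fix b assume b: "b \<in> B"
  show "k = card (A - {a})" "finite (A - {a})" "finite (B - {b})" "card (A - {a}) = card (B - {b})"
   using Suc a b by auto
  show "!!i'. i' < m ==> (R(i := R i - 1)) i' = card {a' \<in> A - {a}. f a' = i'}" using decrA by simp
  show "!!j. j < n ==> (C(g b := C (g b) - 1)) j = card {b' \<in> B - {b}. g b' = j}" using decr[OF b] by simp
 qed (use Suc in auto)
 also have "... = (\<Sum>j<n. \<Sum>b\<in>{b \<in> B. g b = j}. X (i, j) * ?P (R(i := R i - 1)) (C(j := C j - 1)))"
 proof -
  have "(\<Sum>j<n. \<Sum>b\<in>{b \<in> B. g b = j}. X (i, j) * ?P (R(i := R i - 1)) (C(j := C j - 1)))
    = (\<Sum>j<n. \<Sum>b\<in>{b \<in> B. g b = j}. X (i, g b) * ?P (R(i := R i - 1)) (C(g b := C (g b) - 1)))"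
   by (rule sum.cong[OF refl], rule sum.cong[OF refl]) auto
  also have "... = (\<Sum>b\<in>B. X (i, g b) * ?P (R(i := R i - 1)) (C(g b := C (g b) - 1)))"
   by (rule sum.group) (use Suc in auto)
  finally show ?thesis by simp
 qed
 also have "... = (\<Sum>j<n. real (C j) * (X (i, j) * ?P (R(i := R i - 1)) (C(j := C j - 1))))"
  using Suc by (intro sum.cong) auto
 also have "... = (\<Sum>j | j < n \<and> C j > 0. real (C j) * (X (i, j) * ?P (R(i := R i - 1)) (C(j := C j - 1))))"
  by (rule sum.mono_neutral_right) auto
 also have "... = (\<Sum>j | j < n \<and> C j > 0. (\<Prod>i<m. fact (R i)) * (\<Prod>j<n. fact (C j)) / R i * (X (i, j) * table_poly m n (R(i := R i - 1)) (C(j := C j - 1)) X))"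
 proof (rule sum.cong[OF refl])
  fix j assume j: "j \<in> {j. j < n \<and> C j > 0}"
  have f: "(fact (F k) :: real) = F k * fact (F k - 1)" if "F k > 0" for F :: "nat => nat" and k
   using that by (cases "F k") (auto simp: algebra_simps)
  have "(\<Prod>i<m. fact (R i)) = real (R i) * (\<Prod>i'<m. fact ((R(i := R i - 1)) i'))"
   using i Ri by (subst (1 2) prod.remove[of _ i]) (auto simp: f[of R i] intro!: prod.cong)
  moreover have "(\<Prod>j<n. fact (C j)) = real (C j) * (\<Prod>j'<n. fact ((C(j := C j - 1)) j'))"
   using j by (subst (1 2) prod.remove[of _ j]) (auto simp: f[of C j] intro!: prod.cong)
  ultimately show "real (C j) * (X (i, j) * ?P (R(i := R i - 1)) (C(j := C j - 1))) =
   (\<Prod>i<m. fact (R i)) * (\<Prod>j<n. fact (C j)) / R i * (X (i, j) * table_poly m n (R(i := R i - 1)) (C(j := C j - 1)) X)"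
   using Ri by (simp add: mult_ac)
 qed
 also have "... = (\<Prod>i<m. fact (R i)) * (\<Prod>j<n. fact (C j)) / R i * (R i * table_poly m n R C X)"
  unfolding sum_distrib_left[symmetric] using table_poly_row[of i m R X n C] i Ri by simp
 finally show ?case using Ri by simp
qed

lemma block_of_iff:
 assumes "i < m" "a < total m R"
 shows "block_of R a = i \<longleftrightarrow> (\<Sum>i'<i. R i') <= a \<and> a < (\<Sum>i'\<le>i. R i')"
proof
 have ex: "\<exists>i. a < (\<Sum>i'\<le>i. R i')"
  using assms by (intro exI[of _ "m - 1"]) (auto simp: total_def lessThan_Suc_atMost[symmetric])
 assume b: "block_of R a = i"
 have 1: "a < (\<Sum>i'\<le>i. R i')" using LeastI_ex[OF ex] b by (simp add: block_of_def)
 have 2: "(\<Sum>i'<i. R i') <= a"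
 proof (cases i)
  case (Suc k)
  then have "\<not> a < (\<Sum>i'\<le>k. R i')" using not_less_Least[of k "%i. a < (\<Sum>i'\<le>i. R i')"] b by (simp add: block_of_def)
  then show ?thesis using Suc by (simp add: lessThan_Suc_atMost)
 qed simp
 show "(\<Sum>i'<i. R i') <= a \<and> a < (\<Sum>i'\<le>i. R i')" using 1 2 by blast
next
 assume b: "(\<Sum>i'<i. R i') <= a \<and> a < (\<Sum>i'\<le>i. R i')"
 show "block_of R a = i" unfolding block_of_def
 proof (rule Least_equality)
  show "a < (\<Sum>i'\<le>i. R i')" using b by simp
  fix y assume y: "a < (\<Sum>i'\<le>y. R i')"
  show "i <= y"
  proof (rule ccontr)
   assume "\<not> i <= y"
   then have "(\<Sum>i'\<le>y. R i') <= (\<Sum>i'<i. R i')" by (intro sum_mono2) auto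
   then show False using y b by linarith
  qed
 qed
qed

lemma block_of_less: "a < total m R ==> block_of R a < m"
proof -
 assume a: "a < total m R"
 then obtain k where k: "m = Suc k" by (cases m) (auto simp: total_def)
 then have "block_of R a <= k"
  unfolding block_of_def using a by (intro Least_le) (simp add: total_def lessThan_Suc_atMost)
 then show ?thesis using k by simp
qed

lemma card_block:
 assumes "i < m"
 shows "card {a \<in> {..<total m R}. block_of R a = i} = R i"
proof -
 have "(\<Sum>i'\<le>i. R i') <= total m R" unfolding total_def using assms by (intro sum_mono2) auto
 then have "{a \<in> {..<total m R}. block_of R a = i} = {(\<Sum>i'<i. R i')..<(\<Sum>i'\<le>i. R i')}"
  
 proof (intro set_eqI)
  fix x assume tot: "(\<Sum>i'\<le>i. R i') <= total m R"
  show "x \<in> {a \<in> {..<total m R}. block_of R a = i} \<longleftrightarrow> x \<in> {(\<Sum>i'<i. R i')..<(\<Sum>i'\<le>i. R i')}"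
   using block_of_iff[OF assms, of x R] tot by (cases "x < total m R") auto
 qed
 then show ?thesis by (simp add: lessThan_Suc_atMost[symmetric])
qed

lemma permanent_block_mat:
 assumes "total m R = N" "total n C = N"
 shows "permanent N (block_mat N R C Y) = (\<Prod>i<m. fact (R i)) * (\<Prod>j<n. fact (C j)) *
     table_poly m n R C (%(i, j). Y (i, j) / (real (R i) * real (C j)))"
proof -
 let ?X = "%(i, j). Y (i, j) / (real (R i) * real (C j))"
 have "permanent N (block_mat N R C Y) = per_on {..<N} {..<N} (%a b. ?X (block_of R a, block_of C b))"
  unfolding permanent_per_on per_on_def
  by (intro sum.cong refl prod.cong) (auto simp: block_mat_def idx_iff bijs_def Let_def dest: bij_betwE)
 also have "... = (\<Prod>i<m. fact (R i)) * (\<Prod>j<n. fact (C j)) * table_poly m n R C ?X"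
  using assms block_of_less card_block[of _ m R] card_block[of _ n C] by (intro per_on_blocks) auto
 finally show ?thesis .
qed

text \<open>By induction the polynomial for the margins lowered at one position is positive, and
  \<open>table_step\<close> turns this into a nonzero sum over the tables in question.\<close>

lemma tables_nonempty: "total m R = total n C ==> tables m n R C \<noteq> {}"
proof (induction "total m R" arbitrary: R C)
 case 0
 then have "(\<lambda>e\<in>idx m n. 0) \<in> tables m n R C" by (auto simp: tables_def idx_iff total_def)
 then show ?case by auto
next
 case (Suc k)
 have "\<exists>i<m. R i > 0" "\<exists>j<n. C j > 0"
  using Suc(2,3) by (metis Zero_not_Suc neq0_conv sum.neutral total_def lessThan_iff)+
 then obtain i j where i: "i < m" "R i > 0" and j: "j < n" "C j > 0" by auto
 have tot: "total p (f(x := f x - 1)) = total p f - 1" if "x < p" "f x > 0" for p f and x :: nat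
  unfolding total_def using that by (subst (1 2) sum.remove[of _ x]) (auto intro!: arg_cong2[where f = "(+)"] sum.cong)
 have "tables m n (R(i := R i - 1)) (C(j := C j - 1)) \<noteq> {}"
  using Suc tot[of i m R, OF i] tot[of j n C, OF j] by (intro Suc.hyps) (auto simp del: fun_upd_apply)
 then have "0 < table_poly m n (R(i := R i - 1)) (C(j := C j - 1)) (%_. 1)"
  unfolding table_poly_def by (intro sum_pos prod_pos) auto
 then have "(\<Sum>D\<in>tables m n R C. real (D (i, j)) * (\<Prod>e\<in>idx m n. 1 ^ D e / fact (D e))) \<noteq> 0"
  using table_step[where i = i and j = j and R = R and C = C and m = m and n = n and X = "%_. 1"] i j by simp
 then show ?case by force
qed

lemma table_poly_pos:
 assumes "total m R = total n C" "!!e. e \<in> idx m n ==> 0 < X e"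
 shows "0 < table_poly m n R C X"
 unfolding table_poly_def using assms tables_nonempty
 by (intro sum_pos prod_pos) auto

lemma table_poly_nonneg: "(!!e. e \<in> idx m n ==> 0 <= X e) ==> 0 <= table_poly m n R C X"
 unfolding table_poly_def by (auto intro!: sum_nonneg prod_nonneg)

lemma num_tables_pos: "total m R = total n C ==> 0 < num_tables m n R C"
 using tables_nonempty by (simp add: num_tables_def card_gt_0_iff)

section \<open>An upper bound for permanents with small entries\<close>

lemma x_ln_x_tangent:
 fixes x M :: real
 assumes "0 < x" "0 < M"
 shows "x * ln M + x - M <= x * ln x"
proof -
 have "x * (ln M - ln x) <= x * (M / x - 1)"
  using assms ln_le_minus_one[of "M / x"] by (intro mult_left_mono) (auto simp: ln_div)
 then show ?thesis using assms by (simp add: right_diff_distrib)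
qed

text \<open>Log-sum inequality, from tangents of \<open>x ln x\<close> at the common ratio
  \<open>s / t\<close>. It splits the entropy of a permanent into the choice made in one row and the
  permanents of the minors.\<close>

lemma log_sum_le:
 fixes w P :: "'c => real"
 assumes "finite C" "C \<noteq> {}" "!!c. c \<in> C ==> 0 < w c" "!!c. c \<in> C ==> 0 < P c"
 shows "(\<Sum>c\<in>C. w c * P c) * (ln (\<Sum>c\<in>C. w c * P c) - ln (\<Sum>c\<in>C. w c)) <= (\<Sum>c\<in>C. w c * (P c * ln (P c)))"
proof -
 define s t where "s = (\<Sum>c\<in>C. w c * P c)" and "t = (\<Sum>c\<in>C. w c)"
 have st: "s > 0" "t > 0" unfolding s_def t_def using assms by (auto intro!: sum_pos)
 have "s * (ln s - ln t) = (\<Sum>c\<in>C. w c * (P c * ln (s / t) + P c - s / t))"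
 proof -
  have "(\<Sum>c\<in>C. w c * (P c * ln (s / t) + P c - s / t)) = (\<Sum>c\<in>C. (w c * P c) * (ln (s / t) + 1) - w c * (s / t))"
   by (intro sum.cong) (auto simp: algebra_simps)
  also have "... = s * (ln (s / t) + 1) - t * (s / t)"
   unfolding sum_subtractf sum_distrib_right[symmetric] by (simp only: s_def t_def)
  also have "... = s * (ln s - ln t)" using st by (simp add: ln_div algebra_simps)
  finally show ?thesis by simp
 qed
 also have "... <= (\<Sum>c\<in>C. w c * (P c * ln (P c)))"
 proof (rule sum_mono)
  fix c assume "c \<in> C"
  then show "w c * (P c * ln (s / t) + P c - s / t) <= w c * (P c * ln (P c))"
   using assms(3)[of c] assms(4)[of c] st by (intro mult_left_mono x_ln_x_tangent) auto
 qed
 finally show ?thesis by (simp add: s_def t_def)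
qed

lemma per_on_pos:
 assumes "finite A" "finite C" "card A = card C" "!!a c. a \<in> A ==> c \<in> C ==> 0 < w a c"
 shows "0 < per_on A C w"
proof -
 obtain h where h: "bij_betw h A C" using assms finite_same_card_bij by metis
 then have "bij_betw (restrict h A) A C" by (simp add: bij_betw_restrict_eq)
 then have "bijs A C \<noteq> {}" using h by (auto simp: bijs_def dest: bij_betwE intro!: exI[of _ "restrict h A"])
 then show ?thesis unfolding per_on_def using assms
  by (intro sum_pos prod_pos finite_bijs) (auto simp: bijs_def dest: bij_betwE)
qed

text \<open>The right-hand side is the average of the conditional entropies of a random permutation over all
 orders in which its values are revealed: of the row sum \<open>\<rho>\<close> of \<open>a\<close>, the entry \<open>w a (\<sigma> a)\<close> is always
 still available, and the rest is available in proportion \<open>k / (N - 1)\<close> when \<open>k\<close> rows remain.\<close>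

lemma per_ln_per_le:
 fixes w :: "'a => 'c => real"
 assumes "finite A" "finite C" "card A = N" "card C = N" "N \<ge> 1"
  "!!a c. a \<in> A ==> c \<in> C ==> 0 < w a c"
 shows "per_on A C w * ln (per_on A C w) <= (\<Sum>\<sigma>\<in>bijs A C. (\<Prod>a\<in>A. w a (\<sigma> a)) *
  (\<Sum>a\<in>A. \<Sum>k<N. ln (w a (\<sigma> a) + real k / (real N - 1) * ((\<Sum>c\<in>C. w a c) - w a (\<sigma> a)))) / real N)"
 using assms
proof (induction N arbitrary: A C)
 case (Suc M)
 show ?case
 proof (cases "M = 0")
  \<comment> \<open>With a single row the only index is \<open>k = 0\<close>, so the quotient by
    \<open>real N - 1 = 0\<close> is harmless.\<close>
  case True
  then obtain a c where ac: "A = {a}" "C = {c}" using Suc.prems by (metis One_nat_def card_1_singletonE)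
  have "w a (\<sigma> a) = w a c" if "\<sigma> \<in> bijs A C" for \<sigma> using that ac by (auto simp: bijs_def)
  then have "(\<Sum>\<sigma>\<in>bijs A C. (\<Prod>a\<in>A. w a (\<sigma> a)) * (\<Sum>a\<in>A. \<Sum>k<Suc M. ln (w a (\<sigma> a) + real k / (real (Suc M) - 1) * ((\<Sum>c\<in>C. w a c) - w a (\<sigma> a)))) / real (Suc M))
   = per_on A C w * ln (w a c)" using ac True by (simp add: per_on_def)
  moreover have "per_on A C w = w a c" using ac per_on_row[of "{a}" "{c}" a w] by (simp add: per_on_empty)
  ultimately show ?thesis by simp
 next
  case False
  define \<rho> where "\<rho> a = (\<Sum>c\<in>C. w a c)" for a
  let ?N = "real (Suc M)"
  let ?p = "per_on A C w"
  let ?W = "%\<sigma>. \<Prod>a\<in>A. w a (\<sigma> a)"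
  define L where "L a' a \<sigma> = (\<Sum>k<M. ln (w a' (\<sigma> a') + real k / (real M - 1) * (\<rho> a' - w a' (\<sigma> a) - w a' (\<sigma> a'))))" for a' a \<sigma>
  have w: "!!a c. a \<in> A ==> c \<in> C ==> 0 < w a c" by fact
  have Cne: "C \<noteq> {}" using Suc.prems by auto
  \<comment> \<open>Row \<open>a\<close> is revealed first; \<open>L a' a\<close> is then the
    contribution of row \<open>a'\<close> to the minor, in which the column of \<open>a\<close> is
    gone.\<close>
  have step: "?p * ln ?p <= (\<Sum>\<sigma>\<in>bijs A C. ?W \<sigma> * (ln (\<rho> a) + (\<Sum>a'\<in>A - {a}. L a' a \<sigma>) / M))" if a: "a \<in> A" for a
  proof -
   let ?P = "%c. per_on (A - {a}) (C - {c}) w"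
   have P: "0 < ?P c" if "c \<in> C" for c using that a Suc.prems by (intro per_on_pos) auto
   have "?p * (ln ?p - ln (\<rho> a)) <= (\<Sum>c\<in>C. w a c * (?P c * ln (?P c)))"
    unfolding per_on_row[OF Suc.prems(1,2) a] \<rho>_def using Suc.prems(2) Cne w[OF a] P by (intro log_sum_le) auto
   also have "... <= (\<Sum>c\<in>C. w a c * (\<Sum>\<sigma>\<in>bijs (A - {a}) (C - {c}). (\<Prod>a'\<in>A - {a}. w a' (\<sigma> a')) * ((\<Sum>a'\<in>A - {a}. L a' a (\<sigma>(a := c))) / M)))"
   proof (intro sum_mono mult_left_mono)
    fix c assume c: "c \<in> C"
    have "?P c * ln (?P c) <= (\<Sum>\<sigma>\<in>bijs (A - {a}) (C - {c}). (\<Prod>a'\<in>A - {a}. w a' (\<sigma> a')) *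
      (\<Sum>a'\<in>A - {a}. \<Sum>k<M. ln (w a' (\<sigma> a') + real k / (real M - 1) * ((\<Sum>c\<in>C - {c}. w a' c) - w a' (\<sigma> a')))) / real M)"
     using Suc.prems a c False by (intro Suc.IH) auto
    also have "... = (\<Sum>\<sigma>\<in>bijs (A - {a}) (C - {c}). (\<Prod>a'\<in>A - {a}. w a' (\<sigma> a')) * ((\<Sum>a'\<in>A - {a}. L a' a (\<sigma>(a := c))) / M))"
    proof (rule sum.cong[OF refl])
     fix \<sigma>
     have "(\<Sum>a'\<in>A - {a}. \<Sum>k<M. ln (w a' (\<sigma> a') + real k / (real M - 1) * ((\<Sum>c\<in>C - {c}. w a' c) - w a' (\<sigma> a'))))
      = (\<Sum>a'\<in>A - {a}. L a' a (\<sigma>(a := c)))"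
     proof (rule sum.cong[OF refl])
      fix a' assume a': "a' \<in> A - {a}"
      have "(\<Sum>c\<in>C - {c}. w a' c) = \<rho> a' - w a' c" unfolding \<rho>_def using c Suc.prems by (subst sum_diff1) auto
      then show "(\<Sum>k<M. ln (w a' (\<sigma> a') + real k / (real M - 1) * ((\<Sum>c\<in>C - {c}. w a' c) - w a' (\<sigma> a')))) = L a' a (\<sigma>(a := c))"
       using a' by (simp add: L_def)
     qed
     then show "(\<Prod>a'\<in>A - {a}. w a' (\<sigma> a')) * (\<Sum>a'\<in>A - {a}. \<Sum>k<M. ln (w a' (\<sigma> a') + real k / (real M - 1) * ((\<Sum>c\<in>C - {c}. w a' c) - w a' (\<sigma> a')))) / real M
      = (\<Prod>a'\<in>A - {a}. w a' (\<sigma> a')) * ((\<Sum>a'\<in>A - {a}. L a' a (\<sigma>(a := c))) / M)" by simp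
    qed
    finally show "?P c * ln (?P c) <= (\<Sum>\<sigma>\<in>bijs (A - {a}) (C - {c}). (\<Prod>a'\<in>A - {a}. w a' (\<sigma> a')) * ((\<Sum>a'\<in>A - {a}. L a' a (\<sigma>(a := c))) / M))" .
    show "0 <= w a c" using w[OF a c] by simp
   qed
   also have "... = (\<Sum>\<sigma>\<in>bijs A C. ?W \<sigma> * ((\<Sum>a'\<in>A - {a}. L a' a \<sigma>) / M))"
    unfolding sum_bijs_row[OF Suc.prems(1,2) a] prod_fun_upd_remove[OF Suc.prems(1) a]
    by (simp add: sum_distrib_left mult_ac)
   also have "... = (\<Sum>\<sigma>\<in>bijs A C. ?W \<sigma> * (ln (\<rho> a) + (\<Sum>a'\<in>A - {a}. L a' a \<sigma>) / M)) - ?p * ln (\<rho> a)"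
    by (simp add: per_on_def sum_distrib_right distrib_left sum.distrib)
   finally show ?thesis by (simp add: right_diff_distrib)
  qed
  \<comment> \<open>Averaging \<open>step\<close> over the row that is revealed first leaves, for
    each permutation, an inequality between logarithms only.\<close>
  have fixed: "(\<Sum>a\<in>A. ln (\<rho> a) + (\<Sum>a'\<in>A - {a}. L a' a \<sigma>) / M)
    <= (\<Sum>a\<in>A. \<Sum>k<Suc M. ln (w a (\<sigma> a) + real k / (?N - 1) * (\<rho> a - w a (\<sigma> a))))"
   if s: "\<sigma> \<in> bijs A C" for \<sigma>
  proof -
   have sC: "\<sigma> a \<in> C" if "a \<in> A" for a using s that by (auto simp: bijs_def)
   have jensen: "(\<Sum>a\<in>A - {a'}. L a' a \<sigma>) / M <= (\<Sum>k<M. ln (w a' (\<sigma> a') + real k / real M * (\<rho> a' - w a' (\<sigma> a'))))"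
    if a': "a' \<in> A" for a'
   proof -
    define b where "b = w a' (\<sigma> a')"
    have b: "b > 0" using w[OF a' sC[OF a']] by (simp add: b_def)
    have rest: "(\<Sum>a\<in>A - {a'}. w a' (\<sigma> a)) = \<rho> a' - b"
    proof -
     have "(\<Sum>a\<in>A. w a' (\<sigma> a)) = \<rho> a'" unfolding \<rho>_def
      using s by (intro sum.reindex_bij_betw) (auto simp: bijs_def)
     then show ?thesis using Suc.prems a' by (subst sum_diff1) (auto simp: b_def)
    qed
    have c: "card (A - {a'}) = M" using a' Suc.prems by simp
    have "(\<Sum>a\<in>A - {a'}. L a' a \<sigma>) / M = (\<Sum>k<M. \<Sum>a\<in>A - {a'}. 1 / M * ln (b + real k / (real M - 1) * (\<rho> a' - w a' (\<sigma> a) - b)))"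
     unfolding L_def b_def[symmetric] by (subst sum.swap) (simp add: sum_divide_distrib)
    also have "... <= (\<Sum>k<M. ln (\<Sum>a\<in>A - {a'}. 1 / M * (b + real k / (real M - 1) * (\<rho> a' - w a' (\<sigma> a) - b))))"
    proof (intro sum_mono weighted_ln_le(1))
     fix k a assume a: "a \<in> A - {a'}" and k: "k \<in> {..<M}"
     have "w a' (\<sigma> a) <= (\<Sum>a\<in>A - {a'}. w a' (\<sigma> a))" using a Suc.prems a' sC w
      by (intro member_le_sum) (auto simp: less_imp_le[OF w])
     then have "0 <= \<rho> a' - w a' (\<sigma> a) - b" using rest by simp
     then show "0 < b + real k / (real M - 1) * (\<rho> a' - w a' (\<sigma> a) - b)"
      using b False by (intro add_pos_nonneg mult_nonneg_nonneg) auto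
    qed (use Suc.prems c False in auto)
    also have "... = (\<Sum>k<M. ln (b + real k / real M * (\<rho> a' - b)))"
    proof (rule sum.cong[OF refl])
     fix k assume k: "k \<in> {..<M}"
     have "(\<Sum>a\<in>A - {a'}. 1 / M * (b + real k / (real M - 1) * (\<rho> a' - w a' (\<sigma> a) - b)))
      = (\<Sum>a\<in>A - {a'}. 1 / M * (b + real k / (real M - 1) * (\<rho> a' - b))) - real k / (real M - 1) / M * (\<Sum>a\<in>A - {a'}. w a' (\<sigma> a))"
     proof -
      have "1 / M * (b + q * (r - v - b)) = 1 / M * (b + q * (r - b)) - q / M * v" for q r v :: real
       by (simp add: algebra_simps diff_divide_distrib)
      then show ?thesis unfolding sum_distrib_left sum_subtractf[symmetric] by (intro sum.cong refl)
     qed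
     also have "... = b + real k / (real M - 1) * (\<rho> a' - b) - real k / (real M - 1) / M * (\<rho> a' - b)"
      using c False by (simp add: rest)
     \<comment> \<open>Removing one of the \<open>M\<close> other entries costs on average the
       fraction \<open>1 / M\<close> of the rest, which turns \<open>k / (M - 1)\<close> into
       \<open>k / M\<close>. For \<open>M = 1\<close> only \<open>k = 0\<close> occurs.\<close>
     also have "... = b + real k / real M * (\<rho> a' - b)"
     proof (cases "M = 1")
      case False
      then have "real M - 1 \<noteq> 0" "real M \<noteq> 0" using \<open>M \<noteq> 0\<close> by auto
      then show ?thesis by (simp add: divide_simps) (simp add: algebra_simps)
     qed (use k in auto)
     finally show "ln (\<Sum>a\<in>A - {a'}. 1 / M * (b + real k / (real M - 1) * (\<rho> a' - w a' (\<sigma> a) - b))) = ln (b + real k / real M * (\<rho> a' - b))"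
      by simp
    qed
    finally show ?thesis by (simp add: b_def)
   qed
   have "(\<Sum>a\<in>A. ln (\<rho> a) + (\<Sum>a'\<in>A - {a}. L a' a \<sigma>) / M) = (\<Sum>a\<in>A. ln (\<rho> a)) + (\<Sum>a\<in>A. \<Sum>a'\<in>A - {a}. L a' a \<sigma>) / M"
    by (simp add: sum.distrib sum_divide_distrib)
   also have "(\<Sum>a\<in>A. \<Sum>a'\<in>A - {a}. L a' a \<sigma>) = (\<Sum>a'\<in>A. \<Sum>a\<in>A - {a'}. L a' a \<sigma>)"
   proof -
    have "(\<Sum>a\<in>A. \<Sum>a'\<in>A - {a}. L a' a \<sigma>) = (\<Sum>a\<in>A. \<Sum>a'\<in>{a'\<in>A. a' \<noteq> a}. L a' a \<sigma>)"
     by (intro sum.cong refl) auto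
    also have "... = (\<Sum>a'\<in>A. \<Sum>a\<in>{a\<in>A. a' \<noteq> a}. L a' a \<sigma>)" by (rule sum.swap_restrict) (use Suc.prems in auto)
    also have "... = (\<Sum>a'\<in>A. \<Sum>a\<in>A - {a'}. L a' a \<sigma>)" by (intro sum.cong refl) auto
    finally show ?thesis .
   qed
   also have "(\<Sum>a\<in>A. ln (\<rho> a)) + (\<Sum>a'\<in>A. \<Sum>a\<in>A - {a'}. L a' a \<sigma>) / M
     = (\<Sum>a'\<in>A. ln (\<rho> a') + (\<Sum>a\<in>A - {a'}. L a' a \<sigma>) / M)"
    by (simp add: sum.distrib sum_divide_distrib)
   also have "... <= (\<Sum>a'\<in>A. ln (\<rho> a') + (\<Sum>k<M. ln (w a' (\<sigma> a') + real k / real M * (\<rho> a' - w a' (\<sigma> a')))))"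
    using jensen by (intro sum_mono add_left_mono)
   also have "... = (\<Sum>a\<in>A. \<Sum>k<Suc M. ln (w a (\<sigma> a) + real k / (?N - 1) * (\<rho> a - w a (\<sigma> a))))"
    using False by (simp add: add.commute)
   finally show ?thesis .
  qed
  have "?N * (?p * ln ?p) = (\<Sum>a\<in>A. ?p * ln ?p)" using Suc.prems by simp
  also have "... <= (\<Sum>a\<in>A. \<Sum>\<sigma>\<in>bijs A C. ?W \<sigma> * (ln (\<rho> a) + (\<Sum>a'\<in>A - {a}. L a' a \<sigma>) / M))"
   by (rule sum_mono) (rule step)
  also have "... = (\<Sum>\<sigma>\<in>bijs A C. ?W \<sigma> * (\<Sum>a\<in>A. ln (\<rho> a) + (\<Sum>a'\<in>A - {a}. L a' a \<sigma>) / M))"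
   by (subst sum.swap) (simp only: sum_distrib_left)
  also have "... <= (\<Sum>\<sigma>\<in>bijs A C. ?W \<sigma> * (\<Sum>a\<in>A. \<Sum>k<Suc M. ln (w a (\<sigma> a) + real k / (?N - 1) * (\<rho> a - w a (\<sigma> a)))))"
  proof (rule sum_mono, rule mult_left_mono, erule fixed)
   fix \<sigma> assume s: "\<sigma> \<in> bijs A C"
   show "0 <= ?W \<sigma>" using s w by (intro prod_nonneg ballI less_imp_le[OF w]) (auto simp: bijs_def)
  qed
  finally have "?p * ln ?p <= (\<Sum>\<sigma>\<in>bijs A C. ?W \<sigma> * (\<Sum>a\<in>A. \<Sum>k<Suc M. ln (w a (\<sigma> a) + real k / (?N - 1) * (\<rho> a - w a (\<sigma> a))))) / ?N"
   by (simp add: le_divide_eq mult.commute del: sum.lessThan_Suc of_nat_Suc)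
  then show ?thesis unfolding \<rho>_def sum_divide_distrib times_divide_eq_right .
 qed
qed simp

text \<open>With row sums 1, \<open>ln (1 + x) <= x\<close> splits each logarithm into
  \<open>ln ((k + 1) / N)\<close>, which adds up to the logarithm of
  \<open>fact N / real N ^ N\<close>, and a term linear in the entry, whose sum over
  \<open>k\<close> is harmonic.\<close>

lemma permanent_upper:
 fixes w :: "'a => 'c => real"
 assumes A: "finite A" "finite C" "card A = N" "card C = N" "N \<ge> 1"
  and w: "!!a c. a \<in> A ==> c \<in> C ==> 0 < w a c"
  and rows: "!!a. a \<in> A ==> (\<Sum>c\<in>C. w a c) = 1"
  and S: "!!\<sigma>. \<sigma> \<in> bijs A C ==> (\<Sum>a\<in>A. w a (\<sigma> a)) <= S"
 shows "real N ^ N / fact N * per_on A C w <= exp ((1 + ln N) * S)"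
proof -
 let ?p = "per_on A C w"
 have p: "?p > 0" using A w by (intro per_on_pos) auto
 have "fact n = (\<Prod>k<n. real k + 1)" for n by (induction n) (auto simp: algebra_simps)
 then have "fact N / real N ^ N = (\<Prod>k<N. (real k + 1) / real N)" by (simp add: prod_dividef)
 then have lnf: "ln (fact N / real N ^ N) = (\<Sum>k<N. ln ((real k + 1) / N))"
  using A by (simp add: ln_prod)
 have H: "(\<Sum>k<N. 1 / (real k + 1)) <= 1 + ln N"
 proof -
  have "(\<Sum>k<Suc n. 1 / (real k + 1)) <= 1 + ln (Suc n)" for n
  proof (induction n)
   case (Suc n)
   have "ln (real (Suc n) / real (Suc (Suc n))) <= real (Suc n) / real (Suc (Suc n)) - 1"
    by (intro ln_le_minus_one) simp
   also have "... = - 1 / (real (Suc n) + 1)" by (simp add: field_simps)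
   finally have "1 / (real (Suc n) + 1) <= ln (Suc (Suc n)) - ln (Suc n)" by (simp add: ln_div)
   then show ?case using Suc by simp
  qed simp
  from this[of "N - 1"] show ?thesis using A by simp
 qed
 have bound: "(\<Sum>a\<in>A. \<Sum>k<N. ln (w a (\<sigma> a) + real k / (real N - 1) * ((\<Sum>c\<in>C. w a c) - w a (\<sigma> a)))) / real N
  <= ln (fact N / real N ^ N) + (1 + ln N) * S" if s: "\<sigma> \<in> bijs A C" for \<sigma>
 proof -
  have sC: "\<sigma> a \<in> C" if "a \<in> A" for a using s that by (auto simp: bijs_def)
  have "ln (w a (\<sigma> a) + real k / (real N - 1) * ((\<Sum>c\<in>C. w a c) - w a (\<sigma> a)))
    <= ln ((real k + 1) / N) + N * w a (\<sigma> a) * (1 / (real k + 1))" if a: "a \<in> A" and k: "k \<in> {..<N}" for a k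
  proof -
   define b where "b = w a (\<sigma> a)"
   have b: "0 < b" using w[OF a sC[OF a]] by (simp add: b_def)
   have "w a (\<sigma> a) <= (\<Sum>c\<in>C. w a c)"
   proof (rule member_le_sum)
    show "0 <= w a c" if "c \<in> C - {\<sigma> a}" for c using w[OF a, of c] that by simp
   qed (use A sC[OF a] in auto)
   then have b1: "b <= 1" using rows[OF a] by (simp add: b_def)
   \<comment> \<open>Equivalent to \<open>k <= N - 1\<close>. Enlarging the slope to
     \<open>(k + 1) / N\<close> keeps the logarithm finite at \<open>k = 0\<close>.\<close>
   have "real k / (real N - 1) <= (real k + 1) / N"
   proof (cases "N = 1")
    case False
    then have "real N - 1 > 0" using A by simp
    then show ?thesis using k by (auto simp: field_simps)
   qed (use k in auto)
   then have "real k / (real N - 1) * (1 - b) <= (real k + 1) / N * (1 - 0)"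
    using b b1 A by (intro mult_mono) auto
   then have "b + real k / (real N - 1) * (1 - b) <= (real k + 1) / N * (1 + N * b * (1 / (real k + 1)))"
   proof -
    assume "real k / (real N - 1) * (1 - b) <= (real k + 1) / N * (1 - 0)"
    moreover have "(real k + 1) / N * (1 + N * b * (1 / (real k + 1))) = b + (real k + 1) / N * (1 - 0)"
     using A by (simp add: distrib_left)
    ultimately show ?thesis by simp
   qed
   moreover have "0 < b + real k / (real N - 1) * (1 - b)"
    using b b1 A by (intro add_pos_nonneg mult_nonneg_nonneg divide_nonneg_nonneg) auto
   ultimately have "ln (b + real k / (real N - 1) * (1 - b)) <= ln ((real k + 1) / N * (1 + N * b * (1 / (real k + 1))))"
    by simp
   also have "... = ln ((real k + 1) / N) + ln (1 + N * b * (1 / (real k + 1)))"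
    using A b by (intro ln_mult_pos) (auto intro!: add_pos_nonneg mult_nonneg_nonneg)
   also have "... <= ln ((real k + 1) / N) + N * b * (1 / (real k + 1))"
    using b by (intro add_left_mono ln_add_one_self_le_self) (auto intro!: mult_nonneg_nonneg)
   finally show ?thesis using rows[OF a] by (simp add: b_def)
  qed
  then have "(\<Sum>a\<in>A. \<Sum>k<N. ln (w a (\<sigma> a) + real k / (real N - 1) * ((\<Sum>c\<in>C. w a c) - w a (\<sigma> a))))
   <= (\<Sum>a\<in>A. \<Sum>k<N. ln ((real k + 1) / N) + N * w a (\<sigma> a) * (1 / (real k + 1)))"
   by (intro sum_mono)
  also have "... = N * (ln (fact N / real N ^ N) + (\<Sum>a\<in>A. w a (\<sigma> a)) * (\<Sum>k<N. 1 / (real k + 1)))"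
  proof -
   have "(\<Sum>a\<in>A. \<Sum>k<N. N * w a (\<sigma> a) * (1 / (real k + 1))) = N * ((\<Sum>a\<in>A. w a (\<sigma> a)) * (\<Sum>k<N. 1 / (real k + 1)))"
    by (subst sum_product) (simp only: sum_distrib_left mult.assoc)
   then show ?thesis using A by (simp add: sum.distrib lnf distrib_left)
  qed
  also have "... <= N * (ln (fact N / real N ^ N) + S * (1 + ln N))"
   using S[OF s] H A sC sum_nonneg[of A "%a. w a (\<sigma> a)"] less_imp_le[OF w[OF _ sC]]
   by (intro mult_left_mono add_left_mono mult_mono sum_nonneg) (auto intro: order_trans)
  finally show ?thesis using A by (simp add: divide_le_eq mult_ac)
 qed
 have "?p * ln ?p <= (\<Sum>\<sigma>\<in>bijs A C. (\<Prod>a\<in>A. w a (\<sigma> a)) *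
  ((\<Sum>a\<in>A. \<Sum>k<N. ln (w a (\<sigma> a) + real k / (real N - 1) * ((\<Sum>c\<in>C. w a c) - w a (\<sigma> a)))) / real N))"
  using per_ln_per_le[OF A w] by simp
 also have "... <= (\<Sum>\<sigma>\<in>bijs A C. (\<Prod>a\<in>A. w a (\<sigma> a)) * (ln (fact N / real N ^ N) + (1 + ln N) * S))"
 proof (intro sum_mono mult_left_mono bound)
  fix \<sigma> assume s: "\<sigma> \<in> bijs A C"
  show "0 <= (\<Prod>a\<in>A. w a (\<sigma> a))" using s w by (intro prod_nonneg ballI less_imp_le[OF w]) (auto simp: bijs_def)
 qed
 also have "... = ?p * (ln (fact N / real N ^ N) + (1 + ln N) * S)"
  by (simp add: per_on_def sum_distrib_right)
 finally have "ln ?p <= ln (fact N / real N ^ N) + (1 + ln N) * S" using p by simp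
 then have "ln (real N ^ N / fact N * ?p) <= (1 + ln N) * S" using p A by (simp add: ln_mult ln_div)
 then have "exp (ln (real N ^ N / fact N * ?p)) <= exp ((1 + ln N) * S)" by simp
 then show ?thesis using p A by simp
qed

section \<open>Maximizers on the transport polytope and matrix scaling\<close>

lemma compact_PiE_UNIV:
 fixes S :: "'i => real set"
 assumes "!!i. compact (S i)"
 shows "compact (PiE UNIV S)"
proof -
 have "compactin (product_topology (%i::'i. euclidean :: real topology) UNIV) (PiE UNIV S)"
  unfolding compactin_PiE using assms by auto
 then show ?thesis by (simp add: euclidean_product_topology)
qed

lemma in_polytope: "X \<in> transport_polytope m n R C \<longleftrightarrow>
  (\<forall>e\<in>idx m n. 0 <= X e) \<and> X \<in> extensional (idx m n) \<and> has_margins m n R C X"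
 unfolding transport_polytope_def PiE_def Pi_def by blast

lemma polytope_nonneg: "X \<in> transport_polytope m n R C ==> e \<in> idx m n ==> 0 <= X e"
 by (simp only: in_polytope)

lemma polytope_eqI:
 assumes "X \<in> transport_polytope m n R C" "Z \<in> transport_polytope m n R C" "!!e. e \<in> idx m n ==> X e = Z e"
 shows "X = Z"
 using assms extensionalityI[of X "idx m n" Z] by (simp only: in_polytope)

text \<open>Coordinates outside \<open>idx m n\<close> are pinned to the single point
  \<open>undefined\<close>, so that Tychonoff's theorem applies in the full function space.\<close>

lemma compact_polytope: "compact (transport_polytope m n R C)"
proof -
 let ?S = "%e. if e \<in> idx m n then {0..real (total m R)} else {undefined :: real}"
 have c: "continuous_on UNIV (%x :: mat. x e)" for e by simp
 have "transport_polytope m n R C = PiE UNIV ?S \<inter>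
   ((\<Inter>i\<in>{..<m}. {X. (\<Sum>j<n. X (i, j)) = real (R i)}) \<inter> (\<Inter>j\<in>{..<n}. {X. (\<Sum>i<m. X (i, j)) = real (C j)}))"
  (is "_ = ?A \<inter> ?B")
 proof (intro equalityI subsetI)
  fix X assume X: "X \<in> transport_polytope m n R C"
  have "X e <= total m R" if "e \<in> idx m n" for e
  proof -
   have "X e <= (sum X (idx m n))" using that polytope_nonneg[OF X] by (intro member_le_sum) auto
   also have "... = total m R" using X by (simp add: sum_idx transport_polytope_def has_margins_def total_def)
   finally show ?thesis .
  qed
  then show "X \<in> ?A \<inter> ?B"
   using X polytope_nonneg[OF X] by (auto simp: transport_polytope_def has_margins_def PiE_def extensional_def)
 qed (auto simp: transport_polytope_def has_margins_def PiE_def extensional_def Pi_def split: if_splits)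
 moreover have "compact ?A" by (rule compact_PiE_UNIV) auto
 moreover have "closed ?B"
  by (intro closed_Int closed_INT ballI closed_Collect_eq continuous_intros c)
 ultimately show ?thesis by (simp add: compact_Int_closed)
qed

text \<open>The independence table: a point with positive entries, towards which a boundary point
  can be moved.\<close>

lemma product_in_polytope:
 assumes "margins m n R C"
 shows "(\<lambda>(i, j)\<in>idx m n. real (R i) * real (C j) / real (total m R)) \<in> transport_polytope m n R C"
proof -
 have N: "total m R = total n C" using assms by (simp add: margins_def)
 have pos: "0 < total m R" unfolding total_def using assms by (intro sum_pos) (auto simp: margins_def lessThan_empty_iff)
 have N': "(\<Sum>j<n. real (C j)) = total m R" unfolding N by (simp add: total_def)
 have "(\<Sum>j<n. real (R i) * real (C j) / real (total m R)) = R i" for i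
  using pos by (simp add: sum_divide_distrib[symmetric] sum_distrib_left[symmetric] N')
 moreover have "(\<Sum>i<m. real (R i) * real (C j) / real (total m R)) = C j" for j
 proof -
  have "(\<Sum>i<m. real (R i)) = total m R" by (simp add: total_def)
  then show ?thesis using pos by (simp add: sum_divide_distrib[symmetric] sum_distrib_right[symmetric])
 qed
 ultimately show ?thesis by (auto simp: transport_polytope_def has_margins_def idx_iff)
qed

lemma sum_update4:
 assumes "finite I" "distinct [p, q, r, s]" "{p, q, r, s} \<subseteq> I"
 shows "(\<Sum>e\<in>I. F e ((X(p := a, q := b, r := c, s := d)) e))
  = F p a + F q b + F r c + F s d + (\<Sum>e\<in>I - {p, q, r, s}. F e (X e))"
proof -
 have "(\<Sum>e\<in>I. F e ((X(p := a, q := b, r := c, s := d)) e))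
  = (\<Sum>e\<in>{p, q, r, s}. F e ((X(p := a, q := b, r := c, s := d)) e)) + (\<Sum>e\<in>I - {p, q, r, s}. F e ((X(p := a, q := b, r := c, s := d)) e))"
  using assms by (subst sum.subset_diff[of "{p, q, r, s}"]) (auto simp: add.commute)
 also have "(\<Sum>e\<in>I - {p, q, r, s}. F e ((X(p := a, q := b, r := c, s := d)) e)) = (\<Sum>e\<in>I - {p, q, r, s}. F e (X e))"
  by (rule sum.cong) auto
 finally show ?thesis using assms(2) by (simp add: add.assoc del: fun_upd_apply) simp
qed

text \<open>One setting for two maximisations: relative entropy with respect to \<open>X\<close>,
  whose maximiser is the scaled matrix, and the entropy of the typical table. \<open>steep\<close>
  says that near 0 the function gains order \<open>t ln (1 / t)\<close>, more than any linear loss,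
  and so keeps maximisers off the boundary.\<close>

locale separable_concave =
 fixes m n :: nat and R C :: "nat => nat" and f g :: "nat \<times> nat => real => real"
 assumes margins: "margins m n R C"
  and tangent: "!!e x z. e \<in> idx m n ==> 0 < x ==> 0 <= z ==> z \<noteq> x ==> f e z < f e x + g e x * (z - x)"
  and cont: "!!e. e \<in> idx m n ==> continuous_on {0..} (f e)"
  and at_zero: "!!e. f e 0 = 0"
  and steep: "!!e y. e \<in> idx m n ==> 0 < y ==> \<exists>K. \<forall>t\<in>{0<..<1}. f e (t * y) \<ge> t * y * ln (1 / t) - t * K"
  and deriv: "!!e y. e \<in> idx m n ==> 0 < y ==> (f e has_real_derivative g e y) (at y)"
begin

abbreviation "P \<equiv> transport_polytope m n R C"

definition obj :: "mat => real" where "obj X = (\<Sum>e\<in>idx m n. f e (X e))"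

text \<open>A gradient of the form \<open>a i + b j\<close> is orthogonal to differences of matrices
  with equal margins, so only the strict tangent inequality remains.\<close>

lemma critical_unique:
 assumes X: "X \<in> P" "!!e. e \<in> idx m n ==> 0 < X e"
  and ab: "!!i j. i < m ==> j < n ==> g (i, j) (X (i, j)) = a i + b j"
  and Z: "Z \<in> P" "Z \<noteq> X"
 shows "obj Z < obj X"
proof -
 have "\<exists>e\<in>idx m n. Z e \<noteq> X e"
  using Z polytope_eqI[OF Z(1) X(1)] by blast
 then have "obj Z < (\<Sum>e\<in>idx m n. f e (X e) + g e (X e) * (Z e - X e))"
  unfolding obj_def
 proof (intro sum_strict_mono_ex1 ballI)
  fix e assume "e \<in> idx m n"
  then show "f e (Z e) <= f e (X e) + g e (X e) * (Z e - X e)"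
   using tangent[of e "X e" "Z e"] X(2)[of e] polytope_nonneg[OF Z(1), of e] by (cases "Z e = X e") auto
 next
  assume "\<exists>e\<in>idx m n. Z e \<noteq> X e"
  then obtain e where e: "e \<in> idx m n" "Z e \<noteq> X e" by auto
  then show "\<exists>e\<in>idx m n. f e (Z e) < f e (X e) + g e (X e) * (Z e - X e)"
   using tangent[of e "X e" "Z e"] X(2)[of e] polytope_nonneg[OF Z(1), of e] by auto
 qed simp
 also have "... = obj X + (\<Sum>e\<in>idx m n. g e (X e) * (Z e - X e))" by (simp add: obj_def sum.distrib)
 also have "(\<Sum>e\<in>idx m n. g e (X e) * (Z e - X e)) = (\<Sum>i<m. \<Sum>j<n. (a i + b j) * (Z (i, j) - X (i, j)))"
  unfolding sum_idx using ab by (intro sum.cong refl) auto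
 also have "... = (\<Sum>i<m. \<Sum>j<n. a i * (Z (i, j) - X (i, j))) + (\<Sum>j<n. \<Sum>i<m. b j * (Z (i, j) - X (i, j)))"
  by (subst (3) sum.swap) (simp add: distrib_right sum.distrib)
 also have "(\<Sum>i<m. \<Sum>j<n. a i * (Z (i, j) - X (i, j))) = 0"
  using X(1) Z(1) by (intro sum.neutral) (auto simp: sum_distrib_left[symmetric] sum_subtractf transport_polytope_def has_margins_def)
 also have "(\<Sum>j<n. \<Sum>i<m. b j * (Z (i, j) - X (i, j))) = 0"
  using X(1) Z(1) by (intro sum.neutral) (auto simp: sum_distrib_left[symmetric] sum_subtractf transport_polytope_def has_margins_def)
 finally show ?thesis by simp
qed

lemma concave_between:
 assumes "e \<in> idx m n" "0 <= x" "0 < y" "0 < t" "t < 1"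
 shows "(1 - t) * f e x + t * f e y <= f e ((1 - t) * x + t * y)"
proof -
 define w where "w = (1 - t) * x + t * y"
 have w: "w > 0" unfolding w_def using assms by (intro add_nonneg_pos) auto
 have T: "f e z <= f e w + g e w * (z - w)" if "z \<ge> 0" for z
  using tangent[of e w z] assms w that by (cases "z = w") auto
 have "(1 - t) * f e x + t * f e y <= (1 - t) * (f e w + g e w * (x - w)) + t * (f e w + g e w * (y - w))"
  using T[of x] T[of y] assms by (intro add_mono mult_left_mono) auto
 also have "... = f e w + g e w * ((1 - t) * x + t * y - w)" by (simp add: algebra_simps)
 finally show ?thesis by (simp add: w_def)
qed

text \<open>Moving from \<open>X\<close> towards the independence table gains order
  \<open>t ln (1 / t)\<close> at a vanishing entry and loses only order \<open>t\<close>
  elsewhere.\<close>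

lemma maximizer_pos:
 assumes X: "X \<in> P" and max: "!!Z. Z \<in> P ==> obj Z <= obj X" and e0: "e0 \<in> idx m n"
 shows "0 < X e0"
proof (rule ccontr)
 assume "\<not> 0 < X e0"
 then have x0: "X e0 = 0" using polytope_nonneg[OF X e0] by simp
 define Y where "Y = (\<lambda>(i, j)\<in>idx m n. real (R i) * real (C j) / real (total m R))"
 have Y: "Y \<in> P" unfolding Y_def by (rule product_in_polytope[OF margins])
 have pos: "0 < total m R" unfolding total_def using margins by (intro sum_pos) (auto simp: margins_def lessThan_empty_iff)
 have Yp: "0 < Y e" if "e \<in> idx m n" for e
  using that margins pos by (auto simp: Y_def margins_def idx_iff split: prod.splits)
 obtain K where K: "!!t. t \<in> {0<..<1} ==> f e0 (t * Y e0) \<ge> t * Y e0 * ln (1 / t) - t * K"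
  using steep[OF e0 Yp[OF e0]] by blast
 \<comment> \<open>Chosen so that \<open>Y e0 * M\<close> exceeds the constant collected from all
   terms linear in \<open>t\<close>; afterwards \<open>ln (1 / t) = M\<close>.\<close>
 define M where "M = \<bar>obj X - obj Y + K + f e0 (Y e0)\<bar> / Y e0 + 1"
 define t where "t = exp (- M)"
 have "M > 0" unfolding M_def using Yp[OF e0] by (intro add_nonneg_pos divide_nonneg_nonneg) auto
 then have t: "t \<in> {0<..<1}" by (auto simp: t_def)
 define Z where "Z = (\<lambda>e\<in>idx m n. (1 - t) * X e + t * Y e)"
 have ZP: "Z \<in> P"
  unfolding in_polytope
 proof (intro conjI ballI)
  show "0 <= Z e" if "e \<in> idx m n" for e
   using that t polytope_nonneg[OF X that] polytope_nonneg[OF Y that] by (simp add: Z_def)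
  show "Z \<in> extensional (idx m n)" by (simp add: Z_def)
  have conv: "(1 - t) * r + t * r = r" for r by (simp add: algebra_simps)
  show "has_margins m n R C Z"
   using X Y unfolding in_polytope has_margins_def Z_def
   by (simp add: idx_iff sum.distrib sum_distrib_left[symmetric] conv)
 qed
 have "(1 - t) * obj X + t * obj Y + t * Y e0 * M - t * (K + f e0 (Y e0)) <= obj Z"
 proof -
  have "obj Z = f e0 (Z e0) + (\<Sum>e\<in>idx m n - {e0}. f e (Z e))" unfolding obj_def using e0 by (intro sum.remove) auto
  moreover have "f e0 (Z e0) \<ge> t * Y e0 * M - t * K"
  proof -
   have "ln (1 / t) = M" by (simp add: t_def ln_div)
   then show ?thesis using K[OF t] x0 e0 by (simp add: Z_def)
  qed
  moreover have "(\<Sum>e\<in>idx m n - {e0}. f e (Z e)) \<ge> (\<Sum>e\<in>idx m n - {e0}. (1 - t) * f e (X e) + t * f e (Y e))"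
   using t Yp polytope_nonneg[OF X] by (intro sum_mono) (auto simp: Z_def intro!: concave_between)
  moreover have "(\<Sum>e\<in>idx m n - {e0}. (1 - t) * f e (X e) + t * f e (Y e)) = (1 - t) * (obj X - f e0 (X e0)) + t * (obj Y - f e0 (Y e0))"
   using e0 by (simp add: sum_diff1 obj_def sum.distrib sum_distrib_left[symmetric])
  ultimately show ?thesis using x0 at_zero by (simp add: algebra_simps)
 qed
 also have "obj Z <= obj X" using ZP by (rule max)
 finally have "t * (Y e0 * M) <= t * (obj X - obj Y + K + f e0 (Y e0))" by (simp add: algebra_simps)
 then have "Y e0 * M <= obj X - obj Y + K + f e0 (Y e0)" using t by simp
 moreover have "Y e0 * M = \<bar>obj X - obj Y + K + f e0 (Y e0)\<bar> + Y e0" using Yp[OF e0] by (simp add: M_def distrib_left)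
 ultimately show False using Yp[OF e0] by linarith
qed

text \<open>First-order condition for the alternating perturbation of the four cells in rows 0,
  \<open>i\<close> and columns 0, \<open>j\<close>, which preserves all margins.\<close>

lemma maximizer_rank_one:
 assumes X: "X \<in> P" and max: "!!Z. Z \<in> P ==> obj Z <= obj X" and ij: "0 < i" "i < m" "0 < j" "j < n"
 shows "g (i, j) (X (i, j)) = g (i, 0) (X (i, 0)) + g (0, j) (X (0, j)) - g (0, 0) (X (0, 0))"
proof -
 have pos: "0 < X e" if "e \<in> idx m n" for e using maximizer_pos[OF X max that] .
 let ?p = "(i, j)" and ?q = "(i, 0::nat)" and ?r = "(0::nat, j)" and ?s = "(0::nat, 0::nat)"
 have I: "{?p, ?q, ?r, ?s} \<subseteq> idx m n" "distinct [?p, ?q, ?r, ?s]" using ij by (auto simp: idx_iff)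
 let ?Z = "%t. X(?p := X ?p + t, ?q := X ?q - t, ?r := X ?r - t, ?s := X ?s + t)"
 define d where "d = Min (X ` {?p, ?q, ?r, ?s})"
 have dle: "d <= X ?p" "d <= X ?q" "d <= X ?r" "d <= X ?s" by (auto simp: d_def)
 have d: "d > 0" using pos I unfolding d_def by (subst Min_gr_iff) auto
 let ?\<phi> = "%t. f ?p (X ?p + t) + f ?q (X ?q - t) + f ?r (X ?r - t) + f ?s (X ?s + t) + (\<Sum>e\<in>idx m n - {?p, ?q, ?r, ?s}. f e (X e))"
 have obj: "obj (?Z t) = ?\<phi> t" for t
  unfolding obj_def using I by (intro sum_update4) auto
 have ZP: "?Z t \<in> P" if "\<bar>0 - t\<bar> < d" for t
 proof -
  have row: "(\<Sum>j'<n. ?Z t (i', j')) = (\<Sum>j'<n. X (i', j'))" for i'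
  proof -
   have "?Z t (i', j') = X (i', j') + (if j' = j then (if i' = i then t else if i' = 0 then - t else 0) else 0)
     + (if j' = 0 then (if i' = i then - t else if i' = 0 then t else 0) else 0)" for j'
    using ij by auto
   then show ?thesis using ij by (simp only: sum.distrib sum.delta finite_lessThan lessThan_iff) auto
  qed
  have col: "(\<Sum>i'<m. ?Z t (i', j')) = (\<Sum>i'<m. X (i', j'))" for j'
  proof -
   have "?Z t (i', j') = X (i', j') + (if i' = i then (if j' = j then t else if j' = 0 then - t else 0) else 0)
     + (if i' = 0 then (if j' = j then - t else if j' = 0 then t else 0) else 0)" for i'
    using ij by auto
   then show ?thesis using ij by (simp only: sum.distrib sum.delta finite_lessThan lessThan_iff) auto
  qed
  have "?Z t e \<ge> 0" if "e \<in> idx m n" for e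
   using \<open>\<bar>0 - t\<bar> < d\<close> dle polytope_nonneg[OF X that] by (auto simp: abs_if split: if_splits)
  moreover have "?Z t \<in> extensional (idx m n)" using X I by (auto simp: transport_polytope_def PiE_def extensional_def)
  moreover have "has_margins m n R C (?Z t)" using X unfolding in_polytope has_margins_def row col by blast
  ultimately show ?thesis unfolding in_polytope by blast
 qed
 have "(?\<phi> has_real_derivative (g ?p (X ?p) - g ?q (X ?q) - g ?r (X ?r) + g ?s (X ?s))) (at 0)"
 proof -
  have plus: "((%t. f e (X e + t)) has_real_derivative g e (X e)) (at 0)" if "e \<in> idx m n" for e
   using DERIV_chain2[of "f e" "g e (X e)" "%t. X e + t" 0 1 UNIV] deriv[OF that pos[OF that]]
    DERIV_add[OF DERIV_const DERIV_ident, of "X e" 0 UNIV] by simp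
  have minus: "((%t. f e (X e - t)) has_real_derivative - g e (X e)) (at 0)" if "e \<in> idx m n" for e
   using DERIV_chain2[of "f e" "g e (X e)" "%t. X e - t" 0 "- 1" UNIV] deriv[OF that pos[OF that]]
    DERIV_diff[OF DERIV_const DERIV_ident, of "X e" 0 UNIV] by simp
  show ?thesis
   using DERIV_add[OF DERIV_add[OF DERIV_add[OF DERIV_add[OF plus[of ?p] minus[of ?q]] minus[of ?r]] plus[of ?s]] DERIV_const] I
   by simp
 qed
 then have "g ?p (X ?p) - g ?q (X ?q) - g ?r (X ?r) + g ?s (X ?s) = 0"
 proof (rule DERIV_local_max[OF _ d], intro allI impI)
  fix t assume t: "\<bar>0 - t\<bar> < d"
  show "?\<phi> t <= ?\<phi> 0" unfolding obj[symmetric] using max[OF ZP[OF t]] by simp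
 qed
 then show ?thesis by simp
qed

theorem maximizer_exists:
 "\<exists>X a b. X \<in> P \<and> (\<forall>e\<in>idx m n. 0 < X e) \<and> (\<forall>i<m. \<forall>j<n. g (i, j) (X (i, j)) = a i + b j) \<and>
  (\<forall>Z\<in>P. obj Z <= obj X) \<and> (\<forall>Z\<in>P. obj X <= obj Z \<longrightarrow> Z = X)"
proof -
 have ne: "P \<noteq> {}" using product_in_polytope[OF margins] by auto
 have "continuous_on P obj" unfolding obj_def
 proof (intro continuous_on_sum continuous_on_compose2[OF cont])
  show "continuous_on P (%x. x e)" for e by (rule continuous_on_subset[of UNIV]) auto
 qed (use polytope_nonneg in auto)
 then obtain X where X: "X \<in> P" "!!Z. Z \<in> P ==> obj Z <= obj X"
  using continuous_attains_sup[OF compact_polytope ne] by metis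
 have pos: "0 < X e" if "e \<in> idx m n" for e using maximizer_pos[OF X that] .
 \<comment> \<open>Potentials read off from column 0 and row 0, normalised by
   \<open>b 0 = 0\<close>.\<close>
 define a b where "a i = g (i, 0) (X (i, 0))" and "b j = g (0, j) (X (0, j)) - g (0, 0) (X (0, 0))" for i j :: nat
 have ab: "g (i, j) (X (i, j)) = a i + b j" if "i < m" "j < n" for i j
  using maximizer_rank_one[OF X, of i j] that by (cases "i = 0"; cases "j = 0") (auto simp: a_def b_def)
 have "Z = X" if "Z \<in> P" "obj X <= obj Z" for Z
  using critical_unique[OF X(1) pos ab that(1)] that(2) by force
 then show ?thesis using X pos ab by blast
qed

end

section \<open>The two instances: relative entropy and the entropy of the typical table\<close>

lemma sum_margins:
 fixes a b :: "nat => real"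
 assumes "has_margins m n R C Y"
 shows "(\<Sum>e\<in>idx m n. Y e * (a (fst e) + b (snd e))) = (\<Sum>i<m. R i * a i) + (\<Sum>j<n. C j * b j)"
proof -
 have "(\<Sum>e\<in>idx m n. Y e * (a (fst e) + b (snd e))) = (\<Sum>e\<in>idx m n. Y e * a (fst e)) + (\<Sum>e\<in>idx m n. Y e * b (snd e))"
  by (simp add: distrib_left sum.distrib)
 also have "(\<Sum>e\<in>idx m n. Y e * a (fst e)) = (\<Sum>i<m. R i * a i)"
  using assms by (simp add: sum_idx has_margins_def sum_distrib_right[symmetric])
 also have "(\<Sum>e\<in>idx m n. Y e * b (snd e)) = (\<Sum>j<n. C j * b j)"
  using assms by (simp add: sum_idx' has_margins_def sum_distrib_right[symmetric])
 finally show ?thesis .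
qed

lemma continuous_on_mult_ln: "continuous_on {0..} (%x :: real. x * ln x)"
 unfolding continuous_on_def
proof
 fix x :: real assume x: "x \<in> {0..}"
 show "((%x. x * ln x) \<longlongrightarrow> x * ln x) (at x within {0..})"
 proof (cases "x = 0")
  case True
  have "((%x :: real. x * ln x) \<longlongrightarrow> 0) (at_right 0)" by real_asymp
  moreover have "at (0 :: real) within {0..} = at_right 0"
   by (rule at_within_nhd[of _ UNIV]) auto
  ultimately show ?thesis using True by simp
 next
  case False
  then show ?thesis using x by (auto intro!: tendsto_intros)
 qed
qed

lemma margins_pos:
 assumes "margins m n R C"
 shows "0 < total m R" "m > 0" "n > 0" "total m R = total n C"
 using assms unfolding total_def margins_def by (auto intro!: sum_pos simp: lessThan_empty_iff)

lemma ln_less_minus_one: "0 < x ==> x \<noteq> 1 ==> ln x < x - (1 :: real)"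
 using ln_le_minus_one[of x] ln_eq_minus_one[of x] by linarith

lemma x_ln_x_strict:
 fixes x z :: real
 assumes "0 < x" "0 <= z" "z \<noteq> x"
 shows "z * ln x + z - x < z * ln z"
proof (cases "z = 0")
 case False
 then have z: "z > 0" using assms by simp
 have "z * ln (x / z) < z * (x / z - 1)"
  using z assms by (intro mult_strict_left_mono ln_less_minus_one) auto
 then show ?thesis using z assms by (simp add: ln_div right_diff_distrib)
qed (use assms in auto)

lemma separable_concave_scaling:
 assumes mar: "margins m n R C" and X: "!!e. e \<in> idx m n ==> 0 < X e"
 shows "separable_concave m n R C (%e y. y * ln (X e) - y * ln y) (%e y. ln (X e) - ln y - 1)"
proof
 show "margins m n R C" by fact
 fix e assume e: "e \<in> idx m n"
 show "z * ln (X e) - z * ln z < x * ln (X e) - x * ln x + (ln (X e) - ln x - 1) * (z - x)"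
  if "0 < x" "0 <= z" "z \<noteq> x" for x z
  using x_ln_x_strict[OF that] by (simp add: algebra_simps)
 show "continuous_on {0..} (%y. y * ln (X e) - y * ln y)"
  by (intro continuous_intros continuous_on_mult_ln)
 show "\<exists>K. \<forall>t\<in>{0<..<1}. t * y * ln (1 / t) - t * K <= t * y * ln (X e) - t * y * ln (t * y)" if "0 < y" for y
  using that by (intro exI[of _ "- y * (ln (X e) - ln y)"]) (auto simp: ln_div ln_mult algebra_simps)
 show "((%y. y * ln (X e) - y * ln y) has_real_derivative ln (X e) - ln y - 1) (at y)" if "0 < y" for y
  using that by (auto intro!: derivative_eq_intros)
qed simp

text \<open>The log-sum inequality for the pairs \<open>(z, 1)\<close> and \<open>(x, 1)\<close>:
  the factor \<open>M\<close> makes the two bounds of the form \<open>ln y <= y - 1\<close> add up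
  to 0.\<close>

lemma entropy_strict:
 fixes x z :: real
 assumes "0 < x" "0 <= z" "z \<noteq> x"
 shows "(z + 1) * ln (z + 1) - z * ln z < (z + 1) * ln (x + 1) - z * ln x"
proof (cases "z = 0")
 case False
 then have z: "z > 0" using assms by simp
 define M where "M = (x + 1) / (z + 1)"
 have M: "M > 0" using z assms by (simp add: M_def)
 have "x / z / M \<noteq> 1" using z assms by (simp add: M_def field_simps)
 then have "z * ln (x / z / M) < z * (x / z / M - 1)"
  using z assms M by (intro mult_strict_left_mono ln_less_minus_one) auto
 moreover have "ln (1 / M) <= 1 / M - 1" using M by (intro ln_le_minus_one) simp
 moreover have "z * (x / z / M - 1) + (1 / M - 1) = 0"
 proof -
  have "z * (x / z / M - 1) + (1 / M - 1) = (x + 1) / M - (z + 1)" using z by (simp add: algebra_simps add_divide_distrib)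
  also have "... = 0" using z assms by (simp add: M_def)
  finally show ?thesis .
 qed
 ultimately have 1: "z * ln (x / z / M) + ln (1 / M) < 0" by linarith
 have a: "ln (x / z / M) = ln x - ln z - ln M" using z assms M by (subst ln_div, subst ln_div) auto
 have b: "ln (1 / M) = - ln M" using M by (simp add: ln_div)
 have c: "ln M = ln (x + 1) - ln (z + 1)" using z assms by (simp add: M_def ln_div)
 show ?thesis using 1 unfolding a b c by (simp add: algebra_simps)
qed (use assms in auto)

lemma separable_concave_entropy:
 assumes "margins m n R C"
 shows "separable_concave m n R C (%e y. (y + 1) * ln (y + 1) - y * ln y) (%e y. ln (y + 1) - ln y)"
proof
 show "margins m n R C" by fact
 show "(z + 1) * ln (z + 1) - z * ln z < (x + 1) * ln (x + 1) - x * ln x + (ln (x + 1) - ln x) * (z - x)"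
  if "0 < x" "0 <= z" "z \<noteq> x" for x z :: real
  using entropy_strict[OF that] by (simp add: algebra_simps)
 show "continuous_on {0..} (%y :: real. (y + 1) * ln (y + 1) - y * ln y)"
  by (intro continuous_intros continuous_on_mult_ln) auto
 show "\<exists>K. \<forall>t\<in>{0<..<1}. t * y * ln (1 / t) - t * K <= (t * y + 1) * ln (t * y + 1) - t * y * ln (t * y)" if "0 < y" for y :: real
 proof (intro exI[of _ "y * ln y"] ballI)
  fix t :: real assume t: "t \<in> {0<..<1}"
  have "0 <= (t * y + 1) * ln (t * y + 1)" using t that by (intro mult_nonneg_nonneg ln_ge_zero) auto
  then show "t * y * ln (1 / t) - t * (y * ln y) <= (t * y + 1) * ln (t * y + 1) - t * y * ln (t * y)"
   using t that by (simp add: ln_div ln_mult algebra_simps)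
 qed
 show "((%y :: real. (y + 1) * ln (y + 1) - y * ln y) has_real_derivative ln (y + 1) - ln y) (at y)" if "0 < y" for y
  using that by (auto intro!: derivative_eq_intros simp: field_simps)
qed simp

section \<open>Matrix scaling: existence, uniqueness and the scaling value\<close>

lemma scales_polytope:
 assumes "scales m n R C X Y l u" "!!e. e \<in> idx m n ==> 0 < X e"
 shows "Y \<in> transport_polytope m n R C" "!!e. e \<in> idx m n ==> 0 < Y e"
  "!!i j. i < m ==> j < n ==> ln (X (i, j)) - ln (Y (i, j)) - 1 = ln (l i) + (ln (u j) - 1)"
proof -
 have pos: "0 < Y (i, j)" if "i < m" "j < n" for i j
 proof -
  have "X (i, j) = Y (i, j) * (l i * u j)" and lu: "0 < l i * u j"
   using assms(1) that by (auto simp: scales_def)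
  then have "0 < Y (i, j) * (l i * u j)"
   using assms(2)[of "(i, j)"] that by (simp add: idx_iff)
  then show ?thesis using lu zero_less_mult_pos2 by blast
 qed
 then show p: "0 < Y e" if "e \<in> idx m n" for e using that by (cases e) (simp add: idx_iff)
 then show "Y \<in> transport_polytope m n R C" using assms(1) unfolding scales_def in_polytope
  by (metis less_imp_le)
 show "ln (X (i, j)) - ln (Y (i, j)) - 1 = ln (l i) + (ln (u j) - 1)" if "i < m" "j < n" for i j
  using assms(1) that pos[OF that] by (auto simp: scales_def ln_mult)
qed

lemma scales_exists:
 assumes "margins m n R C" "!!e. e \<in> idx m n ==> 0 < X e"
 shows "\<exists>Y l u. scales m n R C X Y l u"
proof -
 interpret separable_concave m n R C "%e y. y * ln (X e) - y * ln y" "%e y. ln (X e) - ln y - 1"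
  by (rule separable_concave_scaling[OF assms])
 obtain Y a b where Y: "Y \<in> P" "!!e. e \<in> idx m n ==> 0 < Y e"
  "!!i j. i < m ==> j < n ==> ln (X (i, j)) - ln (Y (i, j)) - 1 = a i + b j"
  using maximizer_exists by blast
 have "X (i, j) = Y (i, j) * exp (a i) * exp (b j + 1)" if "i < m" "j < n" for i j
 proof -
  have e: "(i, j) \<in> idx m n" using that by (simp add: idx_iff)
  have "X (i, j) = exp (ln (Y (i, j)) + a i + (b j + 1))"
  proof -
   have "ln (Y (i, j)) + a i + (b j + 1) = ln (X (i, j))" using Y(3)[OF that] by simp
   then show ?thesis using assms(2)[OF e] by simp
  qed
  then show ?thesis using Y(2)[OF e] by (simp only: exp_add exp_ln)
 qed
 then have "scales m n R C X Y (%i. exp (a i)) (%j. exp (b j + 1))"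
  using Y(1) by (auto simp: scales_def in_polytope)
 then show ?thesis by blast
qed

lemma scales_unique:
 assumes "margins m n R C" "!!e. e \<in> idx m n ==> 0 < X e"
  "scales m n R C X Y l u" "scales m n R C X Y' l' u'"
 shows "Y' = Y"
proof (rule ccontr)
 interpret separable_concave m n R C "%e y. y * ln (X e) - y * ln y" "%e y. ln (X e) - ln y - 1"
  by (rule separable_concave_scaling[OF assms(1,2)])
 assume ne: "Y' \<noteq> Y"
 note S = scales_polytope[OF assms(3,2)] and S' = scales_polytope[OF assms(4,2)]
 have "obj Y' < obj Y" by (rule critical_unique[OF S(1,2) S(3) S'(1) ne])
 moreover have "obj Y < obj Y'" by (rule critical_unique[OF S'(1,2) S'(3) S(1) ne[symmetric]])
 ultimately show False by simp
qed

lemma scaled_mat_scales: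
 assumes "margins m n R C" "!!e. e \<in> idx m n ==> 0 < X e"
 shows "\<exists>l u. scales m n R C X (scaled_mat m n R C X) l u"
 unfolding scaled_mat_def
proof (rule theI'[of "%Y. \<exists>l u. scales m n R C X Y l u"])
 show "\<exists>!Y. \<exists>l u. scales m n R C X Y l u"
  using scales_exists[of m n R C X, OF assms] scales_unique[of m n R C X, OF assms] by blast
qed

lemma scaling_product_pos: "scales m n R C X Y l u ==> 0 < scaling_product m n R C l u"
 unfolding scaling_product_def scales_def by (auto intro!: mult_pos_pos prod_pos)

lemma ln_scaling_product:
 assumes "!!i. i < m ==> 0 < l i" "!!j. j < n ==> 0 < u j"
 shows "ln (scaling_product m n R C l u) = (\<Sum>i<m. R i * ln (l i)) + (\<Sum>j<n. C j * ln (u j))"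
proof -
 have "ln (scaling_product m n R C l u) = ln (\<Prod>i<m. l i ^ R i) + ln (\<Prod>j<n. u j ^ C j)"
  unfolding scaling_product_def using assms by (intro ln_mult_pos prod_pos) auto
 also have "ln (\<Prod>i<m. l i ^ R i) = (\<Sum>i<m. R i * ln (l i))"
  using assms by (subst ln_prod) (auto simp: ln_realpow order.strict_implies_not_eq intro!: sum.cong dest: assms(1)[THEN less_imp_neq])
 also have "ln (\<Prod>j<n. u j ^ C j) = (\<Sum>j<n. C j * ln (u j))"
  using assms by (subst ln_prod) (auto simp: ln_realpow intro!: sum.cong dest: assms(2)[THEN less_imp_neq])
 finally show ?thesis .
qed

text \<open>The right-hand side mentions only \<open>Y\<close>, which is unique, whereas
  \<open>l\<close> and \<open>u\<close> are not; this makes the product well defined.\<close>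

lemma ln_scaling_product_entropy:
 assumes s: "scales m n R C X Y l u" and X: "!!e. e \<in> idx m n ==> 0 < X e"
 shows "ln (scaling_product m n R C l u) = (\<Sum>e\<in>idx m n. Y e * (ln (X e) - ln (Y e)))"
proof -
 have "ln (scaling_product m n R C l u) = (\<Sum>i<m. R i * ln (l i)) + (\<Sum>j<n. C j * ln (u j))"
  using s by (intro ln_scaling_product) (auto simp: scales_def)
 also have "... = (\<Sum>e\<in>idx m n. Y e * (ln (l (fst e)) + ln (u (snd e))))"
  using s by (intro sum_margins[symmetric, of m n R C Y "%i. ln (l i)" "%j. ln (u j)"]) (auto simp: scales_def)
 also have "... = (\<Sum>e\<in>idx m n. Y e * (ln (X e) - ln (Y e)))"
 proof (rule sum.cong[OF refl])
  fix e assume "e \<in> idx m n"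
  then show "Y e * (ln (l (fst e)) + ln (u (snd e))) = Y e * (ln (X e) - ln (Y e))"
   using scales_polytope(3)[OF s X, of "fst e" "snd e"] by (auto simp: idx_def)
 qed
 finally show ?thesis .
qed

lemma scaling_value_eq:
 assumes mar: "margins m n R C" and X: "!!e. e \<in> idx m n ==> 0 < X e"
  and s: "scales m n R C X Y l u"
 shows "scaling_value m n R C X = scaling_product m n R C l u"
 unfolding scaling_value_def
proof (rule the_equality)
 show "\<exists>Y' l' u'. scales m n R C X Y' l' u' \<and> scaling_product m n R C l u = scaling_product m n R C l' u'"
  using s by blast
 fix v assume "\<exists>Y l u. scales m n R C X Y l u \<and> v = scaling_product m n R C l u"
 then obtain Y' l' u' where s': "scales m n R C X Y' l' u'" "v = scaling_product m n R C l' u'" by blast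
 have "Y' = Y" by (rule scales_unique[OF mar X s s'(1)])
 then have "ln v = ln (scaling_product m n R C l u)"
  using ln_scaling_product_entropy[OF s X] ln_scaling_product_entropy[OF s'(1) X] s'(2) by simp
 then show "v = scaling_product m n R C l u"
  using scaling_product_pos[OF s] scaling_product_pos[OF s'(1)] s'(2) by simp
qed

lemma scaling_value_pos:
 assumes "margins m n R C" "!!e. e \<in> idx m n ==> 0 < X e"
 shows "0 < scaling_value m n R C X"
 using scaled_mat_scales[of m n R C X, OF assms] scaling_value_eq[of m n R C X, OF assms] scaling_product_pos by metis

text \<open>Weighted inequality of means with weights \<open>Y e / N\<close>. Together with
  \<open>scaling_value_attained\<close> it describes the scaling value as an infimum over test
  weights \<open>a\<close>, \<open>b\<close>.\<close>

lemma scaling_value_le: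
 assumes mar: "margins m n R C" and X: "!!e. e \<in> idx m n ==> 0 < X e"
  and a: "!!i. i < m ==> 0 < a i" and b: "!!j. j < n ==> 0 < b j"
 shows "scaling_value m n R C X * scaling_product m n R C a b
  <= ((\<Sum>e\<in>idx m n. X e * a (fst e) * b (snd e)) / total m R) ^ total m R"
proof -
 obtain l u where s: "scales m n R C X (scaled_mat m n R C X) l u" using scaled_mat_scales[of m n R C X, OF mar X] by blast
 define Y where "Y = scaled_mat m n R C X"
 define N where "N = real (total m R)"
 have N: "N > 0" using margins_pos[OF mar] by (simp add: N_def)
 have Y: "Y \<in> transport_polytope m n R C" "!!e. e \<in> idx m n ==> 0 < Y e"
  using scales_polytope[OF s X] by (auto simp: Y_def)
 have sumY: "(sum Y (idx m n)) = N"
  using Y(1) by (simp add: sum_idx in_polytope has_margins_def N_def total_def)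
 have ab: "0 < a (fst e)" "0 < b (snd e)" if "e \<in> idx m n" for e using a b that by (auto simp: idx_def)
 have sp: "0 < scaling_product m n R C a b" unfolding scaling_product_def using a b by (auto intro!: mult_pos_pos prod_pos)
 have sv: "0 < scaling_value m n R C X" by (rule scaling_value_pos[OF mar X])
 have "ln (scaling_value m n R C X * scaling_product m n R C a b)
  = (\<Sum>e\<in>idx m n. Y e * (ln (X e) - ln (Y e))) + (\<Sum>e\<in>idx m n. Y e * (ln (a (fst e)) + ln (b (snd e))))"
  using ln_mult_pos[OF sv sp] ln_scaling_product_entropy[OF s X] scaling_value_eq[OF mar X s]
   ln_scaling_product[of m a n b R C] a b
   sum_margins[of m n R C Y "%i. ln (a i)" "%j. ln (b j)"] Y(1) by (simp add: Y_def in_polytope)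
 also have "... = N * (\<Sum>e\<in>idx m n. Y e / N * ln (X e * a (fst e) * b (snd e) / Y e))"
  unfolding sum_distrib_left sum.distrib[symmetric]
 proof (rule sum.cong[OF refl])
  fix e assume e: "e \<in> idx m n"
  have "ln (X e * a (fst e) * b (snd e) / Y e) = ln (X e) + ln (a (fst e)) + ln (b (snd e)) - ln (Y e)"
   using X[OF e] Y(2)[OF e] ab[OF e] by (subst ln_div) (auto simp: ln_mult_pos intro!: mult_pos_pos)
  then show "Y e * (ln (X e) - ln (Y e)) + Y e * (ln (a (fst e)) + ln (b (snd e))) = N * (Y e / N * ln (X e * a (fst e) * b (snd e) / Y e))"
   using N by (simp add: distrib_left right_diff_distrib)
 qed
 also have "... <= N * ln (\<Sum>e\<in>idx m n. Y e / N * (X e * a (fst e) * b (snd e) / Y e))"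
  using N X Y(2) ab sumY polytope_nonneg[OF Y(1)]
  by (intro mult_left_mono weighted_ln_le) (auto simp: sum_divide_distrib[symmetric] intro!: divide_pos_pos mult_pos_pos)
 also have "(\<Sum>e\<in>idx m n. Y e / N * (X e * a (fst e) * b (snd e) / Y e)) = (\<Sum>e\<in>idx m n. X e * a (fst e) * b (snd e)) / N"
  unfolding sum_divide_distrib
 proof (rule sum.cong[OF refl])
  fix e assume e: "e \<in> idx m n"
  then show "Y e / N * (X e * a (fst e) * b (snd e) / Y e) = X e * a (fst e) * b (snd e) / N"
   using Y(2)[OF e] N by simp
 qed
 finally have "ln (scaling_value m n R C X * scaling_product m n R C a b) <= N * ln ((\<Sum>e\<in>idx m n. X e * a (fst e) * b (snd e)) / N)" .
 moreover have pos: "0 < (\<Sum>e\<in>idx m n. X e * a (fst e) * b (snd e)) / N"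
 proof (intro divide_pos_pos sum_pos mult_pos_pos N)
  show "idx m n \<noteq> {}" using margins_pos[OF mar] by (auto simp: idx_def)
 qed (use X ab in auto)
 ultimately have "ln (scaling_value m n R C X * scaling_product m n R C a b) <= ln (((\<Sum>e\<in>idx m n. X e * a (fst e) * b (snd e)) / N) ^ total m R)"
  by (simp add: ln_realpow N_def)
 then show ?thesis using sv sp pos by (simp add: N_def)
qed

text \<open>The inverse scaling factors turn \<open>X\<close> into the scaled matrix, so they give
  equality in \<open>scaling_value_le\<close>.\<close>

lemma scaling_value_attained:
 assumes mar: "margins m n R C" and X: "!!e. e \<in> idx m n ==> 0 < X e"
 obtains a b where "!!i. i < m ==> 0 < a i" "!!j. j < n ==> 0 < b j"
  "scaling_value m n R C X * scaling_product m n R C a b = 1"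
  "(\<Sum>e\<in>idx m n. X e * a (fst e) * b (snd e)) = total m R"
proof -
 obtain l u where s: "scales m n R C X (scaled_mat m n R C X) l u" using scaled_mat_scales[of m n R C X, OF mar X] by blast
 define Y where "Y = scaled_mat m n R C X"
 have "(\<Sum>e\<in>idx m n. X e * (1 / l (fst e)) * (1 / u (snd e))) = (sum Y (idx m n))"
 proof (rule sum.cong[OF refl])
  fix e assume "e \<in> idx m n"
  then obtain i j where e: "e = (i, j)" "i < m" "j < n" by (auto simp: idx_def)
  have "X (i, j) = Y (i, j) * l i * u j" "0 < l i" "0 < u j" using s e by (auto simp: scales_def Y_def)
  then show "X e * (1 / l (fst e)) * (1 / u (snd e)) = Y e" using e by simp
 qed
 also have "... = total m R" using s by (simp add: sum_idx scales_def has_margins_def total_def Y_def)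
 finally have 1: "(\<Sum>e\<in>idx m n. X e * (1 / l (fst e)) * (1 / u (snd e))) = total m R" .
 have "scaling_product m n R C (%i. 1 / l i) (%j. 1 / u j) = 1 / scaling_product m n R C l u"
  by (simp add: scaling_product_def power_one_over prod_dividef)
 then have 2: "scaling_value m n R C X * scaling_product m n R C (%i. 1 / l i) (%j. 1 / u j) = 1"
  using scaling_value_eq[OF mar X s] scaling_product_pos[OF s] by simp
 show ?thesis using that[of "%i. 1 / l i" "%j. 1 / u j", OF _ _ 2 1] s by (auto simp: scales_def)
qed

lemma table_poly_cong:
 "(!!e. e \<in> idx m n ==> X e = Z e) ==> table_poly m n R C X = table_poly m n R C Z"
 unfolding table_poly_def by (intro sum.cong refl prod.cong) auto

lemma table_poly_scale:
 "table_poly m n R C (%(i, j). X (i, j) * a i * b j) = scaling_product m n R C a b * table_poly m n R C X"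
proof -
 have "(\<Prod>e\<in>idx m n. (case e of (i, j) => X (i, j) * a i * b j) ^ D e / fact (D e))
   = scaling_product m n R C a b * (\<Prod>e\<in>idx m n. X e ^ D e / fact (D e))" if D: "D \<in> tables m n R C" for D
 proof -
  have "(\<Prod>e\<in>idx m n. (case e of (i, j) => X (i, j) * a i * b j) ^ D e / fact (D e))
   = (\<Prod>e\<in>idx m n. a (fst e) ^ D e) * (\<Prod>e\<in>idx m n. b (snd e) ^ D e) * (\<Prod>e\<in>idx m n. X e ^ D e / fact (D e))"
   unfolding prod.distrib[symmetric] by (intro prod.cong refl) (auto simp: power_mult_distrib)
  also have "(\<Prod>e\<in>idx m n. a (fst e) ^ D e) = (\<Prod>i<m. a i ^ R i)"
   using D by (simp add: prod_idx power_sum[symmetric] tables_def)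
  also have "(\<Prod>e\<in>idx m n. b (snd e) ^ D e) = (\<Prod>j<n. b j ^ C j)"
   using D by (simp add: prod_idx' power_sum[symmetric] tables_def)
  finally show ?thesis by (simp add: scaling_product_def)
 qed
 then show ?thesis unfolding table_poly_def sum_distrib_left by (intro sum.cong refl)
qed

lemma p_fun_eq:
 assumes mar: "margins m n R C" and X: "!!e. e \<in> idx m n ==> 0 < X e"
 shows "p_fun m n R C X = real (total m R) ^ total m R / fact (total m R) *
  (\<Prod>i<m. fact (R i) / real (R i) ^ R i) * (\<Prod>j<n. fact (C j) / real (C j) ^ C j) *
  (table_poly m n R C X / scaling_value m n R C X)"
proof -
 let ?N = "total m R"
 obtain l u where s: "scales m n R C X (scaled_mat m n R C X) l u"
  using scaled_mat_scales[of m n R C X, OF mar X] by blast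
 define Y where "Y = scaled_mat m n R C X"
 \<comment> \<open>These weights pass from \<open>X\<close> to the block entries at once: they undo
   the scaling and divide by \<open>R i\<close> and \<open>C j\<close>.\<close>
 let ?a = "%i. 1 / (l i * R i)" and ?b = "%j. 1 / (u j * C j)"
 have lu: "!!i. i < m ==> l i > 0" "!!j. j < n ==> u j > 0" using s by (auto simp: scales_def)
 have RC: "!!i. i < m ==> R i > 0" "!!j. j < n ==> C j > 0" using mar by (auto simp: margins_def)
 have tot: "total m R = total n C" using mar by (simp add: margins_def)
 have "table_poly m n R C (%(i, j). Y (i, j) / (real (R i) * real (C j))) = table_poly m n R C (%(i, j). X (i, j) * ?a i * ?b j)"
 proof (rule table_poly_cong)
  fix e assume "e \<in> idx m n"
  then obtain i j where e: "e = (i, j)" "i < m" "j < n" by (auto simp: idx_def)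
  have "X (i, j) = Y (i, j) * l i * u j" using s e by (auto simp: scales_def Y_def)
  then show "(case e of (i, j) => Y (i, j) / (real (R i) * real (C j))) = (case e of (i, j) => X (i, j) * ?a i * ?b j)"
   using lu(1)[OF e(2)] lu(2)[OF e(3)] RC(1)[OF e(2)] RC(2)[OF e(3)] e by simp
 qed
 also have "... = scaling_product m n R C ?a ?b * table_poly m n R C X" by (rule table_poly_scale)
 also have "scaling_product m n R C ?a ?b = 1 / scaling_value m n R C X * (\<Prod>i<m. 1 / real (R i) ^ R i) * (\<Prod>j<n. 1 / real (C j) ^ C j)"
  using scaling_value_eq[of m n R C X, OF mar X s]
  by (simp add: scaling_product_def power_divide power_mult_distrib prod_dividef prod.distrib)
 finally have T: "table_poly m n R C (%(i, j). Y (i, j) / (real (R i) * real (C j))) =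
   1 / scaling_value m n R C X * (\<Prod>i<m. 1 / real (R i) ^ R i) * (\<Prod>j<n. 1 / real (C j) ^ C j) * table_poly m n R C X" .
 have "permanent ?N (block_mat ?N R C Y) = (\<Prod>i<m. fact (R i)) * (\<Prod>j<n. fact (C j)) *
   table_poly m n R C (%(i, j). Y (i, j) / (real (R i) * real (C j)))"
  by (rule permanent_block_mat) (use tot in auto)
 note this[unfolded T]
 then show ?thesis unfolding p_fun_def normalized_per_def Let_def Y_def by (simp add: prod_dividef mult_ac)
qed

section \<open>The block matrix and bounds for p\<close>

lemma sum_blocks: "(\<Sum>b<total n C. F (block_of C b)) = (\<Sum>j<n. real (C j) * F j)"
proof -
 have "(\<Sum>b<total n C. F (block_of C b)) = (\<Sum>j<n. \<Sum>b\<in>{b \<in> {..<total n C}. block_of C b = j}. F (block_of C b))"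
  by (rule sum.group[symmetric]) (auto intro: block_of_less)
 also have "... = (\<Sum>j<n. \<Sum>b\<in>{b \<in> {..<total n C}. block_of C b = j}. F j)"
  by (intro sum.cong) auto
 also have "... = (\<Sum>j<n. real (C j) * F j)"
  using card_block[of _ n C] by (intro sum.cong) auto
 finally show ?thesis .
qed

lemma per_on_cong:
 assumes "!!a c. a \<in> A ==> c \<in> C ==> w a c = w' a c"
 shows "per_on A C w = per_on A C w'"
 unfolding per_on_def by (intro sum.cong refl prod.cong assms) (auto simp: bijs_def dest: bij_betwE)

context
 fixes m n :: nat and R C :: "nat => nat" and X :: mat
 assumes mar: "margins m n R C" and X: "!!e. e \<in> idx m n ==> 0 < X e"
begin

text \<open>The value 1 off the range makes the function positive everywhere, as
  \<open>van_der_waerden\<close> demands for all column indices.\<close>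

definition block_entry :: "nat => nat => real" where
 "block_entry a b = (if a < total m R \<and> b < total m R then scaled_mat m n R C X (block_of R a, block_of C b) /
  (real (R (block_of R a)) * real (C (block_of C b))) else 1)"

lemma scaled_props:
 "!!i. i < m ==> (\<Sum>j<n. scaled_mat m n R C X (i, j)) = R i" "!!j. j < n ==> (\<Sum>i<m. scaled_mat m n R C X (i, j)) = C j"
 "!!i j. i < m ==> j < n ==> 0 < scaled_mat m n R C X (i, j)"
 "!!i j. i < m ==> j < n ==> scaled_mat m n R C X (i, j) <= R i"
 "!!i j. i < m ==> j < n ==> scaled_mat m n R C X (i, j) <= C j"
proof -
 let ?Y = "scaled_mat m n R C X"
 obtain l u where s: "scales m n R C X ?Y l u" using scaled_mat_scales[of m n R C X, OF mar X] by blast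
 show row: "(\<Sum>j<n. ?Y (i, j)) = R i" if "i < m" for i using s that by (auto simp: scales_def has_margins_def)
 show col: "(\<Sum>i<m. ?Y (i, j)) = C j" if "j < n" for j using s that by (auto simp: scales_def has_margins_def)
 show pos: "0 < ?Y (i, j)" if "i < m" "j < n" for i j
  using scales_polytope(2)[of m n R C X ?Y l u "(i, j)", OF s X] that by (simp add: idx_iff)
 show "?Y (i, j) <= R i" if "i < m" "j < n" for i j
  unfolding row[OF that(1), symmetric] using that pos
  by (intro member_le_sum[of j _ "%j. ?Y (i, j)"]) (auto intro: less_imp_le)
 show "?Y (i, j) <= C j" if "i < m" "j < n" for i j
  unfolding col[OF that(2), symmetric] using that pos
  by (intro member_le_sum[of i _ "%i. ?Y (i, j)"]) (auto intro: less_imp_le)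
qed

lemma block_entry_props:
 "p_fun m n R C X = real (total m R) ^ total m R / fact (total m R) * per_on {..<total m R} {..<total m R} block_entry"
 "!!a b. 0 < block_entry a b"
 "!!a. a < total m R ==> (\<Sum>b<total m R. block_entry a b) = 1"
 "!!b. b < total m R ==> (\<Sum>a<total m R. block_entry a b) = 1"
proof -
 let ?N = "total m R"
 have tot: "?N = total n C" using mar by (simp add: margins_def)
 have RC: "!!i. i < m ==> R i > 0" "!!j. j < n ==> C j > 0" using mar by (auto simp: margins_def)
 have bl: "!!a. a < ?N ==> block_of R a < m" "!!a. a < ?N ==> block_of C a < n"
  using block_of_less[of _ m R] block_of_less[of _ n C] tot by auto
 have "per_on {..<?N} {..<?N} (%a b. block_mat ?N R C (scaled_mat m n R C X) (a, b)) = per_on {..<?N} {..<?N} block_entry"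
  by (rule per_on_cong) (auto simp: block_mat_def block_entry_def idx_iff Let_def)
 then show "p_fun m n R C X = real ?N ^ ?N / fact ?N * per_on {..<?N} {..<?N} block_entry"
  by (simp add: p_fun_def normalized_per_def Let_def permanent_per_on)
 show "0 < block_entry a b" for a b
  unfolding block_entry_def using bl RC scaled_props(3) by (auto intro!: divide_pos_pos mult_pos_pos)
 show "(\<Sum>b<?N. block_entry a b) = 1" if a: "a < ?N" for a
 proof -
  have "(\<Sum>b<?N. block_entry a b) = (\<Sum>b<total n C. scaled_mat m n R C X (block_of R a, block_of C b) / (real (R (block_of R a)) * real (C (block_of C b))))"
   using a tot by (intro sum.cong) (auto simp: block_entry_def)
  also have "... = (\<Sum>j<n. real (C j) * (scaled_mat m n R C X (block_of R a, j) / (real (R (block_of R a)) * real (C j))))"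
   by (rule sum_blocks)
  also have "... = (\<Sum>j<n. scaled_mat m n R C X (block_of R a, j)) / R (block_of R a)"
   unfolding sum_divide_distrib by (intro sum.cong) (auto dest!: RC)
  also have "... = 1" using scaled_props(1)[OF bl(1)[OF a]] RC(1)[OF bl(1)[OF a]] by simp
  finally show ?thesis .
 qed
 show "(\<Sum>a<?N. block_entry a b) = 1" if b: "b < ?N" for b
 proof -
  have "(\<Sum>a<?N. block_entry a b) = (\<Sum>a<total m R. scaled_mat m n R C X (block_of R a, block_of C b) / (real (R (block_of R a)) * real (C (block_of C b))))"
   using b tot by (intro sum.cong) (auto simp: block_entry_def)
  also have "... = (\<Sum>i<m. real (R i) * (scaled_mat m n R C X (i, block_of C b) / (real (R i) * real (C (block_of C b)))))"
   by (rule sum_blocks)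
  also have "... = (\<Sum>i<m. scaled_mat m n R C X (i, block_of C b)) / C (block_of C b)"
   unfolding sum_divide_distrib by (intro sum.cong) (auto dest!: RC)
  also have "... = 1" using scaled_props(2)[OF bl(2)[OF b]] RC(2)[OF bl(2)[OF b]] by simp
  finally show ?thesis .
 qed
qed

lemma p_fun_ge_1: "1 <= p_fun m n R C X"
proof -
 let ?N = "total m R"
 have N: "?N > 0" using margins_pos[OF mar] by simp
 have "fact ?N / real ?N ^ ?N <= per_on {..<?N} {..<?N} block_entry"
  using block_entry_props(2-4) by (intro van_der_waerden) auto
 then have "real ?N ^ ?N / fact ?N * (fact ?N / real ?N ^ ?N) <= real ?N ^ ?N / fact ?N * per_on {..<?N} {..<?N} block_entry"
  by (intro mult_left_mono) auto
 then show ?thesis unfolding block_entry_props(1) using N by simp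
qed

text \<open>An entry of block \<open>(i, j)\<close> is at most \<open>1 / R i\<close> and at most
  \<open>1 / C j\<close>. So a whole block of rows or columns adds at most 1 to a diagonal sum,
  which pays for the exceptional sets; any other entry in block row \<open>i\<close> is at most
  \<open>M i / R i\<close>, and the block has \<open>R i\<close> rows.\<close>

lemma p_fun_upper:
 fixes M :: "nat => real"
 assumes S: "S \<subseteq> {..<m}" and T: "T \<subseteq> {..<n}" and M: "!!i. i < m ==> 0 <= M i"
  "!!i j. i < m ==> j < n ==> i \<notin> S ==> j \<notin> T ==> scaled_mat m n R C X (i, j) / C j <= M i"
 shows "p_fun m n R C X <= exp ((1 + ln (total m R)) * (card S + card T + (\<Sum>i\<in>{..<m} - S. M i)))"
 unfolding block_entry_props(1)
proof (rule permanent_upper)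
 let ?N = "total m R"
 show "finite {..<?N}" "finite {..<?N}" "card {..<?N} = ?N" "card {..<?N} = ?N" "1 <= ?N"
  using margins_pos[OF mar] by auto
 show "0 < block_entry a c" for a c by (rule block_entry_props(2))
 show "(\<Sum>c<?N. block_entry a c) = 1" if "a \<in> {..<?N}" for a using block_entry_props(3) that by simp
 have tot: "?N = total n C" using mar by (simp add: margins_def)
 have RC: "!!i. i < m ==> R i > 0" "!!j. j < n ==> C j > 0" using mar by (auto simp: margins_def)
 have bl: "!!a. a < ?N ==> block_of R a < m" "!!a. a < ?N ==> block_of C a < n"
  using block_of_less[of _ m R] block_of_less[of _ n C] tot by auto
 fix \<sigma> assume s: "\<sigma> \<in> bijs {..<?N} {..<?N}"
 let ?f = "%i. if i \<in> S then 1 / R i else 0" and ?g = "%j. if j \<in> T then 1 / C j else 0" and ?h = "%i. if i \<in> S then 0 else M i / R i"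
 have "(\<Sum>a<?N. block_entry a (\<sigma> a)) <= (\<Sum>a<?N. ?f (block_of R a) + ?g (block_of C (\<sigma> a)) + ?h (block_of R a))"
 proof (rule sum_mono)
  fix a assume "a \<in> {..<?N}"
  then have a: "a < ?N" "\<sigma> a < ?N" using s by (auto simp: bijs_def)
  define i j where "i = block_of R a" and "j = block_of C (\<sigma> a)"
  have ij: "i < m" "j < n" using bl a by (auto simp: i_def j_def)
  define y where "y = scaled_mat m n R C X (i, j)"
  have y: "0 < y" "y <= R i" "y <= C j" using scaled_props(3-5)[OF ij] by (auto simp: y_def)
  have r: "real (R i) > 0" "real (C j) > 0" using RC ij by auto
  have b: "block_entry a (\<sigma> a) = y / (R i * C j)" using a by (simp add: block_entry_def i_def j_def y_def)
  have hn: "0 <= ?h i" "0 <= ?g j" "0 <= ?f i" using M(1)[OF ij(1)] by auto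
  consider "i \<in> S" | "i \<notin> S" "j \<in> T" | "i \<notin> S" "j \<notin> T" by blast
  then have "y / (R i * C j) <= ?f i + ?g j + ?h i"
  proof cases
   case 1
   have "y / (R i * C j) <= 1 / R i" using y r by (simp add: divide_simps)
   then show ?thesis using 1 hn by simp
  next
   case 2
   have "y / (R i * C j) <= 1 / C j" using y r by (simp add: divide_simps)
   then show ?thesis using 2 hn by simp
  next
   case 3
   have "y / (R i * C j) = y / C j / R i" by simp
   also have "... <= M i / R i" using M(2)[OF ij 3] r by (intro divide_right_mono) (auto simp: y_def)
   finally show ?thesis using 3 by simp
  qed
  then show "block_entry a (\<sigma> a) <= ?f (block_of R a) + ?g (block_of C (\<sigma> a)) + ?h (block_of R a)"
   unfolding b i_def j_def .
 qed
 also have "... = (\<Sum>a<?N. ?f (block_of R a)) + (\<Sum>a<?N. ?g (block_of C (\<sigma> a))) + (\<Sum>a<?N. ?h (block_of R a))"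
  by (simp add: sum.distrib)
 also have "(\<Sum>a<?N. ?g (block_of C (\<sigma> a))) = (\<Sum>b<total n C. ?g (block_of C b))"
  unfolding tot[symmetric] using s by (intro sum.reindex_bij_betw[of \<sigma> _ _ "%b. ?g (block_of C b)"]) (auto simp: bijs_def)
 also have "... = (\<Sum>j<n. real (C j) * ?g j)" by (rule sum_blocks)
 also have "... = (\<Sum>j\<in>T. 1)" using T RC by (intro sum.mono_neutral_cong_right) auto
 also have "(\<Sum>a<?N. ?f (block_of R a)) = (\<Sum>i<m. real (R i) * ?f i)" by (rule sum_blocks)
 also have "... = (\<Sum>i\<in>S. 1)" using S RC by (intro sum.mono_neutral_cong_right) auto
 also have "(\<Sum>a<?N. ?h (block_of R a)) = (\<Sum>i<m. real (R i) * ?h i)" by (rule sum_blocks)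
 also have "... = (\<Sum>i\<in>{..<m} - S. M i)" using RC by (intro sum.mono_neutral_cong_right) auto
 finally show "(\<Sum>a<?N. block_entry a (\<sigma> a)) <= card S + card T + (\<Sum>i\<in>{..<m} - S. M i)" by simp
qed

definition log_row_mean :: "nat => real" where
 "log_row_mean i = (\<Sum>j<n. C j / total m R * ln (total m R * X (i, j) / C j))"

definition log_col_mean :: "nat => real" where
 "log_col_mean j = (\<Sum>i<m. R i / total m R * ln (total m R * X (i, j) / R i))"

text \<open>Jensen's inequality in row \<open>i\<close> and in column \<open>j\<close> bounds
  \<open>1 / l i\<close> and \<open>1 / u j\<close> up to the mean logarithms \<open>mu\<close> and
  \<open>lam\<close> of the factors. These cannot be bounded singly, as factors may be traded
  between \<open>l\<close> and \<open>u\<close>, but their sum is the logarithm of the scaling value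
  divided by \<open>N\<close>.\<close>

lemma scaled_mat_le:
 assumes "i < m" "j < n"
 shows "scaled_mat m n R C X (i, j) <=
  X (i, j) * R i * C j * ((sum X (idx m n)) / total m R) / (exp (log_row_mean i) * exp (log_col_mean j))"
proof -
 let ?Y = "scaled_mat m n R C X" and ?N = "real (total m R)"
 obtain l u where s: "scales m n R C X ?Y l u" using scaled_mat_scales[of m n R C X, OF mar X] by blast
 have N: "?N > 0" using margins_pos[OF mar] by simp
 have tot: "(\<Sum>i<m. real (R i)) = ?N" "(\<Sum>j<n. real (C j)) = ?N"
  using mar by (auto simp: margins_def total_def simp flip: of_nat_sum)
 have RC: "!!i. i < m ==> R i > 0" "!!j. j < n ==> C j > 0" using mar by (auto simp: margins_def)
 have lu: "!!i. i < m ==> l i > 0" "!!j. j < n ==> u j > 0" using s by (auto simp: scales_def)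
 have XY: "ln (X (i, j)) = ln (?Y (i, j)) + ln (l i) + ln (u j)" if "i < m" "j < n" for i j
  using scales_polytope(3)[of m n R C X ?Y l u i j, OF s X] that by simp
 have Xp: "0 < X (i, j)" if "i < m" "j < n" for i j using X[of "(i, j)"] that by (simp add: idx_iff)
 define lam mu where "lam = (\<Sum>i<m. R i * ln (l i)) / ?N" and "mu = (\<Sum>j<n. C j * ln (u j)) / ?N"
 have "log_row_mean i - ln (l i) - mu = (\<Sum>j<n. C j / ?N * ln (?N * ?Y (i, j) / C j))"
 proof -
  have "(\<Sum>j<n. C j / ?N * ln (?N * ?Y (i, j) / C j)) = (\<Sum>j<n. C j / ?N * ln (?N * X (i, j) / C j) - C j / ?N * ln (l i) - C j * ln (u j) / ?N)"
  proof (rule sum.cong[OF refl])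
   fix j assume "j \<in> {..<n}"
   then have j: "j < n" by simp
   have "ln (?N * ?Y (i, j) / C j) = ln (?N * X (i, j) / C j) - ln (l i) - ln (u j)"
    using N scaled_props(3)[OF assms(1) j] Xp[OF assms(1) j] RC(2)[OF j] XY[OF assms(1) j] by (simp add: ln_div ln_mult)
   then show "C j / ?N * ln (?N * ?Y (i, j) / C j) = C j / ?N * ln (?N * X (i, j) / C j) - C j / ?N * ln (l i) - C j * ln (u j) / ?N"
    by (simp add: right_diff_distrib)
  qed
  also have "... = log_row_mean i - ln (l i) - mu"
   using tot N by (simp add: sum_subtractf log_row_mean_def mu_def sum_divide_distrib[symmetric] sum_distrib_right[symmetric])
  finally show ?thesis by simp
 qed
 also have "... <= ln (\<Sum>j<n. C j / ?N * (?N * ?Y (i, j) / C j))"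
  using N tot RC scaled_props(3)[OF assms(1)]
  by (intro weighted_ln_le(1)) (auto simp: sum_divide_distrib[symmetric] intro!: divide_pos_pos mult_pos_pos)
 also have "(\<Sum>j<n. C j / ?N * (?N * ?Y (i, j) / C j)) = (\<Sum>j<n. ?Y (i, j))"
  using N RC by (intro sum.cong) auto
 also have "... = R i" using scaled_props(1)[OF assms(1)] .
 finally have row: "log_row_mean i - ln (l i) - mu <= ln (R i)" .
 have "log_col_mean j - ln (u j) - lam = (\<Sum>i<m. R i / ?N * ln (?N * ?Y (i, j) / R i))"
 proof -
  have "(\<Sum>i<m. R i / ?N * ln (?N * ?Y (i, j) / R i)) = (\<Sum>i<m. R i / ?N * ln (?N * X (i, j) / R i) - R i / ?N * ln (u j) - R i * ln (l i) / ?N)"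
  proof (rule sum.cong[OF refl])
   fix i assume "i \<in> {..<m}"
   then have i: "i < m" by simp
   have "ln (?N * ?Y (i, j) / R i) = ln (?N * X (i, j) / R i) - ln (u j) - ln (l i)"
    using N scaled_props(3)[OF i assms(2)] Xp[OF i assms(2)] RC(1)[OF i] XY[OF i assms(2)] by (simp add: ln_div ln_mult)
   then show "R i / ?N * ln (?N * ?Y (i, j) / R i) = R i / ?N * ln (?N * X (i, j) / R i) - R i / ?N * ln (u j) - R i * ln (l i) / ?N"
    by (simp add: right_diff_distrib)
  qed
  also have "... = log_col_mean j - ln (u j) - lam"
   using tot N by (simp add: sum_subtractf log_col_mean_def lam_def sum_divide_distrib[symmetric] sum_distrib_right[symmetric])
  finally show ?thesis by simp
 qed
 also have "... <= ln (\<Sum>i<m. R i / ?N * (?N * ?Y (i, j) / R i))"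
  using N tot RC scaled_props(3)[OF _ assms(2)]
  by (intro weighted_ln_le(1)) (auto simp: sum_divide_distrib[symmetric] intro!: divide_pos_pos mult_pos_pos)
 also have "(\<Sum>i<m. R i / ?N * (?N * ?Y (i, j) / R i)) = (\<Sum>i<m. ?Y (i, j))"
  using N RC by (intro sum.cong) auto
 also have "... = C j" using scaled_props(2)[OF assms(2)] .
 finally have col: "log_col_mean j - ln (u j) - lam <= ln (C j)" .
 have Spos: "0 < (sum X (idx m n))" using X assms by (intro sum_pos) (auto simp: idx_def)
 have "lam + mu = ln (scaling_value m n R C X) / ?N"
  using ln_scaling_product[of m l n u R C] lu scaling_value_eq[OF mar X s] by (simp add: lam_def mu_def add_divide_distrib)
 also have "... <= ln (((sum X (idx m n)) / ?N) ^ total m R) / ?N"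
 proof -
  have "scaling_value m n R C X <= ((sum X (idx m n)) / ?N) ^ total m R"
   using scaling_value_le[of m n R C X "%_. 1" "%_. 1", OF mar X] by (simp add: scaling_product_def)
  moreover have "0 < scaling_value m n R C X" using scaling_value_pos[of m n R C X, OF mar X] .
  ultimately show ?thesis using N by (intro divide_right_mono) auto
 qed
 also have "... = ln ((sum X (idx m n)) / ?N)" using N Spos by (simp add: ln_realpow)
 finally have lm: "lam + mu <= ln ((sum X (idx m n)) / ?N)" .
 have y: "0 < ?Y (i, j)" using scaled_props(3)[OF assms] .
 have "?Y (i, j) = exp (ln (X (i, j)) - ln (l i) - ln (u j))" using XY[OF assms] y by simp
 also have "... <= exp (ln (X (i, j)) + ln (R i) + ln (C j) + ln ((sum X (idx m n)) / ?N) - (log_row_mean i + log_col_mean j))"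
  using row col lm by simp
 also have "... = X (i, j) * R i * C j * ((sum X (idx m n)) / ?N) / (exp (log_row_mean i) * exp (log_col_mean j))"
  using Xp[OF assms] RC(1)[OF assms(1)] RC(2)[OF assms(2)] Spos N by (simp add: exp_add exp_diff)
 finally show ?thesis .
qed

end

section \<open>Monotonicity, homogeneity and log-concavity of the scaling value\<close>

lemma scaling_value_mono:
 assumes mar: "margins m n R C" and X: "!!e. e \<in> idx m n ==> 0 < X e" and le: "!!e. e \<in> idx m n ==> c * X e <= Z e"
  and c: "0 < c"
 shows "c ^ total m R * scaling_value m n R C X <= scaling_value m n R C Z"
proof -
 let ?N = "total m R"
 have N: "real ?N > 0" using margins_pos[OF mar] by simp
 have Z: "0 < Z e" if "e \<in> idx m n" for e using mult_pos_pos[OF c X[OF that]] le[OF that] by linarith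
 obtain a b where ab: "!!i. i < m ==> 0 < a i" "!!j. j < n ==> 0 < b j"
  "scaling_value m n R C Z * scaling_product m n R C a b = 1"
  "(\<Sum>e\<in>idx m n. Z e * a (fst e) * b (snd e)) = ?N"
  using scaling_value_attained[of m n R C Z, OF mar Z] by blast
 have sp: "0 < scaling_product m n R C a b" unfolding scaling_product_def using ab by (auto intro!: mult_pos_pos prod_pos)
 have ab': "0 < a (fst e)" "0 < b (snd e)" if "e \<in> idx m n" for e using ab that by (auto simp: idx_def)
 have "(\<Sum>e\<in>idx m n. c * X e * a (fst e) * b (snd e)) <= (\<Sum>e\<in>idx m n. Z e * a (fst e) * b (snd e))"
  using le ab' by (intro sum_mono mult_right_mono) (auto intro: less_imp_le)
 then have "c * ((\<Sum>e\<in>idx m n. X e * a (fst e) * b (snd e)) / ?N) <= 1"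
  using N unfolding ab(4) by (simp add: sum_distrib_left mult.assoc)
 moreover have nn: "0 <= (\<Sum>e\<in>idx m n. X e * a (fst e) * b (snd e)) / ?N"
  using X ab' by (intro divide_nonneg_nonneg sum_nonneg mult_nonneg_nonneg) (auto intro: less_imp_le)
 ultimately have "(c * ((\<Sum>e\<in>idx m n. X e * a (fst e) * b (snd e)) / ?N)) ^ ?N <= 1"
  using c by (intro power_le_one mult_nonneg_nonneg nn) auto
 moreover have "c ^ ?N * (scaling_value m n R C X * scaling_product m n R C a b) <= c ^ ?N * ((\<Sum>e\<in>idx m n. X e * a (fst e) * b (snd e)) / ?N) ^ ?N"
  using c by (intro mult_left_mono scaling_value_le mar X ab) auto
 ultimately have "(c ^ ?N * scaling_value m n R C X) * scaling_product m n R C a b <= scaling_value m n R C Z * scaling_product m n R C a b"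
  unfolding ab(3) power_mult_distrib by (simp add: mult.assoc)
 then show ?thesis using sp by simp
qed

lemma scaling_value_homogeneous:
 assumes mar: "margins m n R C" and X: "!!e. e \<in> idx m n ==> 0 < X e" and eq: "!!e. e \<in> idx m n ==> Z e = c * X e"
  and c: "0 < c"
 shows "scaling_value m n R C Z = c ^ total m R * scaling_value m n R C X"
proof (rule antisym)
 have Z: "0 < Z e" if "e \<in> idx m n" for e using c X[OF that] eq[OF that] by simp
 show "c ^ total m R * scaling_value m n R C X <= scaling_value m n R C Z"
  using mar X eq c by (intro scaling_value_mono) auto
 have "(1 / c) ^ total m R * scaling_value m n R C Z <= scaling_value m n R C X"
  using mar Z eq c by (intro scaling_value_mono) auto
 then show "scaling_value m n R C Z <= c ^ total m R * scaling_value m n R C X"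
  using c by (simp add: power_divide divide_le_eq mult.commute)
qed

text \<open>Weights optimal at \<open>W\<close> are tested at \<open>X\<close> and \<open>Z\<close>:
  there the linear forms average to 1, and \<open>ln y <= y - 1\<close> shows that the averaged
  logarithms of the two bounds are not positive.\<close>

lemma scaling_value_log_concave:
 assumes mar: "margins m n R C" and X: "!!e. e \<in> idx m n ==> 0 < X e" and Z: "!!e. e \<in> idx m n ==> 0 < Z e"
  and t: "0 <= t" "t <= 1" and W: "!!e. e \<in> idx m n ==> W e = t * X e + (1 - t) * Z e"
 shows "scaling_value m n R C X powr t * scaling_value m n R C Z powr (1 - t) <= scaling_value m n R C W"
proof -
 let ?N = "real (total m R)"
 have N: "?N > 0" using margins_pos[OF mar] by simp
 have Wp: "0 < W e" if "e \<in> idx m n" for e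
 proof (cases "t = 0")
  case False
  then show ?thesis using t X[OF that] Z[OF that] unfolding W[OF that] by (intro add_pos_nonneg mult_pos_pos mult_nonneg_nonneg) auto
 qed (use Z[OF that] W[OF that] in auto)
 obtain a b where ab: "!!i. i < m ==> 0 < a i" "!!j. j < n ==> 0 < b j"
  "scaling_value m n R C W * scaling_product m n R C a b = 1"
  "(\<Sum>e\<in>idx m n. W e * a (fst e) * b (snd e)) = ?N"
  using scaling_value_attained[of m n R C W, OF mar Wp] by blast
 define sp where "sp = scaling_product m n R C a b"
 have sp: "0 < sp" unfolding sp_def scaling_product_def using ab by (auto intro!: mult_pos_pos prod_pos)
 have ab': "0 < a (fst e)" "0 < b (snd e)" if "e \<in> idx m n" for e using ab that by (auto simp: idx_def)
 define x z where "x = (\<Sum>e\<in>idx m n. X e * a (fst e) * b (snd e)) / ?N" and "z = (\<Sum>e\<in>idx m n. Z e * a (fst e) * b (snd e)) / ?N"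
 have ne: "idx m n \<noteq> {}" using margins_pos[OF mar] by (auto simp: idx_def)
 have xz: "0 < x" "0 < z" unfolding x_def z_def using ab' X Z N ne by (auto intro!: divide_pos_pos sum_pos mult_pos_pos)
 have "t * x + (1 - t) * z = (\<Sum>e\<in>idx m n. W e * a (fst e) * b (snd e)) / ?N"
  unfolding x_def z_def by (simp add: sum_divide_distrib sum_distrib_left W sum.distrib[symmetric] algebra_simps flip: add_divide_distrib)
 then have txz: "t * x + (1 - t) * z = 1" using ab(4) N by simp
 have pos: "0 < scaling_value m n R C X" "0 < scaling_value m n R C Z" "0 < scaling_value m n R C W"
  using scaling_value_pos[of m n R C, OF mar] X Z Wp by auto
 have lx: "ln (scaling_value m n R C X) + ln sp <= ?N * ln x"
  using scaling_value_le[of m n R C X a b, OF mar X ab(1,2)] pos sp xz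
  by (simp add: x_def[symmetric] sp_def[symmetric] flip: ln_mult_pos ln_realpow)
 have lz: "ln (scaling_value m n R C Z) + ln sp <= ?N * ln z"
  using scaling_value_le[of m n R C Z a b, OF mar Z ab(1,2)] pos sp xz
  by (simp add: z_def[symmetric] sp_def[symmetric] flip: ln_mult_pos ln_realpow)
 have "t * (ln (scaling_value m n R C X) + ln sp) + (1 - t) * (ln (scaling_value m n R C Z) + ln sp) <= t * (?N * ln x) + (1 - t) * (?N * ln z)"
  using lx lz t by (intro add_mono mult_left_mono) auto
 also have "... = ?N * (t * ln x + (1 - t) * ln z)" by (simp add: algebra_simps)
 also have "... <= ?N * (t * (x - 1) + (1 - t) * (z - 1))"
  using t N xz by (intro mult_left_mono add_mono ln_le_minus_one) auto
 also have "t * (x - 1) + (1 - t) * (z - 1) = 0" using txz by (simp add: algebra_simps)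
 finally have "t * ln (scaling_value m n R C X) + (1 - t) * ln (scaling_value m n R C Z) <= - ln sp"
  by (simp add: algebra_simps)
 also have "- ln sp = ln (scaling_value m n R C W)"
  using ln_mult_pos[OF pos(3) sp] ab(3) by (simp add: sp_def)
 finally have "exp (t * ln (scaling_value m n R C X) + (1 - t) * ln (scaling_value m n R C Z)) <= exp (ln (scaling_value m n R C W))"
  by simp
 then show ?thesis using pos by (simp add: powr_def exp_add)
qed

section \<open>The typical table\<close>

lemma typical_table_exists:
 assumes mar: "margins m n R C"
 shows "typical_table m n R C \<in> transport_polytope m n R C" "!!e. e \<in> idx m n ==> 0 < typical_table m n R C e"
  "\<exists>a b. \<forall>i<m. \<forall>j<n. ln (typical_table m n R C (i, j) + 1) - ln (typical_table m n R C (i, j)) = a i + b j"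
proof -
 interpret separable_concave m n R C "%e y. (y + 1) * ln (y + 1) - y * ln y" "%e y. ln (y + 1) - ln y"
  by (rule separable_concave_entropy[OF mar])
 obtain X a b where X: "X \<in> P" "\<forall>e\<in>idx m n. 0 < X e"
  "\<forall>i<m. \<forall>j<n. ln (X (i, j) + 1) - ln (X (i, j)) = a i + b j"
  "\<forall>Z\<in>P. obj Z <= obj X" "\<forall>Z\<in>P. obj X <= obj Z \<longrightarrow> Z = X"
  using maximizer_exists by blast
 have "obj Z = entropy_g m n Z" for Z by (simp add: obj_def entropy_g_def)
 then have "typical_table m n R C = X"
  unfolding typical_table_def using X by (intro the_equality) auto
 then show "typical_table m n R C \<in> P" "!!e. e \<in> idx m n ==> 0 < typical_table m n R C e"
  "\<exists>a b. \<forall>i<m. \<forall>j<n. ln (typical_table m n R C (i, j) + 1) - ln (typical_table m n R C (i, j)) = a i + b j"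
  using X by auto
qed

lemma exists_ge_average:
 fixes f :: "nat => real" and c :: real
 assumes "n > 0" "(\<Sum>j<n. f j) \<ge> n * c"
 shows "\<exists>j<n. f j \<ge> c"
proof (rule ccontr)
 assume "\<not> ?thesis"
 then have "(\<Sum>j<n. f j) < (\<Sum>j<n. c)" using assms by (intro sum_strict_mono) (auto simp: not_le)
 then show False using assms by simp
qed

text \<open>The quantities \<open>1 + 1 / x\<close> of the typical table have rank one, so the two
  pairs of opposite corners of a rectangle have equal products. The row and the column of
  \<open>e\<close> each contain an entry of at least \<open>\<beta> * s\<close>, and the corner
  opposite to \<open>e\<close> is at most \<open>\<alpha> * s\<close>.\<close>

lemma typical_table_lower:
 assumes mar: "margins m n R C" and ls: "lower_smooth \<beta> m n R C" and us: "strongly_upper_smooth \<alpha> m n R C"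
  and ab: "\<alpha> \<ge> 1" "0 < \<beta>" and e: "e \<in> idx m n"
 shows "typical_table m n R C e \<ge> real (total m R) / (real m * real n) / (2 / \<beta> + \<alpha> / \<beta>\<^sup>2)"
proof -
 let ?X = "typical_table m n R C"
 define s where "s = real (total m R) / (real m * real n)"
 define w where "w = 1 / s"
 note mp = margins_pos[OF mar]
 have s: "s > 0" using mp by (simp add: s_def)
 have w: "w > 0" using s by (simp add: w_def)
 note X = typical_table_exists[OF mar]
 obtain i j where ij: "e = (i, j)" "i < m" "j < n" using e by (auto simp: idx_def)
 have row: "(\<Sum>j<n. ?X (i, j)) = R i" and col: "(\<Sum>i<m. ?X (i, j)) = C j"
  using X(1) ij by (auto simp: in_polytope has_margins_def)
 have "real n * (\<beta> * s) = \<beta> * total m R / m" "real m * (\<beta> * s) = \<beta> * total m R / n"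
  using mp by (auto simp: s_def)
 then have "real n * (\<beta> * s) <= (\<Sum>j<n. ?X (i, j))" "real m * (\<beta> * s) <= (\<Sum>i<m. ?X (i, j))"
  using ls ij row col by (auto simp: lower_smooth_def)
 then obtain j' i' where j': "j' < n" "?X (i, j') \<ge> \<beta> * s" and i': "i' < m" "?X (i', j) \<ge> \<beta> * s"
  using exists_ge_average[of n "\<beta> * s" "%j. ?X (i, j)"] exists_ge_average[of m "\<beta> * s" "%i. ?X (i, j)"] mp by auto
 obtain a b where "\<forall>i<m. \<forall>j<n. ln (?X (i, j) + 1) - ln (?X (i, j)) = a i + b j" using X(3) by blast
 moreover have "ln (?X (i, j) + 1) - ln (?X (i, j)) = ln (1 + 1 / ?X (i, j))" if "i < m" "j < n" for i j
 proof -
  have p: "?X (i, j) > 0" using X(2)[of "(i, j)"] that by (simp add: idx_iff)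
  then have "1 + 1 / ?X (i, j) = (?X (i, j) + 1) / ?X (i, j)" by (simp add: field_simps)
  then show ?thesis using p by (simp add: ln_div)
 qed
 ultimately have L: "ln (1 + 1 / ?X (i, j)) = a i + b j" if "i < m" "j < n" for i j using that by simp
 have "exp (ln (1 + 1 / ?X (i, j)) + ln (1 + 1 / ?X (i', j'))) = exp (ln (1 + 1 / ?X (i, j')) + ln (1 + 1 / ?X (i', j)))"
  using L ij i' j' by simp
 moreover have pos: "?X (i, j) > 0" if "i < m" "j < n" for i j using X(2)[of "(i, j)"] that by (simp add: idx_iff)
 then have pos1: "0 < 1 + 1 / ?X (i, j)" if "i < m" "j < n" for i j using that by (intro add_pos_pos) auto
 ultimately have eq: "(1 + 1 / ?X (i, j)) * (1 + 1 / ?X (i', j')) = (1 + 1 / ?X (i, j')) * (1 + 1 / ?X (i', j))"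
  using ij i' j' by (simp add: exp_add)
 have bs: "\<beta> * s > 0" using ab s by simp
 have u1: "1 / ?X (i, j') <= w / \<beta>" using frac_le[of 1 1 "\<beta> * s" "?X (i, j')"] j' bs by (simp add: w_def mult.commute)
 have u2: "1 / ?X (i', j) <= w / \<beta>" using frac_le[of 1 1 "\<beta> * s" "?X (i', j)"] i' bs by (simp add: w_def mult.commute)
 have "?X (i', j') <= \<alpha> * s" using us i' j' by (auto simp: strongly_upper_smooth_def s_def idx_iff)
 then have u3: "1 / ?X (i', j') \<ge> w / \<alpha>" using frac_le[of 1 1 "?X (i', j')" "\<alpha> * s"] pos[OF i'(1) j'(1)] by (simp add: w_def mult.commute)
 have "(1 + 1 / ?X (i, j)) * (1 + w / \<alpha>) <= (1 + 1 / ?X (i, j)) * (1 + 1 / ?X (i', j'))"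
  using u3 pos1[OF ij(2,3)] by (intro mult_left_mono) auto
 also have "... <= (1 + w / \<beta>) * (1 + w / \<beta>)"
  unfolding eq using u1 u2 pos ij i' j' w ab by (intro mult_mono add_left_mono) (auto intro!: add_nonneg_nonneg less_imp_le[OF pos1] intro: order_trans)
 \<comment> \<open>Compared coefficientwise in \<open>w\<close>: the summand
   \<open>2 / \<beta>\<close> of the constant serves the linear term, the other summand the
   quadratic one.\<close>
 also have "... <= (1 + w * (2 / \<beta> + \<alpha> / \<beta>\<^sup>2)) * (1 + w / \<alpha>)"
 proof -
  have "(1 + w * (2 / \<beta> + \<alpha> / \<beta>\<^sup>2)) * (1 + w / \<alpha>) - (1 + w / \<beta>) * (1 + w / \<beta>) = w * \<alpha> / \<beta>\<^sup>2 + w / \<alpha> + 2 * w * w / (\<alpha> * \<beta>)"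
   using ab by (simp add: field_simps power2_eq_square)
  also have "... \<ge> 0" using w ab by (auto intro!: add_nonneg_nonneg)
  finally show ?thesis by simp
 qed
 finally have "1 + 1 / ?X (i, j) <= 1 + w * (2 / \<beta> + \<alpha> / \<beta>\<^sup>2)"
  using w ab by (subst (asm) mult_le_cancel_right_pos) (auto intro: add_pos_pos)
 then have "1 / ?X (i, j) <= w * (2 / \<beta> + \<alpha> / \<beta>\<^sup>2)" by simp
 moreover have K: "2 / \<beta> + \<alpha> / \<beta>\<^sup>2 > 0" using ab by (intro add_pos_pos) auto
 ultimately have "1 / (w * (2 / \<beta> + \<alpha> / \<beta>\<^sup>2)) <= ?X (i, j)" using pos[OF ij(2,3)] w by (simp add: divide_simps mult.commute)
 then show ?thesis using ij by (simp add: s_def w_def)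
qed

section \<open>The Prekopa--Leindler inequality for midpoints\<close>

text \<open>Initial segments exhaust \<open>A\<close> except possibly for its largest element, a
  null set; so bounds for truncated sets pass to \<open>A\<close>.\<close>

lemma emeasure_lborel_initial:
 fixes A :: "real set"
 assumes A: "A \<in> sets borel" "A \<noteq> {}" and *: "!!r x. x \<in> A ==> r <= x ==> emeasure lborel (A \<inter> {..<r}) <= K"
 shows "emeasure lborel A <= K"
proof (cases "bdd_above A")
 case False
 have "emeasure lborel A = emeasure lborel (\<Union>k. A \<inter> {..<real k})"
  using reals_Archimedean2 by (intro arg_cong[where f = "emeasure lborel"]) auto
 also have "... = (SUP k. emeasure lborel (A \<inter> {..<real k}))"
  using A by (intro SUP_emeasure_incseq[symmetric]) (auto simp: incseq_def)
 also have "... <= K"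
  using False by (intro SUP_least) (meson * bdd_above.I nle_le)
 finally show ?thesis .
next
 case True
 define s where "s = Sup A"
 have "emeasure lborel A <= emeasure lborel ((\<Union>k. A \<inter> {..<s - 1 / real (Suc k)}) \<union> {s})"
 proof (intro emeasure_mono subsetI)
  fix x assume x: "x \<in> A"
  then have "x <= s" unfolding s_def using True by (rule cSup_upper)
  moreover have "\<exists>k. x < s - 1 / real (Suc k)" if "x < s"
   using reals_Archimedean[of "s - x"] that by (auto simp: inverse_eq_divide algebra_simps)
  ultimately show "x \<in> (\<Union>k. A \<inter> {..<s - 1 / real (Suc k)}) \<union> {s}" using x by fastforce
 qed (use A in auto)
 also have "... <= emeasure lborel (\<Union>k. A \<inter> {..<s - 1 / real (Suc k)}) + emeasure lborel {s}"
  using A by (intro emeasure_subadditive) auto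
 also have "... = emeasure lborel (\<Union>k. A \<inter> {..<s - 1 / real (Suc k)})" by simp
 also have "... = (SUP k. emeasure lborel (A \<inter> {..<s - 1 / real (Suc k)}))"
  using A by (intro SUP_emeasure_incseq[symmetric]) (auto simp: incseq_def field_simps intro: less_le_trans)
 also have "... <= K"
 proof (rule SUP_least)
  fix k
  have "s - 1 / real (Suc k) < s" by simp
  then obtain x where "x \<in> A" "s - 1 / real (Suc k) < x" unfolding s_def using less_cSupD[OF A(2)] by blast
  then show "emeasure lborel (A \<inter> {..<s - 1 / real (Suc k)}) <= K" by (intro *[of x]) auto
 qed
 finally show ?thesis .
qed

lemma emeasure_lborel_affine:
 fixes c t :: real
 assumes "S \<in> sets borel" "c \<noteq> 0"
 shows "emeasure lborel S = ennreal \<bar>c\<bar> * emeasure lborel {x. t + c * x \<in> S}"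
proof -
 have m: "{x. t + c * x \<in> S} \<in> sets borel"
  using measurable_sets_borel[of "%x. t + c * x" borel S] assms by (simp add: vimage_def)
 have "emeasure lborel S = (\<integral>\<^sup>+x. indicator S x \<partial>lborel)" using assms by simp
 also have "... = ennreal \<bar>c\<bar> * (\<integral>\<^sup>+x. indicator S (t + c * x) \<partial>lborel)"
  using assms by (intro nn_integral_real_affine) auto
 also have "(\<integral>\<^sup>+x. indicator S (t + c * x) \<partial>lborel) = (\<integral>\<^sup>+x. indicator {x. t + c * x \<in> S} x \<partial>lborel)"
  by (intro nn_integral_cong) (auto split: split_indicator)
 finally show ?thesis using m by simp
qed

text \<open>The part of \<open>A\<close> below \<open>x\<close> and the part of \<open>B\<close>
  above \<open>y\<close>, each translated by the other point and halved, are disjoint subsets of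
  \<open>D\<close>. \<open>D\<close> is any measurable set containing the midpoints, since the set
  of midpoints itself may fail to be measurable.\<close>

lemma brunn_minkowski_midpoint:
 fixes A B D :: "real set"
 assumes [measurable]: "A \<in> sets borel" "B \<in> sets borel" "D \<in> sets borel" and ne: "A \<noteq> {}" "B \<noteq> {}"
  and D: "!!x y. x \<in> A ==> y \<in> B ==> (x + y) / 2 \<in> D"
 shows "emeasure lborel A + emeasure lborel B <= 2 * emeasure lborel D"
proof -
 have 1: "emeasure lborel (A \<inter> {..<r}) + emeasure lborel (B \<inter> {q<..}) <= 2 * emeasure lborel D"
  if "x \<in> A" "r <= x" "y \<in> B" "y <= q" for x y r q
 proof -
  let ?A = "{z. - y + 2 * z \<in> A \<inter> {..<r}}" and ?B = "{z. - x + 2 * z \<in> B \<inter> {q<..}}"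
  have [measurable]: "?A \<in> sets borel" "?B \<in> sets borel"
   using measurable_sets_borel[of "%z. - y + 2 * z" borel "A \<inter> {..<r}"] measurable_sets_borel[of "%z. - x + 2 * z" borel "B \<inter> {q<..}"]
   by (simp_all add: vimage_def)
  have "z \<in> D" if "- y + 2 * z \<in> A" for z using D[OF that \<open>y \<in> B\<close>] by simp
  moreover have "z \<in> D" if "- x + 2 * z \<in> B" for z using D[OF \<open>x \<in> A\<close> that] by simp
  ultimately have "?A \<union> ?B \<subseteq> D" by auto
  then have "emeasure lborel (?A \<union> ?B) <= emeasure lborel D" by (intro emeasure_mono) auto
  moreover have "emeasure lborel ?A + emeasure lborel ?B = emeasure lborel (?A \<union> ?B)"
   using that by (intro plus_emeasure) auto
  ultimately have "2 * (emeasure lborel ?A + emeasure lborel ?B) <= 2 * emeasure lborel D"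
   by (intro mult_left_mono) auto
  then show ?thesis
   using emeasure_lborel_affine[of "A \<inter> {..<r}" 2 "- y"] emeasure_lborel_affine[of "B \<inter> {q<..}" 2 "- x"]
   by (simp add: distrib_left)
 qed
 have 2: "emeasure lborel (A \<inter> {..<r}) + emeasure lborel B <= 2 * emeasure lborel D" if x: "x \<in> A" "r <= x" for x r
 proof (cases "emeasure lborel D = \<infinity>")
  case False
  let ?a = "emeasure lborel (A \<inter> {..<r})"
  obtain y0 where y0: "y0 \<in> B" using ne by auto
  \<comment> \<open>Reflection turns the final segments of \<open>B\<close> into initial ones, as
    \<open>emeasure_lborel_initial\<close> expects.\<close>
  have refl: "emeasure lborel {z. - z \<in> S} = emeasure lborel S" if "S \<in> sets borel" for S :: "real set"
   using emeasure_lborel_affine[OF that, of "-1" 0] by simp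
  have fin: "?a \<noteq> \<infinity>" "?a <= 2 * emeasure lborel D"
   using 1[OF x y0 order_refl] False by (auto simp: ennreal_mult_eq_top_iff top_unique intro: order_trans[rotated])
  have "emeasure lborel {z. - z \<in> B} <= 2 * emeasure lborel D - ?a"
  proof (rule emeasure_lborel_initial)
   show "{z. - z \<in> B} \<in> sets borel" using measurable_sets_borel[of uminus borel B] by (simp add: vimage_def)
   show "{z. - z \<in> B} \<noteq> {}" using ne by (metis (mono_tags) Collect_empty_eq all_not_in_conv minus_minus)
   fix r' z assume z: "z \<in> {z. - z \<in> B}" "r' <= z"
   have "{z. - z \<in> B \<inter> {- r'<..}} = {z. - z \<in> B} \<inter> {..<r'}" by auto
   then have "emeasure lborel ({z. - z \<in> B} \<inter> {..<r'}) = emeasure lborel (B \<inter> {- r'<..})"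
    using refl[of "B \<inter> {- r'<..}"] by simp
   also have "... <= 2 * emeasure lborel D - ?a"
    using 1[OF x, of "- z" "- r'"] z fin by (simp add: ennreal_le_minus_iff add.commute)
   finally show "emeasure lborel ({z. - z \<in> B} \<inter> {..<r'}) <= 2 * emeasure lborel D - ?a" .
  qed
  then have "?a + emeasure lborel B <= ?a + (2 * emeasure lborel D - ?a)"
   using refl[of B] by (intro add_left_mono) simp
  also have "... = 2 * emeasure lborel D" using fin by (intro add_diff_inverse_ennreal)
  finally show ?thesis .
 qed (simp add: ennreal_mult_top)
 show ?thesis
 proof (cases "emeasure lborel D = \<infinity>")
  case False
  let ?b = "emeasure lborel B"
  obtain x0 where x0: "x0 \<in> A" using ne by auto
  have fin: "?b \<noteq> \<infinity>" "?b <= 2 * emeasure lborel D"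
   using 2[OF x0 order_refl] False by (auto simp: ennreal_mult_eq_top_iff top_unique intro: order_trans[rotated])
  have "emeasure lborel A <= 2 * emeasure lborel D - ?b"
  proof (rule emeasure_lborel_initial)
   show "emeasure lborel (A \<inter> {..<r}) <= 2 * emeasure lborel D - ?b" if "x \<in> A" "r <= x" for r x
    using 2[OF that] fin by (simp add: ennreal_le_minus_iff)
  qed (use ne in auto)
  then have "?b + emeasure lborel A <= ?b + (2 * emeasure lborel D - ?b)" by (rule add_left_mono)
  also have "... = 2 * emeasure lborel D" using fin by (intro add_diff_inverse_ennreal)
  finally show ?thesis by (simp add: add.commute)
 qed (simp add: ennreal_mult_top)
qed

text \<open>Layer cake formula; the levels are restricted to nonnegative reals because
  \<open>ennreal\<close> sends all negative ones to 0.\<close>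

lemma nn_integral_layers:
 fixes f :: "real => ennreal"
 assumes [measurable]: "f \<in> borel_measurable borel"
 shows "(\<integral>\<^sup>+x. f x \<partial>lborel) = (\<integral>\<^sup>+t. indicator {0..} t * emeasure lborel {x. ennreal t < f x} \<partial>lborel)"
proof -
 have slice: "(\<integral>\<^sup>+t. indicator {t. 0 <= t \<and> ennreal t < y} t \<partial>lborel) = y" for y
 proof (cases y)
  case (real r)
  then have "{t. 0 <= t \<and> ennreal t < y} = {0..<r}" by (auto simp: ennreal_less_iff)
  then show ?thesis using real by simp
 next
  case top
  then have "{t. 0 <= t \<and> ennreal t < y} = {0..}" by auto
  moreover have "emeasure lborel {0::real..} = \<infinity>"
  proof (rule ccontr)
   assume "emeasure lborel {0::real..} \<noteq> \<infinity>"
   then obtain r where r: "emeasure lborel {0::real..} = ennreal r" "0 <= r" by (cases "emeasure lborel {0::real..}") auto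
   have "emeasure lborel {0..r + 1} <= emeasure lborel {0::real..}" by (intro emeasure_mono) auto
   then show False using r by simp
  qed
  ultimately show ?thesis using top by simp
 qed
 have "(\<integral>\<^sup>+x. f x \<partial>lborel) = (\<integral>\<^sup>+x. \<integral>\<^sup>+t. indicator {t. 0 <= t \<and> ennreal t < f x} t \<partial>lborel \<partial>lborel)"
  by (simp add: slice)
 also have "... = (\<integral>\<^sup>+x. \<integral>\<^sup>+t. indicator {(x, t). 0 <= t \<and> ennreal t < f x} (x, t) \<partial>lborel \<partial>lborel)"
  by (intro nn_integral_cong) (auto split: split_indicator)
 also have "... = (\<integral>\<^sup>+t. \<integral>\<^sup>+x. indicator {(x, t). 0 <= t \<and> ennreal t < f x} (x, t) \<partial>lborel \<partial>lborel)"
 proof -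
  have "case_prod (%x t. indicator {(x, t). 0 <= t \<and> ennreal t < f x} (x, t) :: ennreal) \<in> borel_measurable (lborel \<Otimes>\<^sub>M lborel)"
   by measurable
  from lborel_pair.Fubini'[OF this] show ?thesis by simp
 qed
 also have "... = (\<integral>\<^sup>+t. indicator {0..} t * emeasure lborel {x. ennreal t < f x} \<partial>lborel)"
 proof (rule nn_integral_cong)
  fix t :: real
  have "(\<integral>\<^sup>+x. indicator {(x, t). 0 <= t \<and> ennreal t < f x} (x, t) \<partial>lborel) = (\<integral>\<^sup>+x. indicator {0..} t * indicator {x. ennreal t < f x} x \<partial>lborel)"
   by (intro nn_integral_cong) (auto split: split_indicator)
  also have "... = indicator {0..} t * emeasure lborel {x. ennreal t < f x}"
   by (subst nn_integral_cmult) auto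
  finally show "(\<integral>\<^sup>+x. indicator {(x, t). 0 <= t \<and> ennreal t < f x} (x, t) \<partial>lborel) = indicator {0..} t * emeasure lborel {x. ennreal t < f x}" .
 qed
 finally show ?thesis .
qed

lemma ennreal_four_mult_le: "4 * (u * v) <= (u + v)\<^sup>2" for u v :: ennreal
proof (cases "u = \<infinity> \<or> v = \<infinity>")
 case True
 then show ?thesis by (auto simp: power2_eq_square ennreal_top_mult)
next
 case False
 then obtain a b where ab: "u = ennreal a" "v = ennreal b" "0 <= a" "0 <= b" by (cases u; cases v) auto
 have "0 <= (a - b)\<^sup>2" by simp
 then have "4 * (a * b) <= (a + b)\<^sup>2" by (simp add: power2_eq_square algebra_simps)
 moreover have "4 * (u * v) = ennreal (4 * (a * b))" using ab by (simp add: ennreal_mult ennreal_mult[of 4] mult.assoc flip: ennreal_numeral)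
 moreover have "(u + v)\<^sup>2 = ennreal ((a + b)\<^sup>2)" using ab by (simp add: ennreal_power flip: ennreal_plus)
 ultimately show ?thesis using ab by (simp add: ennreal_leI)
qed

lemma ennreal_square_less:
 assumes "ennreal t < u" "ennreal t < v" "0 <= t"
 shows "ennreal t * ennreal t < u * v"
proof (cases "u = \<infinity> \<or> v = \<infinity>")
 case True
 then have "u * v = \<infinity>" using assms by (auto simp: ennreal_top_mult ennreal_mult_top)
 then show ?thesis by (simp add: ennreal_mult[symmetric] less_top[symmetric] assms(3))
next
 case False
 then obtain a b where ab: "u = ennreal a" "v = ennreal b" "0 <= a" "0 <= b" by (cases u; cases v) auto
 then have "t * t < a * b" using assms by (intro mult_strict_mono) (auto simp: ennreal_less_iff)
 then show ?thesis using ab assms by (simp add: ennreal_mult[symmetric] ennreal_less_iff)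
qed

text \<open>Divided by their suprema, \<open>f\<close> and \<open>g\<close> have nonempty level sets
  at every level below 1 and empty ones from 1 on, so the Brunn-Minkowski inequality applies level
  by level. It yields the arithmetic mean of the integrals, which is at least the geometric mean;
  boundedness makes the suprema finite.\<close>

lemma prekopa_bounded:
 fixes f g h :: "real => ennreal"
 assumes [measurable]: "f \<in> borel_measurable borel" "g \<in> borel_measurable borel" "h \<in> borel_measurable borel"
  and fin: "!!x. f x <= ennreal K" "!!x. g x <= ennreal K"
  and le: "!!x y. f x * g y <= (h ((x + y) / 2))\<^sup>2"
 shows "(\<integral>\<^sup>+x. f x \<partial>lborel) * (\<integral>\<^sup>+x. g x \<partial>lborel) <= (\<integral>\<^sup>+x. h x \<partial>lborel)\<^sup>2"
proof (cases "(\<forall>x. f x = 0) \<or> (\<forall>x. g x = 0)")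
 case True
 then show ?thesis by auto
next
 case False
 have sup: "\<exists>a>0. (SUP x. F x) = ennreal a" if "!!x. F x <= ennreal K" "\<not> (\<forall>x. F x = 0)" for F :: "real => ennreal"
 proof -
  have "(SUP x. F x) <= ennreal K" using that by (intro SUP_least)
  then obtain a where a: "(SUP x. F x) = ennreal a" "0 <= a" by (cases "SUP x. F x") (auto simp: top_unique)
  have "a \<noteq> 0" using that(2) a SUP_upper[of _ UNIV F] by (metis UNIV_I ennreal_0 le_zero_eq)
  then show ?thesis using a by (intro exI[of _ a]) simp
 qed
 obtain a b where ab: "a > 0" "(SUP x. f x) = ennreal a" "b > 0" "(SUP x. g x) = ennreal b"
  using sup[of f, OF fin(1)] sup[of g, OF fin(2)] False by blast
 define c where "c = sqrt (a * b)"
 have c: "c > 0" "c * c = a * b" using ab by (auto simp: c_def)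
 let ?L = "%F d t. indicator {0..} t * emeasure lborel {x. ennreal t < ennreal (1 / d) * F x}"
 have layer: "(\<integral>\<^sup>+x. F x \<partial>lborel) = ennreal d * (\<integral>\<^sup>+t. ?L F d t \<partial>lborel)"
  if "d > 0" and [measurable]: "F \<in> borel_measurable borel" for F :: "real => ennreal" and d
 proof -
  have "(\<integral>\<^sup>+t. ?L F d t \<partial>lborel) = (\<integral>\<^sup>+x. ennreal (1 / d) * F x \<partial>lborel)"
   by (rule nn_integral_layers[of "%x. ennreal (1 / d) * F x", symmetric]) measurable
  also have "... = ennreal (1 / d) * (\<integral>\<^sup>+x. F x \<partial>lborel)" by (rule nn_integral_cmult) measurable
  finally have "(\<integral>\<^sup>+t. ?L F d t \<partial>lborel) = ennreal (1 / d) * (\<integral>\<^sup>+x. F x \<partial>lborel)" .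
  then show ?thesis using that by (simp add: mult.assoc[symmetric] ennreal_mult[symmetric])
 qed
 have "?L f a t + ?L g b t <= 2 * ?L h c t" for t
 proof (cases "0 <= t \<and> t < 1")
  case True
  have ne: "{x. ennreal t < ennreal (1 / d) * F x} \<noteq> {}" if "d > 0" "(SUP x. F x) = ennreal d" for F :: "real => ennreal" and d
  proof -
   have "ennreal (t * d) < (SUP x. F x)" using that True by (simp add: ennreal_less_iff)
   then obtain x where "ennreal (t * d) < F x" by (auto simp: less_SUP_iff)
   then have "ennreal (1 / d) * ennreal (t * d) < ennreal (1 / d) * F x"
    using that by (intro ennreal_mult_strict_left_mono) auto
   then show ?thesis using that True by (auto simp: ennreal_mult[symmetric])
  qed
  have "emeasure lborel {x. ennreal t < ennreal (1 / a) * f x} + emeasure lborel {x. ennreal t < ennreal (1 / b) * g x}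
   <= 2 * emeasure lborel {x. ennreal t < ennreal (1 / c) * h x}"
  proof (rule brunn_minkowski_midpoint)
   fix x y assume "x \<in> {x. ennreal t < ennreal (1 / a) * f x}" "y \<in> {x. ennreal t < ennreal (1 / b) * g x}"
   then have "ennreal t * ennreal t < (ennreal (1 / a) * f x) * (ennreal (1 / b) * g y)"
    using True by (intro ennreal_square_less) auto
   also have "... = ennreal (1 / (a * b)) * (f x * g y)"
   proof -
    have "ennreal (1 / (a * b)) = ennreal (1 / a) * ennreal (1 / b)" using ab by (simp flip: ennreal_mult)
    then show ?thesis by (simp only: mult_ac)
   qed
   also have "... <= ennreal (1 / (a * b)) * (h ((x + y) / 2))\<^sup>2" by (intro mult_left_mono le) auto
   also have "... = (ennreal (1 / c) * h ((x + y) / 2))\<^sup>2"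
   proof -
    have "ennreal (1 / (a * b)) = ennreal (1 / c) * ennreal (1 / c)" using ab c by (simp flip: ennreal_mult)
    then show ?thesis by (simp only: mult_ac power2_eq_square)
   qed
   finally have "(ennreal t)\<^sup>2 < (ennreal (1 / c) * h ((x + y) / 2))\<^sup>2" by (simp add: power2_eq_square)
   then show "(x + y) / 2 \<in> {x. ennreal t < ennreal (1 / c) * h x}"
    using power_mono[of "ennreal (1 / c) * h ((x + y) / 2)" "ennreal t" 2] by (simp add: linorder_not_le[symmetric]) blast
  qed (use ne ab in auto)
  then show ?thesis using True by simp
 next
  case False
  have "{x. ennreal t < ennreal (1 / d) * F x} = {}" if "d > 0" "(SUP x. F x) = ennreal d" "t \<ge> 1" for F :: "real => ennreal" and d
  proof -
   have "ennreal (1 / d) * F x <= ennreal (1 / d) * ennreal d" for x using SUP_upper[of x UNIV F] that by (intro mult_left_mono) auto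
   then have "ennreal (1 / d) * F x <= 1" for x using that by (simp add: ennreal_mult[symmetric])
   moreover have "1 <= ennreal t" using that by (simp add: ennreal_leI flip: ennreal_1)
   ultimately have "ennreal (1 / d) * F x <= ennreal t" for x using order_trans by blast
   then show ?thesis by (auto simp: not_less)
  qed
  then show ?thesis using False ab by (auto split: split_indicator)
 qed
 then have "(\<integral>\<^sup>+t. ?L f a t + ?L g b t \<partial>lborel) <= (\<integral>\<^sup>+t. 2 * ?L h c t \<partial>lborel)" by (intro nn_integral_mono)
 then have sum: "(\<integral>\<^sup>+t. ?L f a t \<partial>lborel) + (\<integral>\<^sup>+t. ?L g b t \<partial>lborel) <= 2 * (\<integral>\<^sup>+t. ?L h c t \<partial>lborel)"
  by (subst (asm) nn_integral_add, measurable, subst (asm) nn_integral_cmult, measurable)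
 define u v w where "u = (\<integral>\<^sup>+t. ?L f a t \<partial>lborel)" and "v = (\<integral>\<^sup>+t. ?L g b t \<partial>lborel)" and "w = (\<integral>\<^sup>+t. ?L h c t \<partial>lborel)"
 have "4 * (u * v) <= (u + v)\<^sup>2" by (rule ennreal_four_mult_le)
 also have "... <= (2 * w)\<^sup>2" using sum by (intro power_mono) (auto simp: u_def v_def w_def)
 also have "... = 4 * w\<^sup>2" by (simp add: power_mult_distrib)
 finally have uvw: "u * v <= w\<^sup>2" by (subst (asm) ennreal_mult_le_mult_iff) auto
 have "(\<integral>\<^sup>+x. f x \<partial>lborel) * (\<integral>\<^sup>+x. g x \<partial>lborel) = (ennreal a * u) * (ennreal b * v)"
  unfolding u_def v_def using layer[of a f] layer[of b g] ab by simp
 also have "... = ennreal (a * b) * (u * v)"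
 proof -
  have "ennreal (a * b) = ennreal a * ennreal b" using ab by (simp add: ennreal_mult)
  then show ?thesis by (simp only: mult_ac)
 qed
 also have "... <= ennreal (a * b) * w\<^sup>2" by (intro mult_left_mono uvw) auto
 also have "... = (ennreal c * w)\<^sup>2"
 proof -
  have "ennreal (a * b) = ennreal c * ennreal c" using ab c by (simp flip: ennreal_mult)
  then show ?thesis by (simp only: mult_ac power2_eq_square)
 qed
 also have "ennreal c * w = (\<integral>\<^sup>+x. h x \<partial>lborel)" unfolding w_def using layer[of c h] c by simp
 finally show ?thesis .
qed

lemma prekopa_real:
 fixes f g h :: "real => ennreal"
 assumes [measurable]: "f \<in> borel_measurable borel" "g \<in> borel_measurable borel" "h \<in> borel_measurable borel"
  and le: "!!x y. f x * g y <= (h ((x + y) / 2))\<^sup>2"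
 shows "(\<integral>\<^sup>+x. f x \<partial>lborel) * (\<integral>\<^sup>+x. g x \<partial>lborel) <= (\<integral>\<^sup>+x. h x \<partial>lborel)\<^sup>2"
proof -
 have trunc: "(\<integral>\<^sup>+x. F x \<partial>lborel) = (SUP k. \<integral>\<^sup>+x. min (F x) (ennreal (real k)) \<partial>lborel)"
  if [measurable]: "F \<in> borel_measurable borel" for F :: "real => ennreal"
 proof -
  have "F x = (SUP k. min (F x) (ennreal (real k)))" for x
  proof -
   have "(SUP k. min (F x) (ennreal (real k))) = min (F x) (SUP k. ennreal (real k))" by (simp add: inf_SUP flip: inf_min)
   also have "(SUP k. ennreal (real k)) = top" by (simp add: ennreal_SUP_of_nat_eq_top ennreal_of_nat_eq_real_of_nat[symmetric])
   finally show ?thesis by simp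
  qed
  then have "(\<integral>\<^sup>+x. F x \<partial>lborel) = (\<integral>\<^sup>+x. (SUP k. min (F x) (ennreal (real k))) \<partial>lborel)" by simp
  also have "... = (SUP k. \<integral>\<^sup>+x. min (F x) (ennreal (real k)) \<partial>lborel)"
   by (intro nn_integral_monotone_convergence_SUP) (auto simp: incseq_def le_fun_def intro: min.coboundedI2 ennreal_leI)
  finally show ?thesis .
 qed
 have "(\<integral>\<^sup>+x. min (f x) (ennreal (real k)) \<partial>lborel) * (\<integral>\<^sup>+x. min (g x) (ennreal (real l)) \<partial>lborel) <= (\<integral>\<^sup>+x. h x \<partial>lborel)\<^sup>2" for k l
 proof (rule prekopa_bounded[where K = "real (max k l)"])
  show "min (f x) (ennreal (real k)) * min (g y) (ennreal (real l)) <= (h ((x + y) / 2))\<^sup>2" for x y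
   by (rule order_trans[OF mult_mono le]) auto
 qed (auto intro: min.coboundedI2 ennreal_leI)
 then show ?thesis unfolding trunc[OF assms(1)] trunc[OF assms(2)]
  by (simp add: SUP_mult_right_ennreal SUP_mult_left_ennreal SUP_least)
qed

text \<open>Integrating one coordinate at a time, the inner integrals inherit the hypothesis by the
  one-dimensional case. The squared form keeps square roots out of \<open>ennreal\<close>.\<close>

theorem prekopa_midpoint:
 fixes f g h :: "('i => real) => ennreal"
 assumes "finite I" "f \<in> borel_measurable (\<Pi>\<^sub>M i\<in>I. lborel)" "g \<in> borel_measurable (\<Pi>\<^sub>M i\<in>I. lborel)"
  "h \<in> borel_measurable (\<Pi>\<^sub>M i\<in>I. lborel)"
  and le: "!!x y. x \<in> extensional I ==> y \<in> extensional I ==> f x * g y <= (h (\<lambda>i\<in>I. (x i + y i) / 2))\<^sup>2"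
 shows "(\<integral>\<^sup>+x. f x \<partial>(\<Pi>\<^sub>M i\<in>I. lborel)) * (\<integral>\<^sup>+x. g x \<partial>(\<Pi>\<^sub>M i\<in>I. lborel)) <= (\<integral>\<^sup>+x. h x \<partial>(\<Pi>\<^sub>M i\<in>I. lborel))\<^sup>2"
 using assms
proof (induction I arbitrary: f g h)
 case empty
 interpret product_sigma_finite "%_::'i. lborel" ..
 have e: "(%i::'i. undefined :: real) \<in> extensional {}" by (simp add: extensional_def)
 have "(\<lambda>i\<in>{}. ((undefined :: real) + undefined) / 2) = (%i::'i. undefined)" by auto
 then show ?case using empty(4)[OF e e] by (simp add: nn_integral_empty)
next
 case (insert i I)
 interpret product_sigma_finite "%_::'i. lborel" ..
 let ?M = "\<Pi>\<^sub>M i\<in>I. lborel :: real measure"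
 have ms: "(%y. F (x(i := y))) \<in> borel_measurable borel"
  if "F \<in> borel_measurable (\<Pi>\<^sub>M i\<in>insert i I. lborel)" "x \<in> space ?M" for F :: "_ => ennreal" and x
 proof -
  have "(%y. x(i := y)) \<in> measurable lborel (\<Pi>\<^sub>M i\<in>insert i I. lborel)"
   using measurable_component_update[OF that(2) insert.hyps(2)] by simp
  then show ?thesis using measurable_compose[OF _ that(1)] by simp
 qed
 have mi: "(%x. \<integral>\<^sup>+y. F (x(i := y)) \<partial>lborel) \<in> borel_measurable ?M"
  if [measurable]: "F \<in> borel_measurable (\<Pi>\<^sub>M i\<in>insert i I. lborel)" for F :: "_ => ennreal"
 proof -
  have "(%z. F ((fst z)(i := snd z))) \<in> borel_measurable (?M \<Otimes>\<^sub>M lborel)"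
   using measurable_compose[OF measurable_add_dim[of i I "%_. lborel"] that] by (simp add: case_prod_beta')
  then show ?thesis by (intro lborel.borel_measurable_nn_integral) (simp add: case_prod_beta')
 qed
 have "(\<integral>\<^sup>+x. (\<integral>\<^sup>+y. f (x(i := y)) \<partial>lborel) \<partial>?M) * (\<integral>\<^sup>+x. (\<integral>\<^sup>+y. g (x(i := y)) \<partial>lborel) \<partial>?M) <= (\<integral>\<^sup>+x. (\<integral>\<^sup>+y. h (x(i := y)) \<partial>lborel) \<partial>?M)\<^sup>2"
 proof (rule insert.IH[OF mi mi mi])
  fix x x' :: "'i => real" assume x: "x \<in> extensional I" "x' \<in> extensional I"
  have sp: "space ?M = extensional I" by (simp add: space_PiM PiE_def)
  show "(\<integral>\<^sup>+y. f (x(i := y)) \<partial>lborel) * (\<integral>\<^sup>+y. g (x'(i := y)) \<partial>lborel) <= (\<integral>\<^sup>+y. h ((\<lambda>i\<in>I. (x i + x' i) / 2)(i := y)) \<partial>lborel)\<^sup>2"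
  proof (rule prekopa_real)
   fix y y' :: real
   have "f (x(i := y)) * g (x'(i := y')) <= (h (\<lambda>j\<in>insert i I. ((x(i := y)) j + (x'(i := y')) j) / 2))\<^sup>2"
    using x by (intro insert.prems) (auto simp: extensional_def)
   also have "(\<lambda>j\<in>insert i I. ((x(i := y)) j + (x'(i := y')) j) / 2) = (\<lambda>i\<in>I. (x i + x' i) / 2)(i := (y + y') / 2)"
    using insert.hyps by (auto simp: fun_eq_iff)
   finally show "f (x(i := y)) * g (x'(i := y')) <= (h ((\<lambda>i\<in>I. (x i + x' i) / 2)(i := (y + y') / 2)))\<^sup>2" .
  qed (use ms insert.prems x sp in auto)
 qed (use insert.prems in auto)
 then show ?case using insert by (simp add: product_nn_integral_insert)
qed

section \<open>A log-concave majorant of the number of tables\<close>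

lemma power_div_fact_le: "real n ^ n / fact n <= exp (real n)"
proof -
 have s: "summable (%k. real n ^ k / fact k)" using summable_exp_generic[of "real n"] by (simp add: field_simps)
 have "real n ^ n / fact n <= (\<Sum>k. real n ^ k / fact k)"
  using sum_le_suminf[OF s, of "{n}"] by simp
 then show ?thesis by (simp add: exp_def field_simps)
qed

lemma fact_div_power_le: "n > 0 ==> fact n / real n ^ n <= exp 1 * real n * exp (- real n)"
proof (induction n rule: nat_induct_non_zero)
 case (Suc n)
 have n: "real n > 0" using Suc by simp
 have "ln (real n / real (Suc n)) <= real n / real (Suc n) - 1" using n by (intro ln_le_minus_one) simp
 then have "1 / real (Suc n) <= ln (real (Suc n) / real n)" using n by (simp add: ln_div field_simps)
 then have "1 <= real (Suc n) * ln (real (Suc n) / real n)" by (simp add: field_simps)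
 also have "... = ln ((real (Suc n) / real n) ^ Suc n)" using n by (simp add: ln_realpow del: power_Suc)
 finally have "exp 1 <= exp (ln ((real (Suc n) / real n) ^ Suc n))" by simp
 \<comment> \<open>This is \<open>e <= (1 + 1 / n) ^ (n + 1)\<close>.\<close>
 then have e: "exp 1 * real n ^ Suc n <= real (Suc n) ^ Suc n"
  using n by (simp add: power_divide le_divide_eq del: power_Suc)
 have "fact (Suc n) = real (Suc n) * fact n" by simp
 also have "... <= real (Suc n) * (exp 1 * real n * exp (- real n) * real n ^ n)"
  using Suc n by (intro mult_left_mono) (simp_all add: divide_le_eq)
 also have "... = real (Suc n) * exp (- real n) * (exp 1 * real n ^ Suc n)" by simp
 also have "... <= real (Suc n) * exp (- real n) * real (Suc n) ^ Suc n"
  using e by (intro mult_left_mono) auto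
 also have "exp (- real n) = exp 1 * exp (- real (Suc n))" by (simp flip: exp_add)
 finally have "fact (Suc n) <= exp 1 * real (Suc n) * exp (- real (Suc n)) * real (Suc n) ^ Suc n" by (simp add: mult_ac)
 then show ?case by (subst divide_le_eq) (simp del: power_Suc of_nat_Suc)
qed (simp add: exp_minus)

definition rat_weights :: "nat => (nat => real) set" where
 "rat_weights k = ({..<k} \<rightarrow>\<^sub>E \<rat> \<inter> {0<..})"

lemma countable_rat_weights: "countable (rat_weights k)"
 unfolding rat_weights_def using countable_rat by (intro countable_PiE) (auto intro: countable_subset)

lemma rat_weights_pos: "a \<in> rat_weights k ==> i < k ==> 0 < a i"
 by (auto simp: rat_weights_def)

lemma rat_weights_between:
 assumes "!!i. i < k ==> (0 :: real) < l i" "!!i. i < k ==> l i < u i"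
 obtains a where "a \<in> rat_weights k" "!!i. i < k ==> l i < a i \<and> a i < u i"
proof -
 have "\<forall>i\<in>{..<k}. \<exists>x. x \<in> \<rat> \<and> l i < x \<and> x < u i"
  using assms(2) Rats_dense_in_real by (metis lessThan_iff)
 then obtain f where f: "\<forall>i\<in>{..<k}. f i \<in> \<rat> \<and> l i < f i \<and> f i < u i" by metis
 show ?thesis
  by (rule that[of "restrict f {..<k}"]) (use f assms(1) in \<open>auto simp: rat_weights_def intro: less_trans\<close>)
qed

text \<open>The capacity of the product of the exponentials of the linear forms, for real exponents
 \<open>u\<close>, \<open>v\<close>; the weights are rational so that it is measurable in \<open>X\<close>.\<close>

definition cap_exp :: "nat => nat => (nat => real) => (nat => real) => (nat => real) => (nat => real) => mat => real" where
 "cap_exp m n u v a b X = (\<Sum>e\<in>idx m n. X e * (a (fst e) * b (snd e))) - (\<Sum>i<m. u i * ln (a i)) - (\<Sum>j<n. v j * ln (b j))"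

definition cap_fun :: "nat => nat => (nat => real) => (nat => real) => mat => ennreal" where
 "cap_fun m n u v X = (INF w\<in>rat_weights m \<times> rat_weights n. ennreal (exp (cap_exp m n u v (fst w) (snd w) X)))"

definition cap_int :: "nat => nat => (nat => real) => (nat => real) => ennreal" where
 "cap_int m n u v = (\<integral>\<^sup>+X. indicator (positive_mats m n) X * (cap_fun m n u v X * ennreal (exp (- (sum X (idx m n))))) \<partial>mat_lebesgue m n)"

lemma measurable_entry [measurable]:
 "e \<in> idx m n ==> (%X. X e) \<in> borel_measurable (mat_lebesgue m n)"
 unfolding mat_lebesgue_def by measurable

lemma positive_mats_iff: "X \<in> positive_mats m n \<longleftrightarrow> (\<forall>e\<in>idx m n. 0 < X e) \<and> X \<in> extensional (idx m n)"
 unfolding positive_mats_def PiE_def Pi_def by blast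

lemma space_mat_lebesgue: "space (mat_lebesgue m n) = extensional (idx m n)"
 by (simp add: mat_lebesgue_def space_PiM PiE_def)

lemma sets_positive_mats [measurable]: "positive_mats m n \<in> sets (mat_lebesgue m n)"
 unfolding positive_mats_def mat_lebesgue_def by (intro sets_PiM_I_finite) auto

lemma measurable_cap_fun [measurable]: "cap_fun m n u v \<in> borel_measurable (mat_lebesgue m n)"
proof -
 have "countable (rat_weights m \<times> rat_weights n)" using countable_rat_weights by auto
 then show ?thesis unfolding cap_fun_def cap_exp_def by measurable
qed

lemma ennreal_le_INF_square:
 assumes "I \<noteq> {}" "!!i. i \<in> I ==> c <= (ennreal (y i))\<^sup>2" "!!i. i \<in> I ==> 0 <= y i"
 shows "c <= (INF i\<in>I. ennreal (y i))\<^sup>2"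
proof (rule ccontr)
 assume "\<not> ?thesis"
 then have less: "(INF i\<in>I. ennreal (y i))\<^sup>2 < c" by simp
 obtain i0 where i0: "i0 \<in> I" using assms by auto
 have "(INF i\<in>I. ennreal (y i)) <= ennreal (y i0)" using i0 by (rule INF_lower)
 then obtain r where r: "(INF i\<in>I. ennreal (y i)) = ennreal r" "0 <= r" by (cases "INF i\<in>I. ennreal (y i)") (auto simp: top_unique)
 have "c <= ennreal ((y i0)\<^sup>2)" using assms(2)[OF i0] assms(3)[OF i0] by (simp add: ennreal_power)
 then obtain d where d: "c = ennreal d" "0 <= d" by (cases c) (auto simp: top_unique)
 have "r\<^sup>2 < d" using less r d by (simp add: ennreal_power ennreal_less_iff)
 then have "r < sqrt d" using r by (simp add: real_less_rsqrt)
 then have "(INF i\<in>I. ennreal (y i)) < ennreal (sqrt d)" using r by (simp add: ennreal_less_iff)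
 then obtain i where i: "i \<in> I" "ennreal (y i) < ennreal (sqrt d)" by (auto simp: INF_less_iff)
 then have "y i < sqrt d" using assms(3) by (simp add: ennreal_less_iff)
 then have "(y i)\<^sup>2 < (sqrt d)\<^sup>2" using assms(3)[OF i(1)] by (intro power_strict_mono) auto
 then have "(y i)\<^sup>2 < d" using d by simp
 moreover have "d <= (y i)\<^sup>2" using assms(2)[OF i(1)] assms(3)[OF i(1)] d by (simp add: ennreal_power)
 ultimately show False by simp
qed

lemma rat_weights_nonempty: "rat_weights m \<times> rat_weights n \<noteq> {}"
proof -
 have "(\<lambda>i\<in>{..<k}. 1) \<in> rat_weights k" for k by (auto simp: rat_weights_def)
 then show ?thesis by blast
qed

text \<open>For fixed weights the exponent \<open>cap_exp\<close> is affine in the margins and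
  \<open>X\<close> jointly, so the infimum is log-concave in all of them; integrating out
  \<open>X\<close> keeps this by \<open>prekopa_midpoint\<close>.\<close>

lemma cap_int_midpoint:
 "cap_int m n u v * cap_int m n u' v' <= (cap_int m n (%i. (u i + u' i) / 2) (%j. (v j + v' j) / 2))\<^sup>2"
 unfolding cap_int_def mat_lebesgue_def
proof (rule prekopa_midpoint)
 fix x y :: mat assume xy: "x \<in> extensional (idx m n)" "y \<in> extensional (idx m n)"
 let ?z = "\<lambda>e\<in>idx m n. (x e + y e) / 2"
 let ?u = "%i. (u i + u' i) / 2" and ?v = "%j. (v j + v' j) / 2"
 let ?s = "%x. ennreal (exp (- (sum x (idx m n))))"
 have cap: "cap_fun m n u v x * cap_fun m n u' v' y <= (cap_fun m n ?u ?v ?z)\<^sup>2"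
  unfolding cap_fun_def[of m n ?u]
 proof (rule ennreal_le_INF_square[OF rat_weights_nonempty])
  fix w assume w: "w \<in> rat_weights m \<times> rat_weights n"
  let ?E = "%u v x. cap_exp m n u v (fst w) (snd w) x"
  have mid: "?E ?u ?v ?z = (?E u v x + ?E u' v' y) / 2"
   unfolding cap_exp_def by (simp add: sum.distrib sum_divide_distrib add_divide_distrib diff_divide_distrib distrib_right)
  have "cap_fun m n u v x * cap_fun m n u' v' y <= ennreal (exp (?E u v x)) * ennreal (exp (?E u' v' y))"
   unfolding cap_fun_def using w by (intro mult_mono INF_lower) auto
  also have "... = (ennreal (exp (?E ?u ?v ?z)))\<^sup>2"
   by (simp add: mid ennreal_mult[symmetric] power2_eq_square exp_add[symmetric])
  finally show "cap_fun m n u v x * cap_fun m n u' v' y <= (ennreal (exp (?E ?u ?v ?z)))\<^sup>2" .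
 qed auto
 have "?s x * ?s y = (?s ?z)\<^sup>2"
 proof -
  have "(\<Sum>e\<in>idx m n. ?z e) = ((sum x (idx m n)) + (sum y (idx m n))) / 2"
   by (simp add: sum.distrib[symmetric] sum_divide_distrib)
  then show ?thesis by (simp add: ennreal_mult[symmetric] power2_eq_square exp_add[symmetric])
 qed
 then have "(cap_fun m n u v x * ?s x) * (cap_fun m n u' v' y * ?s y) = (cap_fun m n u v x * cap_fun m n u' v' y) * (?s ?z)\<^sup>2"
  by (simp only: mult_ac flip: \<open>?s x * ?s y = (?s ?z)\<^sup>2\<close>)
 also have "... <= (cap_fun m n ?u ?v ?z * ?s ?z)\<^sup>2"
  unfolding power_mult_distrib using cap by (intro mult_right_mono) auto
 finally have main: "(cap_fun m n u v x * ?s x) * (cap_fun m n u' v' y * ?s y) <= (cap_fun m n ?u ?v ?z * ?s ?z)\<^sup>2" .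
 show "(indicator (positive_mats m n) x * (cap_fun m n u v x * ?s x)) * (indicator (positive_mats m n) y * (cap_fun m n u' v' y * ?s y))
  <= (indicator (positive_mats m n) ?z * (cap_fun m n ?u ?v ?z * ?s ?z))\<^sup>2"
 proof (cases "x \<in> positive_mats m n \<and> y \<in> positive_mats m n")
  case True
  then have "?z \<in> positive_mats m n" by (auto simp: positive_mats_iff intro: add_pos_pos)
  then show ?thesis using True main by simp
 qed auto
qed (unfold mat_lebesgue_def[symmetric], auto)

text \<open>Dropping the margin conditions enlarges the sum to one over all bounded arrays, which
  factors into truncated exponential series.\<close>

lemma table_poly_le_exp:
 assumes X: "!!e. e \<in> idx m n ==> 0 <= X e"
 shows "table_poly m n R C X <= exp (sum X (idx m n))"
proof -
 have sub: "tables m n R C \<subseteq> idx m n \<rightarrow>\<^sub>E {..total m R}"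
 proof
  fix D assume D: "D \<in> tables m n R C"
  have "D e <= total m R" if "e \<in> idx m n" for e
   using tables_total[OF D] member_le_sum[of e "idx m n" D] that by simp
  then show "D \<in> idx m n \<rightarrow>\<^sub>E {..total m R}" using D by (auto simp: tables_def PiE_def)
 qed
 have "table_poly m n R C X <= (\<Sum>D\<in>idx m n \<rightarrow>\<^sub>E {..total m R}. \<Prod>e\<in>idx m n. X e ^ D e / fact (D e))"
  unfolding table_poly_def using X sub by (intro sum_mono2 finite_PiE prod_nonneg) auto
 also have "... = (\<Prod>e\<in>idx m n. \<Sum>k\<le>total m R. X e ^ k / fact k)"
  by (rule prod_sum_PiE[symmetric]) auto
 also have "... <= (\<Prod>e\<in>idx m n. exp (X e))"
 proof (rule prod_mono, intro conjI)
  fix e assume e: "e \<in> idx m n"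
  show "0 <= (\<Sum>k\<le>total m R. X e ^ k / fact k)" using X[OF e] by (intro sum_nonneg) auto
  have s: "summable (%k. X e ^ k / fact k)" using summable_exp_generic[of "X e"] by (simp add: field_simps)
  have "(\<Sum>k\<le>total m R. X e ^ k / fact k) <= (\<Sum>k. X e ^ k / fact k)"
   using X[OF e] by (intro sum_le_suminf[OF s]) auto
  then show "(\<Sum>k\<le>total m R. X e ^ k / fact k) <= exp (X e)" by (simp add: exp_def field_simps)
 qed
 finally show ?thesis by (simp add: exp_sum)
qed

lemma table_poly_le_cap_exp:
 assumes X: "!!e. e \<in> idx m n ==> 0 <= X e" and a: "!!i. i < m ==> 0 < a i" and b: "!!j. j < n ==> 0 < b j"
 shows "table_poly m n R C X <= exp (cap_exp m n (%i. R i) (%j. C j) a b X)"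
proof -
 have sp: "0 < scaling_product m n R C a b" unfolding scaling_product_def using a b by (auto intro!: mult_pos_pos prod_pos)
 have nn: "0 <= X e * (a (fst e) * b (snd e))" if "e \<in> idx m n" for e
  using X[OF that] that a b by (intro mult_nonneg_nonneg) (auto simp: idx_def less_imp_le)
 have "scaling_product m n R C a b * table_poly m n R C X = table_poly m n R C (%(i, j). X (i, j) * a i * b j)"
  by (rule table_poly_scale[symmetric])
 also have "... = table_poly m n R C (%e. X e * (a (fst e) * b (snd e)))" by (rule table_poly_cong) (auto simp: mult.assoc)
 also have "... <= exp (\<Sum>e\<in>idx m n. X e * (a (fst e) * b (snd e)))"
  using nn by (rule table_poly_le_exp)
 finally have "table_poly m n R C X <= exp (\<Sum>e\<in>idx m n. X e * (a (fst e) * b (snd e))) / exp (ln (scaling_product m n R C a b))"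
  using sp by (simp add: le_divide_eq mult.commute)
 then show ?thesis unfolding cap_exp_def using ln_scaling_product[of m a n b R C] a b by (simp add: exp_diff[symmetric] diff_diff_eq)
qed

text \<open>Each monomial times the exponential is a product of Erlang densities of total mass 1, so
  every table contributes 1.\<close>

lemma nn_integral_table_poly:
 "(\<integral>\<^sup>+X. indicator (positive_mats m n) X * ennreal (table_poly m n R C X * exp (- (sum X (idx m n)))) \<partial>mat_lebesgue m n) = ennreal (num_tables m n R C)"
proof -
 interpret product_sigma_finite "%_::nat \<times> nat. lborel :: real measure" ..
 have split: "indicator (positive_mats m n) X * ennreal (table_poly m n R C X * exp (- (sum X (idx m n))))
   = (\<Sum>D\<in>tables m n R C. \<Prod>e\<in>idx m n. indicator {0<..} (X e) * ennreal (erlang_density (D e) 1 (X e)))"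
  if X: "X \<in> extensional (idx m n)" for X
 proof (cases "X \<in> positive_mats m n")
  case True
  then have p: "!!e. e \<in> idx m n ==> 0 < X e" by (simp add: positive_mats_iff)
  have "table_poly m n R C X * exp (- (sum X (idx m n))) = (\<Sum>D\<in>tables m n R C. \<Prod>e\<in>idx m n. erlang_density (D e) 1 (X e))"
   unfolding table_poly_def sum_distrib_right sum_negf[symmetric] exp_sum[OF finite_idx] prod.distrib[symmetric]
   using p by (intro sum.cong refl prod.cong) (auto simp: erlang_density_def dest: p)
  moreover have "0 <= erlang_density (D e) 1 (X e)" for D e by (rule erlang_density_nonneg) simp
  ultimately show ?thesis using True p by (simp add: prod_ennreal prod_nonneg sum_ennreal)
 next
  case False
  then obtain e where "e \<in> idx m n" "\<not> 0 < X e" using X by (auto simp only: positive_mats_iff)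
  then show ?thesis using False by (auto intro!: sum.neutral[symmetric] prod_zero bexI[of _ e])
 qed
 have "(\<integral>\<^sup>+X. indicator (positive_mats m n) X * ennreal (table_poly m n R C X * exp (- (sum X (idx m n)))) \<partial>mat_lebesgue m n)
  = (\<integral>\<^sup>+X. (\<Sum>D\<in>tables m n R C. \<Prod>e\<in>idx m n. indicator {0<..} (X e) * ennreal (erlang_density (D e) 1 (X e))) \<partial>mat_lebesgue m n)"
  by (intro nn_integral_cong split) (simp add: space_mat_lebesgue)
 also have "... = (\<Sum>D\<in>tables m n R C. \<integral>\<^sup>+X. (\<Prod>e\<in>idx m n. indicator {0<..} (X e) * ennreal (erlang_density (D e) 1 (X e))) \<partial>mat_lebesgue m n)"
  by (rule nn_integral_sum) measurable
 also have "... = (\<Sum>D\<in>tables m n R C. \<Prod>e\<in>idx m n. \<integral>\<^sup>+x. indicator {0<..} x * ennreal (erlang_density (D e) 1 x) \<partial>lborel)"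
  unfolding mat_lebesgue_def by (intro sum.cong refl product_nn_integral_prod) auto
 also have "... = (\<Sum>D\<in>tables m n R C. 1)"
 proof (intro sum.cong refl prod.neutral ballI)
  fix D :: "nat \<times> nat => nat" and e
  have "(\<integral>\<^sup>+x. indicator {0<..} x * ennreal (erlang_density (D e) 1 x) \<partial>lborel) = (\<integral>\<^sup>+x. ennreal (erlang_density (D e) 1 x) \<partial>lborel)"
   using AE_lborel_singleton[of 0] by (intro nn_integral_cong_AE, eventually_elim) (auto simp: erlang_density_def split: split_indicator)
  then show "(\<integral>\<^sup>+x. indicator {0<..} x * ennreal (erlang_density (D e) 1 x) \<partial>lborel) = 1"
   using nn_integral_erlang_ith_moment[of 1 "D e" 0] by simp
 qed
 finally show ?thesis by (simp add: num_tables_def ennreal_of_nat_eq_real_of_nat)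
qed

lemma num_tables_le_cap_int: "ennreal (num_tables m n R C) <= cap_int m n (%i. R i) (%j. C j)"
 unfolding cap_int_def nn_integral_table_poly[symmetric]
proof (rule nn_integral_mono)
 fix X
 have "ennreal (table_poly m n R C X * exp (- (sum X (idx m n)))) <= cap_fun m n (%i. R i) (%j. C j) X * ennreal (exp (- (sum X (idx m n))))"
  if "X \<in> positive_mats m n"
 proof -
  have "ennreal (table_poly m n R C X) <= cap_fun m n (%i. R i) (%j. C j) X"
   unfolding cap_fun_def using that rat_weights_pos
   by (intro INF_greatest ennreal_leI table_poly_le_cap_exp) (auto simp: positive_mats_iff less_imp_le)
  then show ?thesis by (simp add: ennreal_mult'' mult_right_mono)
 qed
 then show "indicator (positive_mats m n) X * ennreal (table_poly m n R C X * exp (- (sum X (idx m n)))) <=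
  indicator (positive_mats m n) X * (cap_fun m n (%i. R i) (%j. C j) X * ennreal (exp (- (sum X (idx m n)))))"
  by (auto split: split_indicator)
qed

text \<open>\<open>p_fun_ge_1\<close> with Stirling's bounds inserted: each of the
  \<open>m + n\<close> factors \<open>fact k / k ^ k\<close> costs at most \<open>exp 1 * N\<close>
  beyond \<open>exp (- k)\<close>.\<close>

lemma scaling_value_le_table_poly:
 assumes mar: "margins m n R C" and X: "!!e. e \<in> idx m n ==> 0 < X e"
 shows "exp (total m R) * scaling_value m n R C X <= (exp 1 * total m R) ^ (m + n) * table_poly m n R C X"
proof -
 let ?N = "total m R"
 have tot: "?N = total n C" using mar by (simp add: margins_def)
 have sv: "0 < scaling_value m n R C X" by (rule scaling_value_pos[of m n R C X, OF mar X])
 have h: "0 < table_poly m n R C X" by (rule table_poly_pos[of m R n C X, OF tot X])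
 have bound: "(\<Prod>i<k. fact (F i) / real (F i) ^ F i) <= (exp 1 * ?N) ^ k * exp (- real ?N)"
  if F: "!!i. i < k ==> 0 < F i" and tF: "total k F = ?N" for k F
 proof -
  have "(\<Prod>i<k. fact (F i) / real (F i) ^ F i) <= (\<Prod>i<k. (exp 1 * ?N) * exp (- real (F i)))"
  proof (rule prod_mono, intro conjI)
   fix i assume i: "i \<in> {..<k}"
   have "F i <= total k F" unfolding total_def using i by (intro member_le_sum) auto
   then have "F i <= ?N" using tF by simp
   then have "exp 1 * real (F i) * exp (- real (F i)) <= (exp 1 * ?N) * exp (- real (F i))" by (intro mult_right_mono) auto
   then show "fact (F i) / real (F i) ^ F i <= (exp 1 * ?N) * exp (- real (F i))"
    using order_trans[OF fact_div_power_le[OF F]] i by simp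
  qed auto
  also have "... = (exp 1 * ?N) ^ k * exp (- real ?N)"
  proof -
   have "(\<Sum>i<k. real (F i)) = real (total m R)" unfolding tF[symmetric] by (simp add: total_def)
   then show ?thesis by (simp add: prod.distrib exp_sum[symmetric] sum_negf)
  qed
  finally show ?thesis .
 qed
 have "1 <= p_fun m n R C X" by (rule p_fun_ge_1[of m n R C X, OF mar X])
 also have "... = real ?N ^ ?N / fact ?N * (\<Prod>i<m. fact (R i) / real (R i) ^ R i) * (\<Prod>j<n. fact (C j) / real (C j) ^ C j) *
  (table_poly m n R C X / scaling_value m n R C X)"
  by (rule p_fun_eq[of m n R C X, OF mar X])
 also have "... <= exp ?N * ((exp 1 * ?N) ^ m * exp (- real ?N)) * ((exp 1 * ?N) ^ n * exp (- real ?N)) * (table_poly m n R C X / scaling_value m n R C X)"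
  using bound[of m R] bound[of n C] mar tot h sv
  by (intro mult_right_mono mult_mono power_div_fact_le) (auto simp: margins_def intro!: prod_nonneg mult_nonneg_nonneg)
 also have "... = (exp 1 * ?N) ^ (m + n) * table_poly m n R C X * exp (- real ?N) / scaling_value m n R C X"
  by (simp add: power_add exp_minus field_simps)
 finally have "scaling_value m n R C X <= (exp 1 * ?N) ^ (m + n) * table_poly m n R C X * exp (- real ?N)"
  using sv by (simp add: le_divide_eq)
 then have "exp ?N * scaling_value m n R C X <= exp ?N * ((exp 1 * ?N) ^ (m + n) * table_poly m n R C X * exp (- real ?N))"
  by (intro mult_left_mono) auto
 then show ?thesis by (simp add: exp_minus field_simps)
qed

lemma cap_fun_le:
 assumes mar: "margins m n R C" and X: "!!e. e \<in> idx m n ==> 0 < X e"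
 shows "cap_fun m n (%i. R i) (%j. C j) X <= ennreal (exp 3 * (exp 1 * total m R) ^ (m + n) * table_poly m n R C X)"
proof -
 let ?N = "real (total m R)"
 have N: "?N \<ge> 1" using margins_pos[OF mar] by simp
 obtain a b where ab: "!!i. i < m ==> 0 < a i" "!!j. j < n ==> 0 < b j"
  "scaling_value m n R C X * scaling_product m n R C a b = 1"
  "(\<Sum>e\<in>idx m n. X e * a (fst e) * b (snd e)) = ?N"
  using scaling_value_attained[of m n R C X, OF mar X] by blast
 \<comment> \<open>The infimum runs over rational weights, so the optimal ones are rounded up by
   less than the factor \<open>1 + 1 / N\<close>. This raises the linear form from \<open>N\<close>
   to at most \<open>N + 3\<close>, whence the factor \<open>exp 3\<close>.\<close>
 define q where "q = 1 + 1 / ?N"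
 have q: "q > 1" using N by (simp add: q_def)
 obtain a' where a': "a' \<in> rat_weights m" "!!i. i < m ==> a i < a' i \<and> a' i < q * a i"
  by (rule rat_weights_between[of m a "%i. q * a i"]) (use ab(1) q in auto)
 obtain b' where b': "b' \<in> rat_weights n" "!!j. j < n ==> b j < b' j \<and> b' j < q * b j"
  by (rule rat_weights_between[of n b "%j. q * b j"]) (use ab(2) q in auto)
 have "cap_fun m n (%i. R i) (%j. C j) X <= ennreal (exp (cap_exp m n (%i. R i) (%j. C j) a' b' X))"
  unfolding cap_fun_def using a' b' by (intro INF_lower2[of "(a', b')"]) auto
 also have "... <= ennreal (exp (?N + 3 + ln (scaling_value m n R C X)))"
 proof (intro ennreal_leI, subst exp_le_cancel_iff)
  have "(\<Sum>e\<in>idx m n. X e * (a' (fst e) * b' (snd e))) <= (\<Sum>e\<in>idx m n. q\<^sup>2 * (X e * a (fst e) * b (snd e)))"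
  proof (rule sum_mono)
   fix e assume "e \<in> idx m n"
   then have e: "fst e < m" "snd e < n" "0 < X e" using X by (auto simp: idx_def)
   have "a' (fst e) * b' (snd e) <= (q * a (fst e)) * (q * b (snd e))"
    using a'(2)[OF e(1)] b'(2)[OF e(2)] ab(1)[OF e(1)] ab(2)[OF e(2)] q by (intro mult_mono) auto
   then have "X e * (a' (fst e) * b' (snd e)) <= X e * ((q * a (fst e)) * (q * b (snd e)))" using e by (intro mult_left_mono) auto
   then show "X e * (a' (fst e) * b' (snd e)) <= q\<^sup>2 * (X e * a (fst e) * b (snd e))" by (simp add: power2_eq_square mult_ac)
  qed
  also have "... = q\<^sup>2 * ?N" using ab(4) by (simp add: sum_distrib_left[symmetric])
  also have "... <= ?N + 3"
  proof -
   have "q\<^sup>2 * ?N = ?N + 2 + 1 / ?N" using N by (simp add: q_def power2_eq_square field_simps)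
   also have "1 / ?N <= 1" using N by simp
   finally show ?thesis by simp
  qed
  finally have 1: "(\<Sum>e\<in>idx m n. X e * (a' (fst e) * b' (snd e))) <= ?N + 3" .
  have "(\<Sum>i<m. R i * ln (a i)) <= (\<Sum>i<m. R i * ln (a' i))" "(\<Sum>j<n. C j * ln (b j)) <= (\<Sum>j<n. C j * ln (b' j))"
   using a'(2) b'(2) ab(1,2) by (auto intro!: sum_mono mult_left_mono simp: less_imp_le order.strict_trans[OF ab(1)] order.strict_trans[OF ab(2)])
  moreover have "ln (scaling_value m n R C X) + ((\<Sum>i<m. R i * ln (a i)) + (\<Sum>j<n. C j * ln (b j))) = 0"
  proof -
   have "0 < scaling_value m n R C X" by (rule scaling_value_pos[of m n R C X, OF mar X])
   moreover have "0 < scaling_product m n R C a b" unfolding scaling_product_def using ab by (auto intro!: mult_pos_pos prod_pos)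
   ultimately show ?thesis using ln_mult_pos[of "scaling_value m n R C X" "scaling_product m n R C a b"]
     ln_scaling_product[of m a n b R C] ab by simp
  qed
  ultimately show "cap_exp m n (%i. R i) (%j. C j) a' b' X <= ?N + 3 + ln (scaling_value m n R C X)"
   unfolding cap_exp_def using 1 by simp
 qed
 also have "exp (?N + 3 + ln (scaling_value m n R C X)) = exp 3 * (exp ?N * scaling_value m n R C X)"
  using scaling_value_pos[of m n R C X, OF mar X] by (simp add: exp_add)
 also have "... <= exp 3 * ((exp 1 * ?N) ^ (m + n) * table_poly m n R C X)"
  using scaling_value_le_table_poly[of m n R C X, OF mar X] by (intro mult_left_mono) auto
 finally show ?thesis by (simp add: mult.assoc ennreal_leI)
qed

lemma cap_int_le_num_tables:
 assumes mar: "margins m n R C"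
 shows "cap_int m n (%i. R i) (%j. C j) <= ennreal (exp 3 * (exp 1 * total m R) ^ (m + n) * num_tables m n R C)"
proof -
 let ?K = "exp 3 * (exp 1 * real (total m R)) ^ (m + n)"
 have "cap_int m n (%i. R i) (%j. C j) <= (\<integral>\<^sup>+X. ennreal ?K * (indicator (positive_mats m n) X * ennreal (table_poly m n R C X * exp (- (sum X (idx m n))))) \<partial>mat_lebesgue m n)"
  unfolding cap_int_def
 proof (rule nn_integral_mono)
  fix X
  show "indicator (positive_mats m n) X * (cap_fun m n (%i. R i) (%j. C j) X * ennreal (exp (- (sum X (idx m n))))) \<le>
   ennreal ?K * (indicator (positive_mats m n) X * ennreal (table_poly m n R C X * exp (- (sum X (idx m n)))))"
  proof (cases "X \<in> positive_mats m n")
   case True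
   then have "cap_fun m n (%i. R i) (%j. C j) X <= ennreal (?K * table_poly m n R C X)"
    using cap_fun_le[OF mar, of X] by (auto simp only: positive_mats_iff)
   then have "cap_fun m n (%i. R i) (%j. C j) X * ennreal (exp (- (sum X (idx m n)))) <= ennreal (?K * table_poly m n R C X) * ennreal (exp (- (sum X (idx m n))))"
    by (rule mult_right_mono) simp
   also have "... = ennreal ?K * ennreal (table_poly m n R C X * exp (- (sum X (idx m n))))"
   proof -
    have "0 <= table_poly m n R C X" using True by (intro table_poly_nonneg) (auto simp only: positive_mats_iff less_imp_le)
    then show ?thesis by (simp add: ennreal_mult[symmetric] mult.assoc)
   qed
   finally show ?thesis using True by simp
  qed auto
 qed
 also have "... = ennreal ?K * ennreal (num_tables m n R C)"
  unfolding table_poly_def by (subst nn_integral_cmult) (auto simp: nn_integral_table_poly[unfolded table_poly_def])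
 finally show ?thesis by (simp add: ennreal_mult')
qed

section \<open>The entropy bound for the number of tables\<close>

text \<open>The number of ways of splitting an entry \<open>z\<close> among \<open>K\<close> tables, so that \<open>weighted_tables K\<close> below counts
 \<open>K\<close>-tuples of tables whose margins add up to the given ones.\<close>

definition compositions :: "nat => nat => nat" where
 "compositions K z = (z + K - 1) choose z"

lemma compositions_gbinomial:
 assumes "K > 0"
 shows "real (compositions K z) = (- 1) ^ z * ((- real K) gchoose z)"
proof -
 have "(- real K) gchoose z = (- 1) ^ z * ((real K + real z - 1) gchoose z)" by (rule gbinomial_minus)
 also have "(real K + real z - 1) = real (z + K - 1)" using assms by (simp add: of_nat_diff)
 finally show ?thesis by (simp add: compositions_def binomial_gbinomial mult.assoc[symmetric] flip: power_mult_distrib)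
qed

text \<open>Vandermonde's convolution for binomial coefficients with the negative upper indices
  \<open>- K\<close> and \<open>- L\<close>.\<close>

lemma compositions_add:
 assumes "K > 0" "L > 0"
 shows "compositions (K + L) z = (\<Sum>k\<le>z. compositions K k * compositions L (z - k))"
proof -
 have "real (compositions (K + L) z) = (- 1) ^ z * ((- real K + - real L) gchoose z)"
  using assms by (simp add: compositions_gbinomial)
 also have "... = (- 1) ^ z * (\<Sum>k\<le>z. ((- real K) gchoose k) * ((- real L) gchoose (z - k)))"
  by (simp add: gbinomial_Vandermonde atMost_atLeast0)
 also have "... = (\<Sum>k\<le>z. real (compositions K k) * real (compositions L (z - k)))"
  unfolding sum_distrib_left
 proof (rule sum.cong[OF refl])
  fix k assume "k \<in> {..z}"
  then have "(- 1 :: real) ^ z = (- 1) ^ k * (- 1) ^ (z - k)" by (simp flip: power_add)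
  then show "(- 1) ^ z * (((- real K) gchoose k) * ((- real L) gchoose (z - k))) = real (compositions K k) * real (compositions L (z - k))"
   using assms by (simp add: compositions_gbinomial)
 qed
 also have "... = real (\<Sum>k\<le>z. compositions K k * compositions L (z - k))" by simp
 finally show ?thesis by linarith
qed

lemma compositions_pos: "K > 0 ==> 0 < compositions K z"
 by (simp add: compositions_def zero_less_binomial_iff)

lemma compositions_mono:
 assumes "K > 0" "z <= z'"
 shows "compositions K z <= compositions K z'"
proof (rule lift_Suc_mono_le[of "compositions K"])
 fix z
 have "compositions K (Suc z) = Suc (z + K - 1) choose Suc z" using assms by (simp add: compositions_def)
 then show "compositions K z <= compositions K (Suc z)" by (simp only: binomial_Suc_Suc compositions_def)
qed fact

text \<open>For \<open>w = K x\<close> the left side is \<open>K\<close> times the entropy of one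
  entry \<open>x\<close>. Stirling's bounds give it for the integer \<open>z\<close>, and passing
  from \<open>z\<close> to \<open>w\<close> costs a constant and one more logarithm.\<close>

lemma ln_compositions_ge:
 fixes z :: nat and w :: real
 assumes K: "K > 0" and w: "real z <= w" "w < z + 1" and W: "0 < w"
 shows "(w + K) * ln (w + K) - w * ln w - K * ln K <= ln (compositions K z) + 4 + 3 * ln (z + K + 1)"
proof -
 have a: "(real z + K) * ln (real z + K) - real z * ln (real z) - K * ln K <= ln (compositions K z) + 2 + 2 * ln (z + K + 1)"
 proof (cases "z = 0")
  case True
  have "0 <= ln (1 + real K)" by simp
  then show ?thesis using True by (simp add: compositions_def)
 next
  case False
  then have z: "z > 0" by simp
  have lower: "real n * ln n - n <= ln (fact n)" if "n > 0" for n :: nat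
  proof -
   have "ln (real n ^ n / fact n) <= ln (exp (real n))" using power_div_fact_le[of n] that by (subst ln_le_cancel_iff) auto
   then show ?thesis using that by (simp add: ln_div ln_realpow)
  qed
  have upper: "ln (fact n) <= 1 + ln n + real n * ln n - n" if "n > 0" for n :: nat
  proof -
   have "ln (fact n / real n ^ n) <= ln (exp 1 * real n * exp (- real n))" using fact_div_power_le[OF that] that by (subst ln_le_cancel_iff) auto
   then show ?thesis using that by (simp add: ln_div ln_realpow ln_mult)
  qed
  have "real (compositions K z) = fact (z + K - 1) / (fact z * fact (K - 1))"
   using K by (simp add: compositions_def binomial_fact)
  also have "fact (z + K - 1) = (fact (z + K) :: real) / (z + K)" using K z by (simp add: fact_reduce[of "z + K"])
  also have "fact (K - 1) = (fact K :: real) / K" using K by (simp add: fact_reduce[of K])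
  finally have c: "real (compositions K z) = fact (z + K) * K / (fact z * fact K * (z + K))" by simp
  have "ln (compositions K z) = ln (fact (z + K)) + ln K - ln (fact z) - ln (fact K) - ln (z + K)"
   unfolding c using K z by (simp add: ln_div ln_mult)
  moreover have "ln z <= ln (real (z + K + 1))" "ln (z + K) <= ln (real (z + K + 1))" using z K by auto
  moreover have "0 < z + K" using z by simp
  ultimately show ?thesis using lower[of "z + K"] upper[OF z] upper[OF K] unfolding of_nat_add by linarith
 qed
 have z0: "0 <= real z + K" "0 < real z + K" using K by auto
 have b: "(w + K) * ln (w + K) - (real z + K) * ln (real z + K) <= 1 + ln (z + K + 1)"
 proof -
  have "(real z + K) * ln (w + K) + (real z + K) - (w + K) <= (real z + K) * ln (real z + K)"
   using K W by (intro x_ln_x_tangent) auto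
  then have "(w + K) * ln (w + K) - (real z + K) * ln (real z + K) <= (w - z) * (1 + ln (w + K))" by (simp add: algebra_simps)
  also have "... <= 1 * (1 + ln (z + K + 1))"
  proof (intro mult_mono)
   show "1 + ln (w + K) <= 1 + ln (z + K + 1)" using w W K by simp
   show "0 <= 1 + ln (w + K)" using W K by simp
  qed (use w in auto)
  finally show ?thesis by simp
 qed
 have c: "real z * ln z - w * ln w <= 1"
 proof (cases "z = 0")
  case True
  then show ?thesis using x_ln_x_tangent[of w 1] W by simp
 next
  case False
  then have "w * ln z + w - z <= w * ln w" using W by (intro x_ln_x_tangent) auto
  moreover have "real z * ln z <= w * ln z" using w False by (intro mult_right_mono) auto
  ultimately show ?thesis using w by linarith
 qed
 show ?thesis using a b c by linarith
qed

definition weighted_tables :: "nat => nat => nat => (nat => nat) => (nat => nat) => real" where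
 "weighted_tables K m n u v = (\<Sum>Z\<in>tables m n u v. \<Prod>e\<in>idx m n. real (compositions K (Z e)))"

definition submargins :: "nat => nat => (nat => nat) => (nat => nat) => ((nat => nat) \<times> (nat => nat)) set" where
 "submargins m n u v = (PiE {..<m} (%i. {..u i})) \<times> (PiE {..<n} (%j. {..v j}))"

lemma finite_submargins [simp]: "finite (submargins m n u v)"
 by (simp add: submargins_def finite_PiE)

lemma card_submargins: "card (submargins m n u v) = (\<Prod>i<m. Suc (u i)) * (\<Prod>j<n. Suc (v j))"
 by (simp add: submargins_def card_cartesian_product card_PiE)

text \<open>A \<open>2 K\<close>-tuple is cut into two halves: \<open>compositions_add\<close>
  splits the weights, and the pairs are sorted by the margins of the first half.\<close>

lemma weighted_tables_double:
 assumes K: "K > 0"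
 shows "weighted_tables (K + K) m n u v \<le>
  (\<Sum>p\<in>submargins m n u v. weighted_tables K m n (fst p) (snd p) * weighted_tables K m n (%i. u i - fst p i) (%j. v j - snd p j))"
proof -
 let ?c = "%Z. \<Prod>e\<in>idx m n. real (compositions K (Z e))"
 let ?B = "%Z :: nat \<times> nat => nat. PiE (idx m n) (%e. {..Z e})"
 let ?T = "%p. tables m n (fst p) (snd p) \<times> tables m n (%i. u i - fst p i) (%j. v j - snd p j)"
 have "weighted_tables (K + K) m n u v = (\<Sum>Z\<in>tables m n u v. \<Sum>Z1\<in>?B Z. \<Prod>e\<in>idx m n. real (compositions K (Z1 e)) * real (compositions K (Z e - Z1 e)))"
  unfolding weighted_tables_def using K by (intro sum.cong refl) (simp add: compositions_add prod_sum_PiE)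
 also have "... = (\<Sum>(Z, Z1)\<in>(SIGMA Z:tables m n u v. ?B Z). \<Prod>e\<in>idx m n. real (compositions K (Z1 e)) * real (compositions K (Z e - Z1 e)))"
  by (rule sum.Sigma) (auto intro: finite_PiE)
 also have "... <= (\<Sum>(p, Z1, Z2)\<in>(SIGMA p:submargins m n u v. ?T p). ?c Z1 * ?c Z2)"
 proof (rule sum_le_included[where i = "%(p, Z1, Z2). (\<lambda>e\<in>idx m n. Z1 e + Z2 e, Z1)"])
  show "finite (SIGMA Z:tables m n u v. ?B Z)" "finite (SIGMA p:submargins m n u v. ?T p)"
   by (auto intro!: finite_SigmaI finite_PiE)
  show "\<forall>y\<in>SIGMA p:submargins m n u v. ?T p. 0 <= (case y of (p, Z1, Z2) => ?c Z1 * ?c Z2)"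
   by (auto intro!: mult_nonneg_nonneg prod_nonneg)
  show "\<forall>x\<in>SIGMA Z:tables m n u v. ?B Z. \<exists>y\<in>SIGMA p:submargins m n u v. ?T p.
   (case y of (p, Z1, Z2) => (\<lambda>e\<in>idx m n. Z1 e + Z2 e, Z1)) = x \<and>
   (case x of (Z, Z1) => \<Prod>e\<in>idx m n. real (compositions K (Z1 e)) * real (compositions K (Z e - Z1 e))) <= (case y of (p, Z1, Z2) => ?c Z1 * ?c Z2)"
  proof clarify
   fix Z Z1 assume Z: "Z \<in> tables m n u v" and Z1: "Z1 \<in> ?B Z"
   define Z2 where "Z2 = (\<lambda>e\<in>idx m n. Z e - Z1 e)"
   define p where "p = ((\<lambda>i\<in>{..<m}. \<Sum>j<n. Z1 (i, j)), (\<lambda>j\<in>{..<n}. \<Sum>i<m. Z1 (i, j)))"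
   have le: "Z1 e <= Z e" if "e \<in> idx m n" for e using Z1 that by (auto simp only: PiE_def Pi_def)
   have rows: "(\<Sum>j<n. Z1 (i, j)) <= u i" "(\<Sum>j<n. Z (i, j) - Z1 (i, j)) = u i - (\<Sum>j<n. Z1 (i, j))" if "i < m" for i
   proof -
    have "(\<Sum>j<n. Z1 (i, j)) <= (\<Sum>j<n. Z (i, j))" using le that by (intro sum_mono) (auto simp: idx_iff)
    then show "(\<Sum>j<n. Z1 (i, j)) <= u i" using Z that by (simp add: tables_def)
    show "(\<Sum>j<n. Z (i, j) - Z1 (i, j)) = u i - (\<Sum>j<n. Z1 (i, j))"
     using Z that le by (subst sum_subtractf_nat) (auto simp: tables_def idx_iff)
   qed
   have cols: "(\<Sum>i<m. Z1 (i, j)) <= v j" "(\<Sum>i<m. Z (i, j) - Z1 (i, j)) = v j - (\<Sum>i<m. Z1 (i, j))" if "j < n" for j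
   proof -
    have "(\<Sum>i<m. Z1 (i, j)) <= (\<Sum>i<m. Z (i, j))" using le that by (intro sum_mono) (auto simp: idx_iff)
    then show "(\<Sum>i<m. Z1 (i, j)) <= v j" using Z that by (simp add: tables_def)
    show "(\<Sum>i<m. Z (i, j) - Z1 (i, j)) = v j - (\<Sum>i<m. Z1 (i, j))"
     using Z that le by (subst sum_subtractf_nat) (auto simp: tables_def idx_iff)
   qed
   have "p \<in> submargins m n u v" using rows cols by (auto simp: p_def submargins_def)
   moreover have "Z1 \<in> tables m n (fst p) (snd p)" using Z1 by (auto simp: tables_def p_def PiE_def)
   moreover have "Z2 \<in> tables m n (%i. u i - fst p i) (%j. v j - snd p j)"
    using rows cols by (auto simp: tables_def p_def Z2_def idx_iff)
   moreover have "(\<lambda>e\<in>idx m n. Z1 e + Z2 e) = Z"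
    using Z le by (auto simp: Z2_def tables_def PiE_def extensional_def fun_eq_iff simp del: split_paired_All)
   moreover have "(\<Prod>e\<in>idx m n. real (compositions K (Z1 e)) * real (compositions K (Z e - Z1 e))) = ?c Z1 * ?c Z2"
    by (simp add: prod.distrib Z2_def)
   ultimately show "\<exists>y\<in>SIGMA p:submargins m n u v. ?T p.
    (case y of (p, Z1, Z2) => (\<lambda>e\<in>idx m n. Z1 e + Z2 e, Z1)) = (Z, Z1) \<and>
    (\<Prod>e\<in>idx m n. real (compositions K (Z1 e)) * real (compositions K (Z e - Z1 e))) <= (case y of (p, Z1, Z2) => ?c Z1 * ?c Z2)"
    by (intro bexI[of _ "(p, Z1, Z2)"]) auto
  qed
 qed
 also have "... = (\<Sum>p\<in>submargins m n u v. \<Sum>(Z1, Z2)\<in>?T p. ?c Z1 * ?c Z2)"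
  by (subst sum.Sigma) (auto simp: case_prod_beta')
 also have "... = (\<Sum>p\<in>submargins m n u v. weighted_tables K m n (fst p) (snd p) * weighted_tables K m n (%i. u i - fst p i) (%j. v j - snd p j))"
  unfolding weighted_tables_def by (simp add: sum_product sum.cartesian_product)
 finally show ?thesis .
qed

lemma cap_int_cong:
 assumes "!!i. i < m ==> u i = u' i" "!!j. j < n ==> v j = v' j"
 shows "cap_int m n u v = cap_int m n u' v'"
proof -
 have "cap_exp m n u v = cap_exp m n u' v'" using assms by (auto simp: cap_exp_def fun_eq_iff)
 then show ?thesis by (simp add: cap_int_def cap_fun_def)
qed

lemma weighted_tables_nonneg: "0 <= weighted_tables K m n u v"
 by (auto simp: weighted_tables_def intro!: sum_nonneg prod_nonneg)

text \<open>Each halving chooses among at most \<open>B\<close> pairs of margins, and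
  \<open>2 ^ p - 1\<close> halvings reduce a tuple to single tables. The normalised margins of the
  two halves average to those of the whole, so \<open>cap_int_midpoint\<close> recombines the
  factors.\<close>

lemma weighted_tables_le:
 assumes "card (submargins m n u v) <= B"
 shows "ennreal (weighted_tables (2 ^ p) m n u v) <=
  ennreal (B ^ (2 ^ p - 1)) * cap_int m n (%i. u i / 2 ^ p) (%j. v j / 2 ^ p) ^ (2 ^ p)"
 using assms
proof (induction p arbitrary: u v)
 case 0
 have "weighted_tables 1 m n u v = num_tables m n u v"
  by (simp add: weighted_tables_def compositions_def num_tables_def)
 then show ?case using num_tables_le_cap_int[of m n u v] by simp
next
 case (Suc p)
 let ?K = "2 ^ p :: nat"
 let ?I = "cap_int m n (%i. u i / 2 ^ Suc p) (%j. v j / 2 ^ Suc p)"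
 let ?W = "%q. weighted_tables ?K m n (fst q) (snd q) * weighted_tables ?K m n (%i. u i - fst q i) (%j. v j - snd q j)"
 have "ennreal (weighted_tables (2 ^ Suc p) m n u v) <= ennreal (\<Sum>q\<in>submargins m n u v. ?W q)"
  using weighted_tables_double[of ?K m n u v] by (intro ennreal_leI) (simp add: mult_2)
 also have "... = (\<Sum>q\<in>submargins m n u v. ennreal (?W q))"
  by (intro sum_ennreal[symmetric] mult_nonneg_nonneg weighted_tables_nonneg)
 also have "... <= (\<Sum>q\<in>submargins m n u v. ennreal (B ^ (?K - 1)) * ennreal (B ^ (?K - 1)) * (?I\<^sup>2) ^ ?K)"
 proof (rule sum_mono)
  fix q assume q: "q \<in> submargins m n u v"
  let ?u = "fst q" and ?v = "snd q"
  have le: "i < m ==> ?u i <= u i" "j < n ==> ?v j <= v j" for i j using q by (auto simp: submargins_def)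
  have "card (submargins m n ?u ?v) <= card (submargins m n u v)" "card (submargins m n (%i. u i - ?u i) (%j. v j - ?v j)) <= card (submargins m n u v)"
   unfolding card_submargins using le by (auto intro!: mult_mono prod_mono)
  then have B: "card (submargins m n ?u ?v) <= B" "card (submargins m n (%i. u i - ?u i) (%j. v j - ?v j)) <= B" using Suc.prems by auto
  let ?I1 = "cap_int m n (%i. ?u i / 2 ^ p) (%j. ?v j / 2 ^ p)"
  let ?I2 = "cap_int m n (%i. real (u i - ?u i) / 2 ^ p) (%j. real (v j - ?v j) / 2 ^ p)"
  have "?I1 * ?I2 <= (cap_int m n (%i. (?u i / 2 ^ p + real (u i - ?u i) / 2 ^ p) / 2) (%j. (?v j / 2 ^ p + real (v j - ?v j) / 2 ^ p) / 2))\<^sup>2"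
   by (rule cap_int_midpoint)
  also have "cap_int m n (%i. (?u i / 2 ^ p + real (u i - ?u i) / 2 ^ p) / 2) (%j. (?v j / 2 ^ p + real (v j - ?v j) / 2 ^ p) / 2) = ?I"
   using le by (intro cap_int_cong) (auto simp: of_nat_diff add_divide_distrib[symmetric])
  finally have I: "?I1 * ?I2 <= ?I\<^sup>2" .
  have "ennreal (?W q) = ennreal (weighted_tables ?K m n ?u ?v) * ennreal (weighted_tables ?K m n (%i. u i - ?u i) (%j. v j - ?v j))"
   by (intro ennreal_mult weighted_tables_nonneg)
  also have "... <= (ennreal (B ^ (?K - 1)) * ?I1 ^ ?K) * (ennreal (B ^ (?K - 1)) * ?I2 ^ ?K)"
   using Suc.IH[OF B(1)] Suc.IH[OF B(2)] by (intro mult_mono) auto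
  also have "... = ennreal (B ^ (?K - 1)) * ennreal (B ^ (?K - 1)) * (?I1 * ?I2) ^ ?K"
   by (simp only: power_mult_distrib mult_ac)
  also have "... <= ennreal (B ^ (?K - 1)) * ennreal (B ^ (?K - 1)) * (?I\<^sup>2) ^ ?K"
   by (intro mult_left_mono power_mono I) auto
  finally show "ennreal (?W q) <= ennreal (B ^ (?K - 1)) * ennreal (B ^ (?K - 1)) * (?I\<^sup>2) ^ ?K" .
 qed
 also have "... = ennreal (card (submargins m n u v)) * (ennreal (B ^ (?K - 1)) * ennreal (B ^ (?K - 1)) * (?I\<^sup>2) ^ ?K)"
  by (simp add: ennreal_of_nat_eq_real_of_nat)
 also have "... <= ennreal B * (ennreal (B ^ (?K - 1)) * ennreal (B ^ (?K - 1)) * (?I\<^sup>2) ^ ?K)"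
  using Suc.prems by (intro mult_right_mono ennreal_leI) auto
 also have "... = (ennreal B * ennreal (B ^ (?K - 1)) * ennreal (B ^ (?K - 1))) * ?I ^ (2 ^ Suc p)"
  by (simp only: mult_ac power_mult[symmetric] power_Suc)
 also have "ennreal B * ennreal (B ^ (?K - 1)) * ennreal (B ^ (?K - 1)) = ennreal (B ^ (2 ^ Suc p - 1))"
 proof -
  have "1 + (?K - 1) + (?K - 1) = 2 ^ Suc p - 1" using one_le_power[of "2::nat" p] by simp
  then have "B * B ^ (?K - 1) * B ^ (?K - 1) = B ^ (2 ^ Suc p - 1)" by (metis power_add power_one_right)
  then show ?thesis by (simp add: ennreal_mult[symmetric] flip: of_nat_mult of_nat_power)
 qed
 finally show ?case by (simp only: of_nat_power)
qed

text \<open>The weight of a single rounding of \<open>K X\<close> already has logarithm about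
  \<open>K\<close> times the entropy. On the other side the \<open>K\<close>-th root of the count of
  tuples is at most the number \<open>B\<close> of margin splittings times the capacity integral;
  both \<open>ln B\<close> and the logarithmic loss of \<open>cap_int_le_num_tables\<close> are O((m
  + n) ln N).\<close>

theorem entropy_le_num_tables:
 assumes mar: "margins m n R C" and X: "X \<in> transport_polytope m n R C" "!!e. e \<in> idx m n ==> 0 < X e"
 shows "entropy_g m n X <= ln (num_tables m n R C) + real (m + n) * (10 + 9 * ln (total m R))"
proof -
 let ?N = "total m R"
 let ?L = "ln (real ?N)"
 note mp = margins_pos[OF mar]
 have N: "real ?N \<ge> 1" using mp by simp
 have L: "?L \<ge> 0" using N by simp
 have mN: "m <= ?N" "n <= ?N"
 proof -
  have "(\<Sum>i<m. 1) <= total m R" "(\<Sum>j<n. 1) <= total n C" unfolding total_def using mar by (intro sum_mono; force simp: margins_def)+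
  then show "m <= ?N" "n <= ?N" using mp by auto
 qed
 obtain p where p: "?N\<^sup>2 <= 2 ^ p" "2 ^ p <= 2 * ?N\<^sup>2"
 proof -
  define p where "p = (LEAST p. ?N\<^sup>2 <= 2 ^ p)"
  have ex: "?N\<^sup>2 <= 2 ^ (?N\<^sup>2)" by (rule less_imp_le[OF less_exp])
  have 1: "?N\<^sup>2 <= 2 ^ p" unfolding p_def by (rule LeastI[of _ "?N\<^sup>2"]) (rule ex)
  have 2: "2 ^ p <= 2 * ?N\<^sup>2"
  proof (cases p)
   case 0
   then show ?thesis using N by (simp add: Suc_le_eq)
  next
   case (Suc q)
   then have "\<not> ?N\<^sup>2 <= 2 ^ q" using not_less_Least[of q "%p. ?N\<^sup>2 <= 2 ^ p"] by (simp add: p_def)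
   then show ?thesis using Suc by simp
  qed
  show ?thesis using that 1 2 by blast
 qed
 define K :: nat where "K = 2 ^ p"
 have K: "K > 0" "?N\<^sup>2 <= K" "K <= 2 * ?N\<^sup>2" using p by (auto simp: K_def)
 have sumR: "(\<Sum>j<n. X (i, j)) = R i" if "i < m" for i using X that by (auto simp: in_polytope has_margins_def)
 have sumC: "(\<Sum>i<m. X (i, j)) = C j" if "j < n" for j using X that by (auto simp: in_polytope has_margins_def)
 have XN: "X e <= ?N" if "e \<in> idx m n" for e
 proof -
  have "X e <= (sum X (idx m n))" using that X(2) by (intro member_le_sum) (auto simp: less_imp_le[OF X(2)])
  also have "... = ?N" using sumR by (simp add: sum_idx total_def)
  finally show ?thesis .
 qed
 define F where "F e = nat \<lfloor>real K * X e\<rfloor>" for e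
 have F: "real (F e) <= K * X e" "K * X e < F e + 1" if "e \<in> idx m n" for e
  using X(2)[OF that] K(1) by (auto simp: F_def mult_nonneg_nonneg less_imp_le) linarith+
 have Frow: "(\<Sum>j<n. F (i, j)) <= K * R i" if "i < m" for i
 proof -
  have "real (\<Sum>j<n. F (i, j)) <= (\<Sum>j<n. K * X (i, j))" unfolding of_nat_sum using F(1) that by (intro sum_mono) (auto simp: idx_iff)
  also have "... = real (K * R i)" using sumR[OF that] by (simp add: sum_distrib_left[symmetric])
  finally show ?thesis by linarith
 qed
 have Fcol: "(\<Sum>i<m. F (i, j)) <= K * C j" if "j < n" for j
 proof -
  have "real (\<Sum>i<m. F (i, j)) <= (\<Sum>i<m. K * X (i, j))" unfolding of_nat_sum using F(1) that by (intro sum_mono) (auto simp: idx_iff)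
  also have "... = real (K * C j)" using sumC[OF that] by (simp add: sum_distrib_left[symmetric])
  finally show ?thesis by linarith
 qed
 \<comment> \<open>Rounding down leaves margins with equal totals; any table \<open>E\<close> with
   these margins completes \<open>F\<close>, and larger entries only increase the weight.\<close>
 have "tables m n (%i. K * R i - (\<Sum>j<n. F (i, j))) (%j. K * C j - (\<Sum>i<m. F (i, j))) \<noteq> {}"
 proof (rule tables_nonempty)
  have "total m (%i. K * R i - (\<Sum>j<n. F (i, j))) = K * total m R - (\<Sum>i<m. \<Sum>j<n. F (i, j))"
   unfolding total_def using Frow by (subst sum_subtractf_nat) (auto simp: sum_distrib_left)
  also have "... = K * total n C - (\<Sum>j<n. \<Sum>i<m. F (i, j))" unfolding mp(4) by (subst sum.swap) (rule refl)
  also have "... = total n (%j. K * C j - (\<Sum>i<m. F (i, j)))"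
   unfolding total_def using Fcol by (subst sum_subtractf_nat) (auto simp: sum_distrib_left)
  finally show "total m (%i. K * R i - (\<Sum>j<n. F (i, j))) = total n (%j. K * C j - (\<Sum>i<m. F (i, j)))" .
 qed
 then obtain E where E: "E \<in> tables m n (%i. K * R i - (\<Sum>j<n. F (i, j))) (%j. K * C j - (\<Sum>i<m. F (i, j)))" by auto
 define Z where "Z = (\<lambda>e\<in>idx m n. F e + E e)"
 have Z: "Z \<in> tables m n (%i. K * R i) (%j. K * C j)"
  using E Frow Fcol by (auto simp: tables_def Z_def idx_iff sum.distrib)
 let ?P = "\<Prod>e\<in>idx m n. real (compositions K (F e))"
 have Ppos: "?P > 0" using compositions_pos[OF K(1)] by (intro prod_pos) auto
 define B where "B = card (submargins m n (%i. K * R i) (%j. K * C j))"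
 have Bpos: "B > 0" unfolding B_def card_submargins by simp
 let ?M = "exp 3 * (exp 1 * real ?N) ^ (m + n) * real (num_tables m n R C)"
 have T: "num_tables m n R C > 0" by (rule num_tables_pos[OF mp(4)])
 have Mpos: "?M > 0" using T N by simp
 have "?P <= (\<Prod>e\<in>idx m n. real (compositions K (Z e)))"
  using compositions_mono[OF K(1)] by (intro prod_mono) (auto simp: Z_def)
 also have "... <= weighted_tables K m n (%i. K * R i) (%j. K * C j)"
  unfolding weighted_tables_def using Z by (intro member_le_sum prod_nonneg) auto
 finally have "ennreal ?P <= ennreal (weighted_tables K m n (%i. K * R i) (%j. K * C j))" by (rule ennreal_leI)
 also have "... <= ennreal (B ^ (K - 1)) * cap_int m n (%i. real (K * R i) / K) (%j. real (K * C j) / K) ^ K"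
  using weighted_tables_le[of m n "%i. K * R i" "%j. K * C j" B p] by (simp add: B_def K_def)
 also have "cap_int m n (%i. real (K * R i) / K) (%j. real (K * C j) / K) = cap_int m n (%i. R i) (%j. C j)"
  using K(1) by (intro cap_int_cong) auto
 also have "ennreal (B ^ (K - 1)) * cap_int m n (%i. R i) (%j. C j) ^ K <= ennreal (B ^ (K - 1)) * ennreal ?M ^ K"
  by (intro mult_left_mono power_mono cap_int_le_num_tables[OF mar]) auto
 also have "... = ennreal (B ^ (K - 1) * ?M ^ K)"
  using Mpos by (subst ennreal_power, simp, subst ennreal_mult) auto
 finally have PK: "?P <= B ^ (K - 1) * ?M ^ K" using Mpos by (subst (asm) ennreal_le_iff) auto
 also have "... <= B ^ K * ?M ^ K" using Bpos Mpos by (intro mult_right_mono of_nat_mono power_increasing) auto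
 finally have "ln ?P <= ln (real (B ^ K) * ?M ^ K)" using Ppos by (subst ln_le_cancel_iff) (auto intro: less_le_trans)
 also have "... = K * (ln B + ln ?M)" using Bpos Mpos by (simp add: ln_mult_pos ln_realpow distrib_left)
 also have "ln ?M = 3 + real (m + n) * (1 + ?L) + ln (num_tables m n R C)"
  using T N by (simp add: ln_mult_pos ln_realpow)
 finally have A: "ln ?P <= K * (ln B + (3 + real (m + n) * (1 + ?L) + ln (num_tables m n R C)))" .
 have N3: "real (K * ?N + K + 1) <= 6 * real ?N ^ 3" "real (K * ?N + 1) <= 6 * real ?N ^ 3"
 proof -
  have a: "1 <= ?N ^ 3" "?N\<^sup>2 <= ?N ^ 3" using mp(1) by (auto simp: Suc_le_eq power_increasing)
  have "K * ?N <= 2 * ?N\<^sup>2 * ?N" using K by (intro mult_right_mono) auto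
  then have b: "K * ?N <= 2 * ?N ^ 3" by (simp add: power3_eq_cube power2_eq_square)
  have "K * ?N + K + 1 <= 6 * ?N ^ 3" "K * ?N + 1 <= 6 * ?N ^ 3" using a b K by linarith+
  then have "real (K * ?N + K + 1) <= real (6 * ?N ^ 3)" "real (K * ?N + 1) <= real (6 * ?N ^ 3)" by (simp_all only: of_nat_le_iff)
  then show "real (K * ?N + K + 1) <= 6 * real ?N ^ 3" "real (K * ?N + 1) <= 6 * real ?N ^ 3" by simp_all
 qed
 have ln6: "ln (6 * real ?N ^ 3) <= 2 + 3 * ?L"
 proof -
  have "(5 / 2)\<^sup>2 <= (exp (1 :: real))\<^sup>2" using exp_lower_Taylor_quadratic[of 1] by (intro power_mono) auto
  then have "6 <= exp (2 :: real)" by (simp add: power2_eq_square exp_add[symmetric])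
  then have "ln 6 <= (2 :: real)" by (metis exp_gt_zero exp_ln ln_exp ln_le_cancel_iff zero_less_numeral)
  then show ?thesis using N by (simp add: ln_mult_pos ln_realpow)
 qed
 have lnB: "ln B <= real (m + n) * (2 + 3 * ?L)"
 proof -
  have "R i <= ?N" if "i < m" for i unfolding total_def using that by (intro member_le_sum) auto
  moreover have "C j <= total n C" if "j < n" for j unfolding total_def using that by (intro member_le_sum) auto
  then have "C j <= ?N" if "j < n" for j using that mp(4) by simp
  ultimately have "B <= (\<Prod>i<m. K * ?N + 1) * (\<Prod>j<n. K * ?N + 1)"
   unfolding B_def card_submargins by (intro mult_mono prod_mono) auto
  also have "... = (K * ?N + 1) ^ (m + n)" by (simp add: power_add)
  finally have "real B <= real (K * ?N + 1) ^ (m + n)" by (metis of_nat_le_iff of_nat_power)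
  also have "... <= (6 * real ?N ^ 3) ^ (m + n)" using N3 by (intro power_mono) auto
  finally have "ln B <= ln ((6 * real ?N ^ 3) ^ (m + n))" using Bpos by (subst ln_le_cancel_iff) (auto intro: less_le_trans)
  also have "... = real (m + n) * ln (6 * real ?N ^ 3)" by (rule ln_realpow)
  also have "... <= real (m + n) * (2 + 3 * ?L)" by (intro mult_left_mono ln6) auto
  finally show ?thesis .
 qed
 have "K * entropy_g m n X = (\<Sum>e\<in>idx m n. (K * X e + K) * ln (K * X e + K) - K * X e * ln (K * X e) - K * ln K)"
  unfolding entropy_g_def sum_distrib_left
 proof (rule sum.cong[OF refl])
  fix e assume "e \<in> idx m n"
  then have x: "0 < X e" by (rule X(2))
  have "ln (K * X e + K) = ln K + ln (X e + 1)" using x K ln_mult_pos[of K "X e + 1"] by (simp add: distrib_left)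
  moreover have "ln (K * X e) = ln K + ln (X e)" using x K by (simp add: ln_mult_pos)
  ultimately show "K * ((X e + 1) * ln (X e + 1) - X e * ln (X e)) = (K * X e + K) * ln (K * X e + K) - K * X e * ln (K * X e) - K * ln K"
   by (simp add: algebra_simps)
 qed
 also have "... <= (\<Sum>e\<in>idx m n. ln (compositions K (F e)) + (10 + 9 * ?L))"
 proof (rule sum_mono)
  fix e assume e: "e \<in> idx m n"
  have "(K * X e + K) * ln (K * X e + K) - K * X e * ln (K * X e) - K * ln K <= ln (compositions K (F e)) + 4 + 3 * ln (F e + K + 1)"
   using F[OF e] X(2)[OF e] K by (intro ln_compositions_ge) auto
  moreover have "ln (F e + K + 1) <= 2 + 3 * ?L"
  proof -
   have "real (F e) <= K * ?N" using order_trans[OF F(1)[OF e] mult_left_mono[OF XN[OF e]]] by simp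
   then have "real (F e + K + 1) <= 6 * real ?N ^ 3" using N3(1) by simp
   then have "ln (F e + K + 1) <= ln (6 * real ?N ^ 3)" using N by (subst ln_le_cancel_iff) auto
   then show ?thesis using ln6 by simp
  qed
  ultimately show "(K * X e + K) * ln (K * X e + K) - K * X e * ln (K * X e) - K * ln K <= ln (compositions K (F e)) + (10 + 9 * ?L)"
   by simp
 qed
 also have "... = ln ?P + real (m * n) * (10 + 9 * ?L)"
 proof -
  have "(\<Sum>e\<in>idx m n. ln (compositions K (F e))) = ln ?P"
   using compositions_pos[OF K(1)] by (subst ln_prod) (simp_all add: less_imp_neq[symmetric])
  then show ?thesis by (simp add: sum.distrib)
 qed
 \<comment> \<open>Here \<open>K\<close> has to be at least the square of the total: then the
   rounding errors of all entries are paid for by a single term after division by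
   \<open>K\<close>.\<close>
 also have "real (m * n) * (10 + 9 * ?L) <= K * (10 + 9 * ?L)"
 proof -
  have "m * n <= ?N * ?N" using mN by (intro mult_mono) auto
  then have "m * n <= K" using K by (simp add: power2_eq_square)
  then have "real (m * n) <= real K" by (simp only: of_nat_le_iff)
  then show ?thesis using L by (intro mult_right_mono) simp_all
 qed
 also note A
 finally have "K * entropy_g m n X <= K * (ln B + (3 + real (m + n) * (1 + ?L) + ln (num_tables m n R C)) + (10 + 9 * ?L))"
  by (simp add: distrib_left)
 then have "entropy_g m n X <= ln B + (3 + real (m + n) * (1 + ?L) + ln (num_tables m n R C)) + (10 + 9 * ?L)"
  using K by simp
 also have "... <= real (m + n) * (2 + 3 * ?L) + real (m + n) * (1 + ?L) + ln (num_tables m n R C) + (13 + 9 * ?L)"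
  using lnB by simp
 also have "13 + 9 * ?L <= 2 * (7 + 5 * ?L)" using L by simp
 also have "2 * (7 + 5 * ?L) <= real (m + n) * (7 + 5 * ?L)" using mp L by (intro mult_right_mono) auto
 finally show ?thesis by (simp add: algebra_simps)
qed

section \<open>Comparison of the density with independent exponential variables\<close>

lemma psi_eq:
 assumes "X \<in> positive_mats m n"
 shows "psi m n R C X = table_poly m n R C X * exp (- (sum X (idx m n))) / num_tables m n R C"
 using assms unfolding psi_def table_poly_def prod.distrib
 by (simp add: exp_sum sum_negf[symmetric] sum_distrib_right)

declare measurable_entry [measurable del]

text \<open>The expectation of \<open>F\<close> at a standard exponential variable.\<close>

definition exp_mean :: "(real => ennreal) => ennreal" where
 "exp_mean F = (\<integral>\<^sup>+x. indicator {0<..} x * (F x * ennreal (exp (- x))) \<partial>lborel)"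

lemma exp_mean_1: "exp_mean (%_. 1) = 1"
proof -
 have "exp_mean (%_. 1) = (\<integral>\<^sup>+x. ennreal (erlang_density 0 1 x) \<partial>lborel)"
  unfolding exp_mean_def using AE_lborel_singleton[of 0]
  by (intro nn_integral_cong_AE, eventually_elim) (auto simp: erlang_density_def split: split_indicator)
 then show ?thesis using nn_integral_erlang_ith_moment[of 1 0 0] by simp
qed

lemma exp_mean_scaled:
 assumes [measurable]: "F \<in> borel_measurable borel" and t: "0 < t"
 shows "(\<integral>\<^sup>+x. indicator {0<..} x * (F (x / t) * ennreal (exp (- x / t) / t)) \<partial>lborel) = exp_mean F"
proof -
 have "(\<integral>\<^sup>+x. indicator {0<..} x * (F (x / t) * ennreal (exp (- x / t) / t)) \<partial>lborel) =
  ennreal \<bar>t\<bar> * (\<integral>\<^sup>+x. indicator {0<..} (0 + t * x) * (F ((0 + t * x) / t) * ennreal (exp (- (0 + t * x) / t) / t)) \<partial>lborel)"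
  using t by (intro nn_integral_real_affine) auto
 also have "... = (\<integral>\<^sup>+x. ennreal \<bar>t\<bar> * (indicator {0<..} (0 + t * x) * (F ((0 + t * x) / t) * ennreal (exp (- (0 + t * x) / t) / t))) \<partial>lborel)"
  by (rule nn_integral_cmult[symmetric]) measurable
 also have "... = exp_mean F"
  unfolding exp_mean_def
 proof (rule nn_integral_cong)
  fix x :: real
  have "ennreal t * ennreal (exp (- x) / t) = ennreal (exp (- x))" using t by (simp add: ennreal_mult[symmetric])
  then show "ennreal \<bar>t\<bar> * (indicator {0<..} (0 + t * x) * (F ((0 + t * x) / t) * ennreal (exp (- (0 + t * x) / t) / t))) = indicator {0<..} x * (F x * ennreal (exp (- x)))"
   using t by (simp add: mult.left_commute[of "ennreal t" "F x"] zero_less_mult_iff split: split_indicator)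
 qed
 finally show ?thesis .
qed

lemma exp_mean_exp_half: "exp_mean (%x. ennreal (exp (x / 2))) = 2"
proof -
 have "exp_mean (%x. ennreal (exp (x / 2))) = (\<integral>\<^sup>+x. ennreal 2 * (indicator {0<..} x * (1 * ennreal (exp (- x / 2) / 2))) \<partial>lborel)"
  unfolding exp_mean_def
 proof (rule nn_integral_cong)
  fix x :: real
  have "ennreal (exp (x / 2)) * ennreal (exp (- x)) = ennreal 2 * ennreal (exp (- x / 2) / 2)"
   by (simp add: ennreal_mult[symmetric] exp_add[symmetric] del: ennreal_numeral)
  then show "indicator {0<..} x * (ennreal (exp (x / 2)) * ennreal (exp (- x))) = ennreal 2 * (indicator {0<..} x * (1 * ennreal (exp (- x / 2) / 2)))"
   by (simp only: mult_ac mult_1_left mult_1_right)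
 qed
 also have "... = ennreal 2 * (\<integral>\<^sup>+x. indicator {0<..} x * (1 * ennreal (exp (- x / 2) / 2)) \<partial>lborel)"
  by (rule nn_integral_cmult) measurable
 also have "... = 2" using exp_mean_scaled[of "%_. 1" 2] exp_mean_1 by simp
 finally show ?thesis .
qed

text \<open>Comparison with \<open>1 + x powr (- (1 / 2))\<close>: the bound 3 is 1 plus an upper
  bound for \<open>Gamma (1 / 2)\<close>. The limit on the exponent reappears as the condition on
  the weights in \<open>psi_bad_lines\<close>.\<close>

lemma exp_mean_powr:
 assumes c: "0 <= c" "c <= 1 / 2"
 shows "exp_mean (%x. ennreal (x powr (- c))) <= 3"
proof -
 have "exp_mean (%x. ennreal (x powr (- c))) <= (\<integral>\<^sup>+x. indicator {0<..} x * (1 * ennreal (exp (- x))) + indicator {0..} x * ennreal (x powr (1 / 2 - 1) / exp x) \<partial>lborel)"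
  unfolding exp_mean_def
 proof (rule nn_integral_mono)
  fix x :: real
  have "x powr (- c) <= 1 + x powr (- (1 / 2))" if "x > 0"
  proof (cases "x \<ge> 1")
   case True
   then have "x powr (- c) <= x powr 0" using c by (intro powr_mono) auto
   then have "x powr (- c) <= 1" using that by simp
   then show ?thesis by (simp add: add_increasing2)
  next
   case False
   have "x powr (- c) <= x powr (- (1 / 2))" using False that c by (intro powr_mono') auto
   then show ?thesis by simp
  qed
  then have "x > 0 ==> x powr (- c) * exp (- x) <= (1 + x powr (- (1 / 2))) * exp (- x)" by (intro mult_right_mono) auto
  then show "indicator {0<..} x * (ennreal (x powr (- c)) * ennreal (exp (- x))) <= indicator {0<..} x * (1 * ennreal (exp (- x))) + indicator {0..} x * ennreal (x powr (1 / 2 - 1) / exp x)"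
   by (auto simp: ennreal_mult[symmetric] exp_minus field_simps ennreal_leI simp flip: ennreal_plus split: split_indicator)
 qed
 also have "... = exp_mean (%_. 1) + (\<integral>\<^sup>+x. indicator {0..} x * ennreal (x powr (1 / 2 - 1) / exp x) \<partial>lborel)"
  unfolding exp_mean_def by (rule nn_integral_add) auto
 also have "(\<integral>\<^sup>+x. indicator {0..} x * ennreal (x powr (1 / 2 - 1) / exp x) \<partial>lborel) = (\<integral>\<^sup>+x. ennreal (indicator {0..} x * (x powr (1 / 2 - 1) / exp x)) \<partial>lborel)"
  by (intro nn_integral_cong) (auto split: split_indicator)
 also have "... = ennreal (Gamma (1 / 2))"
  using nn_integral_has_integral_lebesgue[OF _ Gamma_integral_real[of "1 / 2"]] by simp
 also have "... <= ennreal 2"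
 proof (rule ennreal_leI)
  have "sqrt pi <= sqrt 4" using pi_less_4 by (intro real_sqrt_le_mono) simp
  then show "Gamma (1 / 2) <= (2 :: real)" by (simp add: Gamma_one_half_real)
 qed
 finally show ?thesis unfolding exp_mean_1 by (simp add: add_left_mono order_trans)
qed

declare measurable_entry [measurable]

lemma prod_mono_ennreal:
 fixes f g :: "'a => ennreal"
 assumes "!!i. i \<in> A ==> f i <= g i"
 shows "prod f A <= prod g A"
 using assms by (induction A rule: infinite_finite_induct) (auto intro: mult_mono)

context
 fixes m n :: nat and R C :: "nat => nat"
 assumes mar: "margins m n R C"
begin

text \<open>If an entry of the table is geometric with the mean given by the typical table, the
  matching Gamma variable is exponential with this mean.\<close>

definition theta :: "nat \<times> nat => real" where
 "theta e = 1 + typical_table m n R C e"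

definition exp_density :: "mat => real" where
 "exp_density X = (\<Prod>e\<in>idx m n. exp (- X e / theta e) / theta e)"

text \<open>The price of replacing \<open>psi\<close> by the exponential density; by
  \<open>discrepancy_le\<close> it is exp(O((m + n) ln N)).\<close>

definition discrepancy :: real where
 "discrepancy = exp (entropy_g m n (typical_table m n R C)) / num_tables m n R C"

lemma discrepancy_nonneg: "0 <= discrepancy"
 by (simp add: discrepancy_def)

lemma theta_gt_1: "e \<in> idx m n ==> 1 < theta e"
 using typical_table_exists(2)[OF mar] by (simp add: theta_def)

text \<open>The rank-one form of the typical table supplies test weights whose product at
  \<open>e\<close> is \<open>1 - 1 / theta e\<close>. In \<open>table_poly_le_cap_exp\<close> they
  leave exactly the exponential density of means \<open>theta\<close>, and the margin terms become
  the entropy.\<close>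

lemma psi_le:
 assumes X: "!!e. e \<in> idx m n ==> 0 < X e"
 shows "psi m n R C X <= discrepancy * exp_density X"
proof (cases "X \<in> positive_mats m n")
 case True
 let ?x = "typical_table m n R C"
 note T = typical_table_exists[OF mar]
 obtain a b where ab: "!!i j. i < m ==> j < n ==> ln (?x (i, j) + 1) - ln (?x (i, j)) = a i + b j"
  using T(3) by blast
 let ?A = "%i. exp (- a i)" and ?B = "%j. exp (- b j)"
 have lq: "a (fst e) + b (snd e) = ln (?x e + 1) - ln (?x e)" if "e \<in> idx m n" for e
  using ab[of "fst e" "snd e"] that by (auto simp: idx_def)
 have q: "?A (fst e) * ?B (snd e) = 1 - 1 / theta e" if e: "e \<in> idx m n" for e
 proof -
  have x: "0 < ?x e" using T(2)[OF e] .
  have "?A (fst e) * ?B (snd e) = exp (ln (?x e) - ln (?x e + 1))" using lq[OF e] by (simp flip: exp_add)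
  also have "... = ?x e / (?x e + 1)" using x by (simp add: exp_diff)
  also have "... = 1 - 1 / theta e" using x by (simp add: theta_def field_simps)
  finally show ?thesis .
 qed
 have "table_poly m n R C X <= exp (cap_exp m n (%i. R i) (%j. C j) ?A ?B X)"
  using X by (intro table_poly_le_cap_exp) (auto simp: less_imp_le)
 also have "cap_exp m n (%i. R i) (%j. C j) ?A ?B X = (\<Sum>e\<in>idx m n. X e * (1 - 1 / theta e)) + ((\<Sum>i<m. R i * a i) + (\<Sum>j<n. C j * b j))"
  unfolding cap_exp_def using q by (simp add: sum_negf)
 also have "(\<Sum>i<m. R i * a i) + (\<Sum>j<n. C j * b j) = (\<Sum>e\<in>idx m n. ?x e * (a (fst e) + b (snd e)))"
  using T(1) by (intro sum_margins[symmetric]) (simp add: in_polytope)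
 also have "... = (\<Sum>e\<in>idx m n. ?x e * (ln (?x e + 1) - ln (?x e)))" using lq by simp
 also have "... = entropy_g m n ?x - (\<Sum>e\<in>idx m n. ln (theta e))"
  unfolding entropy_g_def sum_subtractf[symmetric] by (intro sum.cong) (auto simp: theta_def algebra_simps)
 finally have h: "table_poly m n R C X <= exp ((\<Sum>e\<in>idx m n. X e * (1 - 1 / theta e)) + (entropy_g m n ?x - (\<Sum>e\<in>idx m n. ln (theta e))))" .
 have "psi m n R C X = table_poly m n R C X * exp (- (sum X (idx m n))) / num_tables m n R C"
  by (rule psi_eq[OF True])
 also have "... <= exp ((\<Sum>e\<in>idx m n. X e * (1 - 1 / theta e)) + (entropy_g m n ?x - (\<Sum>e\<in>idx m n. ln (theta e)))) * exp (- (sum X (idx m n))) / num_tables m n R C"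
  by (intro divide_right_mono mult_right_mono h) auto
 also have "... = discrepancy * exp (\<Sum>e\<in>idx m n. - X e / theta e - ln (theta e))"
  by (simp add: discrepancy_def right_diff_distrib sum_subtractf sum_negf flip: exp_add)
 also have "exp (\<Sum>e\<in>idx m n. - X e / theta e - ln (theta e)) = exp_density X"
  unfolding exp_density_def exp_sum[OF finite_idx]
  by (rule prod.cong) (use theta_gt_1 in \<open>auto simp: exp_diff dest!: theta_gt_1\<close>)
 finally show ?thesis .
next
 case False
 have "0 <= exp_density X" unfolding exp_density_def using theta_gt_1 by (intro prod_nonneg divide_nonneg_nonneg) force+
 then show ?thesis using False by (simp add: psi_def discrepancy_def)
qed

text \<open>On positive matrices the integrand is a product over the entries, and the substitution
  \<open>x / theta e\<close> reduces each factor to a standard exponential variable.\<close>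

lemma product_expectation:
 assumes [measurable]: "!!e. e \<in> idx m n ==> G e \<in> borel_measurable borel"
 shows "(\<integral>\<^sup>+X. indicator (positive_mats m n) X * ((\<Prod>e\<in>idx m n. G e (X e / theta e)) * ennreal (exp_density X)) \<partial>mat_lebesgue m n)
  = (\<Prod>e\<in>idx m n. exp_mean (G e))"
proof -
 interpret product_sigma_finite "%_::nat \<times> nat. lborel :: real measure" ..
 have "(\<integral>\<^sup>+X. indicator (positive_mats m n) X * ((\<Prod>e\<in>idx m n. G e (X e / theta e)) * ennreal (exp_density X)) \<partial>mat_lebesgue m n)
  = (\<integral>\<^sup>+X. (\<Prod>e\<in>idx m n. indicator {0<..} (X e) * (G e (X e / theta e) * ennreal (exp (- X e / theta e) / theta e))) \<partial>mat_lebesgue m n)"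
 proof (rule nn_integral_cong)
  fix X assume "X \<in> space (mat_lebesgue m n)"
  then have X: "X \<in> extensional (idx m n)" by (simp add: space_mat_lebesgue)
  have d: "ennreal (exp_density X) = (\<Prod>e\<in>idx m n. ennreal (exp (- X e / theta e) / theta e))"
   unfolding exp_density_def using theta_gt_1 by (intro prod_ennreal[symmetric]) force
  show "indicator (positive_mats m n) X * ((\<Prod>e\<in>idx m n. G e (X e / theta e)) * ennreal (exp_density X))
   = (\<Prod>e\<in>idx m n. indicator {0<..} (X e) * (G e (X e / theta e) * ennreal (exp (- X e / theta e) / theta e)))"
  proof (cases "X \<in> positive_mats m n")
   case True
   then have "!!e. e \<in> idx m n ==> 0 < X e" by (simp only: positive_mats_iff)
   then show ?thesis using True unfolding d prod.distrib[symmetric] by simp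
  next
   case False
   then obtain e where "e \<in> idx m n" "\<not> 0 < X e" using X by (auto simp only: positive_mats_iff)
   then show ?thesis using False by (auto intro!: prod_zero[symmetric] bexI[of _ e])
  qed
 qed
 also have "... = (\<Prod>e\<in>idx m n. \<integral>\<^sup>+x. indicator {0<..} x * (G e (x / theta e) * ennreal (exp (- x / theta e) / theta e)) \<partial>lborel)"
  unfolding mat_lebesgue_def by (intro product_nn_integral_prod) auto
 also have "... = (\<Prod>e\<in>idx m n. exp_mean (G e))"
  using theta_gt_1 by (intro prod.cong refl exp_mean_scaled) force+
 finally show ?thesis .
qed

text \<open>Markov's inequality in a form for which bad events need not be described exactly: it suffices that a
 sum of products over the entries is at least 1 on them.\<close>

lemma psi_markov:
 fixes c :: ennreal
 assumes I: "finite I" and G [measurable]: "!!k e. k \<in> I ==> e \<in> idx m n ==> G k e \<in> borel_measurable borel"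
 defines "A \<equiv> {X \<in> positive_mats m n. 1 <= (\<Sum>k\<in>I. c * (\<Prod>e\<in>idx m n. G k e (X e / theta e)))}"
 shows "A \<in> sets (mat_lebesgue m n)"
  and "emeasure (psi_measure m n R C) A <= ennreal discrepancy * (\<Sum>k\<in>I. c * (\<Prod>e\<in>idx m n. exp_mean (G k e)))"
proof -
 let ?L = "mat_lebesgue m n"
 let ?H = "%X. \<Sum>k\<in>I. c * (\<Prod>e\<in>idx m n. G k e (X e / theta e))"
 have G2: "(%X. G k e (X e / theta e)) \<in> borel_measurable ?L" if "k \<in> I" "e \<in> idx m n" for k e
  by (rule measurable_compose[OF _ G[OF that]]) (use that in measurable)
 have P: "(%X. \<Prod>e\<in>idx m n. G k e (X e / theta e)) \<in> borel_measurable ?L" if "k \<in> I" for k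
  using G2[OF that] by (intro borel_measurable_prod_ennreal)
 then have H [measurable]: "?H \<in> borel_measurable ?L"
  by (intro borel_measurable_sum borel_measurable_times_ennreal) auto
 have D [measurable]: "exp_density \<in> borel_measurable ?L" unfolding exp_density_def by measurable
 have "A = positive_mats m n \<inter> {X \<in> space ?L. 1 <= ?H X}"
  unfolding A_def using sets.sets_into_space[OF sets_positive_mats] by auto
 then show A [measurable]: "A \<in> sets ?L" by simp
 have psi [measurable]: "psi m n R C \<in> borel_measurable ?L" unfolding psi_def by measurable
 have dpos: "0 <= discrepancy" by (simp add: discrepancy_def)
 have "emeasure (psi_measure m n R C) A = (\<integral>\<^sup>+X. ennreal (psi m n R C X) * indicator A X \<partial>?L)"
  unfolding psi_measure_def by (intro emeasure_density) auto
 also have "... <= (\<integral>\<^sup>+X. (\<Sum>k\<in>I. (ennreal discrepancy * c) * (indicator (positive_mats m n) X * ((\<Prod>e\<in>idx m n. G k e (X e / theta e)) * ennreal (exp_density X)))) \<partial>?L)"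
 proof (rule nn_integral_mono)
  fix X
  have "ennreal (psi m n R C X) * indicator A X <= ennreal (discrepancy * exp_density X) * (indicator (positive_mats m n) X * ?H X)"
  proof (cases "X \<in> A")
   case True
   then have X: "X \<in> positive_mats m n" "1 <= ?H X" by (auto simp: A_def)
   then have "ennreal (psi m n R C X) * 1 <= ennreal (discrepancy * exp_density X) * ?H X"
    by (intro mult_mono ennreal_leI psi_le) (auto simp only: positive_mats_iff zero_le)
   then show ?thesis using True X by simp
  qed simp
  also have "... = (\<Sum>k\<in>I. (ennreal discrepancy * c) * (indicator (positive_mats m n) X * ((\<Prod>e\<in>idx m n. G k e (X e / theta e)) * ennreal (exp_density X))))"
   unfolding ennreal_mult'[OF dpos] sum_distrib_left by (intro sum.cong refl) (simp only: mult_ac)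
  finally show "ennreal (psi m n R C X) * indicator A X <= ..." .
 qed
 also have "... = (\<Sum>k\<in>I. (ennreal discrepancy * c) * (\<Prod>e\<in>idx m n. exp_mean (G k e)))"
 proof (subst nn_integral_sum)
  show "(%X. (ennreal discrepancy * c) * (indicator (positive_mats m n) X * ((\<Prod>e\<in>idx m n. G k e (X e / theta e)) * ennreal (exp_density X)))) \<in> borel_measurable ?L"
   if "k \<in> I" for k using P[OF that] by measurable
  show "(\<Sum>k\<in>I. \<integral>\<^sup>+X. (ennreal discrepancy * c) * (indicator (positive_mats m n) X * ((\<Prod>e\<in>idx m n. G k e (X e / theta e)) * ennreal (exp_density X))) \<partial>?L)
   = (\<Sum>k\<in>I. (ennreal discrepancy * c) * (\<Prod>e\<in>idx m n. exp_mean (G k e)))"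
  proof (rule sum.cong[OF refl])
   fix k assume k: "k \<in> I"
   have [measurable]: "(%X. \<Prod>e\<in>idx m n. G k e (X e / theta e)) \<in> borel_measurable ?L" by (rule P[OF k])
   show "(\<integral>\<^sup>+X. (ennreal discrepancy * c) * (indicator (positive_mats m n) X * ((\<Prod>e\<in>idx m n. G k e (X e / theta e)) * ennreal (exp_density X))) \<partial>?L)
    = (ennreal discrepancy * c) * (\<Prod>e\<in>idx m n. exp_mean (G k e))"
    by (subst nn_integral_cmult, measurable, subst product_expectation) (use G k in auto)
  qed
 qed
 also have "... = ennreal discrepancy * (\<Sum>k\<in>I. c * (\<Prod>e\<in>idx m n. exp_mean (G k e)))"
  by (simp add: sum_distrib_left mult.assoc)
 finally show "emeasure (psi_measure m n R C) A <= ennreal discrepancy * (\<Sum>k\<in>I. c * (\<Prod>e\<in>idx m n. exp_mean (G k e)))" .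
qed

lemma discrepancy_le: "discrepancy <= exp (real (m + n) * (10 + 9 * ln (total m R)))"
proof -
 have T: "0 < num_tables m n R C" using margins_pos[OF mar] by (intro num_tables_pos)
 have "entropy_g m n (typical_table m n R C) <= ln (num_tables m n R C) + real (m + n) * (10 + 9 * ln (total m R))"
  using typical_table_exists[OF mar] by (intro entropy_le_num_tables[OF mar]) auto
 then have "exp (entropy_g m n (typical_table m n R C)) <= exp (ln (num_tables m n R C) + real (m + n) * (10 + 9 * ln (total m R)))" by simp
 then show ?thesis using T by (simp add: discrepancy_def exp_add divide_le_eq mult.commute)
qed

text \<open>Chernoff bound with exponent \<open>1 / 2\<close>, where the exponential moment of an
  entry is 2: of the gain \<open>exp (- 3 m n)\<close> the moments use up at most
  \<open>exp (m n)\<close>. The measurable superset \<open>B\<close> leaves the events themselves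
  free to be described conveniently.\<close>

lemma psi_sum_large:
 "\<exists>B\<in>sets (mat_lebesgue m n). {X \<in> positive_mats m n. 6 * real (m * n) <= (\<Sum>e\<in>idx m n. X e / theta e)} \<subseteq> B \<and>
  emeasure (psi_measure m n R C) B <= ennreal (discrepancy * exp (- 2 * real (m * n)))"
proof -
 let ?c = "ennreal (exp (- 3 * real (m * n)))"
 let ?B = "{X \<in> positive_mats m n. 1 <= (\<Sum>k\<in>{()}. ?c * (\<Prod>e\<in>idx m n. ennreal (exp (X e / theta e / 2))))}"
 note M = psi_markov[of "{()}" "%_ _ x. ennreal (exp (x / 2))" ?c]
 have "{X \<in> positive_mats m n. 6 * real (m * n) <= (\<Sum>e\<in>idx m n. X e / theta e)} \<subseteq> ?B"
  by (auto simp: prod_ennreal exp_sum[symmetric] ennreal_mult[symmetric] exp_add[symmetric] sum_divide_distrib[symmetric] simp del: divide_divide_eq_left simp flip: ennreal_1)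
 moreover have "emeasure (psi_measure m n R C) ?B <= ennreal discrepancy * (?c * 2 ^ (m * n))"
  using M(2) by (simp add: exp_mean_exp_half)
 moreover have "ennreal discrepancy * (?c * 2 ^ (m * n)) <= ennreal (discrepancy * exp (- 2 * real (m * n)))"
 proof -
  have "2 <= exp (1 :: real)" using exp_ge_add_one_self[of 1] by simp
  then have "2 ^ (m * n) <= exp (1 :: real) ^ (m * n)" by (intro power_mono) auto
  then have "exp (- 3 * real (m * n)) * 2 ^ (m * n) <= exp (- 3 * real (m * n)) * exp 1 ^ (m * n)" by (intro mult_left_mono) auto
  also have "... = exp (- 2 * real (m * n))" by (simp add: exp_of_nat_mult[symmetric] flip: exp_add)
  finally have "?c * ennreal (2 ^ (m * n)) <= ennreal (exp (- 2 * real (m * n)))" by (simp add: ennreal_mult[symmetric] ennreal_leI del: ennreal_power)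
  moreover have "ennreal (2 ^ (m * n)) = 2 ^ (m * n)" by (simp add: ennreal_power[symmetric])
  ultimately show ?thesis by (subst ennreal_mult) (auto intro: mult_left_mono simp: discrepancy_def)
 qed
 ultimately show ?thesis using M(1) by (intro bexI[of _ ?B]) auto
qed

text \<open>Row maxima are handled by a union over all selections of one entry per row: there are
  \<open>n ^ m\<close> selections, each with exponential moment \<open>2 ^ m\<close>.\<close>

lemma psi_row_selection_large:
 "\<exists>B\<in>sets (mat_lebesgue m n). {X \<in> positive_mats m n. \<exists>J\<in>PiE {..<m} (%_. {..<n}). v <= (\<Sum>i<m. X (i, J i) / theta (i, J i))} \<subseteq> B \<and>
  emeasure (psi_measure m n R C) B <= ennreal (discrepancy * (exp (- v / 2) * (2 * real n) ^ m))"
proof -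
 let ?c = "ennreal (exp (- v / 2))" and ?I = "PiE {..<m} (%_. {..<n})"
 let ?G = "%J e x. if snd e = J (fst e) then ennreal (exp (x / 2)) else 1"
 let ?B = "{X \<in> positive_mats m n. 1 <= (\<Sum>J\<in>?I. ?c * (\<Prod>e\<in>idx m n. ?G J e (X e / theta e)))}"
 have I: "finite ?I" by (intro finite_PiE) auto
 note M = psi_markov[of ?I ?G ?c]
 have P: "(\<Prod>e\<in>idx m n. if snd e = J (fst e) then f e else 1) = (\<Prod>i<m. f (i, J i))" if "J \<in> ?I" for J and f :: "nat \<times> nat => ennreal"
  unfolding prod_idx using that by (intro prod.cong refl) (auto simp: prod.delta)
 have "{X \<in> positive_mats m n. \<exists>J\<in>?I. v <= (\<Sum>i<m. X (i, J i) / theta (i, J i))} \<subseteq> ?B"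
 proof clarify
  fix X J assume X: "X \<in> positive_mats m n" and J: "J \<in> ?I" and v: "v <= (\<Sum>i<m. X (i, J i) / theta (i, J i))"
  have "1 <= ?c * (\<Prod>e\<in>idx m n. ?G J e (X e / theta e))"
   unfolding P[OF J, of "%e. ennreal (exp (X e / theta e / 2))"] using v
   by (simp add: prod_ennreal exp_sum[symmetric] ennreal_mult[symmetric] exp_add[symmetric] sum_divide_distrib[symmetric] del: divide_divide_eq_left flip: ennreal_1)
  also have "... <= (\<Sum>J\<in>?I. ?c * (\<Prod>e\<in>idx m n. ?G J e (X e / theta e)))"
   by (rule member_le_sum[OF J]) (auto simp: I)
  finally show "1 <= (\<Sum>J\<in>?I. ?c * (\<Prod>e\<in>idx m n. ?G J e (X e / theta e)))" .
 qed
 moreover have "emeasure (psi_measure m n R C) ?B <= ennreal discrepancy * (\<Sum>J\<in>?I. ?c * (\<Prod>e\<in>idx m n. exp_mean (?G J e)))"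
  by (rule M(2)[OF I]) auto
 moreover have "(\<Sum>J\<in>?I. ?c * (\<Prod>e\<in>idx m n. exp_mean (?G J e))) = ennreal (exp (- v / 2) * (2 * real n) ^ m)"
 proof -
  have "(\<Prod>e\<in>idx m n. exp_mean (?G J e)) = 2 ^ m" if J: "J \<in> ?I" for J
  proof -
   have "(\<Prod>e\<in>idx m n. exp_mean (?G J e)) = (\<Prod>e\<in>idx m n. if snd e = J (fst e) then 2 else 1)"
    by (intro prod.cong) (auto simp: exp_mean_exp_half exp_mean_1)
   then show ?thesis using P[OF J, of "%_. 2"] by simp
  qed
  then have "(\<Sum>J\<in>?I. ?c * (\<Prod>e\<in>idx m n. exp_mean (?G J e))) = of_nat (n ^ m) * (?c * 2 ^ m)" by (simp add: card_PiE)
  also have "... = ennreal (real (n ^ m) * (exp (- v / 2) * 2 ^ m))"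
   by (simp add: ennreal_mult ennreal_power[symmetric] ennreal_of_nat_eq_real_of_nat)
  finally show ?thesis by (simp add: power_mult_distrib mult_ac)
 qed
 ultimately show ?thesis unfolding ennreal_mult'[OF discrepancy_nonneg]
  by (intro bexI[of _ ?B] conjI M(1)[OF I]) (simp_all only:, simp_all)
qed

text \<open>\<open>sel\<close> is the row or the column index, so that both kinds of lines are
  treated at once. Each of the \<open>q * k\<close> entries in \<open>k\<close> lines has a negative
  moment of at most 3, which the \<open>ln 3\<close> in the threshold absorbs; the union over sets
  of lines costs \<open>L ^ k\<close>.\<close>

lemma psi_bad_lines:
 assumes sel: "!!e. e \<in> idx m n ==> sel e < L" and q: "!!i. i < L ==> card {e \<in> idx m n. sel e = i} = q"
  and W: "!!e. e \<in> idx m n ==> 0 <= W e \<and> W e <= 1 / 2"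
 shows "\<exists>B\<in>sets (mat_lebesgue m n). {X \<in> positive_mats m n. \<exists>S\<subseteq>{..<L}. card S = k \<and>
   (1 + ln 3) * real (q * k) <= (\<Sum>e\<in>{e \<in> idx m n. sel e \<in> S}. - W e * ln (X e / theta e))} \<subseteq> B \<and>
  emeasure (psi_measure m n R C) B <= ennreal (discrepancy * (real L ^ k * exp (- real (q * k))))"
proof -
 let ?c = "ennreal (exp (- (1 + ln 3) * real (q * k)))" and ?I = "{S. S \<subseteq> {..<L} \<and> card S = k}"
 let ?G = "%S e x. if sel e \<in> S then ennreal (x powr (- W e)) else 1"
 let ?E = "%S. {e \<in> idx m n. sel e \<in> S}"
 let ?B = "{X \<in> positive_mats m n. 1 <= (\<Sum>S\<in>?I. ?c * (\<Prod>e\<in>idx m n. ?G S e (X e / theta e)))}"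
 have I: "finite ?I" by simp
 note M = psi_markov[of ?I ?G ?c]
 have P: "(\<Prod>e\<in>idx m n. if sel e \<in> S then f e else 1) = (\<Prod>e\<in>?E S. f e)" for S and f :: "nat \<times> nat => ennreal"
  by (rule prod.inter_filter[symmetric]) simp
 have cE: "card (?E S) = q * k" if S: "S \<in> ?I" for S
 proof -
  have "card (?E S) = (\<Sum>i\<in>S. card {e \<in> ?E S. sel e = i})"
   using S finite_subset[of S "{..<L}"] by (subst card_eq_sum, subst sum.group[symmetric, where g = sel and T = S]) auto
  also have "... = (\<Sum>i\<in>S. q)"
  proof (rule sum.cong[OF refl])
   fix i assume i: "i \<in> S"
   then have "{e \<in> ?E S. sel e = i} = {e \<in> idx m n. sel e = i}" by auto
   then show "card {e \<in> ?E S. sel e = i} = q" using q[of i] i S by auto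
  qed
  finally show ?thesis using S by simp
 qed
 have "{X \<in> positive_mats m n. \<exists>S\<subseteq>{..<L}. card S = k \<and>
   (1 + ln 3) * real (q * k) <= (\<Sum>e\<in>?E S. - W e * ln (X e / theta e))} \<subseteq> ?B"
 proof (rule subsetI)
  fix X assume "X \<in> {X \<in> positive_mats m n. \<exists>S\<subseteq>{..<L}. card S = k \<and>
   (1 + ln 3) * real (q * k) <= (\<Sum>e\<in>?E S. - W e * ln (X e / theta e))}"
  then obtain S where X: "X \<in> positive_mats m n" and S: "S \<subseteq> {..<L}" "card S = k"
   and v: "(1 + ln 3) * real (q * k) <= (\<Sum>e\<in>?E S. - W e * ln (X e / theta e))"
   by blast
  have S': "S \<in> ?I" using S by simp
  have "(\<Prod>e\<in>?E S. ennreal ((X e / theta e) powr (- W e))) = (\<Prod>e\<in>?E S. ennreal (exp (- W e * ln (X e / theta e))))"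
  proof (rule prod.cong[OF refl])
   fix e assume "e \<in> ?E S"
   then have "0 < X e" "0 < theta e" using X theta_gt_1[of e] by (auto simp only: positive_mats_iff mem_Collect_eq) auto
   then show "ennreal ((X e / theta e) powr (- W e)) = ennreal (exp (- W e * ln (X e / theta e)))" by (simp add: powr_def)
  qed
  then have "1 <= ?c * (\<Prod>e\<in>idx m n. ?G S e (X e / theta e))"
   unfolding P[of S "%e. ennreal ((X e / theta e) powr (- W e))"] using v
   by (simp add: prod_ennreal exp_sum[symmetric] ennreal_mult[symmetric] exp_add[symmetric] algebra_simps flip: ennreal_1)
  also have "... <= (\<Sum>S\<in>?I. ?c * (\<Prod>e\<in>idx m n. ?G S e (X e / theta e)))"
   by (rule member_le_sum[OF S']) (auto simp: I)
  finally show "X \<in> ?B" using X by blast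
 qed
 moreover have "emeasure (psi_measure m n R C) ?B <= ennreal discrepancy * (\<Sum>S\<in>?I. ?c * (\<Prod>e\<in>idx m n. exp_mean (?G S e)))"
  by (rule M(2)[OF I]) auto
 moreover have "(\<Sum>S\<in>?I. ?c * (\<Prod>e\<in>idx m n. exp_mean (?G S e))) <= ennreal (real L ^ k * exp (- real (q * k)))"
 proof -
  have "(\<Prod>e\<in>idx m n. exp_mean (?G S e)) <= 3 ^ (q * k)" if S: "S \<in> ?I" for S
  proof -
   have "(\<Prod>e\<in>idx m n. exp_mean (?G S e)) <= (\<Prod>e\<in>idx m n. if sel e \<in> S then 3 else 1)"
    using W by (intro prod_mono_ennreal) (auto simp: exp_mean_1 intro!: exp_mean_powr)
   also have "... = 3 ^ (q * k)" using P[of S "%_. 3"] cE[OF S] by simp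
   finally show ?thesis .
  qed
  then have "(\<Sum>S\<in>?I. ?c * (\<Prod>e\<in>idx m n. exp_mean (?G S e))) <= (\<Sum>S\<in>?I. ?c * 3 ^ (q * k))"
   by (intro sum_mono mult_left_mono) auto
  also have "... = of_nat (L choose k) * (?c * 3 ^ (q * k))" using n_subsets[of "{..<L}" k] by simp
  also have "?c * 3 ^ (q * k) = ennreal (exp (- real (q * k)))"
  proof -
   have "(3 :: ennreal) ^ (q * k) = ennreal (3 ^ (q * k))" by (simp add: ennreal_power[symmetric])
   also have "(3 :: real) ^ (q * k) = exp (ln 3 * real (q * k))" by (subst exp_of_nat2_mult) simp
   finally show ?thesis by (simp add: ennreal_mult[symmetric] exp_add[symmetric] algebra_simps)
  qed
  also have "(of_nat (L choose k) :: ennreal) * ennreal (exp (- real (q * k))) <= ennreal (real (L ^ k)) * ennreal (exp (- real (q * k)))"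
  proof (intro mult_right_mono)
   have "L choose k <= L ^ k" by (cases "k <= L") (auto simp: binomial_le_pow binomial_eq_0)
   then show "(of_nat (L choose k) :: ennreal) <= ennreal (real (L ^ k))" by (simp add: ennreal_of_nat_eq_real_of_nat)
  qed simp
  also have "... = ennreal (real L ^ k * exp (- real (q * k)))" by (simp add: ennreal_mult[symmetric])
  finally show ?thesis .
 qed
 ultimately show ?thesis unfolding ennreal_mult'[OF discrepancy_nonneg]
  by (intro bexI[of _ ?B] conjI M(1)[OF I]) (auto intro: order_trans[OF _ mult_left_mono])
qed

end

section \<open>The tail of the permanent factor\<close>

context
 fixes m n :: nat and R C :: "nat => nat" and \<alpha> \<beta> \<rho> :: real
 assumes smooth: "smooth_instance \<rho> \<alpha> \<beta> m n R C" and ab: "1 <= \<alpha>" "0 < \<beta>" "\<beta> <= 1"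
begin

lemma smooth_margins: "margins m n R C"
 using smooth by (simp add: smooth_instance_def)

text \<open>The bound on the typical table, summed over a row or a column, bounds the margins as
  well.\<close>

lemma smooth_upper:
 "j < n ==> real (C j) <= \<alpha> * real (total m R) / n" "i < m ==> real (R i) <= \<alpha> * real (total m R) / m"
proof -
 note T = typical_table_exists(1)[OF smooth_margins] and mp = margins_pos[OF smooth_margins]
 have le: "typical_table m n R C (i, j) <= \<alpha> * (total m R / (m * n))" if "i < m" "j < n" for i j
  using smooth that by (auto simp: smooth_instance_def strongly_upper_smooth_def idx_iff)
 show "real (C j) <= \<alpha> * real (total m R) / n" if "j < n"
 proof -
  have "real (C j) = (\<Sum>i<m. typical_table m n R C (i, j))" using T that by (simp add: in_polytope has_margins_def)
  also have "... <= (\<Sum>i<m. \<alpha> * (total m R / (m * n)))" using le that by (intro sum_mono) auto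
  finally show ?thesis using mp by simp
 qed
 show "real (R i) <= \<alpha> * real (total m R) / m" if "i < m"
 proof -
  have "real (R i) = (\<Sum>j<n. typical_table m n R C (i, j))" using T that by (simp add: in_polytope has_margins_def)
  also have "... <= (\<Sum>j<n. \<alpha> * (total m R / (m * n)))" using le that by (intro sum_mono) auto
  finally show ?thesis using mp by simp
 qed
qed

definition mean_scale :: real where
 "mean_scale = 1 + real (total m R) / (real m * real n)"

definition lower_const :: real where
 "lower_const = 1 / (2 / \<beta> + \<alpha> / \<beta>\<^sup>2)"

lemma lower_const: "0 < lower_const" "lower_const <= 1"
proof -
 have "1 <= 1 / \<beta>" "0 < \<alpha> / \<beta>\<^sup>2" using ab by auto
 then have "1 <= 2 / \<beta> + \<alpha> / \<beta>\<^sup>2" by simp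
 then show "0 < lower_const" "lower_const <= 1" by (auto simp: lower_const_def)
qed

lemma theta_bounds:
 assumes e: "e \<in> idx m n"
 shows "lower_const * mean_scale <= theta m n R C e" "theta m n R C e <= \<alpha> * mean_scale" "0 < mean_scale"
proof -
 have s: "0 <= real (total m R) / (real m * real n)" by simp
 have "real (total m R) / (real m * real n) * lower_const <= typical_table m n R C e"
  using typical_table_lower[OF smooth_margins _ _ ab(1,2) e] smooth by (simp add: smooth_instance_def lower_const_def)
 then show "lower_const * mean_scale <= theta m n R C e"
  using lower_const by (simp add: theta_def[OF smooth_margins] mean_scale_def algebra_simps)
 have "typical_table m n R C e <= \<alpha> * (real (total m R) / (real m * real n))"
  using smooth e by (auto simp: smooth_instance_def strongly_upper_smooth_def)
 then show "theta m n R C e <= \<alpha> * mean_scale" using ab(1) by (simp add: theta_def[OF smooth_margins] mean_scale_def distrib_left)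
 show "0 < mean_scale" using s by (simp add: mean_scale_def add_pos_nonneg)
qed

context
 fixes X :: mat and t V k :: real
 assumes X: "!!e. e \<in> idx m n ==> 0 < X e"
  and total: "(\<Sum>e\<in>idx m n. X e / theta m n R C e) <= 6 * real (m * n)"
  and select: "!!J. J \<in> PiE {..<m} (%_. {..<n}) ==> (\<Sum>i<m. X (i, J i) / theta m n R C (i, J i)) <= V"
  and rows: "real (card {i. i < m \<and> (\<Sum>j<n. C j / total m R * ln (X (i, j) / theta m n R C (i, j))) < - t}) <= k"
  and cols: "real (card {j. j < n \<and> (\<Sum>i<m. R i / total m R * ln (X (i, j) / theta m n R C (i, j))) < - t}) <= k"
begin

text \<open>Exceptional rows and columns are charged 1 each by \<open>p_fun_upper\<close>. At the
  other entries \<open>scaled_mat_le\<close> applies with both logarithmic means bounded below: the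
  entry, the row margin, the total and the two means give one factor \<open>\<alpha>\<close> each,
  and the two means also give \<open>exp (2 * t)\<close> and the square of
  \<open>lower_const\<close>. The factors \<open>mean_scale\<close> cancel.\<close>

lemma p_fun_smooth_bound:
 "p_fun m n R C X <= exp ((1 + ln (total m R)) * (2 * k + 6 * \<alpha> ^ 5 * exp (2 * t) / lower_const\<^sup>2 * V / m))"
proof -
 let ?N = "real (total m R)" and ?c = lower_const and ?w = mean_scale
 let ?xi = "%e. X e / theta m n R C e"
 note mp = margins_pos[OF smooth_margins]
 define S T where "S = {i. i < m \<and> (\<Sum>j<n. C j / total m R * ln (?xi (i, j))) < - t}"
  and "T = {j. j < n \<and> (\<Sum>i<m. R i / total m R * ln (?xi (i, j))) < - t}"
 define Q where "Q = 6 * \<alpha> ^ 5 * exp (2 * t) / ?c\<^sup>2"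
 have N: "?N > 0" "m > 0" "n > 0" using mp by auto
 have sums: "(\<Sum>j<n. C j / ?N) = 1" "(\<Sum>i<m. R i / ?N) = 1"
 proof -
  have "(\<Sum>j<n. real (C j)) = real (total n C)" "(\<Sum>i<m. real (R i)) = ?N" by (simp_all add: total_def)
  then have "(\<Sum>j<n. real (C j)) = ?N" "(\<Sum>i<m. real (R i)) = ?N" using mp(4) by simp_all
  then show "(\<Sum>j<n. C j / ?N) = 1" "(\<Sum>i<m. R i / ?N) = 1" using N by (simp_all add: sum_divide_distrib[symmetric])
 qed
 have RC: "!!i. i < m ==> 0 < R i" "!!j. j < n ==> 0 < C j" using smooth_margins by (auto simp: margins_def)
 have c: "0 < ?c" using lower_const by simp
 have w: "0 < ?w" unfolding mean_scale_def by (intro add_pos_nonneg) auto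
 have th: "0 < theta m n R C e" if "e \<in> idx m n" for e using theta_gt_1[OF smooth_margins that] by simp
 have xi: "0 < ?xi e" if "e \<in> idx m n" for e using X[OF that] th[OF that] by simp
 have Xle: "X e <= \<alpha> * ?w * ?xi e" if "e \<in> idx m n" for e
  using mult_right_mono[OF theta_bounds(2)[OF that], of "?xi e"] th[OF that] xi[OF that] by simp
 have Xge: "?c * ?w * ?xi e <= X e" if "e \<in> idx m n" for e
  using mult_right_mono[OF theta_bounds(1)[OF that], of "?xi e"] th[OF that] xi[OF that] by simp
 have cwx: "0 < ?c * ?w * ?xi e" if "e \<in> idx m n" for e using c w xi[OF that] by (intro mult_pos_pos)
 have lrm: "log_row_mean m n R C X i = (\<Sum>j<n. C j / ?N * ln (?N * X (i, j) / C j))" for i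
  by (rule log_row_mean_def[OF smooth_margins X])
 have lcm: "log_col_mean m R X j = (\<Sum>i<m. R i / ?N * ln (?N * X (i, j) / R i))" for j
  by (rule log_col_mean_def[OF smooth_margins X])
 have row_good: "n * ?c * ?w / \<alpha> * exp (- t) <= exp (log_row_mean m n R C X i)" if i: "i < m" "i \<notin> S" for i
 proof -
  have "ln (n * ?c * ?w / \<alpha>) + - t <= (\<Sum>j<n. C j / ?N) * ln (n * ?c * ?w / \<alpha>) + (\<Sum>j<n. C j / ?N * ln (?xi (i, j)))"
   using i by (simp add: sums S_def)
  also have "... = (\<Sum>j<n. C j / ?N * (ln (n * ?c * ?w / \<alpha>) + ln (?xi (i, j))))"
   by (simp add: sum_distrib_right sum.distrib[symmetric] distrib_left)
  also have "... <= log_row_mean m n R C X i"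
   unfolding lrm
  proof (intro sum_mono mult_left_mono)
   fix j assume "j \<in> {..<n}"
   then have j: "j < n" "(i, j) \<in> idx m n" using i by (auto simp: idx_iff)
   have "n / \<alpha> <= ?N / C j" using smooth_upper(1)[OF j(1)] RC(2)[OF j(1)] ab N by (simp add: field_simps)
   then have "n / \<alpha> * (?c * ?w * ?xi (i, j)) <= ?N / C j * X (i, j)"
    by (rule mult_mono[OF _ Xge[OF j(2)] _ less_imp_le[OF cwx[OF j(2)]]]) simp_all
   then have "ln (n / \<alpha> * (?c * ?w * ?xi (i, j))) <= ln (?N / C j * X (i, j))"
    using c w th[OF j(2)] ab N X[OF j(2)] RC(2)[OF j(1)] by (intro ln_mono mult_pos_pos divide_pos_pos) simp_all
   also have "n / \<alpha> * (?c * ?w * ?xi (i, j)) = (n * ?c * ?w / \<alpha>) * ?xi (i, j)" by simp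
   also have "ln ... = ln (n * ?c * ?w / \<alpha>) + ln (?xi (i, j))"
    using c w xi[OF j(2)] ab N by (intro ln_mult_pos) auto
   finally show "ln (n * ?c * ?w / \<alpha>) + ln (?xi (i, j)) <= ln (?N * X (i, j) / C j)" by simp
  qed simp
  finally have "exp (ln (n * ?c * ?w / \<alpha>) + - t) <= exp (log_row_mean m n R C X i)" by simp
  moreover have "0 < n * ?c * ?w / \<alpha>" using c w ab N by simp
  ultimately show ?thesis by (simp only: exp_add exp_ln)
 qed
 have col_good: "m * ?c * ?w / \<alpha> * exp (- t) <= exp (log_col_mean m R X j)" if j: "j < n" "j \<notin> T" for j
 proof -
  have "ln (m * ?c * ?w / \<alpha>) + - t <= (\<Sum>i<m. R i / ?N) * ln (m * ?c * ?w / \<alpha>) + (\<Sum>i<m. R i / ?N * ln (?xi (i, j)))"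
   using j by (simp add: sums T_def)
  also have "... = (\<Sum>i<m. R i / ?N * (ln (m * ?c * ?w / \<alpha>) + ln (?xi (i, j))))"
   by (simp add: sum_distrib_right sum.distrib[symmetric] distrib_left)
  also have "... <= log_col_mean m R X j"
   unfolding lcm
  proof (intro sum_mono mult_left_mono)
   fix i assume "i \<in> {..<m}"
   then have i: "i < m" "(i, j) \<in> idx m n" using j by (auto simp: idx_iff)
   have "m / \<alpha> <= ?N / R i" using smooth_upper(2)[OF i(1)] RC(1)[OF i(1)] ab N by (simp add: field_simps)
   then have "m / \<alpha> * (?c * ?w * ?xi (i, j)) <= ?N / R i * X (i, j)"
    by (rule mult_mono[OF _ Xge[OF i(2)] _ less_imp_le[OF cwx[OF i(2)]]]) simp_all
   then have "ln (m / \<alpha> * (?c * ?w * ?xi (i, j))) <= ln (?N / R i * X (i, j))"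
    using c w th[OF i(2)] ab N X[OF i(2)] RC(1)[OF i(1)] by (intro ln_mono mult_pos_pos divide_pos_pos) simp_all
   also have "m / \<alpha> * (?c * ?w * ?xi (i, j)) = (m * ?c * ?w / \<alpha>) * ?xi (i, j)" by simp
   also have "ln ... = ln (m * ?c * ?w / \<alpha>) + ln (?xi (i, j))"
    using c w xi[OF i(2)] ab N by (intro ln_mult_pos) auto
   finally show "ln (m * ?c * ?w / \<alpha>) + ln (?xi (i, j)) <= ln (?N * X (i, j) / R i)" by simp
  qed simp
  finally have "exp (ln (m * ?c * ?w / \<alpha>) + - t) <= exp (log_col_mean m R X j)" by simp
  moreover have "0 < m * ?c * ?w / \<alpha>" using c w ab N by simp
  ultimately show ?thesis by (simp only: exp_add exp_ln)
 qed
 have Q: "0 < Q" using c ab by (simp add: Q_def)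
 have entry: "scaled_mat m n R C X (i, j) / C j <= Q / m * ?xi (i, j)" if ij: "i < m" "j < n" "i \<notin> S" "j \<notin> T" for i j
 proof -
  have e: "(i, j) \<in> idx m n" using ij by (simp add: idx_iff)
  let ?A = "exp (log_row_mean m n R C X i)" and ?B = "exp (log_col_mean m R X j)"
  have SX: "(sum X (idx m n)) <= \<alpha> * ?w * (6 * real (m * n))"
  proof -
   have "(sum X (idx m n)) <= (\<Sum>e\<in>idx m n. \<alpha> * ?w * ?xi e)" by (rule sum_mono) (rule Xle)
   also have "... = \<alpha> * ?w * (\<Sum>e\<in>idx m n. ?xi e)" by (simp add: sum_distrib_left)
   also have "... <= \<alpha> * ?w * (6 * real (m * n))" using w ab total by (intro mult_left_mono) auto
   finally show ?thesis .
  qed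
  have SX0: "0 <= (sum X (idx m n))" using X by (intro sum_nonneg) (auto simp: less_imp_le)
  have AB: "(n * ?c * ?w / \<alpha> * exp (- t)) * (m * ?c * ?w / \<alpha> * exp (- t)) <= ?A * ?B"
   using c w ab by (intro mult_mono row_good col_good ij) auto
  have "scaled_mat m n R C X (i, j) <= X (i, j) * R i * C j * ((sum X (idx m n)) / ?N) / (?A * ?B)"
   by (rule scaled_mat_le[of m n R C X, OF smooth_margins X ij(1,2)])
  then have "scaled_mat m n R C X (i, j) / C j <= X (i, j) * R i * ((sum X (idx m n)) / ?N) / (?A * ?B)"
   using RC(2)[OF ij(2)] by (simp add: divide_le_eq mult_ac)
  also have "... <= (\<alpha> * ?w * ?xi (i, j)) * (\<alpha> * ?N / m) * (\<alpha> * ?w * (6 * real (m * n)) / ?N) / ((n * ?c * ?w / \<alpha> * exp (- t)) * (m * ?c * ?w / \<alpha> * exp (- t)))"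
   using Xle[OF e] smooth_upper(2)[OF ij(1)] SX SX0 AB c w ab N X[OF e] xi[OF e] th[OF e] row_good[OF ij(1,3)] col_good[OF ij(2,4)]
   by (intro frac_le mult_mono divide_right_mono mult_nonneg_nonneg divide_nonneg_nonneg) (auto intro!: mult_pos_pos divide_pos_pos)
  also have "... = Q / m * ?xi (i, j)"
  proof -
   have "exp (t * 2) = exp t * exp t" by (simp flip: exp_add)
   then show ?thesis using N c w ab by (simp add: Q_def field_simps exp_minus eval_nat_numeral)
  qed
  finally show ?thesis .
 qed
 \<comment> \<open>\<open>J\<close> selects a largest normalised entry in every row, so that the row
   maxima form a sum covered by \<open>select\<close>.\<close>
 define J where "J = (\<lambda>i\<in>{..<m}. SOME j. j < n \<and> (\<forall>j'<n. ?xi (i, j') <= ?xi (i, j)))"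
 have J: "J i < n \<and> (\<forall>j'<n. ?xi (i, j') <= ?xi (i, J i))" if "i < m" for i
 proof -
  have "Max ((%j. ?xi (i, j)) ` {..<n}) \<in> (%j. ?xi (i, j)) ` {..<n}" using N by (intro Max_in) auto
  then obtain j where "j < n" "?xi (i, j) = Max ((%j. ?xi (i, j)) ` {..<n})" by force
  then have "j < n \<and> (\<forall>j'<n. ?xi (i, j') <= ?xi (i, j))" by simp
  then have "\<exists>j. j < n \<and> (\<forall>j'<n. ?xi (i, j') <= ?xi (i, j))" by blast
  from someI_ex[OF this] show ?thesis using that by (simp add: J_def)
 qed
 have JP: "J \<in> PiE {..<m} (%_. {..<n})" using J by (auto simp: J_def)
 have "p_fun m n R C X <= exp ((1 + ln ?N) * (card S + card T + (\<Sum>i\<in>{..<m} - S. Q / m * ?xi (i, J i))))"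
 proof (rule p_fun_upper[of m n R C X, OF smooth_margins X])
  show "0 <= Q / m * ?xi (i, J i)" if "i < m" for i
   using Q xi[of "(i, J i)"] J[OF that] that by (intro mult_nonneg_nonneg) (simp_all add: idx_iff less_imp_le)
  show "scaled_mat m n R C X (i, j) / C j <= Q / m * ?xi (i, J i)" if "i < m" "j < n" "i \<notin> S" "j \<notin> T" for i j
  proof -
   have "Q / m * ?xi (i, j) <= Q / m * ?xi (i, J i)" using Q J[OF that(1)] that by (intro mult_left_mono) auto
   then show ?thesis using entry[OF that] by simp
  qed
 qed (auto simp: S_def T_def)
 also have "... <= exp ((1 + ln ?N) * (2 * k + Q * V / m))"
 proof -
  have "(\<Sum>i\<in>{..<m} - S. Q / m * ?xi (i, J i)) <= (\<Sum>i<m. Q / m * ?xi (i, J i))"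
  proof (rule sum_mono2)
   show "0 <= Q / m * ?xi (i, J i)" if "i \<in> {..<m} - ({..<m} - S)" for i
    using Q xi[of "(i, J i)"] J[of i] that by (intro mult_nonneg_nonneg) (simp_all add: idx_iff less_imp_le)
  qed auto
  also have "... = Q / m * (\<Sum>i<m. ?xi (i, J i))" by (simp add: sum_distrib_left)
  also have "... <= Q / m * V" using Q select[OF JP] by (intro mult_left_mono) auto
  finally have "card S + card T + (\<Sum>i\<in>{..<m} - S. Q / m * ?xi (i, J i)) <= 2 * k + Q * V / m"
   using rows cols by (simp add: S_def T_def)
  moreover have "0 <= 1 + ln ?N" using N by (simp add: Suc_le_eq add_nonneg_nonneg)
  ultimately show ?thesis by (simp add: mult_left_mono)
 qed
 finally show ?thesis by (simp add: Q_def)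
qed

end

end

text \<open>All rows, or all columns, are taken as exceptional.\<close>

lemma p_fun_le_dimension:
 assumes mar: "margins m n R C" and X: "!!e. e \<in> idx m n ==> 0 < X e"
 shows "p_fun m n R C X <= exp ((1 + ln (total m R)) * m)" "p_fun m n R C X <= exp ((1 + ln (total m R)) * n)"
 using p_fun_upper[of m n R C X "{..<m}" "{}" "%_. 0", OF mar X]
  p_fun_upper[of m n R C X "{}" "{..<n}" "%_. 0", OF mar X] by auto

lemma exp_le_half_power: "exp (- real k) <= (1 / 2) ^ k"
proof -
 have "2 <= exp (1 :: real)" using exp_ge_add_one_self[of 1] by simp
 then have "exp (- 1 :: real) <= 1 / 2" by (simp add: exp_minus field_simps)
 then have "exp (- 1 :: real) ^ k <= (1 / 2) ^ k" by (intro power_mono) auto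
 then show ?thesis by (simp flip: exp_of_nat_mult)
qed

text \<open>Since \<open>ln L <= q / 4\<close>, the union over sets of lines leaves
  \<open>exp (- 3 / 4 * q * k)\<close>, and \<open>k\<close> is large enough for this to beat the
  discrepancy \<open>exp (G * ln N * q)\<close>.\<close>

lemma bad_lines_bound:
 fixes N q L :: nat and G :: real
 assumes l: "2 / 3 <= ln N" and q: "(G + 4) * ln N <= q" and L: "L <= N" and G: "0 <= G" and pos: "0 < L"
  and k: "(2 * G + 6) * ln N <= real k"
 shows "exp (G * ln N * q) * (real L ^ k * exp (- real (q * k))) <= (1 / 2) ^ q"
proof -
 have "4 * ln N <= (G + 4) * ln N" using G l by (intro mult_right_mono) auto
 then have lnq: "ln N <= q / 4" using q by simp
 have "ln (real L) <= ln (real N)" using L pos by simp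
 then have lnL: "ln (real L) <= q / 4" using lnq by linarith
 have "real L ^ k = exp (real k * ln L)" using pos by (simp add: exp_of_nat_mult)
 then have "exp (G * ln N * q) * (real L ^ k * exp (- real (q * k))) = exp (G * ln N * q + real k * ln L - real q * real k)"
  by (simp add: exp_add exp_diff exp_minus field_simps)
 also have "... <= exp (- real q)"
 proof -
  have "real k * ln L <= real k * (q / 4)" by (intro mult_left_mono lnL) auto
  moreover have "(2 * G + 6) * ln N * (q * 3 / 4) <= real k * (q * 3 / 4)" by (intro mult_right_mono k) auto
  moreover have "0 <= G * ln N * q" using G l by simp
  moreover have "2 / 3 * real q <= ln N * q" by (intro mult_right_mono l) auto
  ultimately show ?thesis by (simp add: algebra_simps)
 qed
 also have "... <= (1 / 2) ^ q" by (rule exp_le_half_power)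
 finally show ?thesis .
qed

context
 fixes m n :: nat and R C :: "nat => nat" and \<alpha> \<beta> \<rho> :: real
 assumes smooth: "smooth_instance \<rho> \<alpha> \<beta> m n R C" and ab: "1 <= \<alpha>" "0 < \<beta>" "\<beta> <= 1" "1 <= \<rho>"
begin

abbreviation (input) "ln_total \<equiv> ln (real (total m R))"

lemma total_ge: "m <= total m R" "n <= total m R"
proof -
 have mar: "margins m n R C" by (rule smooth_margins[OF smooth ab(1-3)])
 have "(\<Sum>i<m. 1) <= total m R" "(\<Sum>j<n. 1) <= total n C"
  unfolding total_def using mar by (intro sum_mono; force simp: margins_def)+
 then show "m <= total m R" "n <= total m R" using margins_pos(4)[OF mar] by auto
qed

text \<open>Outside four events (large total, large row maxima, too many small rows, too many small
  columns) \<open>p_fun_smooth_bound\<close> stays below \<open>\<tau>\<close>. Each event beats the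
  discrepancy because both dimensions exceed a multiple of the logarithm of the total.\<close>

lemma p_tail_large:
 fixes G :: real
 defines "G \<equiv> 24 * (1 + \<rho>)"
 assumes l: "2 / 3 <= ln_total" and mn: "(G + 4) * ln_total <= m" "(G + 4) * ln_total <= n"
  and tau: "exp ((1 + ln_total) * (2 * ((2 * G + 6) * ln_total)
  + 6 * \<alpha> ^ 5 * exp (4 * \<alpha> * (1 + ln 3)) / (lower_const \<alpha> \<beta>)\<^sup>2 * (2 * (G + 4) * ln_total))) <= \<tau>"
 defines "bad \<equiv> {X \<in> positive_mats m n. \<tau> < p_fun m n R C X}"
 shows "emeasure (psi_measure m n R C) bad <= ennreal (2 * ((1 / 2) ^ m + (1 / 2) ^ n))"
proof -
 let ?l = "ln_total" and ?N = "real (total m R)"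
 have mar: "margins m n R C" by (rule smooth_margins[OF smooth ab(1-3)])
 note mp = margins_pos[OF mar]
 have G: "0 <= G" using ab by (simp add: G_def)
 have rho: "real m <= \<rho> * real n" "real n <= \<rho> * real m" using smooth by (auto simp: smooth_instance_def)
 define D where "D = discrepancy m n R C"
 have D0: "0 <= D" unfolding D_def by (rule discrepancy_nonneg[OF mar])
 \<comment> \<open>As the logarithm is at least \<open>2 / 3\<close>, the constant 10 is at most 15
   logarithms; hence 24. The factor \<open>1 + \<rho>\<close> in \<open>G\<close> then lets either
   dimension alone stand for \<open>m + n\<close>.\<close>
 have D: "D <= exp (24 * real (m + n) * ?l)"
 proof -
  have "real (m + n) * (10 + 9 * ?l) <= real (m + n) * (24 * ?l)" using l by (intro mult_left_mono) auto
  then show ?thesis using discrepancy_le[OF mar] unfolding D_def by (simp add: algebra_simps order_trans)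
 qed
 have Dn: "D <= exp (G * ?l * n)" "D <= exp (G * ?l * m)"
 proof -
  have "24 * ?l * real (m + n) <= 24 * ?l * ((1 + \<rho>) * n)" "24 * ?l * real (m + n) <= 24 * ?l * ((1 + \<rho>) * m)"
   using l rho by (intro mult_left_mono; simp add: algebra_simps)+
  then have "24 * real (m + n) * ?l <= G * ?l * n" "24 * real (m + n) * ?l <= G * ?l * m"
   by (simp_all add: G_def algebra_simps)
  then show "D <= exp (G * ?l * n)" "D <= exp (G * ?l * m)"
   using D by (meson exp_le_cancel_iff order_trans)+
 qed
 \<comment> \<open>A number of bad lines above \<open>(2 * G + 6) * ?l\<close> is at least
   \<open>k\<close>. The factor \<open>2 * \<alpha>\<close> in \<open>t\<close> undoes the scaling
   that brings the weights \<open>Wr\<close> and \<open>Wc\<close> below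
   \<open>1 / 2\<close>.\<close>
 define t k where "t = 2 * \<alpha> * (1 + ln 3)" and "k = nat \<lceil>(2 * G + 6) * ?l\<rceil>"
 have k: "(2 * G + 6) * ?l <= real k" "0 < k" "real (k - 1) <= (2 * G + 6) * ?l"
 proof -
  have p: "0 < (2 * G + 6) * ?l" using G l by (intro mult_pos_pos) auto
  then show "(2 * G + 6) * ?l <= real k" "0 < k" unfolding k_def by linarith+
  show "real (k - 1) <= (2 * G + 6) * ?l" using p unfolding k_def by linarith
 qed
 let ?S = "sets (mat_lebesgue m n)" and ?xi = "%X e. X e / theta m n R C e" and ?E = "emeasure (psi_measure m n R C)"
 obtain B1 where B1: "B1 \<in> ?S" "{X \<in> positive_mats m n. 6 * real (m * n) <= (\<Sum>e\<in>idx m n. ?xi X e)} \<subseteq> B1"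
   "?E B1 <= ennreal (D * exp (- 2 * real (m * n)))"
  using psi_sum_large[OF mar] unfolding D_def by blast
 \<comment> \<open>Half of \<open>?V\<close> is \<open>(G + 4) * ?l\<close> per row: it outweighs
   the discrepancy, \<open>G * ?l\<close> per row, and the factor \<open>2 * n\<close> per row, at
   most \<open>exp (1 + ?l)\<close>.\<close>
 let ?V = "2 * (G + 4) * ?l * m"
 obtain B2 where B2: "B2 \<in> ?S" "{X \<in> positive_mats m n. \<exists>J\<in>PiE {..<m} (%_. {..<n}). ?V <= (\<Sum>i<m. ?xi X (i, J i))} \<subseteq> B2"
   "?E B2 <= ennreal (D * (exp (- ?V / 2) * (2 * real n) ^ m))"
  using psi_row_selection_large[OF mar, of ?V] unfolding D_def by blast
 define Wr Wc where "Wr e = n / (2 * \<alpha> * ?N) * C (snd e)" and "Wc e = m / (2 * \<alpha> * ?N) * R (fst e)" for e :: "nat \<times> nat"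
 have Wr: "0 <= Wr e \<and> Wr e <= 1 / 2" and Wc: "0 <= Wc e \<and> Wc e <= 1 / 2" if "e \<in> idx m n" for e
  using smooth_upper[OF smooth ab(1-3)] that mp ab by (auto simp: Wr_def Wc_def idx_def field_simps)
 have "card {e \<in> idx m n. fst e = i} = n" if "i < m" for i
 proof -
  have "{e \<in> idx m n. fst e = i} = {i} \<times> {..<n}" using that by (auto simp: idx_def)
  then show ?thesis by simp
 qed
 then obtain B3 where B3: "B3 \<in> ?S" "{X \<in> positive_mats m n. \<exists>S\<subseteq>{..<m}. card S = k \<and>
   (1 + ln 3) * real (n * k) <= (\<Sum>e\<in>{e \<in> idx m n. fst e \<in> S}. - Wr e * ln (?xi X e))} \<subseteq> B3"
   "?E B3 <= ennreal (D * (real m ^ k * exp (- real (n * k))))"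
  using psi_bad_lines[OF mar, of fst m n Wr k] Wr unfolding D_def by (auto simp: idx_def)
 have "card {e \<in> idx m n. snd e = j} = m" if "j < n" for j
 proof -
  have "{e \<in> idx m n. snd e = j} = {..<m} \<times> {j}" using that by (auto simp: idx_def)
  then show ?thesis by simp
 qed
 then obtain B4 where B4: "B4 \<in> ?S" "{X \<in> positive_mats m n. \<exists>S\<subseteq>{..<n}. card S = k \<and>
   (1 + ln 3) * real (m * k) <= (\<Sum>e\<in>{e \<in> idx m n. snd e \<in> S}. - Wc e * ln (?xi X e))} \<subseteq> B4"
   "?E B4 <= ennreal (D * (real n ^ k * exp (- real (m * k))))"
  using psi_bad_lines[OF mar, of snd n m Wc k] Wc unfolding D_def by (auto simp: idx_def)
 have e1: "D * exp (- 2 * real (m * n)) <= (1 / 2) ^ n"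
 proof -
  have "D * exp (- 2 * real (m * n)) <= exp (G * ?l * n) * exp (- 2 * real (m * n))" by (intro mult_right_mono Dn) auto
  also have "... = exp (G * ?l * n - 2 * real m * n)" by (simp flip: exp_add)
  also have "... <= exp (- real n)"
  proof -
   have "0 <= G * ?l" using G l by simp
   then have "G * ?l + 1 <= 2 * real m" using mn(1) l by (simp add: algebra_simps)
   then have "(G * ?l + 1) * n <= 2 * real m * n" by (intro mult_right_mono) auto
   then show ?thesis by (simp add: algebra_simps)
  qed
  finally show ?thesis using exp_le_half_power[of n] by simp
 qed
 have e2: "D * (exp (- ?V / 2) * (2 * real n) ^ m) <= (1 / 2) ^ m"
 proof -
  have V2: "- ?V / 2 = - ((G + 4) * ?l * m)" by simp
  have "2 <= exp (1 :: real)" using exp_ge_add_one_self[of 1] by simp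
  moreover have "real n <= exp ?l" using total_ge mp by simp
  ultimately have "2 * real n <= exp (1 + ?l)" unfolding exp_add by (intro mult_mono) auto
  then have "(2 * real n) ^ m <= exp (1 + ?l) ^ m" by (intro power_mono) auto
  also have "... = exp (m * (1 + ?l))" by (simp add: exp_of_nat_mult)
  finally have "D * (exp (- ?V / 2) * (2 * real n) ^ m) <= exp (G * ?l * m) * (exp (- ?V / 2) * exp (m * (1 + ?l)))"
   by (intro mult_mono Dn) auto
  also note V2
  also have "exp (G * ?l * m) * (exp (- ((G + 4) * ?l * m)) * exp (m * (1 + ?l))) = exp (m * (G * ?l - (G + 4) * ?l + 1 + ?l))"
   by (simp add: exp_add[symmetric] algebra_simps)
  also have "... <= exp (m * (- 1))"
  proof -
   have "G * ?l - (G + 4) * ?l + 1 + ?l <= - 1" using l by (simp add: algebra_simps)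
   then have "real m * (G * ?l - (G + 4) * ?l + 1 + ?l) <= real m * (- 1)" by (intro mult_left_mono) auto
   then show ?thesis by simp
  qed
  finally show ?thesis unfolding V2 using exp_le_half_power[of m] by simp
 qed
 have e3: "D * (real m ^ k * exp (- real (n * k))) <= (1 / 2) ^ n"
  using mult_right_mono[OF Dn(1), of "real m ^ k * exp (- real (n * k))"] bad_lines_bound[OF l mn(2) total_ge(1) G mp(2) k(1)] by simp
 have e4: "D * (real n ^ k * exp (- real (m * k))) <= (1 / 2) ^ m"
  using mult_right_mono[OF Dn(2), of "real n ^ k * exp (- real (m * k))"] bad_lines_bound[OF l mn(1) total_ge(2) G mp(3) k(1)] by simp
 have "bad \<subseteq> B1 \<union> B2 \<union> B3 \<union> B4"
 proof
  fix X assume "X \<in> bad"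
  then have X: "X \<in> positive_mats m n" and big: "\<tau> < p_fun m n R C X" by (auto simp: bad_def)
  have Xp: "!!e. e \<in> idx m n ==> 0 < X e" using X by (simp only: positive_mats_iff)
  show "X \<in> B1 \<union> B2 \<union> B3 \<union> B4"
  proof (rule ccontr)
   assume out: "X \<notin> B1 \<union> B2 \<union> B3 \<union> B4"
   have rows: "real (card {i. i < m \<and> (\<Sum>j<n. C j / ?N * ln (?xi X (i, j))) < - t}) <= (2 * G + 6) * ?l" (is "real (card ?T) <= _")
   proof (rule ccontr)
    assume "\<not> ?thesis"
    then have "k <= card ?T" using k by linarith
    then obtain S where S: "S \<subseteq> ?T" "card S = k" by (meson obtain_subset_with_card_n)
    then have Sm: "S \<subseteq> {..<m}" by auto
    have "{e \<in> idx m n. fst e \<in> S} = S \<times> {..<n}" using Sm by (auto simp: idx_def)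
    then have "(\<Sum>e\<in>{e \<in> idx m n. fst e \<in> S}. - Wr e * ln (?xi X e)) = (\<Sum>i\<in>S. \<Sum>j<n. - Wr (i, j) * ln (?xi X (i, j)))"
     by (simp add: sum.cartesian_product)
    also have "... = (\<Sum>i\<in>S. n / (2 * \<alpha>) * - (\<Sum>j<n. C j / ?N * ln (?xi X (i, j))))"
     unfolding sum_distrib_left sum_negf[symmetric] by (intro sum.cong refl) (simp add: Wr_def)
    also have "... \<ge> (\<Sum>i\<in>S. n / (2 * \<alpha>) * t)"
    proof (rule sum_mono)
     fix i assume "i \<in> S"
     then have "t <= - (\<Sum>j<n. C j / ?N * ln (?xi X (i, j)))" using S by auto
     then show "n / (2 * \<alpha>) * t <= n / (2 * \<alpha>) * - (\<Sum>j<n. C j / ?N * ln (?xi X (i, j)))" using ab by (intro mult_left_mono) auto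
    qed
    also have "(\<Sum>i\<in>S. n / (2 * \<alpha>) * t) = (1 + ln 3) * real (n * k)" using S ab by (simp add: t_def)
    finally show False using B3(2) X S Sm out by blast
   qed
   have cols: "real (card {j. j < n \<and> (\<Sum>i<m. R i / ?N * ln (?xi X (i, j))) < - t}) <= (2 * G + 6) * ?l" (is "real (card ?T) <= _")
   proof (rule ccontr)
    assume "\<not> ?thesis"
    then have "k <= card ?T" using k by linarith
    then obtain S where S: "S \<subseteq> ?T" "card S = k" by (meson obtain_subset_with_card_n)
    then have Sm: "S \<subseteq> {..<n}" by auto
    have "{e \<in> idx m n. snd e \<in> S} = {..<m} \<times> S" using Sm by (auto simp: idx_def)
    then have "(\<Sum>e\<in>{e \<in> idx m n. snd e \<in> S}. - Wc e * ln (?xi X e)) = (\<Sum>i<m. \<Sum>j\<in>S. - Wc (i, j) * ln (?xi X (i, j)))"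
     by (simp add: sum.cartesian_product)
    also have "... = (\<Sum>j\<in>S. \<Sum>i<m. - Wc (i, j) * ln (?xi X (i, j)))" by (rule sum.swap)
    also have "... = (\<Sum>j\<in>S. m / (2 * \<alpha>) * - (\<Sum>i<m. R i / ?N * ln (?xi X (i, j))))"
     unfolding sum_distrib_left sum_negf[symmetric] by (intro sum.cong refl) (simp add: Wc_def)
    also have "... \<ge> (\<Sum>j\<in>S. m / (2 * \<alpha>) * t)"
    proof (rule sum_mono)
     fix j assume "j \<in> S"
     then have "t <= - (\<Sum>i<m. R i / ?N * ln (?xi X (i, j)))" using S by auto
     then show "m / (2 * \<alpha>) * t <= m / (2 * \<alpha>) * - (\<Sum>i<m. R i / ?N * ln (?xi X (i, j)))" using ab by (intro mult_left_mono) auto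
    qed
    also have "(\<Sum>j\<in>S. m / (2 * \<alpha>) * t) = (1 + ln 3) * real (m * k)" using S ab by (simp add: t_def)
    finally show False using B4(2) X S Sm out by blast
   qed
   have tot: "(\<Sum>e\<in>idx m n. ?xi X e) <= 6 * real (m * n)"
   proof (rule ccontr)
    assume "\<not> ?thesis"
    then have "6 * real (m * n) <= (\<Sum>e\<in>idx m n. ?xi X e)" by linarith
    then show False using B1(2) X out by blast
   qed
   have sel: "(\<Sum>i<m. ?xi X (i, J i)) <= ?V" if J: "J \<in> PiE {..<m} (%_. {..<n})" for J
   proof (rule ccontr)
    assume "\<not> ?thesis"
    then have "?V <= (\<Sum>i<m. ?xi X (i, J i))" by linarith
    then show False using B2(2) X J out by blast
   qed
   have "p_fun m n R C X <= exp ((1 + ?l) * (2 * ((2 * G + 6) * ?l) + 6 * \<alpha> ^ 5 * exp (2 * t) / (lower_const \<alpha> \<beta>)\<^sup>2 * ?V / m))"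
    by (rule p_fun_smooth_bound[OF smooth ab(1-3) Xp tot sel rows cols])
   also have "2 * t = 4 * \<alpha> * (1 + ln 3)" by (simp add: t_def)
   also have "6 * \<alpha> ^ 5 * exp (4 * \<alpha> * (1 + ln 3)) / (lower_const \<alpha> \<beta>)\<^sup>2 * ?V / m =
     6 * \<alpha> ^ 5 * exp (4 * \<alpha> * (1 + ln 3)) / (lower_const \<alpha> \<beta>)\<^sup>2 * (2 * (G + 4) * ?l)" using mp by simp
   finally show False using big tau by simp
  qed
 qed
 then have "?E bad <= ?E (B1 \<union> B2 \<union> B3 \<union> B4)" using B1(1) B2(1) B3(1) B4(1) by (intro emeasure_mono) (auto simp: psi_measure_def)
 also have "... <= ?E B1 + ?E B2 + ?E B3 + ?E B4"
  using B1(1) B2(1) B3(1) B4(1) by (intro order_trans[OF emeasure_subadditive] add_mono order_refl) (auto simp: psi_measure_def)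
 also have "... <= ennreal ((1 / 2) ^ n) + ennreal ((1 / 2) ^ m) + ennreal ((1 / 2) ^ n) + ennreal ((1 / 2) ^ m)"
  by (intro add_mono order_trans[OF B1(3)] order_trans[OF B2(3)] order_trans[OF B3(3)] order_trans[OF B4(3)] ennreal_leI e1 e2 e3 e4)
 also have "... = ennreal (2 * ((1 / 2) ^ m + (1 / 2) ^ n))" by (simp flip: ennreal_plus)
 finally show ?thesis .
qed

end

text \<open>If a dimension is below a multiple of the logarithm of the total, the events are not
  rare enough, but then \<open>p_fun_le_dimension\<close> keeps p below the threshold everywhere. A
  total of at least 2 keeps the logarithm away from 0.\<close>

theorem p_tail:
 assumes ab: "1 <= \<alpha>" "0 < \<beta>" "\<beta> <= 1" "1 <= \<rho>"
 obtains \<delta> :: real where "\<delta> \<ge> 1"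
  "!!m n R C. smooth_instance \<rho> \<alpha> \<beta> m n R C ==> 2 <= total m R ==>
   emeasure (psi_measure m n R C) {X \<in> positive_mats m n. p_fun m n R C X > threshold \<delta> (total m R)} <= ennreal (2 * ((1 / 2) ^ m + (1 / 2) ^ n))"
proof -
 define G Q where "G = 24 * (1 + \<rho>)" and "Q = 6 * \<alpha> ^ 5 * exp (4 * \<alpha> * (1 + ln 3)) / (lower_const \<alpha> \<beta>)\<^sup>2 * (2 * (G + 4))"
 \<comment> \<open>The factor 3 comes from \<open>1 + ?l <= 3 * ?l\<close>. The first summand serves
   large dimensions, the second the case of a dimension below \<open>(G + 4) * ?l\<close>.\<close>
 define \<delta> where "\<delta> = 3 * (2 * (2 * G + 6) + Q) + 3 * (G + 4)"
 have G: "0 <= G" using ab by (simp add: G_def)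
 have Q: "0 <= Q" using ab G unfolding Q_def by (intro mult_nonneg_nonneg divide_nonneg_nonneg) auto
 have "\<delta> \<ge> 1" using G Q by (simp add: \<delta>_def)
 moreover have "emeasure (psi_measure m n R C) {X \<in> positive_mats m n. p_fun m n R C X > threshold \<delta> (total m R)} <= ennreal (2 * ((1 / 2) ^ m + (1 / 2) ^ n))"
  if s: "smooth_instance \<rho> \<alpha> \<beta> m n R C" and N: "2 <= total m R" for m n R C
 proof -
  let ?l = "ln (real (total m R))"
  have mar: "margins m n R C" using s by (simp add: smooth_instance_def)
  have "2 / 3 <= ln (2 :: real)" using ln2_ge_two_thirds by simp
  also have "... <= ?l" using N by simp
  finally have l: "2 / 3 <= ?l" .
  have thr: "threshold \<delta> (total m R) = exp (\<delta> * ?l * ?l)" using N by (simp add: threshold_def powr_def)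
  have le: "exp ((1 + ?l) * (a * ?l)) <= threshold \<delta> (total m R)" if "3 * a <= \<delta>" "0 <= a" for a
  proof -
   have "(1 + ?l) * (a * ?l) <= (3 * ?l) * (a * ?l)" using l that by (intro mult_right_mono) auto
   also have "... = (3 * a) * (?l * ?l)" by simp
   also have "... <= \<delta> * (?l * ?l)" using that by (intro mult_right_mono) auto
   finally show ?thesis unfolding thr by (simp add: mult.assoc)
  qed
  show ?thesis
  proof (cases "(G + 4) * ?l <= m \<and> (G + 4) * ?l <= n")
   case True
   let ?b = "exp ((1 + ?l) * ((2 * (2 * G + 6) + Q) * ?l))"
   have b: "?b = exp ((1 + ?l) * (2 * ((2 * G + 6) * ?l) + 6 * \<alpha> ^ 5 * exp (4 * \<alpha> * (1 + ln 3)) / (lower_const \<alpha> \<beta>)\<^sup>2 * (2 * (G + 4) * ?l)))"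
    by (simp add: Q_def distrib_right mult.assoc)
   have "?b <= threshold \<delta> (total m R)" using G Q by (intro le) (auto simp: \<delta>_def)
   then show ?thesis
    using p_tail_large[OF s ab l, folded G_def, of "threshold \<delta> (total m R)"] True unfolding b by simp
  next
   case False
   have "p_fun m n R C X <= threshold \<delta> (total m R)" if X: "X \<in> positive_mats m n" for X
   proof -
    have Xp: "!!e. e \<in> idx m n ==> 0 < X e" using X by (simp only: positive_mats_iff)
    have "p_fun m n R C X <= exp ((1 + ?l) * ((G + 4) * ?l))"
    proof -
     have "(1 + ?l) * m <= (1 + ?l) * ((G + 4) * ?l) \<or> (1 + ?l) * n <= (1 + ?l) * ((G + 4) * ?l)"
      using False l by (auto intro!: mult_left_mono)
     then have "exp ((1 + ?l) * m) <= exp ((1 + ?l) * ((G + 4) * ?l)) \<or> exp ((1 + ?l) * n) <= exp ((1 + ?l) * ((G + 4) * ?l))" by simp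
     then show ?thesis using p_fun_le_dimension[of m n R C X, OF mar Xp] by linarith
    qed
    also have "... <= threshold \<delta> (total m R)" using G Q by (intro le) (auto simp: \<delta>_def)
    finally show ?thesis .
   qed
   then have E: "{X \<in> positive_mats m n. p_fun m n R C X > threshold \<delta> (total m R)} = {}" by force
   show ?thesis unfolding E by simp
  qed
 qed
 ultimately show ?thesis using that by blast
qed

section \<open>Polar coordinates on the simplex\<close>

declare measurable_entry [measurable del]

lemma measurable_upd_nn_integral:
 fixes F :: "('i => real) => ennreal"
 assumes F [measurable]: "F \<in> borel_measurable (\<Pi>\<^sub>M i\<in>insert i I. lborel)" and g [measurable]: "(%z. g (fst z) (snd z)) \<in> borel_measurable ((\<Pi>\<^sub>M i\<in>I. lborel) \<Otimes>\<^sub>M lborel)"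
 shows "(%z. F ((fst z)(i := g (fst z) (snd z)))) \<in> borel_measurable ((\<Pi>\<^sub>M i\<in>I. lborel) \<Otimes>\<^sub>M lborel)"
proof -
 have "(%z. (fst z)(i := g (fst z) (snd z))) \<in> measurable ((\<Pi>\<^sub>M i\<in>I. lborel) \<Otimes>\<^sub>M lborel) (\<Pi>\<^sub>M i\<in>insert i I. lborel)"
  by (rule measurable_fun_upd[where J = I]) auto
 then show ?thesis by (rule measurable_compose[OF _ F])
qed

lemma nn_integral_PiM_affine:
 fixes f :: "('i => real) => ennreal"
 assumes "finite I" "f \<in> borel_measurable (\<Pi>\<^sub>M i\<in>I. lborel)" and r: "r > 0"
 shows "(\<integral>\<^sup>+x. f x \<partial>(\<Pi>\<^sub>M i\<in>I. lborel)) = ennreal (r ^ card I) * (\<integral>\<^sup>+x. f (\<lambda>i\<in>I. a i + r * x i) \<partial>(\<Pi>\<^sub>M i\<in>I. lborel))"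
 using assms(1,2)
proof (induction I arbitrary: f)
 case empty
 interpret product_sigma_finite "%_::'i. lborel" ..
 show ?case using nn_integral_empty[of "%x. f (\<lambda>i\<in>{}. a i + r * x i)"] nn_integral_empty[of f] by (simp add: restrict_def)
next
 case (insert i I)
 interpret product_sigma_finite "%_::'i. lborel" ..
 interpret finite_product_sigma_finite "%_::'i. lborel" I by standard (rule insert.hyps)
 let ?M = "\<Pi>\<^sub>M i\<in>I. lborel :: real measure"
 let ?h = "%x. \<integral>\<^sup>+y. f (x(i := a i + r * y)) \<partial>lborel"
 have sect: "(%y. f (x(i := y))) \<in> borel_measurable borel" if "x \<in> space ?M" for x
  using measurable_compose[OF measurable_component_update[OF that insert.hyps(2)] insert.prems] by (simp add: fun_upd_def)
 have mh: "?h \<in> borel_measurable ?M"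
  using measurable_upd_nn_integral[OF insert.prems, of "%x y. a i + r * y"]
  by (intro lborel.borel_measurable_nn_integral) (simp add: case_prod_beta' fun_upd_def)
 have g: "(%x. f (\<lambda>j\<in>insert i I. a j + r * x j)) \<in> borel_measurable (\<Pi>\<^sub>M i\<in>insert i I. lborel)"
  by (rule measurable_compose[OF _ insert.prems]) (intro measurable_restrict, auto)
 have "(\<integral>\<^sup>+x. f x \<partial>(\<Pi>\<^sub>M i\<in>insert i I. lborel)) = (\<integral>\<^sup>+x. (\<integral>\<^sup>+y. f (x(i := y)) \<partial>lborel) \<partial>?M)"
  using insert by (simp add: product_nn_integral_insert)
 also have "... = (\<integral>\<^sup>+x. ennreal r * ?h x \<partial>?M)"
 proof (rule nn_integral_cong)
  fix x assume "x \<in> space ?M"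
  then show "(\<integral>\<^sup>+y. f (x(i := y)) \<partial>lborel) = ennreal r * ?h x"
   using nn_integral_real_affine[OF sect, of x r "a i"] r by simp
 qed
 also have "... = ennreal r * (\<integral>\<^sup>+x. ?h x \<partial>?M)" by (rule nn_integral_cmult) (rule mh)
 also have "(\<integral>\<^sup>+x. ?h x \<partial>?M) = ennreal (r ^ card I) * (\<integral>\<^sup>+x. ?h (\<lambda>i\<in>I. a i + r * x i) \<partial>?M)"
  by (rule insert.IH[OF mh])
 also have "(\<integral>\<^sup>+x. ?h (\<lambda>i\<in>I. a i + r * x i) \<partial>?M) = (\<integral>\<^sup>+x. (\<integral>\<^sup>+y. f (\<lambda>j\<in>insert i I. a j + r * (x(i := y)) j) \<partial>lborel) \<partial>?M)"
 proof (intro nn_integral_cong arg_cong[where f = f])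
  fix x y
  show "(\<lambda>i\<in>I. a i + r * x i)(i := a i + r * y) = (\<lambda>j\<in>insert i I. a j + r * (x(i := y)) j)"
   using insert.hyps by (auto simp: fun_eq_iff)
 qed
 also have "... = (\<integral>\<^sup>+x. f (\<lambda>j\<in>insert i I. a j + r * x j) \<partial>(\<Pi>\<^sub>M i\<in>insert i I. lborel))"
  using product_nn_integral_insert[OF insert.hyps g] by simp
 also have "ennreal r * (ennreal (r ^ card I) * z) = ennreal (r ^ card (insert i I)) * z" for z
  using insert.hyps r by (simp add: ennreal_mult mult.assoc)
 finally show ?case .
qed

lemma sets_mat_space: "sets (mat_space m n) = sets (mat_lebesgue m n)"
 unfolding mat_space_def mat_lebesgue_def by (rule sets_PiM_cong) auto

lemma measurable_mat_space: "f \<in> borel_measurable (mat_space m n) \<longleftrightarrow> f \<in> borel_measurable (mat_lebesgue m n)"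
 by (rule arg_cong[where f = "%S. f \<in> S"], rule measurable_cong_sets[OF sets_mat_space refl])

context
 fixes m n :: nat
 assumes mn: "0 < m" "0 < n"
begin

definition chart_idx :: "(nat \<times> nat) set" where
 "chart_idx = idx m n - {(0, 0)}"

definition chart :: "mat => mat" where
 "chart x = x((0, 0) := 1 - (\<Sum>e\<in>chart_idx. x e))"

definition chart_domain :: "mat set" where
 "chart_domain = {x \<in> chart_idx \<rightarrow>\<^sub>E {0<..}. (\<Sum>e\<in>chart_idx. x e) < 1}"

definition chart_measure :: "mat measure" where
 "chart_measure = (\<Pi>\<^sub>M e\<in>chart_idx. lborel)"

lemma chart_idx: "finite chart_idx" "(0, 0) \<notin> chart_idx" "idx m n = insert (0, 0) chart_idx" "card chart_idx = m * n - 1"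
 using mn by (auto simp: chart_idx_def idx_iff)

lemma sum_idx_chart: "(\<Sum>e\<in>idx m n. f e) = f (0, 0) + (\<Sum>e\<in>chart_idx. f e)"
 unfolding chart_idx(3) using chart_idx(1,2) by simp

lemma measurable_chart_domain [measurable]: "chart_domain \<in> sets chart_measure"
proof -
 have "chart_idx \<rightarrow>\<^sub>E {0<..} \<in> sets chart_measure"
  unfolding chart_measure_def using chart_idx(1) by (intro sets_PiM_I_finite) auto
 moreover have "{x \<in> space chart_measure. (\<Sum>e\<in>chart_idx. x e) < 1} \<in> sets chart_measure"
  unfolding chart_measure_def by measurable
 moreover have "chart_domain = (chart_idx \<rightarrow>\<^sub>E {0<..}) \<inter> {x \<in> space chart_measure. (\<Sum>e\<in>chart_idx. x e) < 1}"
  by (auto simp: chart_domain_def chart_measure_def space_PiM)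
 ultimately show ?thesis by auto
qed

lemma measurable_chart: "chart \<in> measurable chart_measure (mat_space m n)"
 unfolding chart_measure_def mat_space_def chart_def
proof (rule measurable_fun_upd[where J = chart_idx])
 show "idx m n = chart_idx \<union> {(0, 0)}" using chart_idx by auto
 show "(%x. x) \<in> measurable (\<Pi>\<^sub>M e\<in>chart_idx. lborel) (\<Pi>\<^sub>M e\<in>chart_idx. borel)"
  by (rule measurable_ident_sets) (rule sets_PiM_cong, auto)
qed measurable

lemma chart_in_simplex:
 assumes "x \<in> chart_domain"
 shows "chart x \<in> open_simplex m n"
proof -
 have "sum (chart x) chart_idx = sum x chart_idx"
  by (rule sum.cong) (use chart_idx(2) in \<open>auto simp: chart_def\<close>)
 then have "sum (chart x) (idx m n) = 1" unfolding sum_idx_chart by (simp add: chart_def)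
 moreover have "chart x \<in> positive_mats m n"
  unfolding positive_mats_def chart_idx(3) using assms by (auto simp: chart_domain_def chart_def PiE_def extensional_def Pi_def)
 ultimately show ?thesis by (simp add: open_simplex_def)
qed

text \<open>The entry \<open>(0, 0)\<close> is replaced by the total \<open>r\<close>; for fixed
  \<open>r\<close> the other entries are scaled by \<open>r\<close>, with Jacobian
  \<open>r ^ (m * n - 1)\<close>, and homogeneity gives \<open>r ^ d\<close>. What remains in
  \<open>r\<close> is a Gamma integral.\<close>

theorem polar:
 fixes F :: "mat => ennreal"
 assumes F [measurable]: "F \<in> borel_measurable (mat_lebesgue m n)"
  and hom: "!!X r. X \<in> open_simplex m n ==> 0 < r ==> F (\<lambda>e\<in>idx m n. r * X e) = ennreal (r ^ d) * F X"
 shows "(\<integral>\<^sup>+X. indicator (positive_mats m n) X * (F X * ennreal (exp (- (sum X (idx m n))))) \<partial>mat_lebesgue m n)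
  = ennreal (fact (m * n - 1 + d)) * (\<integral>\<^sup>+x. indicator chart_domain x * F (chart x) \<partial>chart_measure)"
proof -
 interpret product_sigma_finite "%_::nat \<times> nat. lborel :: real measure" ..
 interpret finite_product_sigma_finite "%_::nat \<times> nat. lborel :: real measure" chart_idx by standard (rule chart_idx)
 interpret pair_sigma_finite chart_measure "lborel :: real measure" unfolding chart_measure_def ..
 let ?o = "(0, 0) :: nat \<times> nat" and ?k = "m * n - 1"
 define H where "H X = indicator (positive_mats m n) X * (F X * ennreal (exp (- (sum X (idx m n)))))" for X
 have H [measurable]: "H \<in> borel_measurable (mat_lebesgue m n)" unfolding H_def using measurable_entry[measurable] by measurable
 have H' [measurable]: "H \<in> borel_measurable (\<Pi>\<^sub>M e\<in>insert ?o chart_idx. lborel)"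
  using H unfolding mat_lebesgue_def chart_idx(3) .
 let ?s = "%x :: mat. \<Sum>e\<in>chart_idx. x e"
 let ?J = "\<integral>\<^sup>+x. indicator chart_domain x * F (chart x) \<partial>chart_measure"
 have Fc: "(%x. F (chart x)) \<in> borel_measurable chart_measure"
  using measurable_compose[OF measurable_chart] F unfolding measurable_mat_space[symmetric] by blast
 have sect: "(%y. H (x(?o := y))) \<in> borel_measurable borel" if "x \<in> space chart_measure" for x
  using measurable_compose[OF measurable_component_update[OF _ chart_idx(2)] H', of x] that by (simp add: chart_measure_def fun_upd_def)
 have m2: "(%z. H ((fst z)(?o := snd z - ?s (fst z)))) \<in> borel_measurable (chart_measure \<Otimes>\<^sub>M lborel)"
  unfolding chart_measure_def by (rule measurable_upd_nn_integral[OF H']) measurable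
 have "(\<integral>\<^sup>+X. H X \<partial>mat_lebesgue m n) = (\<integral>\<^sup>+x. (\<integral>\<^sup>+y. H (x(?o := y)) \<partial>lborel) \<partial>chart_measure)"
  unfolding mat_lebesgue_def chart_measure_def chart_idx(3) by (rule product_nn_integral_insert[OF chart_idx(1,2) H'])
 also have "... = (\<integral>\<^sup>+x. (\<integral>\<^sup>+r. H (x(?o := r - ?s x)) \<partial>lborel) \<partial>chart_measure)"
 proof (rule nn_integral_cong)
  fix x assume x: "x \<in> space chart_measure"
  show "(\<integral>\<^sup>+y. H (x(?o := y)) \<partial>lborel) = (\<integral>\<^sup>+r. H (x(?o := r - ?s x)) \<partial>lborel)"
   using nn_integral_real_affine[OF sect[OF x], of 1 "- ?s x"] by simp
 qed
 also have "... = (\<integral>\<^sup>+r. (\<integral>\<^sup>+x. H (x(?o := r - ?s x)) \<partial>chart_measure) \<partial>lborel)"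
  by (rule Fubini'[symmetric]) (use m2 in \<open>simp add: case_prod_beta' fun_upd_def\<close>)
 also have "... = (\<integral>\<^sup>+r. ennreal (fact (?k + d)) * ?J * ennreal (erlang_density (?k + d) 1 r) \<partial>lborel)"
 proof (rule nn_integral_cong_AE, use AE_lborel_singleton[of "0 :: real"] in eventually_elim)
  fix r :: real assume r0: "r \<noteq> 0"
  show "(\<integral>\<^sup>+x. H (x(?o := r - ?s x)) \<partial>chart_measure) = ennreal (fact (?k + d)) * ?J * ennreal (erlang_density (?k + d) 1 r)"
  \<comment> \<open>Positive matrices have a positive total, so negative \<open>r\<close> contribute
    nothing, in accordance with \<open>erlang_density\<close>.\<close>
  proof (cases "r < 0")
   case True
   have "H (x(?o := r - ?s x)) = 0" for x
   proof -
    have "x(?o := r - ?s x) \<notin> positive_mats m n"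
    proof
     assume "x(?o := r - ?s x) \<in> positive_mats m n"
     then have p: "!!e. e \<in> idx m n ==> 0 < (x(?o := r - ?s x)) e" by (simp only: positive_mats_iff)
     have "0 <= ?s x"
     proof (rule sum_nonneg)
      fix e assume "e \<in> chart_idx" then show "0 <= x e" using p[of e] chart_idx(2,3) by (cases "e = ?o") auto
     qed
     then show False using p[of ?o] True chart_idx(3) by simp
    qed
    then show ?thesis by (simp add: H_def)
   qed
   then show ?thesis using True by (simp add: erlang_density_def)
  next
   case False
   then have r: "r > 0" using r0 by simp
   have g: "(%x. H (x(?o := r - ?s x))) \<in> borel_measurable chart_measure"
    using measurable_compose[OF measurable_Pair2'[of r] m2]
     measurable_compose[of "%x. (x, r)" chart_measure "chart_measure \<Otimes>\<^sub>M lborel", OF _ m2] by simp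
   have "(\<integral>\<^sup>+x. H (x(?o := r - ?s x)) \<partial>chart_measure) = ennreal (r ^ ?k) * (\<integral>\<^sup>+x. H ((\<lambda>i\<in>chart_idx. 0 + r * x i)(?o := r - ?s (\<lambda>i\<in>chart_idx. 0 + r * x i))) \<partial>chart_measure)"
    using nn_integral_PiM_affine[OF chart_idx(1) g[unfolded chart_measure_def] r, of "%_. 0"] chart_idx(4) by (simp add: chart_measure_def)
   also have "(\<integral>\<^sup>+x. H ((\<lambda>i\<in>chart_idx. 0 + r * x i)(?o := r - ?s (\<lambda>i\<in>chart_idx. 0 + r * x i))) \<partial>chart_measure)
    = (\<integral>\<^sup>+x. ennreal (r ^ d * exp (- r)) * (indicator chart_domain x * F (chart x)) \<partial>chart_measure)"
   proof (rule nn_integral_cong)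
    fix x assume "x \<in> space chart_measure"
    then have x: "x \<in> extensional chart_idx" by (simp add: chart_measure_def space_PiM PiE_def)
    have eq: "(\<lambda>i\<in>chart_idx. 0 + r * x i)(?o := r - ?s (\<lambda>i\<in>chart_idx. 0 + r * x i)) = (\<lambda>e\<in>idx m n. r * chart x e)"
     using chart_idx by (auto simp: fun_eq_iff chart_def sum_distrib_left right_diff_distrib)
    show "H ((\<lambda>i\<in>chart_idx. 0 + r * x i)(?o := r - ?s (\<lambda>i\<in>chart_idx. 0 + r * x i))) = ennreal (r ^ d * exp (- r)) * (indicator chart_domain x * F (chart x))"
    proof (cases "x \<in> chart_domain")
     case True
     then have c: "chart x \<in> open_simplex m n" by (rule chart_in_simplex)
     then have "(\<lambda>e\<in>idx m n. r * chart x e) \<in> positive_mats m n" using r by (auto simp: open_simplex_def positive_mats_iff)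
     moreover have "(\<Sum>e\<in>idx m n. (\<lambda>e\<in>idx m n. r * chart x e) e) = r"
      using c by (simp add: open_simplex_def sum_distrib_left[symmetric])
     ultimately show ?thesis unfolding eq H_def using True r hom[OF c r] by (simp add: ennreal_mult mult_ac)
    next
     case False
     have "(\<lambda>e\<in>idx m n. r * chart x e) \<notin> positive_mats m n"
     proof
      assume "(\<lambda>e\<in>idx m n. r * chart x e) \<in> positive_mats m n"
      then have p: "0 < chart x e" if "e \<in> idx m n" for e using that r by (auto simp: positive_mats_iff zero_less_mult_iff)
      have "0 < x e" if "e \<in> chart_idx" for e using p[of e] that chart_idx(2,3) by (cases "e = ?o") (auto simp: chart_def)
      moreover have "?s x < 1" using p[of ?o] chart_idx(3) by (simp add: chart_def)
      ultimately have "x \<in> chart_domain" using x by (simp add: chart_domain_def PiE_def Pi_def)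
      then show False using False by blast
     qed
     then show ?thesis unfolding eq H_def using False by simp
    qed
   qed
   also have "... = ennreal (r ^ d * exp (- r)) * ?J" by (rule nn_integral_cmult) (use Fc in measurable)
   also have "ennreal (r ^ ?k) * (ennreal (r ^ d * exp (- r)) * ?J) = ennreal (r ^ (?k + d) * exp (- r)) * ?J"
    using r by (simp add: mult.assoc[symmetric] ennreal_mult[symmetric] power_add)
   also have "r ^ (?k + d) * exp (- r) = fact (?k + d) * erlang_density (?k + d) 1 r"
    using r by (simp add: erlang_density_def)
   also have "ennreal (fact (?k + d) * erlang_density (?k + d) 1 r) * ?J = ennreal (fact (?k + d)) * ?J * ennreal (erlang_density (?k + d) 1 r)"
    by (simp add: ennreal_mult' mult_ac)
   finally show ?thesis .
  qed
 qed
 also have "... = ennreal (fact (?k + d)) * ?J * (\<integral>\<^sup>+r. ennreal (erlang_density (?k + d) 1 r) \<partial>lborel)"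
  by (rule nn_integral_cmult) measurable
 also have "(\<integral>\<^sup>+r. ennreal (erlang_density (?k + d) 1 r) \<partial>lborel) = 1" using nn_integral_erlang_ith_moment[of 1 "?k + d" 0] by simp
 finally show ?thesis by (simp add: H_def)
qed

text \<open>\<open>polar\<close> for the constant function and \<open>d = 0\<close>; the integral
  over the orthant is 1 because zero margins have exactly one table.\<close>

lemma nn_integral_chart_domain: "emeasure chart_measure chart_domain = ennreal (1 / fact (m * n - 1))"
proof -
 let ?z = "%_::nat. 0 :: nat"
 have "ennreal (fact (m * n - 1)) * emeasure chart_measure chart_domain
   = (\<integral>\<^sup>+X. indicator (positive_mats m n) X * (1 * ennreal (exp (- (sum X (idx m n))))) \<partial>mat_lebesgue m n)"
  by (subst polar[where d = 0]) auto
 also have "... = 1"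
  using nn_integral_table_poly[of m n ?z ?z] by (simp add: table_poly_zero num_tables_zero)
 finally have "ennreal (1 / fact (m * n - 1)) * (ennreal (fact (m * n - 1)) * emeasure chart_measure chart_domain) = ennreal (1 / fact (m * n - 1))"
  by simp
 then show ?thesis by (simp add: mult.assoc[symmetric] ennreal_mult[symmetric])
qed

lemma simplex_measure_eq:
 "simplex_measure m n = restrict_space (distr (uniform_measure chart_measure chart_domain) (mat_space m n) chart) (open_simplex m n)"
 by (simp add: simplex_measure_def Let_def chart_measure_def chart_domain_def chart_idx_def chart_def[abs_def])

lemma sets_open_simplex: "open_simplex m n \<in> sets (mat_space m n)"
proof -
 have "{X \<in> space (mat_lebesgue m n). (sum X (idx m n)) = 1} \<in> sets (mat_lebesgue m n)"
  using measurable_entry[measurable] by measurable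
 moreover have "open_simplex m n = positive_mats m n \<inter> {X \<in> space (mat_lebesgue m n). (sum X (idx m n)) = 1}"
  by (auto simp: open_simplex_def space_mat_lebesgue positive_mats_def PiE_def)
 ultimately show ?thesis unfolding sets_mat_space using sets_positive_mats by auto
qed

lemma space_simplex: "space (simplex_measure m n) = open_simplex m n"
 using sets.sets_into_space[OF sets_open_simplex] by (auto simp: simplex_measure_eq space_restrict_space)

lemma sets_simplex: "sets (simplex_measure m n) = sets (restrict_space (mat_space m n) (open_simplex m n))"
 by (simp add: simplex_measure_eq sets_restrict_space)

lemma measurable_simplex:
 assumes "f \<in> borel_measurable (mat_lebesgue m n)"
 shows "f \<in> borel_measurable (simplex_measure m n)"
 using assms measurable_restrict_space1[of f "mat_space m n" borel "open_simplex m n"]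
 unfolding measurable_cong_sets[OF sets_simplex refl] measurable_mat_space[symmetric] by blast

lemma nn_integral_simplex:
 assumes F: "F \<in> borel_measurable (mat_lebesgue m n)"
 shows "(\<integral>\<^sup>+X. F X \<partial>simplex_measure m n)
  = ennreal (fact (m * n - 1)) * (\<integral>\<^sup>+x. indicator chart_domain x * F (chart x) \<partial>chart_measure)"
proof -
 have O: "open_simplex m n \<inter> space (distr (uniform_measure chart_measure chart_domain) (mat_space m n) chart) \<in> sets (distr (uniform_measure chart_measure chart_domain) (mat_space m n) chart)"
  using sets_open_simplex by auto
 have c: "chart \<in> measurable (uniform_measure chart_measure chart_domain) (mat_space m n)"
  using measurable_chart by (simp add: measurable_cong_sets[OF sets_uniform_measure refl])
 have F': "F \<in> borel_measurable (mat_space m n)" using F by (simp add: measurable_mat_space)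
 have G: "(%X. F X * indicator (open_simplex m n) X) \<in> borel_measurable (mat_space m n)"
  using F' sets_open_simplex by measurable
 have "(\<integral>\<^sup>+X. F X \<partial>simplex_measure m n) = (\<integral>\<^sup>+x. F (chart x) * indicator (open_simplex m n) (chart x) \<partial>uniform_measure chart_measure chart_domain)"
  unfolding simplex_measure_eq nn_integral_restrict_space[OF O] by (rule nn_integral_distr[OF c]) (simp add: G)
 also have "... = (\<integral>\<^sup>+x. F (chart x) * indicator (open_simplex m n) (chart x) * indicator chart_domain x \<partial>chart_measure) / emeasure chart_measure chart_domain"
  by (rule nn_integral_uniform_measure) (rule measurable_compose[OF measurable_chart G], rule measurable_chart_domain)
 also have "(\<integral>\<^sup>+x. F (chart x) * indicator (open_simplex m n) (chart x) * indicator chart_domain x \<partial>chart_measure)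
   = (\<integral>\<^sup>+x. indicator chart_domain x * F (chart x) \<partial>chart_measure)"
  using chart_in_simplex by (intro nn_integral_cong) (auto split: split_indicator)
 also have "z / emeasure chart_measure chart_domain = ennreal (fact (m * n - 1)) * z" for z
  unfolding nn_integral_chart_domain by (simp add: divide_ennreal_def inverse_ennreal mult.commute)
 finally show ?thesis .
qed

lemma prob_space_simplex: "prob_space (simplex_measure m n)"
proof
 have "emeasure (simplex_measure m n) (space (simplex_measure m n)) = (\<integral>\<^sup>+X. 1 \<partial>simplex_measure m n)" by simp
 also have "... = 1"
  by (subst nn_integral_simplex) (auto simp: nn_integral_chart_domain ennreal_mult[symmetric])
 finally show "emeasure (simplex_measure m n) (space (simplex_measure m n)) = 1" .
qed

theorem simplex_homogeneous:
 fixes F :: "mat => ennreal"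
 assumes F: "F \<in> borel_measurable (mat_lebesgue m n)"
  and hom: "!!X r. X \<in> open_simplex m n ==> 0 < r ==> F (\<lambda>e\<in>idx m n. r * X e) = ennreal (r ^ d) * F X"
 shows "(\<integral>\<^sup>+X. indicator (positive_mats m n) X * (F X * ennreal (exp (- (sum X (idx m n))))) \<partial>mat_lebesgue m n)
  = ennreal (fact (m * n - 1 + d) / fact (m * n - 1)) * (\<integral>\<^sup>+X. F X \<partial>simplex_measure m n)"
proof -
 have "ennreal (fact (m * n - 1 + d) / fact (m * n - 1)) * ennreal (fact (m * n - 1)) = ennreal (fact (m * n - 1 + d))"
  by (simp add: ennreal_mult[symmetric])
 then have "ennreal (fact (m * n - 1 + d)) * z = ennreal (fact (m * n - 1 + d) / fact (m * n - 1)) * (ennreal (fact (m * n - 1)) * z)" for z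
  by (simp only: mult.assoc[symmetric])
 then show ?thesis unfolding nn_integral_simplex[OF F] using polar[where F = F and d = d, OF F hom] by simp
qed

end

declare measurable_entry [measurable]

section \<open>The function phi\<close>

lemma fact_add_prod: "0 < d ==> fact (d - 1 + N) = (fact (d - 1) * (\<Prod>k<N. real (d + k)) :: real)"
proof (induction N)
 case (Suc N)
 have "fact (d - 1 + Suc N) = real (d + N) * fact (d - 1 + N)"
  using Suc.prems by (simp add: fact_num_eq_if)
 then show ?case using Suc by simp
qed simp

text \<open>Each factor satisfies \<open>y <= exp (y - 1)\<close> with
  \<open>y = (d + k) / N\<close>, and \<open>k / N - 1\<close> is not positive.\<close>

lemma prod_rising_le:
 assumes "0 < N"
 shows "(\<Prod>k<N. real (d + k)) <= exp (real d) * real N ^ N"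
proof -
 have "(\<Prod>k<N. real (d + k) / N) <= (\<Prod>k<N. exp (real (d + k) / N - 1))"
 proof (rule prod_mono)
  fix k show "0 <= real (d + k) / N \<and> real (d + k) / N <= exp (real (d + k) / N - 1)"
   using exp_ge_add_one_self[of "real (d + k) / N - 1"] by simp
 qed
 also have "... = exp (\<Sum>k<N. real (d + k) / N - 1)" by (simp add: exp_sum)
 also have "(\<Sum>k<N. real (d + k) / N - 1) <= (\<Sum>k<N. real d / N)"
 proof (rule sum_mono)
  fix k assume "k \<in> {..<N}"
  then have "real k / N <= 1" by simp
  then show "real (d + k) / N - 1 <= real d / N" by (simp add: add_divide_distrib)
 qed
 also have "... = d" using assms by simp
 finally show ?thesis using assms by (simp add: prod_dividef divide_simps mult.commute)
qed

lemma table_poly_homogeneous: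
 "table_poly m n R C (\<lambda>e\<in>idx m n. r * X e) = r ^ total m R * table_poly m n R C X"
proof -
 have "table_poly m n R C (\<lambda>e\<in>idx m n. r * X e) = table_poly m n R C (%(i, j). X (i, j) * (%_. r) i * (%_. 1) j)"
  by (rule table_poly_cong) auto
 also have "... = r ^ total m R * table_poly m n R C X"
  unfolding table_poly_scale[of m n R C X "%_. r" "%_. 1"] by (simp add: scaling_product_def total_def power_sum case_prod_beta)
 finally show ?thesis .
qed

lemma p_fun_homogeneous:
 assumes "margins m n R C" "X \<in> positive_mats m n" "0 < r"
 shows "p_fun m n R C (\<lambda>e\<in>idx m n. r * X e) = p_fun m n R C X"
proof -
 have X: "!!e. e \<in> idx m n ==> 0 < X e" using assms(2) by (simp only: positive_mats_iff)
 then have X': "!!e. e \<in> idx m n ==> 0 < (\<lambda>e\<in>idx m n. r * X e) e" using assms(3) by simp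
 have "scaling_value m n R C (\<lambda>e\<in>idx m n. r * X e) = r ^ total m R * scaling_value m n R C X"
  by (rule scaling_value_homogeneous) (use assms X in auto)
 moreover note p_fun_eq[of m n R C "\<lambda>e\<in>idx m n. r * X e", OF assms(1) X'] p_fun_eq[of m n R C X, OF assms(1) X]
 ultimately show ?thesis using assms(3) by (simp add: table_poly_homogeneous)
qed

lemma open_simplex_positive: "X \<in> open_simplex m n ==> X \<in> positive_mats m n"
 by (simp add: open_simplex_def)

lemma open_simplex_pos: "X \<in> open_simplex m n ==> e \<in> idx m n ==> 0 < X e"
 unfolding open_simplex_def mem_Collect_eq positive_mats_iff by blast

lemma positive_mats_scale:
 assumes "0 < r" "X \<in> positive_mats m n"
 shows "(\<lambda>e\<in>idx m n. r * X e) \<in> positive_mats m n"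
 using assms by (auto simp: positive_mats_iff)

lemma open_simplex_sum: "X \<in> open_simplex m n ==> (sum X (idx m n)) = 1"
 by (simp add: open_simplex_def)

context
 fixes m n :: nat and R C :: "nat => nat" and T :: toolkit
 assumes mar: "margins m n R C" and T: "scaling_ok T"
begin

abbreviation (input) "N \<equiv> total m R"
abbreviation (input) "S \<equiv> simplex_measure m n"
abbreviation (input) "P \<equiv> p_fun m n R C"
abbreviation (input) "F \<equiv> phi_fun m n R C"
abbreviation (input) "sv \<equiv> scaling_value m n R C"

lemmas mpos = margins_pos[OF mar]

text \<open>The scaling value is given by a definite description, but it is the pointwise limit of
  the outputs of the scaling procedure for tolerances tending to 0, and these are measurable by
  \<open>scaling_ok\<close>.\<close>

lemma measurable_scaling_value: "sv \<in> borel_measurable (restrict_space (mat_space m n) (positive_mats m n))"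
proof -
 let ?M = "restrict_space (mat_space m n) (positive_mats m n)" and ?\<eta> = "%k::nat. 1 / (real k + 2)"
 define f where "f k X = (case scaling T m n R C (?\<eta> k) X of (l, u, t) => scaling_product m n R C l u)" for k X
 have "f k \<in> borel_measurable ?M" for k
 proof -
  have k: "?\<eta> k \<in> {0<..<1}" by simp
  have "\<forall>i<m. (%X. fst (scaling T m n R C (?\<eta> k) X) i) \<in> borel_measurable ?M"
   "\<forall>j<n. (%X. fst (snd (scaling T m n R C (?\<eta> k) X)) j) \<in> borel_measurable ?M"
   using T mar k unfolding scaling_ok_def by blast+
  then show ?thesis unfolding f_def scaling_product_def case_prod_beta
   by (intro borel_measurable_times borel_measurable_prod borel_measurable_power) auto
 qed
 moreover have "(%k. f k X) \<longlonglongrightarrow> sv X" if "X \<in> space ?M" for X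
 proof -
  have X: "X \<in> positive_mats m n" using that by (simp add: space_restrict_space)
  have "\<bar>f k X - sv X\<bar> <= ?\<eta> k * sv X" for k
  proof -
   have k: "?\<eta> k \<in> {0<..<1}" by simp
   show ?thesis using T mar X k unfolding scaling_ok_def f_def by (fastforce split: prod.splits)
  qed
  moreover have "(%k. ?\<eta> k * sv X) \<longlonglongrightarrow> 0" by (rule tendsto_mult_left_zero) real_asymp
  ultimately have "(%k. f k X - sv X) \<longlonglongrightarrow> 0"
   by (intro Lim_null_comparison[of "%k. f k X - sv X"]) auto
  then show ?thesis by (simp add: LIM_zero_iff)
 qed
 ultimately show ?thesis by (rule borel_measurable_LIMSEQ_real[rotated])
qed

lemma measurable_table_poly: "table_poly m n R C \<in> borel_measurable (mat_lebesgue m n)"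
 unfolding table_poly_def[abs_def] by measurable

lemma restrict_pos:
 "f \<in> borel_measurable (restrict_space (mat_space m n) (positive_mats m n)) \<longleftrightarrow>
 (%X. indicator (positive_mats m n) X * f X) \<in> borel_measurable (mat_lebesgue m n)" for f :: "mat => real"
proof -
 have "positive_mats m n \<inter> space (mat_space m n) \<in> sets (mat_space m n)"
  using sets_positive_mats[of m n] by (simp add: sets_mat_space[symmetric])
 from borel_measurable_restrict_space_iff[OF this, of f] show ?thesis by (simp add: measurable_mat_space)
qed

lemma restrict_simplex:
 assumes "f \<in> borel_measurable (restrict_space (mat_space m n) (positive_mats m n))"
 shows "f \<in> borel_measurable S"
 unfolding measurable_cong_sets[OF sets_simplex[OF mpos(2,3)] refl]
 by (rule measurable_restrict_mono[OF assms]) (auto simp: open_simplex_def)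

lemma measurable_p: "P \<in> borel_measurable (restrict_space (mat_space m n) (positive_mats m n))"
proof -
 have "(%X. table_poly m n R C X) \<in> borel_measurable (restrict_space (mat_space m n) (positive_mats m n))"
  by (rule measurable_restrict_space1) (use measurable_table_poly in \<open>simp add: measurable_mat_space\<close>)
 note [measurable] = this measurable_scaling_value
 have "P X = real N ^ N / fact N * (\<Prod>i<m. fact (R i) / real (R i) ^ R i) * (\<Prod>j<n. fact (C j) / real (C j) ^ C j) * (table_poly m n R C X / sv X)"
  if "X \<in> space (restrict_space (mat_space m n) (positive_mats m n))" for X
 proof (rule p_fun_eq[OF mar])
  have "X \<in> positive_mats m n" using that by (simp add: space_restrict_space)
  then show "!!e. e \<in> idx m n ==> 0 < X e" by (simp only: positive_mats_iff)
 qed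
 note cong = measurable_cong[OF this]
 show ?thesis by (subst cong) (assumption, measurable)
qed

lemma measurable_phi: "F \<in> borel_measurable (restrict_space (mat_space m n) (positive_mats m n))"
 using measurable_scaling_value unfolding phi_fun_def[abs_def] by measurable

lemma phi_const_pos: "0 < phi_const m n R C"
proof -
 have "\<forall>i<m. 0 < R i" "\<forall>j<n. 0 < C j" using mar by (auto simp: margins_def)
 then show ?thesis unfolding phi_const_def Let_def using mpos(1)
  by (intro mult_pos_pos divide_pos_pos prod_pos) auto
qed

lemma scaling_value_simplex_pos: "X \<in> open_simplex m n ==> 0 < sv X"
 using scaling_value_pos[of m n R C X, OF mar] open_simplex_pos by blast

lemma phi_pos: "X \<in> open_simplex m n ==> 0 < F X"
 unfolding phi_fun_def using phi_const_pos scaling_value_simplex_pos by simp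

lemma p_times_phi:
 assumes "X \<in> open_simplex m n"
 shows "P X * F X = fact (m * n - 1 + N) / fact (m * n - 1) * table_poly m n R C X"
proof -
 have R: "(\<Prod>i<m. fact (R i) / real (R i) ^ R i) * (\<Prod>i<m. real (R i) ^ R i / fact (R i)) = 1"
  "(\<Prod>j<n. fact (C j) / real (C j) ^ C j) * (\<Prod>j<n. real (C j) ^ C j / fact (C j)) = 1"
  unfolding prod.distrib[symmetric] by (auto intro!: prod.neutral)
 have "0 < sv X" by (rule scaling_value_simplex_pos[OF assms])
 moreover have "m * n - 1 + N = N + m * n - 1" using mpos by (cases "m * n") auto
 moreover have id: "a / b * r * c * (h / s) * (k * b / (d * a) * r' * c' * s) = k / d * h"
  if "r * r' = 1" "c * c' = 1" "a \<noteq> 0" "b \<noteq> 0" "s \<noteq> 0" for a b c c' r r' h s k d :: real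
 proof -
  have "a / b * r * c * (h / s) * (k * b / (d * a) * r' * c' * s) = k / d * h * (r * r') * (c * c')"
   using that(3-5) by simp
  then show ?thesis using that by simp
 qed
 moreover have "P X = real N ^ N / fact N * (\<Prod>i<m. fact (R i) / real (R i) ^ R i) * (\<Prod>j<n. fact (C j) / real (C j) ^ C j)
   * (table_poly m n R C X / sv X)"
  by (rule p_fun_eq[OF mar open_simplex_pos[OF assms]])
 ultimately show ?thesis
  unfolding phi_fun_def phi_const_def Let_def using mpos(1) by (simp only:) (rule id[OF R], auto)
qed

text \<open>\<open>A\<close> is a cone over its part in the simplex, so its indicator keeps the
  integrand homogeneous; it is used for the whole space and for the set where p exceeds a
  threshold.\<close>

lemma nn_integral_simplex_table_poly:
 assumes A: "(%X. indicator A X * table_poly m n R C X) \<in> borel_measurable (mat_lebesgue m n)"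
  and hom: "!!X r. X \<in> open_simplex m n ==> 0 < r ==> (\<lambda>e\<in>idx m n. r * X e) \<in> A \<longleftrightarrow> X \<in> A"
 shows "ennreal (fact (m * n - 1 + N) / fact (m * n - 1)) * (\<integral>\<^sup>+X. ennreal (indicator A X * table_poly m n R C X) \<partial>S)
  = (\<integral>\<^sup>+X. indicator (positive_mats m n) X * ennreal (indicator A X * table_poly m n R C X * exp (- (sum X (idx m n)))) \<partial>mat_lebesgue m n)"
proof -
 have m: "(%X. ennreal (indicator A X * table_poly m n R C X)) \<in> borel_measurable (mat_lebesgue m n)" using A by measurable
 show ?thesis
 proof (subst simplex_homogeneous[OF mpos(2,3) m, symmetric])
  fix X and r :: real assume "X \<in> open_simplex m n" "0 < r"
  then show "ennreal (indicator A (\<lambda>e\<in>idx m n. r * X e) * table_poly m n R C (\<lambda>e\<in>idx m n. r * X e)) = ennreal (r ^ N) * ennreal (indicator A X * table_poly m n R C X)"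
   unfolding table_poly_homogeneous using hom[of X r] by (auto simp: ennreal_mult'[symmetric] split: split_indicator)
 qed (simp add: ennreal_mult'')
qed

lemma table_poly_simplex_nonneg: "X \<in> open_simplex m n ==> 0 <= table_poly m n R C X"
 using table_poly_pos[of m R n C X, OF mpos(4)] open_simplex_pos[of X] by (meson less_imp_le)

lemma nn_integral_p_phi: "(\<integral>\<^sup>+X. ennreal (P X * F X) \<partial>S) = ennreal (num_tables m n R C)"
proof -
 have "(\<integral>\<^sup>+X. ennreal (P X * F X) \<partial>S) = (\<integral>\<^sup>+X. ennreal (fact (m * n - 1 + N) / fact (m * n - 1)) * ennreal (indicator UNIV X * table_poly m n R C X) \<partial>S)"
  by (rule nn_integral_cong) (simp add: space_simplex[OF mpos(2,3)] p_times_phi ennreal_mult'[symmetric])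
 also have "... = ennreal (fact (m * n - 1 + N) / fact (m * n - 1)) * (\<integral>\<^sup>+X. ennreal (indicator UNIV X * table_poly m n R C X) \<partial>S)"
  by (rule nn_integral_cmult) (use measurable_simplex[OF mpos(2,3) measurable_table_poly] in measurable)
 also have "... = ennreal (num_tables m n R C)"
  by (subst nn_integral_simplex_table_poly) (use measurable_table_poly nn_integral_table_poly[of m n R C] in auto)
 finally show ?thesis .
qed

lemma nn_integral_p_phi_large:
 "(\<integral>\<^sup>+X. ennreal (indicator {X. P X > \<tau>} X * (P X * F X)) \<partial>S)
  = ennreal (num_tables m n R C) * emeasure (psi_measure m n R C) {X \<in> positive_mats m n. P X > \<tau>}"
proof -
 let ?A = "{X \<in> positive_mats m n. P X > \<tau>}"
 let ?c = "fact (m * n - 1 + N) / fact (m * n - 1) :: real"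
 have "?A = {X \<in> space (mat_lebesgue m n). indicator (positive_mats m n) X * P X > \<tau> \<and> X \<in> positive_mats m n}"
  by (auto simp: space_mat_lebesgue positive_mats_iff)
 also have "... \<in> sets (mat_lebesgue m n)" using measurable_p[unfolded restrict_pos] by measurable
 finally have A [measurable]: "?A \<in> sets (mat_lebesgue m n)" .
 note [measurable] = measurable_table_poly
 have psi [measurable]: "psi m n R C \<in> borel_measurable (mat_lebesgue m n)" unfolding psi_def[abs_def] by measurable
 have "(\<integral>\<^sup>+X. ennreal (indicator {X. P X > \<tau>} X * (P X * F X)) \<partial>S) = (\<integral>\<^sup>+X. ennreal ?c * ennreal (indicator ?A X * table_poly m n R C X) \<partial>S)"
  by (rule nn_integral_cong) (auto simp: space_simplex[OF mpos(2,3)] p_times_phi ennreal_mult'[symmetric] open_simplex_positive split: split_indicator)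
 also have "... = ennreal ?c * (\<integral>\<^sup>+X. ennreal (indicator ?A X * table_poly m n R C X) \<partial>S)"
  by (rule nn_integral_cmult) (intro measurable_compose[OF _ measurable_ennreal] measurable_simplex[OF mpos(2,3)], measurable)
 also have "... = (\<integral>\<^sup>+X. indicator (positive_mats m n) X * ennreal (indicator ?A X * table_poly m n R C X * exp (- (sum X (idx m n)))) \<partial>mat_lebesgue m n)"
 proof (rule nn_integral_simplex_table_poly)
  fix X and r :: real assume "X \<in> open_simplex m n" "0 < r"
  then show "(\<lambda>e\<in>idx m n. r * X e) \<in> ?A \<longleftrightarrow> X \<in> ?A"
   using p_fun_homogeneous[OF mar open_simplex_positive] positive_mats_scale open_simplex_positive by auto
 qed measurable
 also have "... = (\<integral>\<^sup>+X. ennreal (num_tables m n R C) * (ennreal (psi m n R C X) * indicator ?A X) \<partial>mat_lebesgue m n)"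
  using num_tables_pos[OF mpos(4)]
  by (intro nn_integral_cong) (auto simp: psi_eq ennreal_mult'[symmetric] split: split_indicator)
 also have "... = ennreal (num_tables m n R C) * (\<integral>\<^sup>+X. ennreal (psi m n R C X) * indicator ?A X \<partial>mat_lebesgue m n)"
  by (rule nn_integral_cmult) measurable
 also have "(\<integral>\<^sup>+X. ennreal (psi m n R C X) * indicator ?A X \<partial>mat_lebesgue m n) = emeasure (psi_measure m n R C) ?A"
  unfolding psi_measure_def by (rule emeasure_density[symmetric]) auto
 finally show ?thesis .
qed

lemma p_phi_integrable: "integrable S (%X. P X * F X)" "(\<integral>X. P X * F X \<partial>S) = num_tables m n R C"
proof -
 note [measurable] = restrict_simplex[OF measurable_p] restrict_simplex[OF measurable_phi]
 have nn: "AE X in S. 0 <= P X * F X"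
  by (rule AE_I2) (simp add: space_simplex[OF mpos(2,3)] p_times_phi table_poly_simplex_nonneg)
 show "integrable S (%X. P X * F X)"
  by (rule integrableI_nonneg[OF _ nn]) (auto simp: nn_integral_p_phi)
 show "(\<integral>X. P X * F X \<partial>S) = num_tables m n R C"
  by (subst integral_eq_nn_integral[OF _ nn]) (auto simp: nn_integral_p_phi)
qed

lemma p_simplex_ge_1: "X \<in> open_simplex m n ==> 1 <= P X"
 by (rule p_fun_ge_1[OF mar open_simplex_pos])

text \<open>Since p is at least 1, \<open>F\<close> is dominated by the integrable product of p and
  phi.\<close>

lemma phi_integrable: "integrable S F" "0 < (\<integral>X. F X \<partial>S)"
proof -
 interpret prob_space S by (rule prob_space_simplex[OF mpos(2,3)])
 have sp: "space S = open_simplex m n" by (rule space_simplex[OF mpos(2,3)])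
 show i: "integrable S F"
 proof (rule Bochner_Integration.integrable_bound[OF p_phi_integrable(1) restrict_simplex[OF measurable_phi]], rule AE_I2)
  fix X assume "X \<in> space S"
  then have "1 <= P X" "0 < F X" using p_simplex_ge_1 phi_pos sp by auto
  then show "norm (F X) <= norm (P X * F X)" by (simp add: abs_mult)
 qed
 have "(\<integral>X. F X \<partial>S) \<noteq> 0"
 proof
  assume "(\<integral>X. F X \<partial>S) = 0"
  then have "AE X in S. F X = 0"
   by (subst (asm) integral_nonneg_eq_0_iff_AE[OF i]) (auto simp: sp phi_pos less_imp_le)
  moreover have "AE X in S. F X \<noteq> 0" by (rule AE_I2) (use phi_pos sp in force)
  ultimately have "AE X in S. False" by eventually_elim simp
  then show False by simp
 qed
 moreover have "0 <= (\<integral>X. F X \<partial>S)" by (rule Bochner_Integration.integral_nonneg) (simp add: sp phi_pos less_imp_le)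
 ultimately show "0 < (\<integral>X. F X \<partial>S)" by simp
qed

text \<open>The loss is confined to the set where \<open>P\<close> exceeds \<open>\<tau>\<close>,
  and there it is at most the full integrand, whose integral is the number of tables times the tail
  probability.\<close>

lemma truncated_integral:
 assumes tau: "1 <= \<tau>" and d: "emeasure (psi_measure m n R C) {X \<in> positive_mats m n. P X > \<tau>} <= ennreal d" "0 <= d"
 shows "integrable S (%X. min (P X) \<tau> * F X)" "(\<integral>X. min (P X) \<tau> * F X \<partial>S) <= num_tables m n R C"
  "(1 - d) * num_tables m n R C <= (\<integral>X. min (P X) \<tau> * F X \<partial>S)"
proof -
 note sp = space_simplex[OF mpos(2,3)]
 note [measurable] = restrict_simplex[OF measurable_p] restrict_simplex[OF measurable_phi]
 have b: "0 <= min (P X) \<tau> * F X" "min (P X) \<tau> * F X <= P X * F X" if "X \<in> space S" for X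
  using that p_simplex_ge_1[of X] phi_pos[of X] tau by (auto simp: sp intro!: mult_right_mono)
 show i: "integrable S (%X. min (P X) \<tau> * F X)"
 proof (rule Bochner_Integration.integrable_bound[OF p_phi_integrable(1)], measurable, rule AE_I2)
  fix X assume "X \<in> space S"
  from b[OF this] show "norm (min (P X) \<tau> * F X) <= norm (P X * F X)" unfolding real_norm_def by linarith
 qed
 show "(\<integral>X. min (P X) \<tau> * F X \<partial>S) <= num_tables m n R C"
  unfolding p_phi_integrable(2)[symmetric] by (rule integral_mono[OF i p_phi_integrable(1) b(2)])
 have "(\<integral>X. P X * F X - min (P X) \<tau> * F X \<partial>S) = enn2real (\<integral>\<^sup>+X. ennreal (P X * F X - min (P X) \<tau> * F X) \<partial>S)"
  by (rule integral_eq_nn_integral) (use b in auto)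
 also have "... <= enn2real (ennreal (num_tables m n R C * d))"
 proof (rule enn2real_mono)
  have "(\<integral>\<^sup>+X. ennreal (P X * F X - min (P X) \<tau> * F X) \<partial>S) <= (\<integral>\<^sup>+X. ennreal (indicator {X. P X > \<tau>} X * (P X * F X)) \<partial>S)"
  proof (rule nn_integral_mono)
   fix X assume "X \<in> space S"
   from b(1)[OF this] show "ennreal (P X * F X - min (P X) \<tau> * F X) <= ennreal (indicator {X. P X > \<tau>} X * (P X * F X))"
    by (cases "P X > \<tau>") (auto intro!: ennreal_leI)
  qed
  also have "... <= ennreal (num_tables m n R C) * ennreal d"
   unfolding nn_integral_p_phi_large by (intro mult_left_mono d) simp
  also have "... = ennreal (num_tables m n R C * d)" using d by (simp add: ennreal_mult)
  finally show "(\<integral>\<^sup>+X. ennreal (P X * F X - min (P X) \<tau> * F X) \<partial>S) <= ..." .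
 qed simp
 also have "... = num_tables m n R C * d" using d by simp
 finally show "(1 - d) * num_tables m n R C <= (\<integral>X. min (P X) \<tau> * F X \<partial>S)"
  using i p_phi_integrable by (simp add: algebra_simps)
qed

lemma phi_log_concave: "log_concave_on_simplex m n F"
 unfolding log_concave_on_simplex_def
proof (intro conjI ballI)
 fix X Z and t :: real assume XZ: "X \<in> open_simplex m n" "Z \<in> open_simplex m n" and t: "t \<in> {0..1}"
 let ?c = "phi_const m n R C"
 have "F X powr t * F Z powr (1 - t) = (?c powr t * ?c powr (1 - t)) * (sv X powr t * sv Z powr (1 - t))"
  unfolding phi_fun_def using phi_const_pos scaling_value_simplex_pos XZ
  by (simp add: powr_mult)
 also have "?c powr t * ?c powr (1 - t) = ?c" using phi_const_pos by (simp add: powr_add[symmetric])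
 also have "?c * (sv X powr t * sv Z powr (1 - t)) <= ?c * sv (\<lambda>e\<in>idx m n. t * X e + (1 - t) * Z e)"
  using phi_const_pos t XZ mar open_simplex_pos by (intro mult_left_mono scaling_value_log_concave) auto
 finally show "F X powr t * F Z powr (1 - t) <= F (\<lambda>e\<in>idx m n. t * X e + (1 - t) * Z e)" by (simp add: phi_fun_def)
qed (rule phi_pos)

text \<open>On the translate of the positive orthant by \<open>u X\<close> the scaling value is at least \<open>u\<^sup>N\<close> times
 its value at \<open>X\<close>; take \<open>u = N\<close>.\<close>

lemma scaling_value_le_mean:
 assumes X: "X \<in> open_simplex m n"
 shows "ennreal (sv X) <= ennreal (exp (N + m * n)) * (\<integral>\<^sup>+Z. ennreal (sv Z) \<partial>S)"
proof -
 let ?I = "idx m n" and ?L = "mat_lebesgue m n" and ?P = "positive_mats m n"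
 let ?s = "%Z. indicator ?P Z * sv Z"
 have sm [measurable]: "?s \<in> borel_measurable ?L" using measurable_scaling_value[unfolded restrict_pos] .
 define f where "f Z = indicator ?P Z * (ennreal (?s Z) * ennreal (exp (- (\<Sum>e\<in>?I. Z e))))" for Z
 have f: "f \<in> borel_measurable (\<Pi>\<^sub>M i\<in>?I. lborel)" unfolding f_def mat_lebesgue_def[symmetric] by measurable
 let ?k = "real N ^ N * exp (- real N) * sv X"
 have sv: "0 < sv X" by (rule scaling_value_pos[OF mar open_simplex_pos[OF X]])
 have "ennreal ?k = ennreal ?k * (\<integral>\<^sup>+Z. indicator ?P Z * ennreal (table_poly m n (%_. 0) (%_. 0) Z * exp (- (\<Sum>e\<in>?I. Z e))) \<partial>?L)"
  unfolding nn_integral_table_poly num_tables_zero by simp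
 also have "... = (\<integral>\<^sup>+Z. ennreal ?k * (indicator ?P Z * ennreal (exp (- (\<Sum>e\<in>?I. Z e)))) \<partial>?L)"
  by (subst nn_integral_cmult) (auto simp: table_poly_zero)
 also have "... <= (\<integral>\<^sup>+Z. f (\<lambda>e\<in>?I. N * X e + 1 * Z e) \<partial>?L)"
 proof (rule nn_integral_mono)
  fix Z
  show "ennreal ?k * (indicator ?P Z * ennreal (exp (- (\<Sum>e\<in>?I. Z e)))) <= f (\<lambda>e\<in>?I. N * X e + 1 * Z e)"
  proof (cases "Z \<in> ?P")
   case True
   let ?W = "\<lambda>e\<in>?I. N * X e + 1 * Z e"
   have Z: "!!e. e \<in> ?I ==> 0 < Z e" using True by (simp only: positive_mats_iff)
   have W: "?W \<in> ?P" using Z open_simplex_pos[OF X] by (auto simp: positive_mats_iff add_nonneg_pos less_imp_le)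
   have "real N ^ N * sv X <= sv ?W"
    by (rule scaling_value_mono[OF mar open_simplex_pos[OF X]]) (use Z mpos(1) in \<open>auto simp: less_imp_le\<close>)
   then have "?k * exp (- (\<Sum>e\<in>?I. Z e)) <= sv ?W * (exp (- real N) * exp (- (\<Sum>e\<in>?I. Z e)))"
    using mult_right_mono[of "real N ^ N * sv X" "sv ?W" "exp (- real N) * exp (- (\<Sum>e\<in>?I. Z e))"] by (simp add: mult_ac)
   also have "exp (- real N) * exp (- (\<Sum>e\<in>?I. Z e)) = exp (- (\<Sum>e\<in>?I. ?W e))"
    using open_simplex_sum[OF X] by (simp add: sum.distrib sum_distrib_left[symmetric] exp_add[symmetric])
   finally have "ennreal (?k * exp (- (\<Sum>e\<in>?I. Z e))) <= ennreal (sv ?W * exp (- (\<Sum>e\<in>?I. ?W e)))" by (rule ennreal_leI)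
   moreover have "ennreal (?k * exp (- (\<Sum>e\<in>?I. Z e))) = ennreal ?k * ennreal (exp (- (\<Sum>e\<in>?I. Z e)))"
    by (rule ennreal_mult'') simp
   ultimately show ?thesis using True W unfolding f_def by (simp add: ennreal_mult'')
  qed simp
 qed
 also have "... = (\<integral>\<^sup>+Z. f Z \<partial>?L)"
  unfolding mat_lebesgue_def using nn_integral_PiM_affine[OF finite_idx f, of 1 "%e. N * X e"] by simp
 also have "... = ennreal (fact (m * n - 1 + N) / fact (m * n - 1)) * (\<integral>\<^sup>+Z. ennreal (?s Z) \<partial>S)"
  unfolding f_def
 proof (rule simplex_homogeneous[OF mpos(2,3)])
  fix Z and r :: real assume Z: "Z \<in> open_simplex m n" "0 < r"
  have "sv (\<lambda>e\<in>?I. r * Z e) = r ^ N * sv Z"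
   by (rule scaling_value_homogeneous[OF mar open_simplex_pos[OF Z(1)]]) (use Z in auto)
  then show "ennreal (?s (\<lambda>e\<in>?I. r * Z e)) = ennreal (r ^ N) * ennreal (?s Z)"
   using positive_mats_scale[OF Z(2) open_simplex_positive[OF Z(1)]] open_simplex_positive[OF Z(1)] Z
   by (simp add: ennreal_mult')
 qed measurable
 also have "(\<integral>\<^sup>+Z. ennreal (?s Z) \<partial>S) = (\<integral>\<^sup>+Z. ennreal (sv Z) \<partial>S)"
  by (rule nn_integral_cong) (simp add: space_simplex[OF mpos(2,3)] open_simplex_positive)
 also have "fact (m * n - 1 + N) / fact (m * n - 1) = (\<Prod>k<N. real (m * n + k))"
  using mpos fact_add_prod[of "m * n" N] by simp
 \<comment> \<open>The rising factorial from the radial integral is at most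
   \<open>exp (m * n) * real N ^ N\<close>; the translation by \<open>N * X\<close> was chosen so
   that its factor \<open>real N ^ N\<close> cancels this one.\<close>
 also have "ennreal (\<Prod>k<N. real (m * n + k)) * (\<integral>\<^sup>+Z. ennreal (sv Z) \<partial>S) <= ennreal (exp (m * n) * real N ^ N) * (\<integral>\<^sup>+Z. ennreal (sv Z) \<partial>S)"
  by (intro mult_right_mono ennreal_leI prod_rising_le[OF mpos(1)]) simp
 finally have le: "ennreal ?k <= ennreal (exp (m * n) * real N ^ N) * (\<integral>\<^sup>+Z. ennreal (sv Z) \<partial>S)" .
 have NN: "0 < real N ^ N" using mpos(1) by simp
 have "ennreal (sv X) = ennreal (exp N / real N ^ N) * ennreal ?k"
  using NN by (simp add: ennreal_mult'[symmetric] exp_minus) (simp add: mult.assoc[symmetric])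
 also have "... <= ennreal (exp N / real N ^ N) * (ennreal (exp (m * n) * real N ^ N) * (\<integral>\<^sup>+Z. ennreal (sv Z) \<partial>S))"
  by (intro mult_left_mono le) simp
 also have "... = ennreal (exp (N + m * n)) * (\<integral>\<^sup>+Z. ennreal (sv Z) \<partial>S)"
  using NN by (simp add: mult.assoc[symmetric] ennreal_mult'[symmetric] exp_add)
 finally show ?thesis .
qed

lemma phi_conditioned: "conditioned m n (real (N + m * n)) F"
 unfolding conditioned_def
proof (intro conjI ballI phi_log_concave restrict_simplex[OF measurable_phi])
 fix X assume X: "X \<in> open_simplex m n"
 let ?c = "phi_const m n R C"
 note sp = space_simplex[OF mpos(2,3)]
 note [measurable] = restrict_simplex[OF measurable_scaling_value]
 have nn: "(\<integral>\<^sup>+Z. ennreal (F Z) \<partial>S) = ennreal (\<integral>Z. F Z \<partial>S)"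
  by (rule nn_integral_eq_integral[OF phi_integrable(1)], rule AE_I2) (simp add: sp phi_pos less_imp_le)
 have "ennreal (F X) = ennreal ?c * ennreal (sv X)" using phi_const_pos by (simp add: phi_fun_def ennreal_mult')
 also have "... <= ennreal ?c * (ennreal (exp (N + m * n)) * (\<integral>\<^sup>+Z. ennreal (sv Z) \<partial>S))"
  by (intro mult_left_mono scaling_value_le_mean[OF X]) simp
 also have "... = ennreal (exp (N + m * n)) * (\<integral>\<^sup>+Z. ennreal ?c * ennreal (sv Z) \<partial>S)"
  by (subst nn_integral_cmult) (auto simp: mult_ac)
 also have "... = ennreal (exp (N + m * n)) * (\<integral>\<^sup>+Z. ennreal (F Z) \<partial>S)"
  using phi_const_pos by (simp add: phi_fun_def ennreal_mult')
 also have "... = ennreal (exp (N + m * n) * (\<integral>Z. F Z \<partial>S))" unfolding nn by (simp add: ennreal_mult')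
 finally show "F X <= exp (real (N + m * n)) * (\<integral>Z. F Z \<partial>S)"
  using phi_integrable(2) by (simp add: ennreal_le_iff)
qed

end

section \<open>Independent seeds\<close>

lemma prob_space_seed: "prob_space seed_space"
 unfolding seed_space_def by (intro prob_space_PiM prob_space_uniform_measure) auto

lemma prob_space_coin: "prob_space coin_space"
 unfolding coin_space_def by (intro prob_space_PiM prob_space_seed)

lemma measurable_coin [measurable]: "(%\<omega>. \<omega> i) \<in> measurable coin_space seed_space"
 unfolding coin_space_def by measurable

lemma distr_coin: "distr coin_space seed_space (%\<omega>. \<omega> i) = seed_space"
 unfolding coin_space_def by (rule distr_PiM_component) (auto simp: prob_space_seed)

lemma indep_coin:
 assumes "I \<noteq> {}" "inj_on g I"
 shows "prob_space.indep_vars coin_space (%_. seed_space) (%i \<omega>. \<omega> (g i)) I"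
proof (subst prob_space.indep_vars_iff_distr_eq_PiM'[OF prob_space_coin assms(1)])
 show "distr coin_space (Pi\<^sub>M I (%_. seed_space)) (%x. \<lambda>i\<in>I. x (g i)) = Pi\<^sub>M I (%i. distr coin_space seed_space (%x. x (g i)))"
  unfolding distr_coin unfolding coin_space_def
  by (rule distr_PiM_reindex) (use assms prob_space_seed in auto)
qed auto

lemma measure_coin_component:
 assumes "A \<in> sets seed_space"
 shows "measure coin_space {\<omega> \<in> space coin_space. \<omega> i \<in> A} = measure seed_space A"
proof -
 have "measure seed_space A = measure (distr coin_space seed_space (%\<omega>. \<omega> i)) A" by (simp add: distr_coin)
 also have "... = measure coin_space ((%\<omega>. \<omega> i) -` A \<inter> space coin_space)" by (rule measure_distr) (auto simp: assms)
 finally show ?thesis by (simp add: vimage_def Int_def conj_commute)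
qed

text \<open>Conditioning on the seed at \<open>a\<close>: seeds are independent, so a bound valid
  for every fixed first seed holds for the pair. It is meant for the permanent at a random sample
  point.\<close>

lemma measure_coin_pair_le:
 assumes ab: "a \<noteq> b" and A: "A \<in> sets (seed_space \<Otimes>\<^sub>M seed_space)" and d: "0 <= d"
  and le: "!!s. s \<in> space seed_space ==> measure seed_space {t \<in> space seed_space. (s, t) \<in> A} <= d"
 shows "measure coin_space {\<omega> \<in> space coin_space. (\<omega> a, \<omega> b) \<in> A} <= d"
proof -
 interpret C: prob_space coin_space by (rule prob_space_coin)
 interpret Q: prob_space seed_space by (rule prob_space_seed)
 have "C.indep_var seed_space (%\<omega>. \<omega> a) seed_space (%\<omega>. \<omega> b)"
 proof -
  have "(%i \<omega>. \<omega> (case_bool a b i)) = case_bool (%\<omega> :: nat => seed. \<omega> a) (%\<omega>. \<omega> b)"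
   "(%_. seed_space) = case_bool seed_space seed_space" by (auto simp: fun_eq_iff split: bool.split)
  then show ?thesis using indep_coin[of UNIV "case_bool a b"] ab
   by (simp add: C.indep_var_def inj_on_def split: bool.split)
 qed
 then have "distr coin_space (seed_space \<Otimes>\<^sub>M seed_space) (%\<omega>. (\<omega> a, \<omega> b)) = seed_space \<Otimes>\<^sub>M seed_space"
  by (simp add: C.indep_var_distribution_eq distr_coin)
 then have "emeasure (seed_space \<Otimes>\<^sub>M seed_space) A = emeasure coin_space ((%\<omega>. (\<omega> a, \<omega> b)) -` A \<inter> space coin_space)"
  using emeasure_distr[of "%\<omega>. (\<omega> a, \<omega> b)" coin_space "seed_space \<Otimes>\<^sub>M seed_space" A] A by simp
 also have "(%\<omega>. (\<omega> a, \<omega> b)) -` A \<inter> space coin_space = {\<omega> \<in> space coin_space. (\<omega> a, \<omega> b) \<in> A}" by auto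
 also have "emeasure (seed_space \<Otimes>\<^sub>M seed_space) A = (\<integral>\<^sup>+s. emeasure seed_space (Pair s -` A) \<partial>seed_space)"
  by (rule Q.emeasure_pair_measure_alt[OF A])
 finally have "emeasure coin_space {\<omega> \<in> space coin_space. (\<omega> a, \<omega> b) \<in> A} = (\<integral>\<^sup>+s. emeasure seed_space (Pair s -` A) \<partial>seed_space)" ..
 also have "... <= (\<integral>\<^sup>+s. ennreal d \<partial>seed_space)"
 proof (rule nn_integral_mono)
  fix s assume s: "s \<in> space seed_space"
  have "Pair s -` A = {t \<in> space seed_space. (s, t) \<in> A}"
   using sets.sets_into_space[OF A] by (auto simp: space_pair_measure)
  then show "emeasure seed_space (Pair s -` A) <= ennreal d"
   using le[OF s] d by (simp add: Q.emeasure_eq_measure)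
 qed
 also have "... = ennreal d" by (simp add: Q.emeasure_space_1)
 finally show ?thesis using d by (simp add: C.emeasure_eq_measure)
qed

lemma sample_mean:
 fixes Y :: "seed => real"
 assumes Y: "Y \<in> borel_measurable seed_space" and b: "!!s. s \<in> space seed_space ==> 0 <= Y s \<and> Y s <= \<tau>"
  and g: "inj g" and tau: "0 < \<tau>" and k: "0 < k" and eps: "0 <= eps"
 shows "measure coin_space {\<omega> \<in> space coin_space. \<bar>(\<Sum>i<k. Y (\<omega> (g i))) / k - (\<integral>s. Y s \<partial>seed_space)\<bar> \<ge> eps}
  <= 2 * exp (- 2 * real k * eps\<^sup>2 / \<tau>\<^sup>2)"
proof -
 interpret C: prob_space coin_space by (rule prob_space_coin)
 have Yg: "(%\<omega>. Y (\<omega> j)) \<in> borel_measurable coin_space" for j by (rule measurable_compose[OF measurable_coin Y])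
 have dist: "distr coin_space borel (%\<omega>. Y (\<omega> j)) = distr seed_space borel Y" for j
  using distr_distr[OF Y measurable_coin[of j]] by (simp add: distr_coin comp_def)
 have ind: "C.indep_vars (%_. borel) (%i \<omega>. Y (\<omega> (g i))) {..<k}"
 proof -
  have "C.indep_vars (%_. seed_space) (%i \<omega>. \<omega> (g i)) {..<k}"
   by (rule indep_coin) (use g k in \<open>auto intro: inj_on_subset\<close>)
  then show ?thesis by (rule C.indep_vars_compose2) (rule Y)
 qed
 interpret H: Hoeffding_ineq_iid coin_space "{..<k}" "%i \<omega>. Y (\<omega> (g i))" "%\<omega>. Y (\<omega> 0)" 0 \<tau> "C.expectation (%\<omega>. Y (\<omega> 0))"
 proof unfold_locales
  have "\<omega> 0 \<in> space seed_space" if "\<omega> \<in> space coin_space" for \<omega>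
   using measurable_space[OF measurable_coin that] by simp
  then show "AE \<omega> in coin_space. Y (\<omega> 0) \<in> {0..\<tau>}" using b by (intro AE_I2) auto
 qed (use ind Yg dist in auto)
 have "C.expectation (%\<omega>. Y (\<omega> 0)) = (\<integral>s. Y s \<partial>distr coin_space seed_space (%\<omega>. \<omega> 0))"
  by (rule integral_distr[symmetric]) (auto simp: Y)
 also have "... = (\<integral>s. Y s \<partial>seed_space)" by (simp add: distr_coin)
 finally show ?thesis using H.Hoeffding_ineq_abs_ge'[OF eps tau] k by (auto simp: lessThan_empty_iff)
qed

lemma integral_layer_cake:
 assumes "prob_space M" and f [measurable]: "f \<in> borel_measurable M" and b: "!!x. x \<in> space M ==> 0 <= f x \<and> f x <= \<tau>"
 shows "(\<integral>\<^sup>+x. ennreal (f x) \<partial>M) = (\<integral>\<^sup>+t. indicator {0..<\<tau>} t * emeasure M {x \<in> space M. t < f x} \<partial>lborel)"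
proof -
 interpret prob_space M by fact
 interpret pair_sigma_finite M "lborel :: real measure" ..
 have "(\<integral>\<^sup>+x. ennreal (f x) \<partial>M) = (\<integral>\<^sup>+x. (\<integral>\<^sup>+t. indicator {0..<\<tau>} t * indicator {t. t < f x} t \<partial>lborel) \<partial>M)"
 proof (rule nn_integral_cong)
  fix x assume "x \<in> space M"
  from b[OF this] have fx: "0 <= f x" "f x <= \<tau>" by auto
  have "(\<integral>\<^sup>+t. indicator {0..<\<tau>} t * indicator {t. t < f x} t \<partial>lborel) = (\<integral>\<^sup>+t. indicator {0..<f x} t \<partial>lborel)"
   by (rule nn_integral_cong) (use fx in \<open>auto split: split_indicator\<close>)
  then show "ennreal (f x) = (\<integral>\<^sup>+t. indicator {0..<\<tau>} t * indicator {t. t < f x} t \<partial>lborel)" using fx by simp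
 qed
 also have "... = (\<integral>\<^sup>+t. (\<integral>\<^sup>+x. indicator {0..<\<tau>} t * indicator {t. t < f x} t \<partial>M) \<partial>lborel)"
  by (rule Fubini'[symmetric]) measurable
 also have "... = (\<integral>\<^sup>+t. indicator {0..<\<tau>} t * emeasure M {x \<in> space M. t < f x} \<partial>lborel)"
 proof (rule nn_integral_cong)
  fix t :: real
  have "(\<integral>\<^sup>+x. indicator {0..<\<tau>} t * indicator {t. t < f x} t \<partial>M) = (\<integral>\<^sup>+x. indicator {0..<\<tau>} t * indicator {x \<in> space M. t < f x} x \<partial>M)"
   by (rule nn_integral_cong) (auto split: split_indicator)
  also have "... = indicator {0..<\<tau>} t * (\<integral>\<^sup>+x. indicator {x \<in> space M. t < f x} x \<partial>M)"
   by (rule nn_integral_cmult) measurable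
  also have "(\<integral>\<^sup>+x. indicator {x \<in> space M. t < f x} x \<partial>M) = emeasure M {x \<in> space M. t < f x}"
   by (rule nn_integral_indicator) measurable
  finally show "(\<integral>\<^sup>+x. indicator {0..<\<tau>} t * indicator {t. t < f x} t \<partial>M) = indicator {0..<\<tau>} t * emeasure M {x \<in> space M. t < f x}" .
 qed
 finally show ?thesis .
qed

text \<open>By the layer cake formula the integral collects the measures of superlevel sets over the
  levels in \<open>{0..<\<tau>}\<close>, and each of these exceeds its counterpart by at most
  \<open>\<xi>\<close>.\<close>

lemma integral_total_variation_le:
 assumes M: "prob_space M" "prob_space M'" and sets: "sets M = sets M'" and f: "f \<in> borel_measurable M"
  and b: "!!x. x \<in> space M ==> 0 <= f x \<and> f x <= \<tau>" and tau: "0 <= \<tau>" and xi: "0 <= \<xi>"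
  and tv: "!!A. A \<in> sets M ==> measure M A <= measure M' A + \<xi>"
 shows "(\<integral>x. f x \<partial>M) <= (\<integral>x. f x \<partial>M') + \<tau> * \<xi>"
proof -
 interpret M: prob_space M by fact
 interpret M': prob_space M' by fact
 have sp: "space M = space M'" using sets by (rule sets_eq_imp_space_eq)
 have f' [measurable]: "f \<in> borel_measurable M'" using f by (simp add: measurable_cong_sets[OF sets refl])
 note f [measurable]
 have nn: "(\<integral>\<^sup>+x. ennreal (f x) \<partial>L) = ennreal (\<integral>x. f x \<partial>L)" "0 <= (\<integral>x. f x \<partial>L)" if "L = M \<or> L = M'" for L
 proof -
  interpret L: prob_space L using that M by auto
  have "f \<in> borel_measurable L" "!!x. x \<in> space L ==> 0 <= f x \<and> f x <= \<tau>" using that f f' b sp by auto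
  then show "(\<integral>\<^sup>+x. ennreal (f x) \<partial>L) = ennreal (\<integral>x. f x \<partial>L)" "0 <= (\<integral>x. f x \<partial>L)"
   by (auto intro!: nn_integral_eq_integral L.integrable_const_bound[of _ \<tau>] integral_nonneg_AE)
 qed
 have "(\<integral>\<^sup>+x. ennreal (f x) \<partial>M) <= (\<integral>\<^sup>+t. indicator {0..<\<tau>} t * (emeasure M' {x \<in> space M'. t < f x} + ennreal \<xi>) \<partial>lborel)"
 proof (subst integral_layer_cake[where \<tau> = \<tau>, OF M(1) f], rule b, assumption, rule nn_integral_mono)
  fix t :: real
  have "measure M {x \<in> space M. t < f x} <= measure M' {x \<in> space M. t < f x} + \<xi>" by (rule tv) measurable
  then have "emeasure M {x \<in> space M. t < f x} <= emeasure M' {x \<in> space M'. t < f x} + ennreal \<xi>"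
   using xi by (simp add: M.emeasure_eq_measure M'.emeasure_eq_measure sp ennreal_plus[symmetric] del: ennreal_plus)
  then show "indicator {0..<\<tau>} t * emeasure M {x \<in> space M. t < f x} <= indicator {0..<\<tau>} t * (emeasure M' {x \<in> space M'. t < f x} + ennreal \<xi>)"
   by (rule mult_left_mono) simp
 qed
 also have "... = (\<integral>\<^sup>+t. indicator {0..<\<tau>} t * emeasure M' {x \<in> space M'. t < f x} \<partial>lborel) + (\<integral>\<^sup>+t. indicator {0..<\<tau>} t * ennreal \<xi> \<partial>lborel)"
 proof -
  have "(%t. emeasure M' {x \<in> space M'. t < f x}) \<in> borel_measurable borel" by measurable
  then show ?thesis unfolding distrib_left by (intro nn_integral_add) measurable
 qed
 also have "(\<integral>\<^sup>+t. indicator {0..<\<tau>} t * emeasure M' {x \<in> space M'. t < f x} \<partial>lborel) = (\<integral>\<^sup>+x. ennreal (f x) \<partial>M')"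
  by (rule integral_layer_cake[OF M(2) f', symmetric]) (use b sp in auto)
 also have "(\<integral>\<^sup>+t. indicator {0..<\<tau>} t * ennreal \<xi> \<partial>lborel) = ennreal (\<tau> * \<xi>)"
  using tau xi by (subst nn_integral_multc) (auto simp: ennreal_mult)
 finally show ?thesis using nn tau xi by (simp add: ennreal_plus[symmetric] del: ennreal_plus)
qed

hide_const (open) N S P F sv

section \<open>Accuracy of the algorithm\<close>

lemma relative_error_trans:
 fixes x y z :: real
 assumes "\<bar>x - y\<bar> <= e * y" "\<bar>y - z\<bar> <= e' * z" "0 <= e"
 shows "\<bar>x - z\<bar> <= (e + e' + e * e') * z"
proof -
 have "e * y <= e * (z + e' * z)" using assms(2,3) by (intro mult_left_mono) auto
 then show ?thesis using assms(1,2) by (simp add: algebra_simps abs_le_iff)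
qed

lemma relative_error_mult:
 fixes x y z :: real
 assumes "\<bar>x - y\<bar> <= e * y" "0 <= z"
 shows "\<bar>x * z - y * z\<bar> <= e * (y * z)"
 using mult_right_mono[OF assms] assms(2) by (simp add: left_diff_distrib[symmetric] abs_mult mult.assoc)

text \<open>Truncation does not enlarge a relative error: even when \<open>y\<close> is cut off,
  \<open>x\<close> is still at least \<open>(1 - e) * \<tau>\<close>.\<close>

lemma relative_error_min:
 fixes x y \<tau> e :: real
 assumes xy: "\<bar>x - y\<bar> <= e * y" and "0 <= \<tau>" "0 <= e" "e <= 1"
 shows "\<bar>min x \<tau> - min y \<tau>\<bar> <= e * min y \<tau>"
proof (cases "y <= \<tau>")
 case True
 have "0 <= e * y" using xy by linarith
 then show ?thesis using True xy by (simp add: min_def abs_le_iff)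
next
 case False
 have "(1 - e) * \<tau> <= (1 - e) * y" using assms False by (intro mult_left_mono) auto
 moreover have "0 <= e * \<tau>" using assms by simp
 ultimately show ?thesis using False xy by (simp add: min_def abs_le_iff algebra_simps)
qed

text \<open>\<open>U\<close>, \<open>X\<close> and \<open>Q\<close> stand for the integration, the
  sampling and the evaluation of p, reduced to their measurability and error guarantees.\<close>

context
 fixes m n :: nat and R C :: "nat => nat" and T :: toolkit
  and U :: "seed => real" and X :: "seed => mat" and Q :: "mat => seed => real" and \<tau> eps d :: real and c k :: nat
 assumes mar: "margins m n R C" and T: "scaling_ok T" and tau: "1 <= \<tau>" and eps: "0 < eps" "eps < 1"
  and c: "1000 <= c" and k: "real c * \<tau>\<^sup>2 / eps\<^sup>2 <= k"
  and d: "emeasure (psi_measure m n R C) {X \<in> positive_mats m n. p_fun m n R C X > \<tau>} <= ennreal d" "0 <= d" "d <= eps / 10"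
  and U [measurable]: "U \<in> borel_measurable seed_space"
  and U_ok: "measure seed_space {s \<in> space seed_space. \<bar>U s - (\<integral>Z. phi_fun m n R C Z \<partial>simplex_measure m n)\<bar>
    <= eps / c * (\<integral>Z. phi_fun m n R C Z \<partial>simplex_measure m n)} \<ge> 1 - 1 / c"
  and X [measurable]: "X \<in> measurable seed_space (simplex_measure m n)"
  and X_ok: "!!A. A \<in> sets (simplex_measure m n) ==> \<bar>measure (distr seed_space (simplex_measure m n) X) A
    - measure (density (simplex_measure m n) (%Z. ennreal (phi_fun m n R C Z / (\<integral>Z. phi_fun m n R C Z \<partial>simplex_measure m n)))) A\<bar> <= eps / (c * \<tau>)"
  and Q [measurable]: "(%(Z, s). Q Z s) \<in> borel_measurable (simplex_measure m n \<Otimes>\<^sub>M seed_space)"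
  and Q_ok: "!!Z. Z \<in> open_simplex m n ==>
    measure seed_space {s \<in> space seed_space. \<bar>Q Z s - p_fun m n R C Z\<bar> <= 3 * (eps / c) * p_fun m n R C Z} \<ge> 1 - 1 / (real c * k)"
begin

abbreviation (input) "S' \<equiv> simplex_measure m n"
abbreviation (input) "P' \<equiv> p_fun m n R C"
abbreviation (input) "I \<equiv> (\<integral>Z. phi_fun m n R C Z \<partial>simplex_measure m n)"
abbreviation (input) "f \<equiv> (%Z. min (p_fun m n R C Z) \<tau>)"

lemma k_pos: "0 < k"
proof -
 have "0 < real c * \<tau>\<^sup>2 / eps\<^sup>2" using c tau eps by simp
 then show ?thesis using k by linarith
qed

lemmas sp = space_simplex[OF margins_pos(2,3)[OF mar]]

lemma meas_p [measurable]: "P' \<in> borel_measurable S'"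
 by (rule restrict_simplex[OF mar T measurable_p[OF mar T]])

lemma meas_phi [measurable]: "phi_fun m n R C \<in> borel_measurable S'"
 by (rule restrict_simplex[OF mar T measurable_phi[OF mar T]])

lemma f_bounds: "Z \<in> space S' ==> 1 <= f Z \<and> f Z <= \<tau>"
 using p_simplex_ge_1[OF mar T, of Z] tau by (auto simp: sp)

lemma I_pos: "0 < I" by (rule phi_integrable(2)[OF mar T])

text \<open>The mean under the exact density is at least 1 because p is; this turns the additive
  errors of sampling and averaging into relative ones.\<close>

lemma exact_mean:
 "prob_space (density S' (%Z. ennreal (phi_fun m n R C Z / I)))" (is "prob_space ?D")
 "(\<integral>Z. f Z \<partial>density S' (%Z. ennreal (phi_fun m n R C Z / I))) = (\<integral>Z. f Z * phi_fun m n R C Z \<partial>S') / I"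
 "1 <= (\<integral>Z. f Z \<partial>density S' (%Z. ennreal (phi_fun m n R C Z / I)))"
proof -
 have nn: "0 <= phi_fun m n R C Z / I" if "Z \<in> space S'" for Z
  using that phi_pos[OF mar T, of Z] I_pos by (simp add: sp)
 show D: "prob_space ?D"
 proof
  have "(\<integral>\<^sup>+Z. ennreal (phi_fun m n R C Z / I) \<partial>S') = ennreal (\<integral>Z. phi_fun m n R C Z / I \<partial>S')"
   by (rule nn_integral_eq_integral) (use phi_integrable[OF mar T] nn in \<open>auto intro!: AE_I2\<close>)
  then show "emeasure ?D (space ?D) = 1" using I_pos by (simp add: emeasure_density cong: nn_integral_cong)
 qed
 then interpret D: prob_space ?D .
 have "(\<integral>Z. f Z \<partial>?D) = (\<integral>Z. (phi_fun m n R C Z / I) *\<^sub>R f Z \<partial>S')"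
  by (rule integral_density) (use nn in \<open>auto intro!: AE_I2\<close>)
 also have "... = (\<integral>Z. (f Z * phi_fun m n R C Z) / I \<partial>S')" by (rule Bochner_Integration.integral_cong) auto
 finally show "(\<integral>Z. f Z \<partial>?D) = (\<integral>Z. f Z * phi_fun m n R C Z \<partial>S') / I" by simp
 have "(\<integral>Z. 1 \<partial>?D) <= (\<integral>Z. f Z \<partial>?D)"
 proof (rule integral_mono)
  show "integrable ?D f"
   by (rule D.integrable_const_bound[of _ \<tau>]) (use f_bounds in \<open>force intro!: AE_I2\<close>, measurable)
 qed (use f_bounds in auto)
 then show "1 <= (\<integral>Z. f Z \<partial>?D)" using D.prob_space by simp
qed

text \<open>A deviation \<open>eps / (c * \<tau>)\<close> in total variation moves the mean of a
  function with values up to \<open>\<tau>\<close> by at most \<open>eps / c\<close>, which explains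
  the accuracy asked of the sampling.\<close>

lemma sampled_mean:
 "\<bar>(\<integral>s. f (X s) \<partial>seed_space) - (\<integral>Z. f Z * phi_fun m n R C Z \<partial>S') / I\<bar> <= eps / c"
proof -
 let ?D = "density S' (%Z. ennreal (phi_fun m n R C Z / I))" and ?V = "distr seed_space S' X"
 have V: "prob_space ?V" by (rule prob_space.prob_space_distr[OF prob_space_seed X])
 have eq: "(\<integral>s. f (X s) \<partial>seed_space) = (\<integral>Z. f Z \<partial>?V)" by (rule integral_distr[symmetric]) measurable
 have b: "0 <= f Z \<and> f Z <= \<tau>" if "Z \<in> space S'" for Z using f_bounds[OF that] by linarith
 have "(\<integral>Z. f Z \<partial>?V) <= (\<integral>Z. f Z \<partial>?D) + \<tau> * (eps / (c * \<tau>))"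
  by (rule integral_total_variation_le[OF V exact_mean(1)]) (use b X_ok c eps tau in \<open>auto simp: abs_le_iff algebra_simps\<close>)
 moreover have "(\<integral>Z. f Z \<partial>?D) <= (\<integral>Z. f Z \<partial>?V) + \<tau> * (eps / (c * \<tau>))"
  by (rule integral_total_variation_le[OF exact_mean(1) V]) (use b X_ok c eps tau in \<open>auto simp: abs_le_iff algebra_simps\<close>)
 moreover have "\<tau> * (eps / (c * \<tau>)) = eps / c" using tau by simp
 ultimately show ?thesis unfolding eq exact_mean(2)[symmetric] by (simp add: abs_le_iff)
qed

text \<open>The part without probability: the errors of the permanents, of the average, of the
  integral and of the truncation are chained as relative errors, each a fraction of
  \<open>eps\<close> small enough to cover the cross terms as well.\<close>

lemma accurate_if:
 assumes w: "!!i. w i \<in> open_simplex m n"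
  and 1: "\<bar>u - I\<bar> <= eps / c * I"
  and 2: "!!i. i < k ==> \<bar>q i - P' (w i)\<bar> <= 3 * (eps / c) * P' (w i)"
  and 3: "\<bar>(\<Sum>i<k. f (w i)) / k - (\<integral>s. f (X s) \<partial>seed_space)\<bar> < eps / 10"
 shows "\<bar>u * (1 / real k * (\<Sum>i<k. min (q i) \<tau>)) - num_tables m n R C\<bar> <= eps * num_tables m n R C"
proof -
 let ?A = "(\<integral>Z. f Z * phi_fun m n R C Z \<partial>S') / I" and ?M = "(\<Sum>i<k. f (w i)) / k" and ?Q = "(\<Sum>i<k. min (q i) \<tau>) / k"
 have A: "1 <= ?A" using exact_mean(2,3) by simp
 have ec: "eps / c <= eps / 1000" using c eps by (intro divide_left_mono) auto
 have M: "\<bar>?M - ?A\<bar> <= eps / 5 * ?A"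
 proof -
  have "\<bar>?M - ?A\<bar> <= eps / 10 + eps / c" using 3 sampled_mean by linarith
  also have "... <= eps / 5 * 1" using ec eps by linarith
  also have "... <= eps / 5 * ?A" using A eps by (intro mult_left_mono) auto
  finally show ?thesis .
 qed
 have Q': "\<bar>?Q - ?M\<bar> <= eps / 10 * ?M"
 proof -
  have "\<bar>(\<Sum>i<k. min (q i) \<tau>) - (\<Sum>i<k. f (w i))\<bar> <= (\<Sum>i<k. \<bar>min (q i) \<tau> - f (w i)\<bar>)"
   unfolding sum_subtractf[symmetric] by (rule sum_abs)
  also have "... <= (\<Sum>i<k. eps / 10 * f (w i))"
  proof (rule sum_mono)
   fix i assume "i \<in> {..<k}"
   then have "\<bar>min (q i) \<tau> - f (w i)\<bar> <= 3 * (eps / c) * f (w i)"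
    using eps tau ec 2 by (intro relative_error_min) auto
   also have "... <= eps / 10 * f (w i)" using ec eps f_bounds[of "w i"] w by (intro mult_right_mono) (auto simp: sp)
   finally show "\<bar>min (q i) \<tau> - f (w i)\<bar> <= eps / 10 * f (w i)" .
  qed
  finally have "\<bar>(\<Sum>i<k. min (q i) \<tau>) - (\<Sum>i<k. f (w i))\<bar> <= eps / 10 * (\<Sum>i<k. f (w i))"
   by (simp only: sum_distrib_left)
  then have "\<bar>(\<Sum>i<k. min (q i) \<tau>) - (\<Sum>i<k. f (w i))\<bar> / k <= eps / 10 * (\<Sum>i<k. f (w i)) / k" by (rule divide_right_mono) simp
  then show ?thesis by (simp add: diff_divide_distrib[symmetric])
 qed
 have QA: "\<bar>?Q - ?A\<bar> <= (eps / 10 + eps / 5 + eps / 10 * (eps / 5)) * ?A"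
  by (rule relative_error_trans[OF Q' M]) (use eps in auto)
 define e where "e = eps / 10 + eps / 5 + eps / 10 * (eps / 5)"
 have e2: "eps * eps <= eps" using eps by (simp add: mult_left_le)
 have e: "0 <= e" "e <= 32 / 100 * eps" using eps e2 unfolding e_def by (simp, linarith)
 have "e * ?A <= 1 * ?A" using e eps A by (intro mult_right_mono) auto
 then have Q0: "0 <= ?Q" using QA unfolding e_def[symmetric] by linarith
 have "\<bar>u - I\<bar> <= eps / 10 * I"
  by (rule order_trans[OF 1]) (use ec eps I_pos in \<open>intro mult_right_mono[OF order_trans[OF ec]], auto\<close>)
 then have "\<bar>u * ?Q - I * ?Q\<bar> <= eps / 10 * (I * ?Q)" by (rule relative_error_mult) (rule Q0)
 moreover have "\<bar>?Q * I - ?A * I\<bar> <= e * (?A * I)" using QA I_pos unfolding e_def[symmetric] by (intro relative_error_mult) auto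
 then have "\<bar>I * ?Q - I * ?A\<bar> <= e * (I * ?A)" by (simp only: mult.commute)
 ultimately have "\<bar>u * ?Q - I * ?A\<bar> <= (eps / 10 + e + eps / 10 * e) * (I * ?A)"
  by (rule relative_error_trans) (use eps in simp)
 moreover have "\<bar>I * ?A - num_tables m n R C\<bar> <= eps / 10 * num_tables m n R C"
 proof -
  have "I * ?A = (\<integral>Z. f Z * phi_fun m n R C Z \<partial>S')" using I_pos by simp
  moreover have "d * num_tables m n R C <= eps / 10 * num_tables m n R C" using d(3) by (intro mult_right_mono) auto
  ultimately show ?thesis using truncated_integral(2,3)[OF mar T tau d(1,2)] by (simp add: algebra_simps abs_le_iff)
 qed
 ultimately have r: "\<bar>u * ?Q - num_tables m n R C\<bar> <= ((eps / 10 + e + eps / 10 * e) + eps / 10 + (eps / 10 + e + eps / 10 * e) * (eps / 10)) * num_tables m n R C"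
  by (rule relative_error_trans) (use eps e in simp)
 have h: "eps / 10 * e <= eps / 10 * 1" using e eps by (intro mult_left_mono) auto
 then have "eps / 10 + e + eps / 10 * e <= 1" using e eps by linarith
 then have "(eps / 10 + e + eps / 10 * e) * (eps / 10) <= 1 * (eps / 10)" using eps by (intro mult_right_mono) auto
 with h have "(eps / 10 + e + eps / 10 * e) + eps / 10 + (eps / 10 + e + eps / 10 * e) * (eps / 10) <= eps" using e eps by linarith
 from mult_right_mono[OF this, of "real (num_tables m n R C)"] r show ?thesis by simp
qed

lemma QX:
 assumes "g \<in> measurable L seed_space" "h \<in> measurable L seed_space"
 shows "(%x. Q (X (g x)) (h x)) \<in> borel_measurable L"
proof -
 have "(%x. (X (g x), h x)) \<in> measurable L (S' \<Otimes>\<^sub>M seed_space)"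
  by (rule measurable_Pair[OF measurable_compose[OF assms(1) X] assms(2)])
 from measurable_compose[OF this Q] show ?thesis by simp
qed

text \<open>Union bound over failures of the integration, of any of the \<open>k\<close> permanents,
  and of the average. The permanents are run with failure probability \<open>1 / (c * k)\<close>, so
  that together they fail with probability at most \<open>1 / c\<close>.\<close>

theorem estimate_accurate:
 "measure coin_space {\<omega> \<in> space coin_space.
  \<bar>U (\<omega> 0) * (1 / real k * (\<Sum>i<k. min (Q (X (\<omega> (2 * i + 1))) (\<omega> (2 * i + 2))) \<tau>)) - num_tables m n R C\<bar>
   <= eps * num_tables m n R C} \<ge> 2 / 3" (is "measure _ ?G \<ge> _")
proof -
 interpret W: prob_space coin_space by (rule prob_space_coin)
 interpret Q: prob_space seed_space by (rule prob_space_seed)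
 let ?ok = "%Z s. \<bar>Q Z s - P' Z\<bar> <= 3 * (eps / c) * P' Z"
 have c0: "0 < real c" using c by simp
 have Qc [measurable]: "(%\<omega>. Q (X (\<omega> i)) (\<omega> j)) \<in> borel_measurable coin_space" for i j
  using QX[where g = "%\<omega>. \<omega> i" and h = "%\<omega>. \<omega> j" and L = coin_space] by simp
 have G: "?G \<in> W.events" by measurable
 define A1 where "A1 = {s \<in> space seed_space. \<not> \<bar>U s - I\<bar> <= eps / c * I}"
 define A2 where "A2 = {x \<in> space (seed_space \<Otimes>\<^sub>M seed_space). \<not> ?ok (X (fst x)) (snd x)}"
 define B1 where "B1 = {\<omega> \<in> space coin_space. \<omega> 0 \<in> A1}"
 define B2 where "B2 i = {\<omega> \<in> space coin_space. (\<omega> (2 * i + 1), \<omega> (2 * i + 2)) \<in> A2}" for i :: nat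
 define B3 where "B3 = {\<omega> \<in> space coin_space. \<bar>(\<Sum>i<k. f (X (\<omega> (2 * i + 1)))) / k - (\<integral>s. f (X s) \<partial>seed_space)\<bar> \<ge> eps / 10}"
 have A1 [measurable]: "A1 \<in> sets seed_space" unfolding A1_def by measurable
 have Qp [measurable]: "(%x. Q (X (fst x)) (snd x)) \<in> borel_measurable (seed_space \<Otimes>\<^sub>M seed_space)"
  using QX[where g = fst and h = snd and L = "seed_space \<Otimes>\<^sub>M seed_space"] by simp
 have A2 [measurable]: "A2 \<in> sets (seed_space \<Otimes>\<^sub>M seed_space)" unfolding A2_def by measurable
 have B [measurable]: "B1 \<in> W.events" "!!i. B2 i \<in> W.events" "B3 \<in> W.events" unfolding B1_def B2_def B3_def by measurable
 have 1: "W.prob B1 <= 1 / c"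
 proof -
  have e: "A1 = space seed_space - {s \<in> space seed_space. \<bar>U s - I\<bar> <= eps / c * I}" by (auto simp: A1_def)
  have "Q.prob A1 = 1 - Q.prob {s \<in> space seed_space. \<bar>U s - I\<bar> <= eps / c * I}" unfolding e by (rule Q.prob_compl) measurable
  then show ?thesis using U_ok unfolding B1_def measure_coin_component[OF A1] by simp
 qed
 have 2: "W.prob (B2 i) <= 1 / (real c * k)" for i
  unfolding B2_def
 proof (rule measure_coin_pair_le[where a = "2 * i + 1" and b = "2 * i + 2", OF _ A2])
  fix s assume s: "s \<in> space seed_space"
  have Xs: "X s \<in> open_simplex m n" unfolding sp[symmetric] by (rule measurable_space[OF X s])
  have m: "(%t. Q (X s) t) \<in> borel_measurable seed_space" by (rule QX[where g = "%_. s" and h = "%t. t"]) (use s in auto)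
  have e: "{t \<in> space seed_space. (s, t) \<in> A2} = space seed_space - {t \<in> space seed_space. ?ok (X s) t}"
   using s by (auto simp: A2_def space_pair_measure)
  have "Q.prob {t \<in> space seed_space. (s, t) \<in> A2} = 1 - Q.prob {t \<in> space seed_space. ?ok (X s) t}"
   unfolding e by (rule Q.prob_compl) (use m in measurable)
  then show "Q.prob {t \<in> space seed_space. (s, t) \<in> A2} <= 1 / (real c * k)" using Q_ok[OF Xs] by simp
 qed auto
 have 3: "W.prob B3 <= 2 * exp (- 20)"
 proof -
  have "W.prob B3 <= 2 * exp (- 2 * real k * (eps / 10)\<^sup>2 / \<tau>\<^sup>2)"
   unfolding B3_def
  proof (rule sample_mean)
   fix s assume "s \<in> space seed_space"
   then show "0 <= f (X s) \<and> f (X s) <= \<tau>" using f_bounds[of "X s"] measurable_space[OF X] by force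
  qed (use tau eps k_pos in \<open>auto simp: inj_def\<close>)
  \<comment> \<open>\<open>k\<close> is at least 1000 times the square of
    \<open>\<tau> / eps\<close>, and 2 * 1000 / 100 = 20.\<close>
  moreover have "20 <= 2 * real k * (eps / 10)\<^sup>2 / \<tau>\<^sup>2"
  proof -
   have "1000 * \<tau>\<^sup>2 / eps\<^sup>2 <= real c * \<tau>\<^sup>2 / eps\<^sup>2" using c by (intro divide_right_mono mult_right_mono) auto
   then have "1000 * \<tau>\<^sup>2 / eps\<^sup>2 <= k" using k by linarith
   then show ?thesis using eps tau by (simp add: field_simps power2_eq_square)
  qed
  ultimately show ?thesis by (smt (verit) exp_le_cancel_iff minus_divide_left mult_minus_left)
 qed
 have "space coin_space - ?G \<subseteq> B1 \<union> (\<Union>i<k. B2 i) \<union> B3"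
 proof (rule subsetI, rule ccontr)
  fix \<omega> assume \<omega>: "\<omega> \<in> space coin_space - ?G" "\<omega> \<notin> B1 \<union> (\<Union>i<k. B2 i) \<union> B3"
  have s: "\<omega> i \<in> space seed_space" for i using measurable_space[OF measurable_coin] \<omega>(1) by blast
  have "\<bar>U (\<omega> 0) * (1 / real k * (\<Sum>i<k. min (Q (X (\<omega> (2 * i + 1))) (\<omega> (2 * i + 2))) \<tau>)) - num_tables m n R C\<bar> <= eps * num_tables m n R C"
  proof (rule accurate_if)
   show "X (\<omega> (2 * i + 1)) \<in> open_simplex m n" for i using measurable_space[OF X s] by (simp add: sp)
  qed (use \<omega> s in \<open>auto simp: B1_def A1_def B2_def A2_def B3_def space_pair_measure not_le not_less\<close>)
  then show False using \<omega>(1) by blast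
 qed
 then have "W.prob (space coin_space - ?G) <= W.prob (B1 \<union> (\<Union>i<k. B2 i) \<union> B3)"
  by (rule W.finite_measure_mono) measurable
 also have "... <= W.prob B1 + (\<Sum>i<k. W.prob (B2 i)) + W.prob B3"
  by (intro order_trans[OF measure_Un_le] add_right_mono add_left_mono measure_UNION_le) auto
 also have "... <= 1 / c + (\<Sum>i<k. 1 / (real c * k)) + 2 * exp (- 20)" by (intro add_mono sum_mono 1 2 3)
 also have "... = 2 / c + 2 * exp (- 20)" using k_pos by simp
 also have "... <= 2 / 1000 + 2 * (1 / 21)"
 proof (intro add_mono mult_left_mono)
  show "2 / real c <= 2 / 1000" using c by (intro divide_left_mono) auto
  have "21 <= exp (20 :: real)" using exp_ge_add_one_self[of 20] by simp
  then show "exp (- 20) <= 1 / (21 :: real)" unfolding exp_minus inverse_eq_divide by (intro divide_left_mono) auto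
 qed simp
 finally have "1 - W.prob ?G <= 1 / 3" unfolding W.prob_compl[OF G] by simp
 then show ?thesis by simp
qed

end

hide_const (open) S' P' I f

section \<open>The subroutines\<close>

text \<open>Changing the factors multiplies the permanent and the scaling product by inverse
  amounts, so their product does not depend on the factors. Inexact factors thus affect the computed
  p only through the scaling product.\<close>

lemma normalized_per_unscale:
 assumes mar: "margins m n R C" and X: "X \<in> open_simplex m n" and lu: "!!i. i < m ==> 0 < l i" "!!j. j < n ==> 0 < u j"
 shows "normalized_per (total m R) (permanent (total m R) (block_mat (total m R) R C (unscale m n X l u))) * scaling_product m n R C l u
  = p_fun m n R C X * scaling_value m n R C X"
proof -
 let ?Y = "unscale m n X l u" and ?N = "total m R"
 have "table_poly m n R C X = table_poly m n R C (%(i, j). ?Y (i, j) * l i * u j)"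
  by (rule table_poly_cong) (use lu in \<open>force simp: unscale_def idx_iff less_imp_neq[symmetric]\<close>)
 then have 1: "table_poly m n R C X = scaling_product m n R C l u * table_poly m n R C ?Y" by (simp only: table_poly_scale)
 have "table_poly m n R C (%(i, j). ?Y (i, j) / (real (R i) * real (C j))) = table_poly m n R C (%(i, j). ?Y (i, j) * (1 / real (R i)) * (1 / real (C j)))"
  by (rule table_poly_cong) auto
 then have 2: "permanent ?N (block_mat ?N R C ?Y) = (\<Prod>i<m. fact (R i) / real (R i) ^ R i) * (\<Prod>j<n. fact (C j) / real (C j) ^ C j) * table_poly m n R C ?Y"
  unfolding permanent_block_mat[OF refl margins_pos(4)[OF mar, symmetric]] table_poly_scale[of m n R C ?Y "%i. 1 / R i" "%j. 1 / C j"]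
  by (simp add: scaling_product_def prod_dividef power_divide mult_ac)
 have "p_fun m n R C X = real ?N ^ ?N / fact ?N * (\<Prod>i<m. fact (R i) / real (R i) ^ R i) * (\<Prod>j<n. fact (C j) / real (C j) ^ C j)
   * (table_poly m n R C X / scaling_value m n R C X)"
  by (rule p_fun_eq[OF mar open_simplex_pos[OF X]])
 moreover have "0 < scaling_value m n R C X" by (rule scaling_value_pos[OF mar open_simplex_pos[OF X]])
 ultimately show ?thesis unfolding 2 normalized_per_def 1 by simp
qed

lemma scaling_spec:
 assumes "scaling_ok T"
 obtains a :: nat where "!!m n R C \<eta> X l u t. margins m n R C ==> 0 < \<eta> ==> \<eta> < 1 ==> X \<in> open_simplex m n ==> scaling T m n R C \<eta> X = (l, u, t) ==>
  (\<forall>i<m. 0 < l i) \<and> (\<forall>j<n. 0 < u j) \<and> \<bar>scaling_product m n R C l u - scaling_value m n R C X\<bar> <= \<eta> * scaling_value m n R C X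
   \<and> real t <= real a * (real (total m R) / \<eta>) ^ a"
proof (rule exE[OF assms[unfolded scaling_ok_def]], goal_cases)
 case (1 a)
 show ?case
 proof (rule 1(1))
  fix m n R C \<eta> X l u t
  assume h: "margins m n R C" "0 < (\<eta> :: real)" "\<eta> < 1" "X \<in> open_simplex m n" "scaling T m n R C \<eta> X = (l, u, t)"
  have "\<eta> \<in> {0<..<1}" using h by simp
  note bspec[OF mp[OF spec[OF spec[OF spec[OF spec[OF 1(2), of m], of n], of R], of C] h(1)] this]
  note bspec[OF conjunct2[OF conjunct2[OF this]] open_simplex_positive[OF h(4)]]
  then show "(\<forall>i<m. 0 < l i) \<and> (\<forall>j<n. 0 < u j) \<and> \<bar>scaling_product m n R C l u - scaling_value m n R C X\<bar> <= \<eta> * scaling_value m n R C X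
   \<and> real t <= real a * (real (total m R) / \<eta>) ^ a" by (simp add: h(5) Let_def)
 qed
qed

lemma scaling_factors:
 assumes "scaling_ok T" "margins m n R C" "0 < \<eta>" "\<eta> < 1" "X \<in> open_simplex m n" "scaling T m n R C \<eta> X = (l, u, t)"
 shows "\<forall>i<m. 0 < l i" "\<forall>j<n. 0 < u j" "\<bar>scaling_product m n R C l u - scaling_value m n R C X\<bar> <= \<eta> * scaling_value m n R C X"
 using scaling_spec[OF assms(1)] assms(2-6) by metis+

lemma scaling_factors_measurable:
 assumes "scaling_ok T" "margins m n R C" "0 < \<eta>" "\<eta> < 1"
 shows "i < m ==> (%X. fst (scaling T m n R C \<eta> X) i) \<in> borel_measurable (simplex_measure m n)"
  "j < n ==> (%X. fst (snd (scaling T m n R C \<eta> X)) j) \<in> borel_measurable (simplex_measure m n)"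
proof -
 have "\<eta> \<in> {0<..<1}" using assms by simp
 then have "i < m ==> (%X. fst (scaling T m n R C \<eta> X) i) \<in> borel_measurable (restrict_space (mat_space m n) (positive_mats m n))"
  "j < n ==> (%X. fst (snd (scaling T m n R C \<eta> X)) j) \<in> borel_measurable (restrict_space (mat_space m n) (positive_mats m n))"
  using assms(1,2) unfolding scaling_ok_def by blast+
 then show "i < m ==> (%X. fst (scaling T m n R C \<eta> X) i) \<in> borel_measurable (simplex_measure m n)"
  "j < n ==> (%X. fst (snd (scaling T m n R C \<eta> X)) j) \<in> borel_measurable (simplex_measure m n)"
  using restrict_simplex[OF assms(2,1)] by blast+
qed

lemma phi_alg_approximates:
 assumes "scaling_ok T" "margins m n R C" "0 < \<eta>" "\<eta> < 1" "\<eta> <= e"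
 shows "approximates m n e (phi_alg T m n R C \<eta>) (phi_fun m n R C)"
 unfolding approximates_def
proof (intro conjI ballI)
 show "phi_alg T m n R C \<eta> \<in> borel_measurable (simplex_measure m n)"
  unfolding phi_alg_def[abs_def] scaling_product_def case_prod_beta
  by (intro borel_measurable_times borel_measurable_prod borel_measurable_power borel_measurable_const scaling_factors_measurable[OF assms(1-4)]) auto
 fix X assume X: "X \<in> open_simplex m n"
 obtain l u t where lut: "scaling T m n R C \<eta> X = (l, u, t)" by (metis prod_cases3)
 have pc: "0 < phi_const m n R C" by (rule phi_const_pos[OF assms(2,1)])
 have "phi_const m n R C * \<bar>scaling_product m n R C l u - scaling_value m n R C X\<bar> <= phi_const m n R C * (\<eta> * scaling_value m n R C X)"
  using scaling_factors(3)[OF assms(1-4) X lut] pc by (intro mult_left_mono) auto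
 then have "\<bar>phi_alg T m n R C \<eta> X - phi_fun m n R C X\<bar> <= \<eta> * phi_fun m n R C X"
  using pc by (simp add: phi_alg_def phi_fun_def lut right_diff_distrib[symmetric] abs_mult mult_ac)
 also have "... <= e * phi_fun m n R C X"
  using phi_pos[OF assms(2,1) X] assms(5) by (intro mult_right_mono) auto
 finally show "\<bar>phi_alg T m n R C \<eta> X - phi_fun m n R C X\<bar> <= e * phi_fun m n R C X" .
qed

lemma block_unscale_nonneg:
 assumes "margins m n R C" "X \<in> open_simplex m n" "\<forall>i<m. 0 < l i" "\<forall>j<n. 0 < u j"
 shows "block_mat (total m R) R C (unscale m n X l u) \<in> idx (total m R) (total m R) \<rightarrow>\<^sub>E {0..}"
proof
 fix e assume "e \<in> idx (total m R) (total m R)"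
 then obtain a b where e: "e = (a, b)" "a < total m R" "b < total m R" by (auto simp: idx_def)
 have "block_of R a < m" "block_of C b < n" using e margins_pos(4)[OF assms(1)] by (auto intro: block_of_less)
 then show "block_mat (total m R) R C (unscale m n X l u) e \<in> {0..}"
  using e assms(3,4) open_simplex_pos[OF assms(2), of "(block_of R a, block_of C b)"]
  by (simp add: block_mat_def unscale_def idx_iff less_imp_le Let_def)
qed (auto simp: block_mat_def)

lemma p_alg_measurable:
 assumes T: "scaling_ok T" "permanent_ok T" and mar: "margins m n R C" and eta: "0 < \<eta>" "\<eta> < 1" and e: "0 < e" "e < 1" "0 < \<zeta>" "\<zeta> < 1"
 shows "(%(X, s). fst (p_alg T m n R C \<eta> e \<zeta> X s)) \<in> borel_measurable (simplex_measure m n \<Otimes>\<^sub>M seed_space)"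
proof -
 let ?N = "total m R" and ?S = "simplex_measure m n"
 let ?M = "restrict_space (mat_space ?N ?N) (idx ?N ?N \<rightarrow>\<^sub>E {0..})"
 define B where "B X = block_mat ?N R C (unscale m n X (fst (scaling T m n R C \<eta> X)) (fst (snd (scaling T m n R C \<eta> X))))" for X
 have B: "B \<in> measurable ?S ?M"
 proof (rule measurable_restrict_space2)
  have "B X \<in> idx ?N ?N \<rightarrow>\<^sub>E {0..}" if X: "X \<in> open_simplex m n" for X
  proof -
   obtain l u t where lut: "scaling T m n R C \<eta> X = (l, u, t)" by (metis prod_cases3)
   show ?thesis unfolding B_def lut fst_conv snd_conv
    by (rule block_unscale_nonneg[OF mar X scaling_factors(1,2)[OF T(1) mar eta X lut]])
  qed
  then show "B \<in> space ?S \<rightarrow> idx ?N ?N \<rightarrow>\<^sub>E {0..}" using space_simplex margins_pos[OF mar] by auto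
  show "B \<in> measurable ?S (mat_space ?N ?N)"
   unfolding mat_space_def B_def block_mat_def
  proof (rule measurable_restrict)
   fix e assume "e \<in> idx ?N ?N"
   then obtain a b where ab: "e = (a, b)" "a < ?N" "b < ?N" by (auto simp: idx_def)
   have ij: "block_of R a < m" "block_of C b < n" using ab margins_pos(4)[OF mar] by (auto intro: block_of_less)
   have "(%X. X (block_of R a, block_of C b)) \<in> borel_measurable ?S"
    by (rule measurable_simplex[OF margins_pos(2,3)[OF mar] measurable_entry]) (simp add: idx_iff ij)
   note [measurable] = this scaling_factors_measurable(1)[OF T(1) mar eta ij(1)] scaling_factors_measurable(2)[OF T(1) mar eta ij(2)]
   show "(%X. case e of (a, b) => let i = block_of R a; j = block_of C b in
     unscale m n X (fst (scaling T m n R C \<eta> X)) (fst (snd (scaling T m n R C \<eta> X))) (i, j) / (real (R i) * real (C j))) \<in> borel_measurable ?S"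
    unfolding ab(1) Let_def unscale_def by (simp add: idx_iff ij)
  qed
 qed
 have "(%(A, s). fst (permanent_alg T ?N A e \<zeta> s)) \<in> borel_measurable (?M \<Otimes>\<^sub>M seed_space)"
 proof -
  have "e \<in> {0<..<1}" "\<zeta> \<in> {0<..<1}" using e by auto
  then show ?thesis using T(2) margins_pos(1)[OF mar] unfolding permanent_ok_def by blast
 qed
 from measurable_compose[OF _ this, of "%x. (B (fst x), snd x)"]
 have "(%x. fst (permanent_alg T ?N (B (fst x)) e \<zeta> (snd x))) \<in> borel_measurable (?S \<Otimes>\<^sub>M seed_space)"
  using measurable_compose[OF measurable_fst B, of seed_space] by simp
 moreover have "(%(X, s). fst (p_alg T m n R C \<eta> e \<zeta> X s)) = (%x. normalized_per ?N (fst (permanent_alg T ?N (B (fst x)) e \<zeta> (snd x))))"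
  by (auto simp: p_alg_def B_def Let_def fun_eq_iff split: prod.splits)
 ultimately show ?thesis by (simp add: normalized_per_def)
qed

text \<open>By \<open>normalized_per_unscale\<close> the inexact scaling costs a relative error
  \<open>3 / 2 * e\<close> and the permanent costs \<open>e\<close>; \<open>e <= 1 / 3\<close> keeps
  the sum with the cross term within \<open>3 * e\<close>.\<close>

lemma p_alg_accurate:
 assumes T: "scaling_ok T" "permanent_ok T" and mar: "margins m n R C" and eta: "0 < \<eta>" "\<eta> <= e" and e: "0 < e" "e <= 1 / 3" "0 < \<zeta>" "\<zeta> < 1"
  and X: "X \<in> open_simplex m n"
 shows "measure seed_space {s \<in> space seed_space. \<bar>fst (p_alg T m n R C \<eta> e \<zeta> X s) - p_fun m n R C X\<bar> <= 3 * e * p_fun m n R C X} \<ge> 1 - \<zeta>"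
proof -
 let ?N = "total m R"
 have eta1: "\<eta> < 1" using eta e by linarith
 obtain l u t where lut: "scaling T m n R C \<eta> X = (l, u, t)" by (metis prod_cases3)
 note f = scaling_factors[OF T(1) mar eta(1) eta1 X lut]
 define B where "B = block_mat ?N R C (unscale m n X l u)"
 have B: "B \<in> idx ?N ?N \<rightarrow>\<^sub>E {0..}" unfolding B_def by (rule block_unscale_nonneg[OF mar X f(1,2)])
 let ?sv = "scaling_value m n R C X" and ?sp = "scaling_product m n R C l u" and ?p = "p_fun m n R C X" and ?q = "normalized_per ?N (permanent ?N B)"
 have sv: "0 < ?sv" by (rule scaling_value_pos[OF mar open_simplex_pos[OF X]])
 have p: "1 <= ?p" by (rule p_fun_ge_1[OF mar open_simplex_pos[OF X]])
 have "\<eta> * ?sv <= 1 / 3 * ?sv" using eta e sv by (intro mult_right_mono) auto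
 \<comment> \<open>The tolerance is at most \<open>1 / 3\<close>; the inverse of this
   \<open>2 / 3\<close> is the factor \<open>3 / 2\<close> in the next error bound.\<close>
 then have sp: "2 / 3 * ?sv <= ?sp" using f(3) by linarith
 have q: "?q * ?sp = ?p * ?sv" unfolding B_def by (rule normalized_per_unscale[OF mar X]) (use f in auto)
 have qp: "\<bar>?q - ?p\<bar> <= 3 / 2 * e * ?p"
 proof -
  have "(?q - ?p) * ?sp = ?p * (?sv - ?sp)" using q by (simp add: algebra_simps)
  then have "\<bar>?q - ?p\<bar> * \<bar>?sp\<bar> = \<bar>?p\<bar> * \<bar>?sv - ?sp\<bar>" unfolding abs_mult[symmetric] by (rule arg_cong)
  then have "\<bar>?q - ?p\<bar> * ?sp = ?p * \<bar>?sp - ?sv\<bar>" using sp sv p by (simp add: abs_minus_commute)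
  also have "... <= ?p * (\<eta> * ?sv)" using f(3) p by (intro mult_left_mono) auto
  also have "... <= ?p * (e * (3 / 2 * ?sp))" using eta e sp sv p by (intro mult_left_mono mult_mono) auto
  finally have "\<bar>?q - ?p\<bar> * ?sp <= 3 / 2 * e * ?p * ?sp" by (simp add: mult_ac)
  then show ?thesis by (rule mult_right_le_imp_le) (use sp sv in linarith)
 qed
 have M: "measure seed_space {s \<in> space seed_space. \<bar>fst (permanent_alg T ?N B e \<zeta> s) - permanent ?N B\<bar> <= e * permanent ?N B} \<ge> 1 - \<zeta>"
 proof -
  have "e \<in> {0<..<1}" "\<zeta> \<in> {0<..<1}" using e by auto
  then show ?thesis using T(2) margins_pos(1)[OF mar] B unfolding permanent_ok_def by blast
 qed
 interpret prob_space seed_space by (rule prob_space_seed)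
 have "(%s. fst (p_alg T m n R C \<eta> e \<zeta> X s)) \<in> borel_measurable seed_space"
  using measurable_compose[OF measurable_Pair1'[of X "simplex_measure m n" seed_space] p_alg_measurable[OF T mar eta(1) eta1 e(1) _ e(3,4)]] X e
  by (simp add: space_simplex[OF margins_pos(2,3)[OF mar]])
 then have G: "{s \<in> space seed_space. \<bar>fst (p_alg T m n R C \<eta> e \<zeta> X s) - ?p\<bar> <= 3 * e * ?p} \<in> events" by measurable
 have "\<bar>fst (p_alg T m n R C \<eta> e \<zeta> X s) - ?p\<bar> <= 3 * e * ?p"
  if s: "\<bar>fst (permanent_alg T ?N B e \<zeta> s) - permanent ?N B\<bar> <= e * permanent ?N B" for s
 proof -
  have a: "fst (p_alg T m n R C \<eta> e \<zeta> X s) = normalized_per ?N (fst (permanent_alg T ?N B e \<zeta> s))"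
   by (simp add: p_alg_def lut B_def Let_def split: prod.splits)
  have "\<bar>fst (p_alg T m n R C \<eta> e \<zeta> X s) - ?q\<bar> <= e * ?q"
   using mult_left_mono[OF s, of "real ?N ^ ?N / fact ?N"]
   unfolding a normalized_per_def right_diff_distrib[symmetric] abs_mult by (simp add: mult_ac)
  from relative_error_trans[OF this qp] have "\<bar>fst (p_alg T m n R C \<eta> e \<zeta> X s) - ?p\<bar> <= (e + 3 / 2 * e + e * (3 / 2 * e)) * ?p" using e by simp
  also have "... <= 3 * e * ?p"
  proof (intro mult_right_mono)
   have "e * e <= e * (1 / 3)" using e by (intro mult_left_mono) auto
   then show "e + 3 / 2 * e + e * (3 / 2 * e) <= 3 * e" by simp
  qed (use p in simp)
  finally show ?thesis .
 qed
 then have "measure seed_space {s \<in> space seed_space. \<bar>fst (permanent_alg T ?N B e \<zeta> s) - permanent ?N B\<bar> <= e * permanent ?N B}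
   <= measure seed_space {s \<in> space seed_space. \<bar>fst (p_alg T m n R C \<eta> e \<zeta> X s) - ?p\<bar> <= 3 * e * ?p}"
  by (intro finite_measure_mono G) auto
 with M show ?thesis by linarith
qed

section \<open>Running time\<close>

text \<open>The local abbreviations of \<open>integrate_ok\<close> become parameters with defining
  equations, so that instances can keep \<open>b\<close> folded.\<close>

lemma integrate_spec:
 assumes "integrate_ok T"
 obtains a :: nat where "0 < a" "!!m n L eps \<zeta> F F' b I. 0 < m ==> 0 < n ==> 1 <= L ==> 0 < eps ==> eps < 1 ==> 0 < \<zeta> ==> \<zeta> < 1 ==>
  b = real a * (real (m * n) * L / (eps * \<zeta>)) ^ a ==> I = (\<integral>X. F X \<partial>simplex_measure m n) ==>
  conditioned m n L F ==> approximates m n (1 / b) F' F ==>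
   (%s. outcome (integrate T m n L eps \<zeta> F' s)) \<in> borel_measurable seed_space \<and>
   measure seed_space {s \<in> space seed_space. \<bar>outcome (integrate T m n L eps \<zeta> F' s) - I\<bar> <= eps * I} \<ge> 1 - \<zeta> \<and>
   (\<forall>s\<in>space seed_space. real (steps (integrate T m n L eps \<zeta> F' s)) <= b
    \<and> length (calls (integrate T m n L eps \<zeta> F' s)) <= steps (integrate T m n L eps \<zeta> F' s)
    \<and> set (calls (integrate T m n L eps \<zeta> F' s)) \<subseteq> open_simplex m n)"
proof (rule exE[OF assms[unfolded integrate_ok_def Let_def]], goal_cases)
 case (1 a)
 show ?case by (rule 1(1)[of a]) (use 1(2) in auto)
qed

lemma sample_spec:
 assumes "sample_ok T"
 obtains a :: nat where "0 < a" "!!m n L \<xi> F F' b I. 0 < m ==> 0 < n ==> 1 <= L ==> 0 < \<xi> ==> \<xi> < 1 ==>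
  b = real a * (real (m * n) * L / \<xi>) ^ a ==> I = (\<integral>X. F X \<partial>simplex_measure m n) ==>
  conditioned m n L F ==> approximates m n (1 / b) F' F ==>
   (%s. outcome (sample T m n L \<xi> F' s)) \<in> measurable seed_space (simplex_measure m n) \<and>
   (\<forall>A\<in>sets (simplex_measure m n).
    \<bar>measure (distr seed_space (simplex_measure m n) (%s. outcome (sample T m n L \<xi> F' s))) A
     - measure (density (simplex_measure m n) (%X. ennreal (F X / I))) A\<bar> <= \<xi>) \<and>
   (\<forall>s\<in>space seed_space. real (steps (sample T m n L \<xi> F' s)) <= b
    \<and> length (calls (sample T m n L \<xi> F' s)) <= steps (sample T m n L \<xi> F' s)
    \<and> set (calls (sample T m n L \<xi> F' s)) \<subseteq> open_simplex m n)"
proof (rule exE[OF assms[unfolded sample_ok_def Let_def]], goal_cases)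
 case (1 a)
 show ?case by (rule 1(1)[of a]) (use 1(2) in auto)
qed

lemma permanent_spec:
 assumes "permanent_ok T"
 obtains a :: nat where "!!N eps \<zeta> A s. 0 < N ==> 0 < eps ==> eps < 1 ==> 0 < \<zeta> ==> \<zeta> < 1 ==> A \<in> idx N N \<rightarrow>\<^sub>E {0..} ==> s \<in> space seed_space ==>
  real (snd (permanent_alg T N A eps \<zeta> s)) <= real a * (real N / (eps * \<zeta>)) ^ a"
proof (rule exE[OF assms[unfolded permanent_ok_def]], goal_cases)
 case (1 a)
 show ?case by (rule 1(1)[of a]) (use 1(2) in auto)
qed

text \<open>All running times are measured in powers of one base \<open>w\<close>; a polynomial
  bound of a subroutine becomes a single power, one extra factor \<open>w\<close> absorbing the
  leading coefficient.\<close>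

lemma polynomial_bound:
 fixes w y :: real
 assumes "1 <= w" "0 <= y" "y <= w ^ q" "real a <= w" "q * a + 1 <= D"
 shows "real a * y ^ a <= w ^ D"
proof -
 have "real a * y ^ a <= w * (w ^ q) ^ a" using assms by (intro mult_mono power_mono) auto
 also have "... = w ^ (q * a + 1)" by (simp add: power_mult)
 also have "... <= w ^ D" by (rule power_increasing[OF assms(5,1)])
 finally show ?thesis .
qed

text \<open>The base is at least 1000, so raising the exponent by one pays for adding two terms with
  coefficients up to 40.\<close>

lemma powers_add_le:
 fixes w :: real
 assumes "1000 <= w" "i <= D" "j <= D" "x <= 40 * w ^ i" "y <= 40 * w ^ j"
 shows "x + y <= w ^ Suc D"
proof -
 have "w ^ i <= w ^ D" "w ^ j <= w ^ D" using assms(1) by (auto intro!: power_increasing assms)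
 then have "x + y <= 80 * w ^ D" using assms(4,5) by linarith
 also have "... <= w * w ^ D" using assms(1) by (intro mult_right_mono) auto
 finally show ?thesis by simp
qed

lemma oracle_cost_power:
 fixes w :: real
 assumes w: "1000 <= w" and st: "real (steps r) <= w ^ D" "length (calls r) <= steps r" and cost: "!!X. X \<in> set (calls r) ==> real (cost X) <= w ^ Suc D"
 shows "real (oracle_cost cost r) <= w ^ (2 * D + 2)"
proof -
 have "real (\<Sum>X\<leftarrow>xs. cost X) <= length xs * w ^ Suc D" if "!!X. X \<in> set xs ==> real (cost X) <= w ^ Suc D" for xs
  using that
 proof (induction xs)
  case (Cons X xs)
  then have "real (cost X) <= w ^ Suc D" "real (\<Sum>X\<leftarrow>xs. cost X) <= length xs * w ^ Suc D" by simp_all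
  then show ?case by (simp add: distrib_right)
 qed simp
 from this[OF cost] have "real (\<Sum>X\<leftarrow>calls r. cost X) <= length (calls r) * w ^ Suc D" by simp
 also have "... <= w ^ D * w ^ Suc D" using st w by (intro mult_right_mono zero_le_power) linarith+
 finally have "real (oracle_cost cost r) <= w ^ D + w ^ D * w ^ Suc D" using st(1) by (simp add: oracle_cost_def)
 also have "... <= w ^ Suc (2 * D + 1)"
  by (rule powers_add_le[OF w, of D _ "2 * D + 1"]) (use w in \<open>auto simp: power_add mult_2\<close>)
 finally show ?thesis by simp
qed

lemma ln_ge_two_thirds: "2 <= x ==> 2 / 3 <= ln (x :: real)"
 using ln2_ge_two_thirds by (smt (verit) ln_mono)

text \<open>The threshold is \<open>N\<close> to the power \<open>\<delta> * ln N\<close>, so the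
  exponent of \<open>N\<close> becomes \<open>B * (1 + \<delta> * ln N)\<close>; the 1 is absorbed
  by \<open>2 * ln N\<close>.\<close>

lemma quasi_polynomial:
 assumes N: "2 <= N" and eps: "0 < eps" "eps < 1" and c: "1 <= c" and delta: "0 <= \<delta>"
  and K: "c ^ B + 2 * real B + \<delta> * B <= K"
 shows "(c * real N * threshold \<delta> N / eps) ^ B <= K * eps powr (- K) * real N powr (K * ln N)"
proof -
 let ?l = "ln (real N)"
 have l: "2 / 3 <= ?l" using N by (intro ln_ge_two_thirds) simp
 have Bd: "0 <= \<delta> * B" "1 <= c ^ B" using delta c by auto
 have "(c * real N * threshold \<delta> N / eps) ^ B = c ^ B * (1 / eps) ^ B * (real N * threshold \<delta> N) ^ B"
  by (simp add: power_mult_distrib power_divide)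
 also have "(1 / eps) ^ B = eps powr (- real B)" using eps by (simp add: powr_minus powr_realpow power_one_over inverse_eq_divide)
 also have "(real N * threshold \<delta> N) ^ B = real N powr (real B * (1 + \<delta> * ?l))"
  using N by (simp add: threshold_def powr_add powr_powr mult.commute flip: powr_realpow powr_mult)
   (simp add: powr_add powr_powr powr_realpow[symmetric] powr_mult algebra_simps)
 also have "c ^ B * eps powr (- real B) * ... <= K * eps powr (- K) * real N powr (K * ?l)"
 proof (intro mult_mono)
  show "c ^ B <= K" using K Bd by linarith
  show "eps powr (- real B) <= eps powr (- K)" using K Bd eps by (intro powr_mono') auto
  have "real B * (1 + \<delta> * ?l) <= (2 * real B + \<delta> * B) * ?l"
   using mult_left_mono[OF l, of "real B"] by (simp add: algebra_simps)
  also have "... <= K * ?l" using K Bd l by (intro mult_right_mono) auto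
  finally show "real N powr (real B * (1 + \<delta> * ?l)) <= real N powr (K * ?l)" using N by (intro powr_mono) auto
 qed (use K Bd in auto)
 finally show ?thesis .
qed

definition accurate :: "toolkit => real => nat => nat => nat => (nat => nat) => (nat => nat) => real => (nat => seed) set" where
 "accurate T \<delta> c m n R C eps = {\<omega> \<in> space coin_space.
  \<bar>fst (count_alg T \<delta> c m n R C eps \<omega>) - real (num_tables m n R C)\<bar> <= eps * real (num_tables m n R C)}"

text \<open>One constant \<open>c\<close> has to serve the accuracies and, as an exponent, the
  scaling tolerance. It must exceed the degrees of the subroutines, so that the inverse
  \<open>w ^ c\<close> of the tolerance dominates the bounds \<open>b\<close> that integration and
  sampling put on their oracle.\<close>

theorem count_alg_spec:
 assumes T: "toolkit_ok T" and delta: "0 < \<delta>"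
 obtains c B :: nat where "0 < c"
  "!!m n R C eps d. margins m n R C ==> 2 <= total m R ==> 0 < eps ==> eps < 1 ==>
   emeasure (psi_measure m n R C) {X \<in> positive_mats m n. p_fun m n R C X > threshold \<delta> (total m R)} <= ennreal d ==>
   0 <= d ==> d <= eps / 10 ==> measure coin_space (accurate T \<delta> c m n R C eps) \<ge> 2 / 3"
  "!!m n R C eps \<omega>. margins m n R C ==> 2 <= total m R ==> 0 < eps ==> eps < 1 ==> \<omega> \<in> space coin_space ==>
   real (snd (count_alg T \<delta> c m n R C eps \<omega>)) <= (real c * real (total m R) * threshold \<delta> (total m R) / eps) ^ B"
proof -
 have ok: "scaling_ok T" "permanent_ok T" "integrate_ok T" "sample_ok T" using T by (simp_all add: toolkit_ok_def)
 obtain a1 where a1: "!!m n R C \<eta> X l u t. margins m n R C ==> 0 < \<eta> ==> \<eta> < 1 ==> X \<in> open_simplex m n ==> scaling T m n R C \<eta> X = (l, u, t) ==>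
   real t <= real a1 * (real (total m R) / \<eta>) ^ a1"
  using scaling_spec[OF ok(1)] by metis
 obtain a2 where a2: "!!N eps \<zeta> A s. 0 < N ==> 0 < eps ==> eps < 1 ==> 0 < \<zeta> ==> \<zeta> < 1 ==> A \<in> idx N N \<rightarrow>\<^sub>E {0..} ==> s \<in> space seed_space ==>
  real (snd (permanent_alg T N A eps \<zeta> s)) <= real a2 * (real N / (eps * \<zeta>)) ^ a2"
  using permanent_spec[OF ok(2)] by blast
 show thesis
 proof (rule integrate_spec[OF ok(3)], rule sample_spec[OF ok(4)], goal_cases)
  case (1 a3 a4)
  note a3 = 1(1,2) and a4 = 1(3,4)
  \<comment> \<open>At least 1000 for \<open>estimate_accurate\<close>, and at least each
    \<open>a\<close> and each \<open>7 * a + 1\<close>: the bounds \<open>b3\<close> and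
    \<open>b4\<close> turn out to be at most \<open>w ^ (7 * a3 + 1)\<close> and
    \<open>w ^ (7 * a4 + 1)\<close>.\<close>
  define c where "c = 1001 + 7 * (a1 + a2 + a3 + a4)"
  \<comment> \<open>With tolerance \<open>1 / w ^ c\<close> the scaling procedure takes at most
    \<open>w ^ ((c + 1) * a1 + 1)\<close> steps; \<open>D\<close> bounds this exponent and those of
    the other subroutines.\<close>
  define D where "D = (c + 1) * c + 1"
  have c: "1000 <= c" "real a1 <= c" "real a2 <= c" "real a3 <= c" "real a4 <= c" "7 * a3 + 1 <= c" "7 * a4 + 1 <= c"
   by (auto simp: c_def)
  have D: "(c + 1) * a1 + 1 <= D" "7 * a2 + 1 <= D" "7 * a3 + 1 <= D" "7 * a4 + 1 <= D" "3 <= D" "c <= D"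
  proof -
   have "(c + 1) * a <= (c + 1) * c" if "real a <= c" for a using that by (intro mult_left_mono) auto
   moreover have "7 * a <= (c + 1) * a" for a using c(1) by (intro mult_right_mono) auto
   ultimately show "(c + 1) * a1 + 1 <= D" "7 * a2 + 1 <= D" "7 * a3 + 1 <= D" "7 * a4 + 1 <= D"
    unfolding D_def using c(2-5) by (meson add_right_mono order_trans)+
   have "c * 1 <= (c + 1) * c" using c(1) by simp
   then show "3 <= D" "c <= D" using c(1) unfolding D_def by linarith+
  qed
  have main: "(emeasure (psi_measure m n R C) {X \<in> positive_mats m n. p_fun m n R C X > threshold \<delta> (total m R)} <= ennreal d \<and>
    0 <= d \<and> d <= eps / 10 \<longrightarrow> measure coin_space (accurate T \<delta> c m n R C eps) \<ge> 2 / 3) \<and>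
   (\<forall>\<omega>\<in>space coin_space. real (snd (count_alg T \<delta> c m n R C eps \<omega>)) <= (real c * real (total m R) * threshold \<delta> (total m R) / eps) ^ (2 * D + 8))"
   if h: "margins m n R C" "2 <= total m R" "0 < eps" "eps < 1" for m n R C eps d
  proof -
   let ?N = "total m R" and ?F = "phi_fun m n R C"
   define \<tau> where "\<tau> = threshold \<delta> ?N"
   \<comment> \<open>The base of the time bound in the conclusion; every parameter of the run is at
     most a small power of it.\<close>
   define w where "w = real c * real ?N * \<tau> / eps"
   define k where "k = num_samples c \<tau> eps"
   define \<eta> where "\<eta> = scaling_tol c ?N \<tau> eps"
   define L where "L = real (?N + m * n)"
   define \<zeta> where "\<zeta> = 1 / (real c * real k)"
   note pos = margins_pos[OF h(1)]
   have "0 <= \<delta> * ln (real ?N)" using delta h(2) by simp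
   then have tau: "1 <= \<tau>" unfolding \<tau>_def threshold_def using h(2) by (intro ge_one_powr_ge_zero) auto
   have e: "1 / eps \<ge> 1" using h by simp
   have prodle: "x * y <= x * y * z" if "0 <= x * y" "1 <= z" for x y z :: real using mult_left_mono[OF that(2,1)] by simp
   have w: "real c <= w" "real ?N <= w" "c * \<tau> / eps <= w" "c / eps <= w" "\<tau> / eps <= w"
   proof -
    have N: "1 <= real ?N" "1 <= real c" using h(2) c(1) by auto
    have 1: "1 * 1 <= real ?N * \<tau>" "1 * 1 <= real c * \<tau>" "1 * 1 <= real c * real ?N" using N tau by (intro mult_mono; simp)+
    then have 2: "1 * 1 <= (real ?N * \<tau>) * (1 / eps)" "1 * 1 <= (real c * \<tau>) * (1 / eps)" using e by (intro mult_mono; simp)+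
    have le: "x * 1 <= x * y" if "0 <= x" "1 <= y" for x y :: real using that by (intro mult_left_mono) auto
    show "real c <= w" using le[of c "(real ?N * \<tau>) * (1 / eps)"] 2 by (simp add: w_def mult_ac)
    show "real ?N <= w" using le[of ?N "(real c * \<tau>) * (1 / eps)"] 2 by (simp add: w_def mult_ac)
    show "c * \<tau> / eps <= w" using le[of "c * \<tau> / eps" "real ?N"] N tau h by (simp add: w_def mult_ac)
    show "c / eps <= w" using le[of "c / eps" "real ?N * \<tau>"] 1 h by (simp add: w_def mult_ac)
    show "\<tau> / eps <= w" using le[of "\<tau> / eps" "real c * real ?N"] 1 tau h by (simp add: w_def mult_ac)
   qed
   have w1000: "1000 <= w" using w(1) c(1) by linarith
   then have w1: "1 <= w" "0 < w" by auto
   have up: "x <= w ^ i ==> x <= 40 * w ^ i" for x i using zero_le_power[of w i] w1 by linarith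
   have eta: "\<eta> = 1 / w ^ c" by (simp add: \<eta>_def scaling_tol_def w_def power_divide)
   have "w ^ 1 <= w ^ c" using w1 c(1) by (intro power_increasing) auto
   then have "\<eta> <= 1 / w" unfolding eta using w1 by (intro divide_left_mono) auto
   moreover have "1 / w <= eps / c" using w(4) w1 h c(1) by (simp add: field_simps)
   moreover have "eps / c <= 1 / 1000" using h c(1) by (intro frac_le) auto
   moreover have "0 < \<eta>" unfolding eta using w1 by simp
   ultimately have eta': "0 < \<eta>" "\<eta> <= eps / c" "eps / c <= 1 / 1000" "\<eta> < 1"
    by linarith+
   have ec: "0 < eps / c" using h c(1) by simp
   have k: "real c * \<tau>\<^sup>2 / eps\<^sup>2 <= k" unfolding k_def num_samples_def by (rule real_nat_ceiling_ge)
   have ct: "1000 <= real c * \<tau>\<^sup>2 / eps\<^sup>2"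
   proof -
    have "1 * 1000 <= (\<tau> / eps)\<^sup>2 * real c"
    proof (intro mult_mono one_le_power)
     have "1 * 1 <= \<tau> * (1 / eps)" using tau e by (intro mult_mono) auto
     then show "1 <= \<tau> / eps" by simp
    qed (use c in auto)
    then show ?thesis by (simp add: power_divide mult.commute)
   qed
   then have k1: "1000 <= real k" using k by linarith
   have k3: "real k <= w ^ 3"
   proof -
    have "real k <= real c * \<tau>\<^sup>2 / eps\<^sup>2 + 1" unfolding k_def num_samples_def using ct by linarith
    also have "... = (c * \<tau> / eps) * (\<tau> / eps) + 1" by (simp add: power2_eq_square)
    also have "... <= w * w + 1" using w tau h by (intro add_right_mono mult_mono) auto
    also have "... <= w ^ Suc 2" using w1 w1000 by (intro powers_add_le[of w 2 2 0]) (auto simp: power2_eq_square)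
    finally show ?thesis by (simp add: eval_nat_numeral)
   qed
   have zeta: "0 < \<zeta>" "\<zeta> < 1"
   proof -
    have "1 * 1 < real c * real k" using c(1) k1 by (intro mult_strict_mono) auto
    then show "0 < \<zeta>" "\<zeta> < 1" by (auto simp: \<zeta>_def)
   qed
   have mnN: "m * n <= ?N * ?N"
   proof -
    have "(\<Sum>i<m. 1) <= total m R" "(\<Sum>j<n. 1) <= total n C"
     unfolding total_def using h(1) by (intro sum_mono; force simp: margins_def)+
    then show ?thesis using pos(4) by (intro mult_mono) auto
   qed
   have mn: "real (m * n) <= w ^ 2" "L <= w ^ 3" "1 <= L"
   proof -
    have "real (m * n) <= real ?N * real ?N" using mnN by (metis of_nat_le_iff of_nat_mult)
    also have "... <= w * w" using w w1 by (intro mult_mono) auto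
    finally show *: "real (m * n) <= w ^ 2" by (simp add: power2_eq_square)
    have "real ?N + real (m * n) <= w ^ Suc 2"
    proof (rule powers_add_le[OF w1000])
     show "real ?N <= 40 * w ^ 1" using w(2) w1 by simp
     show "real (m * n) <= 40 * w ^ 2" using * zero_le_power2[of w] by linarith
    qed auto
    then show "L <= w ^ 3" by (simp add: L_def eval_nat_numeral)
    show "1 <= L" using h(2) by (simp add: L_def add_increasing2)
   qed
   have mnL: "real (m * n) * L <= w ^ 5" using mult_mono[OF mn(1,2)] mn w1 by (simp flip: power_add)
   define b3 b4 where "b3 = real a3 * (real (m * n) * L / (eps / c * (1 / c))) ^ a3" and "b4 = real a4 * (real (m * n) * L / (eps / (c * \<tau>))) ^ a4"
   have b3: "b3 <= w ^ D" "b3 <= w ^ c" "0 < b3" and b4: "b4 <= w ^ D" "b4 <= w ^ c" "0 < b4"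
   proof -
    have p: "0 < real (m * n) * L" using pos mn(3) by simp
    have "real (m * n) * L * (c / eps) * c <= w ^ 5 * w * w" using mnL w p h c(1) w1 by (intro mult_mono) auto
    then have y3: "real (m * n) * L / (eps / c * (1 / c)) <= w ^ 7" by (simp add: eval_nat_numeral mult_ac)
    have "real (m * n) * L * (c * \<tau> / eps) <= w ^ 5 * w" using mnL w p h c(1) w1 tau by (intro mult_mono) auto
    also have "... = w ^ 6" by (simp add: eval_nat_numeral)
    also have "... <= w ^ 7" using w1 by (intro power_increasing) auto
    finally have y4: "real (m * n) * L / (eps / (c * \<tau>)) <= w ^ 7" by (simp add: mult_ac)
    have y: "0 < real (m * n) * L / (eps / c * (1 / c))" "0 < real (m * n) * L / (eps / (c * \<tau>))"
     using p h c(1) tau by (intro divide_pos_pos mult_pos_pos p; simp)+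
    have "b3 <= w ^ E" if "7 * a3 + 1 <= E" for E
     unfolding b3_def by (rule polynomial_bound[OF w1(1) less_imp_le[OF y(1)] y3 _ that]) (use c(4) w(1) in linarith)
    then show "b3 <= w ^ D" "b3 <= w ^ c" using c D by blast+
    have "b4 <= w ^ E" if "7 * a4 + 1 <= E" for E
     unfolding b4_def by (rule polynomial_bound[OF w1(1) less_imp_le[OF y(2)] y4 _ that]) (use c(5) w(1) in linarith)
    then show "b4 <= w ^ D" "b4 <= w ^ c" using c D by blast+
    show "0 < b3" "0 < b4" unfolding b3_def b4_def using a3(1) a4(1) by (intro mult_pos_pos zero_less_power y; simp)+
   qed
   \<comment> \<open>The oracle for phi is accurate enough because its tolerance
     \<open>\<eta> = 1 / w ^ c\<close> is below the tolerance \<open>1 / b\<close> of the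
     caller.\<close>
   have app: "approximates m n (1 / b) (phi_alg T m n R C \<eta>) ?F" if "b <= w ^ c" "0 < b" for b
    by (rule phi_alg_approximates[OF ok(1) h(1) eta'(1,4)]) (use that w1 in \<open>auto simp: eta intro!: divide_left_mono\<close>)
   have cond: "conditioned m n L ?F" unfolding L_def by (rule phi_conditioned[OF h(1) ok(1)])
   have ec1: "eps / c < 1" "0 < 1 / real c" "1 / real c < 1" using eta'(3) c(1) by auto
   note I = a3(2)[OF pos(2,3) mn(3) ec ec1 b3_def refl cond app[OF b3(2,3)]]
   have xi: "0 < eps / (c * \<tau>)" "eps / (c * \<tau>) < 1"
    using ec tau ec1 mult_left_mono[OF tau, of "real c"] h c(1) by (auto simp: divide_less_eq intro: less_le_trans)
   note S = a4(2)[OF pos(2,3) mn(3) xi b4_def refl cond app[OF b4(2,3)]]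
   let ?cost = "phi_cost T m n R C \<eta>" and ?int = "integrate T m n L (eps / real c) (1 / real c) (phi_alg T m n R C \<eta>)"
    and ?smp = "sample T m n L (eps / (real c * \<tau>)) (phi_alg T m n R C \<eta>)"
   let ?p = "p_alg T m n R C \<eta> (eps / real c) \<zeta>"
   let ?P = "%\<omega> i. ?p (outcome (?smp (\<omega> (2 * i + 1)))) (\<omega> (2 * i + 2))" and ?O = "%\<omega> i. oracle_cost ?cost (?smp (\<omega> (2 * i + 1)))"
   have alg: "count_alg T \<delta> c m n R C eps \<omega> =
     (outcome (?int (\<omega> 0)) * (1 / real k * (\<Sum>i<k. min (fst (?P \<omega> i)) \<tau>)),
     oracle_cost ?cost (?int (\<omega> 0)) + (\<Sum>i<k. ?O \<omega> i + snd (?P \<omega> i) + 5) + c + 20)" for \<omega>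
    unfolding count_alg_def Let_def \<tau>_def[symmetric] k_def[symmetric] \<eta>_def[symmetric] L_def[symmetric] \<zeta>_def[symmetric] ..
   have "2 / 3 <= measure coin_space (accurate T \<delta> c m n R C eps)"
    if dd: "emeasure (psi_measure m n R C) {X \<in> positive_mats m n. p_fun m n R C X > threshold \<delta> (total m R)} <= ennreal d" "0 <= d" "d <= eps / 10"
    unfolding accurate_def alg fst_conv
   proof (rule estimate_accurate[OF h(1) ok(1) tau h(3,4) c(1) k dd(1)[folded \<tau>_def] dd(2,3), where X = "%s. outcome (?smp s)" and U = "%s. outcome (?int s)" and Q = "%Z s. fst (?p Z s)"])
    show "(%(Z, s). fst (?p Z s)) \<in> borel_measurable (simplex_measure m n \<Otimes>\<^sub>M seed_space)"
     by (rule p_alg_measurable[OF ok(1,2) h(1) eta'(1,4) ec ec1(1) zeta])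
    fix Z assume Z: "Z \<in> open_simplex m n"
    show "1 - 1 / (real c * real k) <= measure seed_space {s \<in> space seed_space. \<bar>fst (?p Z s) - p_fun m n R C Z\<bar> <= 3 * (eps / c) * p_fun m n R C Z}"
     using p_alg_accurate[OF ok(1,2) h(1) eta'(1,2) ec _ zeta Z] eta'(3) unfolding \<zeta>_def by simp
   qed (use I S in auto)
   moreover have "real (snd (count_alg T \<delta> c m n R C eps \<omega>)) <= w ^ (2 * D + 8)" if \<omega>: "\<omega> \<in> space coin_space" for \<omega>
   proof -
    have s: "\<omega> i \<in> space seed_space" for i using measurable_space[OF measurable_coin \<omega>] .
    have tm: "real (snd (snd (scaling T m n R C \<eta> X))) <= w ^ D" if X: "X \<in> open_simplex m n" for X
    proof -
     obtain l u t where lut: "scaling T m n R C \<eta> X = (l, u, t)" by (metis prod_cases3)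
     have "real t <= real a1 * (real ?N / \<eta>) ^ a1" by (rule a1[OF h(1) eta'(1,4) X lut])
     also have "... <= w ^ D"
      by (rule polynomial_bound[where q = "c + 1"]) (use w w1 c D in \<open>auto simp: eta intro: mult_mono\<close>)
     finally show ?thesis by (simp add: lut)
    qed
    have cost: "real (?cost X) <= w ^ Suc D" if X: "X \<in> open_simplex m n" for X
    proof -
     have "real (snd (snd (scaling T m n R C \<eta> X))) + real (20 * ?N) <= w ^ Suc D"
      by (rule powers_add_le[OF w1000, of D D 1]) (use tm[OF X] w w1 D in auto)
     then show ?thesis by (simp add: phi_cost_def case_prod_beta)
    qed
    have ot: "real (oracle_cost ?cost (?int (\<omega> 0))) <= w ^ (2 * D + 2)" "real (oracle_cost ?cost (?smp (\<omega> j))) <= w ^ (2 * D + 2)" for j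
    proof -
     note bI = bspec[OF conjunct2[OF conjunct2[OF I]] s[of 0]] and bS = bspec[OF conjunct2[OF conjunct2[OF S]] s[of j]]
     show "real (oracle_cost ?cost (?int (\<omega> 0))) <= w ^ (2 * D + 2)"
      by (rule oracle_cost_power[OF w1000 order_trans[OF conjunct1[OF bI] b3(1)]]) (use bI cost in blast)+
     show "real (oracle_cost ?cost (?smp (\<omega> j))) <= w ^ (2 * D + 2)"
      by (rule oracle_cost_power[OF w1000 order_trans[OF conjunct1[OF bS] b4(1)]]) (use bS cost in blast)+
    qed
    have pt: "real (snd (?p Z (\<omega> j))) <= w ^ (D + 2)" if Z: "Z \<in> open_simplex m n" for Z j
    proof -
     obtain l u t where lut: "scaling T m n R C \<eta> Z = (l, u, t)" by (metis prod_cases3)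
     note f = scaling_factors[OF ok(1) h(1) eta'(1,4) Z lut]
     let ?A = "block_mat ?N R C (unscale m n Z l u)"
     have "real (snd (permanent_alg T ?N ?A (eps / c) \<zeta> (\<omega> j))) <= real a2 * (real ?N / (eps / c * \<zeta>)) ^ a2"
      by (rule a2[OF pos(1) ec ec1(1) zeta block_unscale_nonneg[OF h(1) Z f(1,2)] s])
     also have "... <= w ^ D"
     proof (rule polynomial_bound[where q = 7])
      have "real ?N * (c / eps) * c * k <= w * w * w * w ^ 3" using w k3 w1 h by (intro mult_mono) auto
      also have "... = w ^ 6" by (simp add: eval_nat_numeral)
      also have "... <= w ^ 7" using w1 by (intro power_increasing) auto
      finally show "real ?N / (eps / c * \<zeta>) <= w ^ 7" by (simp add: \<zeta>_def mult_ac)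
      show "0 <= real ?N / (eps / c * \<zeta>)" using h(3) zeta by (intro divide_nonneg_nonneg mult_nonneg_nonneg) auto
     qed (use w1 w c D in auto)
     finally have t: "real (snd (permanent_alg T ?N ?A (eps / c) \<zeta> (\<omega> j))) <= w ^ D" .
     have tN: "real t + real (20 * ?N\<^sup>2) <= w ^ Suc D"
     proof (rule powers_add_le[OF w1000, of D _ 2])
      have "(real ?N)\<^sup>2 <= w\<^sup>2" using w by (intro power_mono) auto
      then have "20 * (real ?N)\<^sup>2 <= 40 * w\<^sup>2" using zero_le_power2[of w] by linarith
      then show "real (20 * ?N\<^sup>2) <= 40 * w ^ 2" by simp
     qed (use tm[OF Z] lut D w1 in auto)
     have "(real t + real (20 * ?N\<^sup>2)) + real (snd (permanent_alg T ?N ?A (eps / c) \<zeta> (\<omega> j))) <= w ^ Suc (Suc D)"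
      by (rule powers_add_le[OF w1000 _ _ up[OF tN] up[OF t]]) auto
     then show ?thesis by (simp add: p_alg_def lut Let_def case_prod_beta)
    qed
    define M where "M = 2 * D + 4"
    have each: "real (?O \<omega> i + snd (?P \<omega> i) + 5) <= w ^ M" for i
    proof -
     have Z: "outcome (?smp (\<omega> (2 * i + 1))) \<in> open_simplex m n"
      using measurable_space[OF conjunct1[OF S] s] by (simp add: space_simplex[OF pos(2,3)])
     have "real (?O \<omega> i) + real (snd (?P \<omega> i)) <= w ^ Suc (2 * D + 2)"
      by (rule powers_add_le[OF w1000 _ _ up[OF ot(2)] up[OF pt[OF Z]]]) auto
     from up[OF this] have "(real (?O \<omega> i) + real (snd (?P \<omega> i))) + 5 <= w ^ Suc (2 * D + 3)"
      by (rule powers_add_le[OF w1000, of "Suc (2 * D + 2)" _ 0, rotated 2]) auto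
     then show ?thesis by (simp add: M_def eval_nat_numeral)
    qed
    have "real (\<Sum>i<k. ?O \<omega> i + snd (?P \<omega> i) + 5) <= k * w ^ M"
     unfolding of_nat_sum using sum_mono[of "{..<k}", OF each] by simp
    also have "... <= w ^ 3 * w ^ M" using k3 w1 by (intro mult_right_mono) auto
    finally have sum: "real (\<Sum>i<k. ?O \<omega> i + snd (?P \<omega> i) + 5) <= w ^ (M + 3)"
     by (simp add: power_add mult.commute)
    have ci: "real c + 20 <= 40 * w ^ 1" using w(1) w1000 by simp
    have "real (oracle_cost ?cost (?int (\<omega> 0))) + (real c + 20) <= w ^ Suc (2 * D + 2)"
     by (rule powers_add_le[OF w1000 _ _ up[OF ot(1)] ci]) auto
    from powers_add_le[OF w1000 _ _ up[OF this] up[OF sum], of "M + 3"] have "(real (oracle_cost ?cost (?int (\<omega> 0))) + (real c + 20)) + real (\<Sum>i<k. ?O \<omega> i + snd (?P \<omega> i) + 5) <= w ^ Suc (M + 3)"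
     by (simp add: M_def)
    moreover have "Suc (M + 3) = 2 * D + 8" by (simp add: M_def)
    ultimately show ?thesis unfolding alg snd_conv by simp
   qed
   ultimately show ?thesis unfolding w_def \<tau>_def by blast
  qed
  show ?case by (rule that[of c "2 * D + 8"]) (use main c in auto)
 qed
qed

text \<open>The density integrates to 1; this settles the tail bound when the total is 1 and its
  logarithm is 0.\<close>

lemma emeasure_psi_le_1:
 assumes "margins m n R C"
 shows "emeasure (psi_measure m n R C) A <= 1"
proof -
 have [measurable]: "psi m n R C \<in> borel_measurable (mat_lebesgue m n)" unfolding psi_def[abs_def] by measurable
 have "emeasure (psi_measure m n R C) A <= emeasure (psi_measure m n R C) (space (psi_measure m n R C))" by (rule emeasure_space)
 also have "... = (\<integral>\<^sup>+X. ennreal (psi m n R C X) \<partial>mat_lebesgue m n)"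
  unfolding psi_measure_def by (subst emeasure_density) (auto cong: nn_integral_cong)
 also have "... = (\<integral>\<^sup>+X. ennreal (1 / num_tables m n R C) * (indicator (positive_mats m n) X * ennreal (table_poly m n R C X * exp (- (sum X (idx m n))))) \<partial>mat_lebesgue m n)"
 proof (rule nn_integral_cong)
  fix X
  show "ennreal (psi m n R C X) = ennreal (1 / num_tables m n R C) * (indicator (positive_mats m n) X * ennreal (table_poly m n R C X * exp (- (sum X (idx m n)))))"
  proof (cases "X \<in> positive_mats m n")
   case True
   then show ?thesis by (simp add: psi_eq ennreal_mult'[symmetric])
  qed (simp add: psi_def)
 qed
 also have "... = ennreal (1 / num_tables m n R C) * ennreal (num_tables m n R C)"
  unfolding nn_integral_table_poly[symmetric] by (rule nn_integral_cmult) (unfold table_poly_def, measurable)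
 also have "... = 1" using num_tables_pos[OF margins_pos(4)[OF assms]] by (simp add: ennreal_mult[symmetric])
 finally show ?thesis .
qed

theorem theorem3p3:
  shows "\<exists>\<kappa>::real. \<kappa> > 0 \<and> (\<forall>(\<alpha>::real) (\<beta>::real) (\<rho>::real). \<alpha> \<ge> 1 \<and> 0 < \<beta> \<and> \<beta> \<le> 1 \<and> \<rho> \<ge> 1 \<longrightarrow>
    (\<exists>\<delta>::real. \<delta> > 0 \<and>
      (\<forall>m n R C. smooth_instance \<rho> \<alpha> \<beta> m n R C \<longrightarrow>
         measure (psi_measure m n R C)
           {X \<in> positive_mats m n.
              p_fun m n R C X > real (total m R) powr (\<delta> * ln (real (total m R)))}
         \<le> \<kappa> * ((1/2) ^ m + (1/2) ^ n)) \<and>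
      (\<forall>T. toolkit_ok T \<longrightarrow>
         (\<exists>(c::nat) (K::real). c > 0 \<and> K > 0 \<and>
            (\<forall>m n R C (\<epsilon>::real).
               smooth_instance \<rho> \<alpha> \<beta> m n R C \<and> 0 < \<epsilon> \<and> \<epsilon> < 1 \<and>
               \<epsilon> \<ge> K * ((1/2) ^ m + (1/2) ^ n) \<longrightarrow>
               measure coin_space
                 {\<omega> \<in> space coin_space.
                    \<bar>fst (count_alg T \<delta> c m n R C \<epsilon> \<omega>) - real (num_tables m n R C)\<bar>
                      \<le> \<epsilon> * real (num_tables m n R C)} \<ge> 2 / 3 \<and>
               (\<forall>\<omega>\<in>space coin_space.
                  real (snd (count_alg T \<delta> c m n R C \<epsilon> \<omega>))
                    \<le> K * \<epsilon> powr (- K)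
                        * real (total m R) powr (K * ln (real (total m R)))))))))"
\<comment> \<open>Of the four events behind \<open>p_tail\<close> two are bounded by
  \<open>(1 / 2) ^ m\<close> and two by \<open>(1 / 2) ^ n\<close>; hence the constant 2.\<close>
proof (rule exI[of _ 2], intro conjI allI impI, goal_cases)
 case (2 \<alpha> \<beta> \<rho>)
 obtain \<delta> :: real where \<delta>: "1 <= \<delta>"
  "!!m n R C. smooth_instance \<rho> \<alpha> \<beta> m n R C ==> 2 <= total m R ==>
   emeasure (psi_measure m n R C) {X \<in> positive_mats m n. p_fun m n R C X > threshold \<delta> (total m R)} <= ennreal (2 * ((1 / 2) ^ m + (1 / 2) ^ n))"
  using p_tail[of \<alpha> \<beta> \<rho>] 2 by blast
 then have d0: "0 < \<delta>" by simp
 \<comment> \<open>A total of 1 forces a single row and column. Then the right-hand side of the tail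
   bound is 2, and the lower bound on the accuracy cannot be met by a number below 1.\<close>
 have small: "m = 1 \<and> n = 1" if s: "smooth_instance \<rho> \<alpha> \<beta> m n R C" and "\<not> 2 <= total m R" for m n R C
 proof -
  have "margins m n R C" "m <= total m R" "n <= total m R" using s total_ge[OF s] 2 by (auto simp: smooth_instance_def)
  then show ?thesis using that(2) by (auto simp: margins_def)
 qed
 show ?case
 proof (rule exI[of _ \<delta>], intro conjI allI impI, goal_cases)
  case (2 m n R C)
  have "emeasure (psi_measure m n R C) {X \<in> positive_mats m n. p_fun m n R C X > threshold \<delta> (total m R)} <= ennreal (2 * ((1 / 2) ^ m + (1 / 2) ^ n))"
  proof (cases "2 <= total m R")
   case False
   then show ?thesis using small[OF 2] 2 by (auto simp: smooth_instance_def intro!: order_trans[OF emeasure_psi_le_1])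
  qed (rule \<delta>(2)[OF 2])
  then show ?case unfolding measure_def threshold_def by (intro enn2real_leI) auto
 next
  case (3 T)
  from count_alg_spec[OF 3 d0] obtain c B :: nat where c: "0 < c"
   "!!m n R C eps d. margins m n R C ==> 2 <= total m R ==> 0 < eps ==> eps < 1 ==>
    emeasure (psi_measure m n R C) {X \<in> positive_mats m n. p_fun m n R C X > threshold \<delta> (total m R)} <= ennreal d ==>
    0 <= d ==> d <= eps / 10 ==> measure coin_space (accurate T \<delta> c m n R C eps) \<ge> 2 / 3"
   "!!m n R C eps \<omega>. margins m n R C ==> 2 <= total m R ==> 0 < eps ==> eps < 1 ==> \<omega> \<in> space coin_space ==>
    real (snd (count_alg T \<delta> c m n R C eps \<omega>)) <= (real c * real (total m R) * threshold \<delta> (total m R) / eps) ^ B"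
   by blast
  \<comment> \<open>The summand 20 keeps the truncated fraction, twice
    \<open>(1 / 2) ^ m + (1 / 2) ^ n\<close>, within \<open>eps / 10\<close>; the rest is what
    \<open>quasi_polynomial\<close> asks for.\<close>
  define K where "K = real c ^ B + 2 * real B + \<delta> * B + 20"
  have K: "20 <= K" "real c ^ B + 2 * real B + \<delta> * B <= K" using d0 by (auto simp: K_def)
  have large: "2 <= total m R \<and> 2 * ((1 / 2) ^ m + (1 / 2) ^ n) <= eps / 10"
   if s: "smooth_instance \<rho> \<alpha> \<beta> m n R C" and e: "eps < 1" "K * ((1 / 2) ^ m + (1 / 2) ^ n) <= eps" for m n R C eps
  proof -
   have "20 * ((1 / 2) ^ m + (1 / 2) ^ n) <= K * ((1 / 2) ^ m + (1 / 2 :: real) ^ n)" using K(1) by (intro mult_right_mono) auto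
   then have "20 * ((1 / 2) ^ m + (1 / 2) ^ n) <= eps" using e(2) by linarith
   then show ?thesis using small[OF s] e(1) by (cases "2 <= total m R") auto
  qed
  show ?case
  proof (rule exI[of _ c], rule exI[of _ K], intro conjI allI impI ballI, goal_cases)
   case (3 m n R C eps)
   then have h: "margins m n R C" "2 <= total m R" "2 * ((1 / 2) ^ m + (1 / 2) ^ n) <= eps / 10"
    using large[of m n R C eps] by (auto simp: smooth_instance_def)
   show ?case unfolding accurate_def[symmetric] by (rule c(2)[OF h(1,2) _ _ \<delta>(2) _ h(3)]) (use 3 h(2) in auto)
  next
   case (4 m n R C eps \<omega>)
   then have h: "margins m n R C" "2 <= total m R" using large[of m n R C eps] by (auto simp: smooth_instance_def)
   have "real (snd (count_alg T \<delta> c m n R C eps \<omega>)) <= (real c * real (total m R) * threshold \<delta> (total m R) / eps) ^ B"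
    by (rule c(3)[OF h]) (use 4 in auto)
   also have "... <= K * eps powr (- K) * real (total m R) powr (K * ln (real (total m R)))"
    by (rule quasi_polynomial[OF h(2) _ _ _ _ K(2)]) (use 4 c(1) d0 in auto)
   finally show ?case .
  qed (use c K in auto)
 qed (use d0 in simp)
qed simp

end
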